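(* Assuming the Exponential-Time Hypothesis, there is no algorithm solving ATSP on graphs of pathwidth at most $p$ in time $f(p)\,n^{o(p)}$, for any computable function $f$, where $n$ is the size of the input.
   Context: ATSP: given a digraph $\vec G$ with non-negative arc costs, find a closed walk visiting every vertex of minimum total cost (equivalently, decide whether such a walk of cost at most a given bound exists). The pathwidth of a digraph is the pathwidth of its underlying undirected graph. The Exponential-Time Hypothesis (ETH) states that 3-SAT on $n$ variables cannot be solved in time $2^{o(n)}$. *)

theory Defs
  imports
    Complex_Main
    "HOL-Library.Landau_Symbols"
    "Graph_Theory.Graph_Theory"
begin

section \<open>Deterministic multi-tape Turing machines\<close>

text \<open>
  States and tape symbols are natural numbers below a fixed bound. Symbol 0 is the blank, and
  input words are written with the symbols 1, 2, 3 (bit 0, bit 1, separator). State 0 is the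
  start state; 1 and 2 are the accepting and the rejecting halting state. An action is a symbol
  to write together with a head movement in \<open>{-1, 0, 1}\<close>.
\<close>

record tm =
  tm_tapes :: nat
  tm_symbols :: nat
  tm_states :: nat
  tm_trans :: "nat \<Rightarrow> nat list \<Rightarrow> nat \<times> (nat \<times> int) list"

definition turing_machine :: "tm \<Rightarrow> bool" where
  "turing_machine M \<longleftrightarrow>
     1 \<le> tm_tapes M \<and> 4 \<le> tm_symbols M \<and> 3 \<le> tm_states M \<and>
     (\<forall>q rs. q < tm_states M \<and> length rs = tm_tapes M \<and> set rs \<subseteq> {..<tm_symbols M} \<longrightarrow>
        (case tm_trans M q rs of (q', as) \<Rightarrow>
           q' < tm_states M \<and> length as = tm_tapes M \<and>
           set as \<subseteq> {..<tm_symbols M} \<times> {-1, 0, 1}))"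

text \<open>A tape is two-way infinite and comes with its head position.\<close>

type_synonym tape = "int \<times> (int \<Rightarrow> nat)"
type_synonym config = "nat \<times> tape list"

definition tm_step :: "tm \<Rightarrow> config \<Rightarrow> config" where
  "tm_step M = (\<lambda>(q, ts).
     if q \<in> {1, 2} then (q, ts)
     else case tm_trans M q (map (\<lambda>(i, t). t i) ts) of (q', as) \<Rightarrow>
       (q', map2 (\<lambda>(s, d) (i, t). (i + d, t(i := s))) as ts))"

definition input_tape :: "nat list \<Rightarrow> tape" where
  "input_tape w = (0, \<lambda>i. if 0 \<le> i \<and> i < int (length w) then w ! nat i else 0)"

definition tm_run :: "tm \<Rightarrow> nat list \<Rightarrow> nat \<Rightarrow> config" where
  "tm_run M w k =
     (tm_step M ^^ k) (0, input_tape w # replicate (tm_tapes M - 1) (input_tape []))"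

definition decides_within :: "tm \<Rightarrow> nat list \<Rightarrow> bool \<Rightarrow> real \<Rightarrow> bool" where
  "decides_within M w answer T \<longleftrightarrow>
     (\<exists>k. real k \<le> T \<and> fst (tm_run M w k) = (if answer then 1 else 2))"

text \<open>
  Computability of a function on the natural numbers: argument and value are given in unary, the
  value being read off the last tape, starting from cell 0 up to the first blank.
\<close>

definition computable :: "(nat \<Rightarrow> nat) \<Rightarrow> bool" where
  "computable f \<longleftrightarrow>
     (\<exists>M. turing_machine M \<and>
        (\<forall>x. \<exists>k. fst (tm_run M (replicate x 2) k) \<in> {1, 2} \<and>
           (let t = snd (last (snd (tm_run M (replicate x 2) k)))
            in (\<forall>i<f x. t (int i) = 2) \<and> t (int (f x)) = 0)))"


section \<open>Encoding of numbers as words\<close>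

text \<open>Least significant bit first; bit \<open>b\<close> is the symbol \<open>b + 1\<close>.\<close>

fun bin :: "nat \<Rightarrow> nat list" where
  "bin n = (if n = 0 then [] else (n mod 2 + 1) # bin (n div 2))"

declare bin.simps [simp del]

definition enc_unary :: "nat \<Rightarrow> nat list" where
  "enc_unary n = replicate n 2 @ [3]"

definition enc_nat :: "nat \<Rightarrow> nat list" where
  "enc_nat n = bin n @ [3]"

definition enc_nonneg_rat :: "rat \<Rightarrow> nat list" where
  "enc_nonneg_rat r =
     enc_nat (nat (fst (quotient_of r))) @ enc_nat (nat (snd (quotient_of r)))"


section \<open>3-SAT and the Exponential-Time Hypothesis\<close>

text \<open>
  The literal \<open>(v, True)\<close> is the variable \<open>v\<close> and \<open>(v, False)\<close> its negation. A clause has three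
  literals, which need not be different. A formula has no repeated clauses; hence the length of
  its encoding is polynomial in the number of variables, and a running time \<open>2\<^bsup>o(n)\<^esup>\<close> depending on
  the number \<open>n\<close> of variables alone is not ruled out just by the length of the input.
\<close>

type_synonym literal = "nat \<times> bool"
type_synonym cnf = "literal list list"

definition is_3cnf :: "nat \<Rightarrow> cnf \<Rightarrow> bool" where
  "is_3cnf n F \<longleftrightarrow> distinct F \<and> (\<forall>C\<in>set F. length C = 3 \<and> (\<forall>(v, b)\<in>set C. v < n))"

definition satisfiable :: "cnf \<Rightarrow> bool" where
  "satisfiable F \<longleftrightarrow> (\<exists>\<alpha> :: nat \<Rightarrow> bool. \<forall>C\<in>set F. \<exists>(v, b)\<in>set C. \<alpha> v = b)"

definition enc_cnf :: "nat \<Rightarrow> cnf \<Rightarrow> nat list" where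
  "enc_cnf n F = enc_unary n @ concat (map (\<lambda>(v, b). enc_nat (2 * v + of_bool b)) (concat F))"

definition ETH :: bool where
  "ETH \<longleftrightarrow>
     \<not> (\<exists>M g. turing_machine M \<and> g \<in> o(\<lambda>n. real n) \<and>
          (\<forall>n F. is_3cnf n F \<longrightarrow>
             decides_within M (enc_cnf n F) (satisfiable F) (2 powr g n)))"


section \<open>Pathwidth\<close>

definition path_decomposition :: "'a pair_pre_digraph \<Rightarrow> 'a set list \<Rightarrow> bool" where
  "path_decomposition G Bs \<longleftrightarrow>
     Bs \<noteq> [] \<and> \<Union> (set Bs) = pverts G \<and>
     (\<forall>(u, v)\<in>parcs G. \<exists>B\<in>set Bs. u \<in> B \<and> v \<in> B) \<and>
     (\<forall>i j k. i \<le> j \<and> j \<le> k \<and> k < length Bs \<longrightarrow> Bs ! i \<inter> Bs ! k \<subseteq> Bs ! j)"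

definition decomposition_width :: "'a set list \<Rightarrow> nat" where
  "decomposition_width Bs = Max (card ` set Bs) - 1"

text \<open>Meant for finite graphs with at least one vertex.\<close>

definition pathwidth :: "'a pair_pre_digraph \<Rightarrow> nat" where
  "pathwidth G = (LEAST w. \<exists>Bs. path_decomposition G Bs \<and> decomposition_width Bs = w)"

text \<open>An undirected graph is represented by its symmetric digraph.\<close>

definition digraph_pathwidth :: "'a pair_pre_digraph \<Rightarrow> nat" where
  "digraph_pathwidth D = pathwidth (mk_symmetric (with_proj D))"


section \<open>The asymmetric travelling salesperson problem\<close>

record atsp_instance =
  num_verts :: nat
  arc_costs :: "((nat \<times> nat) \<times> rat) list"
  budget :: rat

definition atsp_digraph :: "atsp_instance \<Rightarrow> nat pair_pre_digraph" where
  "atsp_digraph I = \<lparr> pverts = {..<num_verts I}, parcs = fst ` set (arc_costs I) \<rparr>"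

definition arc_cost :: "atsp_instance \<Rightarrow> nat \<times> nat \<Rightarrow> rat" where
  "arc_cost I e = the (map_of (arc_costs I) e)"

definition is_atsp_instance :: "atsp_instance \<Rightarrow> bool" where
  "is_atsp_instance I \<longleftrightarrow>
     1 \<le> num_verts I \<and> pair_digraph (atsp_digraph I) \<and> distinct (map fst (arc_costs I)) \<and>
     (\<forall>e\<in>parcs (atsp_digraph I). 0 \<le> arc_cost I e) \<and> 0 \<le> budget I"

definition atsp_yes :: "atsp_instance \<Rightarrow> bool" where
  "atsp_yes I \<longleftrightarrow>
     (let D = with_proj (atsp_digraph I) in
      \<exists>u p. pre_digraph.awalk D u p u \<and> verts D \<subseteq> set (pre_digraph.awalk_verts D u p) \<and>
        sum_list (map (arc_cost I) p) \<le> budget I)"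

text \<open>The word given to an algorithm: the bound \<open>p\<close> on the pathwidth, followed by the instance.\<close>

definition enc_atsp :: "nat \<Rightarrow> atsp_instance \<Rightarrow> nat list" where
  "enc_atsp p I =
     enc_unary p @ enc_unary (num_verts I) @ enc_nonneg_rat (budget I) @
     concat (map (\<lambda>((u, v), c). enc_nat u @ enc_nat v @ enc_nonneg_rat c) (arc_costs I))"

text \<open>
  On instances of pathwidth larger than \<open>p\<close> the machine may behave arbitrarily. The time bound
  is a function of \<open>p\<close> and of the length of the input word.
\<close>

definition solves_atsp_bounded_pathwidth :: "tm \<Rightarrow> (nat \<Rightarrow> nat \<Rightarrow> real) \<Rightarrow> bool" where
  "solves_atsp_bounded_pathwidth M T \<longleftrightarrow>
     (\<forall>p I. is_atsp_instance I \<and> digraph_pathwidth (atsp_digraph I) \<le> p \<longrightarrow>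
        decides_within M (enc_atsp p I) (atsp_yes I) (T p (length (enc_atsp p I))))"

end

theory Submission
  imports Defs "HOL-Real_Asymp.Real_Asymp"
begin

text \<open>
  A formula with \<open>n\<close> variables is turned into an ATSP instance of pathwidth at most \<open>3 p + 14\<close>: the
  variables are split into \<open>p\<close> groups of size \<open>s = n div p + 1\<close>, and an assignment of the variables
  of a group is a number \<open>t < 2\<^sup>s\<close>, namely the number of times, minus one, that the walk runs through
  the channel of this group. The instance has size \<open>2\<^bsup>n/p\<^esup> n\<^bsup>O(1)\<^esup>\<close>, so an algorithm running in time
  \<open>f(p) N\<^bsup>o(p)\<^esup>\<close> decides satisfiability in time \<open>2\<^bsup>o(n)\<^esup>\<close>, provided that \<open>p\<close> tends to infinity with \<open>n\<close>,
  but so slowly that \<open>f(3 p + 14)\<close> is linear in \<open>n\<close>. Such a \<open>p\<close> is found by running the machine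
  computing \<open>f\<close> for \<open>n\<close> steps on small arguments: the value of \<open>f\<close> is written in unary, so it is
  bounded by the running time.
\<close>


section \<open>While-programs over tapes\<close>

text \<open>The obstacle is uniformity. One fixed machine has to choose \<open>p\<close> from
  \<open>n\<close>, and it knows nothing about how fast \<open>h p / p\<close> decays. The search
  for \<open>p\<close> thus depends on a machine for \<open>f\<close> alone, and the decay enters
  only in a limit at the end: up to lower-order terms the exponent is
  \<open>k (1 + |h (3 p + 14)|) n / p\<close>, which is o(n) as soon as \<open>p\<close> tends to
  infinity.

  ETH speaks about machines, so the reduction itself has to be run on one. To keep this feasible,
  adjacency is a single arithmetic predicate on pairs of vertex numbers, and writing the instance is
  a double loop that evaluates one expression; numbers without a meaning become junk vertices tied
  to the hub. Times matter only up to a fixed power of the instance size, hence even unary counters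
  are affordable.

  The number \<open>t\<close> of a group travels through the columns as an amount of flow, not as a
  choice among \<open>q\<close> separate tracks. So each bag of the decomposition needs only a
  bounded number of vertices per group, although a group has exponentially many values.\<close>

text \<open>
  A tape is represented by its contents relative to the head, so that moving the head shifts the
  function. There are infinitely many tapes; a program only uses finitely many of them. The tape
  \<open>Cell\<close> carries the state of a simulated machine and finally the answer, \<open>Cnt v\<close> is a
  counter, and \<open>Sim b j\<close> is the \<open>j\<close>-th tape of one of two simulated machines.
\<close>

datatype tapeid = Inp | Cell | Cnt nat | Sim bool nat

type_synonym view = "int \<Rightarrow> nat"
type_synonym mem = "tapeid \<Rightarrow> view"
type_synonym reads = "tapeid \<Rightarrow> nat"
type_synonym action = "reads \<Rightarrow> tapeid \<Rightarrow> nat \<times> int"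

datatype prog =
    Skip
  | Act action
  | Seq prog prog (infixr ";;" 60)
  | Cond "reads \<Rightarrow> bool" prog prog
  | Loop "reads \<Rightarrow> bool" prog

definition heads :: "mem \<Rightarrow> reads" where
  "heads m x = m x 0"

text \<open>In head-relative coordinates a head movement by \<open>d\<close> is a shift of the whole
  contents by \<open>d\<close>, performed after the write at cell 0.\<close>

definition act_mem :: "action \<Rightarrow> mem \<Rightarrow> mem" where
  "act_mem a m x j = ((m x)(0 := fst (a (heads m) x))) (j + snd (a (heads m) x))"

fun next_stack :: "prog list \<Rightarrow> reads \<Rightarrow> prog list" where
  "next_stack [] r = []"
| "next_stack (Skip # K) r = K"
| "next_stack (Act a # K) r = K"
| "next_stack ((c ;; d) # K) r = c # d # K"
| "next_stack (Cond b c d # K) r = (if b r then c else d) # K"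
| "next_stack (Loop b c # K) r = (if b r then c # Loop b c # K else K)"

fun stack_action :: "prog list \<Rightarrow> action" where
  "stack_action (Act a # K) = a"
| "stack_action K = (\<lambda>r x. (r x, 0))"

definition pstep :: "prog list \<times> mem \<Rightarrow> prog list \<times> mem" where
  "pstep = (\<lambda>(K, m). (next_stack K (heads m), act_mem (stack_action K) m))"

text \<open>Quantifying over the rest \<open>K\<close> of the control stack is what makes the notion
  compositional: the continuation of \<open>c\<close> is arbitrary and remains untouched.
  \<open>T\<close> is only an upper bound on the number of steps.\<close>

definition runs :: "prog \<Rightarrow> mem \<Rightarrow> mem \<Rightarrow> nat \<Rightarrow> bool" where
  "runs c m m' T \<longleftrightarrow> (\<forall>K. \<exists>k\<le>T. (pstep ^^ k) (c # K, m) = (K, m'))"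

lemma act_mem_id [simp]: "act_mem (\<lambda>r x. (r x, 0)) m = m"
  by (auto simp: act_mem_def heads_def fun_eq_iff)

lemma runs_mono: "runs c m m' T \<Longrightarrow> T \<le> T' \<Longrightarrow> runs c m m' T'"
  unfolding runs_def using order_trans by blast

lemma runs_step:
  assumes "\<And>K. \<exists>k\<le>T. (pstep ^^ k) (pstep (c # K, m)) = (K, m')" and "Suc T \<le> T'"
  shows "runs c m m' T'"
  unfolding runs_def
proof
  fix K
  obtain k where "k \<le> T" "(pstep ^^ k) (pstep (c # K, m)) = (K, m')" using assms(1) by blast
  then have "Suc k \<le> T'" "(pstep ^^ Suc k) (c # K, m) = (K, m')"
    using assms(2) by (auto simp: funpow_swap1)
  then show "\<exists>k\<le>T'. (pstep ^^ k) (c # K, m) = (K, m')" by blast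
qed

lemma runs_Skip [intro]: "1 \<le> T \<Longrightarrow> runs Skip m m T"
  by (rule runs_step[of 0]) (auto simp: pstep_def)

lemma runs_Act: "m' = act_mem a m \<Longrightarrow> 1 \<le> T \<Longrightarrow> runs (Act a) m m' T"
  by (rule runs_step[of 0]) (auto simp: pstep_def)

lemma stack_runs:
  assumes "runs c m m1 T1" and "\<And>K. \<exists>k\<le>T2. (pstep ^^ k) (K' K, m1) = (K, m2)"
  shows "\<exists>k\<le>T1 + T2. (pstep ^^ k) (c # K' K, m) = (K, m2)"
proof -
  obtain k1 where k1: "k1 \<le> T1" "(pstep ^^ k1) (c # K' K, m) = (K' K, m1)"
    using assms(1) unfolding runs_def by blast
  obtain k2 where k2: "k2 \<le> T2" "(pstep ^^ k2) (K' K, m1) = (K, m2)" using assms(2) by blast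
  have "(pstep ^^ (k2 + k1)) (c # K' K, m) = (K, m2)" using k1 k2 by (simp add: funpow_add)
  moreover have "k2 + k1 \<le> T1 + T2" using k1 k2 by simp
  ultimately show ?thesis by blast
qed

lemma runs_Seq:
  assumes "runs c m m1 T1" and "runs d m1 m2 T2" and "Suc (T1 + T2) \<le> T"
  shows "runs (c ;; d) m m2 T"
proof (rule runs_step[OF _ assms(3)])
  fix K
  have "\<exists>k\<le>T2. (pstep ^^ k) (d # K, m1) = (K, m2)" for K
    using assms(2) unfolding runs_def by blast
  from stack_runs[OF assms(1) this]
  show "\<exists>k\<le>T1 + T2. (pstep ^^ k) (pstep ((c ;; d) # K, m)) = (K, m2)"
    by (simp add: pstep_def)
qed

lemma runs_Cond:
  assumes "b (heads m) \<Longrightarrow> runs c m m' T1" and "\<not> b (heads m) \<Longrightarrow> runs d m m' T1"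
    and "Suc T1 \<le> T"
  shows "runs (Cond b c d) m m' T"
proof (rule runs_step[OF _ assms(3)])
  fix K
  show "\<exists>k\<le>T1. (pstep ^^ k) (pstep (Cond b c d # K, m)) = (K, m')"
    using assms(1,2) unfolding runs_def by (cases "b (heads m)") (auto simp: pstep_def)
qed

lemma runs_Loop_end: "\<not> b (heads m) \<Longrightarrow> 1 \<le> T \<Longrightarrow> runs (Loop b c) m m T"
  by (rule runs_step[of 0]) (auto simp: pstep_def)

lemma runs_Loop_step:
  assumes "b (heads m)" and "runs c m m1 T1" and "runs (Loop b c) m1 m2 T2" and "Suc (T1 + T2) \<le> T"
  shows "runs (Loop b c) m m2 T"
proof (rule runs_step[OF _ assms(4)])
  fix K
  have "\<exists>k\<le>T2. (pstep ^^ k) (Loop b c # K, m1) = (K, m2)" for K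
    using assms(3) unfolding runs_def by blast
  from stack_runs[OF assms(2) this]
  show "\<exists>k\<le>T1 + T2. (pstep ^^ k) (pstep (Loop b c # K, m)) = (K, m2)"
    using assms(1) by (simp add: pstep_def)
qed

text \<open>\<open>I i\<close> is the memory before test number \<open>i\<close>. The induction runs
  over the iterations that are still left, so that each step puts one iteration in front by
  \<open>runs_Loop_step\<close>; the \<open>Suc\<close> pays for the test.\<close>

lemma runs_Loop_iterate:
  assumes "\<And>i. i < n \<Longrightarrow> b (heads (I i)) \<and> runs c (I i) (I (Suc i)) T1"
    and "\<not> b (heads (I n))" and "n * Suc T1 + 1 \<le> T"
  shows "runs (Loop b c) (I 0) (I n) T"
proof -
  have "runs (Loop b c) (I (n - i)) (I n) (i * Suc T1 + 1)" if "i \<le> n" for i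
    using that
  proof (induction i)
    case 0
    then show ?case using assms(2) by (simp add: runs_Loop_end)
  next
    case (Suc i)
    then have *: "Suc (n - Suc i) = n - i" and "n - Suc i < n" by auto
    then have "b (heads (I (n - Suc i)))" "runs c (I (n - Suc i)) (I (n - i)) T1"
      using assms(1) by (force, metis assms(1))
    moreover have "runs (Loop b c) (I (n - i)) (I n) (i * Suc T1 + 1)" using Suc by simp
    ultimately show ?case by (rule runs_Loop_step) simp
  qed
  from this[of n] show ?thesis using assms(3) by (auto intro: runs_mono)
qed


section \<open>Compilation to Turing machines\<close>

text \<open>The three infinite families are interleaved by residues modulo 3, so that finitely many
  tapes always lie in an initial segment. \<open>Inp\<close> has index 0, where a machine finds its
  input.\<close>

fun tape_index :: "tapeid \<Rightarrow> nat" where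
  "tape_index Inp = 0"
| "tape_index Cell = 1"
| "tape_index (Cnt v) = 3 * v + 2"
| "tape_index (Sim b j) = 3 * j + (if b then 3 else 4)"

definition tape_of :: "nat \<Rightarrow> tapeid" where
  "tape_of n =
     (if n = 0 then Inp else if n = 1 then Cell else if n mod 3 = 2 then Cnt ((n - 2) div 3)
      else if n mod 3 = 0 then Sim True ((n - 3) div 3) else Sim False ((n - 4) div 3))"

lemma tape_index_tape_of [simp]: "tape_index (tape_of n) = n"
  unfolding tape_of_def by auto presburger+

lemma tape_of_tape_index [simp]: "tape_of (tape_index x) = x"
  by (cases x) (auto simp: tape_of_def, presburger+)

section \<open>Programs confined to finitely many tapes and symbols\<close>

definition test_wf :: "nat \<Rightarrow> (reads \<Rightarrow> bool) \<Rightarrow> bool" where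
  "test_wf K b \<longleftrightarrow> (\<forall>r r'. (\<forall>x. tape_index x < K \<longrightarrow> r x = r' x) \<longrightarrow> b r = b r')"

text \<open>Locality and closure of the alphabet: the two properties that let the first
  \<open>K\<close> tapes, with symbols below \<open>B\<close>, be run without the others.\<close>

definition action_wf :: "nat \<Rightarrow> nat \<Rightarrow> action \<Rightarrow> bool" where
  "action_wf K B a \<longleftrightarrow>
     (\<forall>r r'. (\<forall>x. tape_index x < K \<longrightarrow> r x = r' x) \<longrightarrow> (\<forall>x. tape_index x < K \<longrightarrow> a r x = a r' x)) \<and>
     (\<forall>r. (\<forall>x. tape_index x < K \<longrightarrow> r x < B) \<longrightarrow>
        (\<forall>x. tape_index x < K \<longrightarrow> fst (a r x) < B \<and> snd (a r x) \<in> {-1, 0, 1}))"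

fun prog_wf :: "nat \<Rightarrow> nat \<Rightarrow> prog \<Rightarrow> bool" where
  "prog_wf K B Skip = True"
| "prog_wf K B (Act a) = action_wf K B a"
| "prog_wf K B (c ;; d) = (prog_wf K B c \<and> prog_wf K B d)"
| "prog_wf K B (Cond b c d) = (test_wf K b \<and> prog_wf K B c \<and> prog_wf K B d)"
| "prog_wf K B (Loop b c) = (test_wf K b \<and> prog_wf K B c)"

text \<open>\<open>prog_wf\<close> is not monotone in \<open>K\<close> and \<open>B\<close>. A
  condition for all large values, in contrast, is preserved by every program constructor, with the
  maximum of the thresholds.\<close>

definition legal :: "prog \<Rightarrow> bool" where
  "legal c \<longleftrightarrow> (\<exists>N. \<forall>K\<ge>N. \<forall>B\<ge>N. prog_wf K B c)"

definition legal_test :: "(reads \<Rightarrow> bool) \<Rightarrow> bool" where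
  "legal_test b \<longleftrightarrow> (\<exists>N. \<forall>K\<ge>N. test_wf K b)"

lemma legal_Skip: "legal Skip"
  by (auto simp: legal_def)

lemma legal_ActI: "(\<And>K B. N \<le> K \<Longrightarrow> N \<le> B \<Longrightarrow> action_wf K B a) \<Longrightarrow> legal (Act a)"
  by (auto simp: legal_def)

lemma legal_Seq: assumes "legal c" "legal d" shows "legal (c ;; d)"
proof -
  obtain N N' where "\<forall>K\<ge>N. \<forall>B\<ge>N. prog_wf K B c" "\<forall>K\<ge>N'. \<forall>B\<ge>N'. prog_wf K B d"
    using assms unfolding legal_def by blast
  then show ?thesis unfolding legal_def by (intro exI[of _ "max N N'"]) auto
qed

lemma legal_Cond: assumes "legal_test b" "legal c" "legal d" shows "legal (Cond b c d)"
proof -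
  obtain N N' N'' where "\<forall>K\<ge>N. \<forall>B\<ge>N. prog_wf K B c" "\<forall>K\<ge>N'. \<forall>B\<ge>N'. prog_wf K B d"
    "\<forall>K\<ge>N''. test_wf K b"
    using assms unfolding legal_def legal_test_def by blast
  then show ?thesis unfolding legal_def by (intro exI[of _ "max N (max N' N'')"]) auto
qed

lemma legal_Loop: assumes "legal_test b" "legal c" shows "legal (Loop b c)"
proof -
  obtain N N'' where "\<forall>K\<ge>N. \<forall>B\<ge>N. prog_wf K B c" "\<forall>K\<ge>N''. test_wf K b"
    using assms unfolding legal_def legal_test_def by blast
  then show ?thesis unfolding legal_def by (intro exI[of _ "max N N''"]) auto
qed

lemma legal_test_read: "legal_test (\<lambda>r. P (r x))"
  unfolding legal_test_def test_wf_def
  by (rule exI[of _ "Suc (tape_index x)"]) (metis Suc_le_eq)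

lemmas legal_intros = legal_Skip legal_Seq legal_Cond legal_Loop legal_test_read

text \<open>The control stacks that occur while \<open>c\<close> runs on top of \<open>K\<close>;
  they become the states of the compiled machine. There are finitely many, because each round of a
  loop runs its body on top of the same \<open>Loop b c # K\<close>.\<close>

fun stacks :: "prog \<Rightarrow> prog list \<Rightarrow> prog list set" where
  "stacks Skip K = {Skip # K}"
| "stacks (Act a) K = {Act a # K}"
| "stacks (c ;; d) K = insert ((c ;; d) # K) (stacks c (d # K) \<union> stacks d K)"
| "stacks (Cond b c d) K = insert (Cond b c d # K) (stacks c K \<union> stacks d K)"
| "stacks (Loop b c) K = insert (Loop b c # K) (stacks c (Loop b c # K))"

lemma finite_stacks: "finite (stacks c K)"
  by (induction c arbitrary: K) auto

lemma stacks_start: "c # K \<in> stacks c K"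
  by (cases c) auto

lemma stacks_closed: "S \<in> stacks c K \<Longrightarrow> next_stack S r \<in> insert K (stacks c K)"
proof (induction c arbitrary: K)
  case (Seq c d)
  show ?case
    using Seq.IH(1)[of "d # K"] Seq.IH(2)[of K] Seq.prems stacks_start[of c "d # K"] stacks_start[of d K]
    by auto
next
  case (Cond b c d)
  show ?case
    using Cond.IH(1)[of K] Cond.IH(2)[of K] Cond.prems stacks_start[of c K] stacks_start[of d K]
    by auto
next
  case (Loop b c)
  show ?case
    using Loop.IH[of "Loop b c # K"] Loop.prems stacks_start[of c "Loop b c # K"]
    by (cases "b r") auto
qed auto

lemma stacks_wf:
  "S \<in> stacks c K \<Longrightarrow> prog_wf k B c \<Longrightarrow> \<forall>d\<in>set K. prog_wf k B d \<Longrightarrow> \<forall>d\<in>set S. prog_wf k B d"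
proof (induction c arbitrary: K)
  case (Seq c d)
  show ?case using Seq.IH(1)[of "d # K"] Seq.IH(2)[of K] Seq.prems by auto
next
  case (Cond b c d)
  show ?case using Cond.IH(1)[of K] Cond.IH(2)[of K] Cond.prems by auto
next
  case (Loop b c)
  show ?case using Loop.IH[of "Loop b c # K"] Loop.prems by auto
qed auto

lemma next_stack_cong:
  assumes "\<forall>d\<in>set S. prog_wf K B d" and "\<forall>x. tape_index x < K \<longrightarrow> r x = r' x"
  shows "next_stack S r = next_stack S r'"
proof -
  have "b r = b r'" if "test_wf K b" for b using that assms(2) unfolding test_wf_def by blast
  then show ?thesis using assms(1) by (cases "(S, r)" rule: next_stack.cases) auto
qed

lemma stack_action_wf: "\<forall>d\<in>set S. prog_wf K B d \<Longrightarrow> action_wf K B (stack_action S)"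
  by (cases S rule: stack_action.cases) (auto simp: action_wf_def)

section \<open>From programs to machines\<close>

definition tape_view :: "tape \<Rightarrow> view" where
  "tape_view t j = snd t (fst t + j)"

definition initial_mem :: "nat list \<Rightarrow> mem" where
  "initial_mem w x = (if x = Inp then tape_view (input_tape w) else (\<lambda>_. 0))"

definition represents :: "nat \<Rightarrow> nat \<Rightarrow> tape list \<Rightarrow> mem \<Rightarrow> bool" where
  "represents K B ts m \<longleftrightarrow> length ts = K \<and>
     (\<forall>n<K. tape_view (ts ! n) = m (tape_of n) \<and> (\<forall>j. snd (ts ! n) j < B))"

lemma act_view:
  "tape_view (i + d, t(i := s)) = (\<lambda>j. ((tape_view (i, t))(0 := s)) (j + d))"
  by (auto simp: tape_view_def fun_eq_iff algebra_simps)

text \<open>With control stacks as states, one step of the program is one step of the machine. The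
  additional step in the bound leads from the empty stack to the halting state determined by the
  symbol on \<open>Cell\<close>.\<close>

theorem legal_compile:
  assumes "legal c"
  obtains M where "turing_machine M"
    and "\<And>w m' T. set w \<subseteq> {1, 2, 3} \<Longrightarrow> runs c (initial_mem w) m' T \<Longrightarrow> m' Cell 0 \<in> {1, 2} \<Longrightarrow>
           decides_within M w (m' Cell 0 = 1) (real T + 1)"
proof -
  obtain N where N: "\<And>K B. K \<ge> N \<Longrightarrow> B \<ge> N \<Longrightarrow> prog_wf K B c" using assms unfolding legal_def by blast
  \<comment> \<open>The summands 2 and 4 below make room for the tapes \<open>Inp\<close> and
    \<open>Cell\<close> and for the symbols 0 to 3.\<close>
  define K where "K = N + 2"
  define B where "B = N + 4"
  have wf: "prog_wf K B c" using N[of K B] by (simp add: K_def B_def)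
  define Q where "Q = insert [] (stacks c [])"
  have finQ: "finite Q" by (simp add: Q_def finite_stacks)
  then obtain e where e: "bij_betw e Q {0..<card Q}" using ex_bij_betw_finite_nat by blast
  \<comment> \<open>The start state has to be 0; the shift by 3 keeps all other stacks away from the
    halting states 1 and 2.\<close>
  define enc where "enc = (\<lambda>S. if S = [c] then 0 else e S + 3)"
  have inj: "inj_on enc Q" using e by (auto simp: inj_on_def bij_betw_def enc_def)
  have enc_less: "enc S < card Q + 3" if "S \<in> Q" for S
    using e that by (auto simp: bij_betw_def enc_def)
  define dec where "dec = inv_into Q enc"
  have dec_enc: "dec (enc S) = S" if "S \<in> Q" for S
    using inj that by (simp add: dec_def)
  have dec_in: "dec q \<in> Q" if "q \<in> enc ` Q" for q using that by (auto simp: dec_enc)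
  define reads_of :: "nat list \<Rightarrow> reads" where
    "reads_of = (\<lambda>rs x. if tape_index x < K then rs ! tape_index x else 0)"
  define trans where "trans = (\<lambda>q rs.
     if q \<in> enc ` Q then
       if dec q = [] then (if reads_of rs Cell = 1 then 1 else 2, map (\<lambda>s. (s, 0)) rs)
       else (enc (next_stack (dec q) (reads_of rs)),
             map (\<lambda>n. stack_action (dec q) (reads_of rs) (tape_of n)) [0..<K])
     else (q, map (\<lambda>s. (s, 0 :: int)) rs))"
  define M where "M = \<lparr>tm_tapes = K, tm_symbols = B, tm_states = card Q + 3, tm_trans = trans\<rparr>"
  have closed: "next_stack S r \<in> Q" if "S \<in> Q" for S r
    using that stacks_closed[of S c "[]" r] by (auto simp: Q_def)
  have wfQ: "\<forall>d\<in>set S. prog_wf K B d" if "S \<in> Q" for S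
    using that stacks_wf[of S c "[]" K B] wf by (auto simp: Q_def)
  have "turing_machine M"
    unfolding turing_machine_def
  proof (intro conjI allI impI)
    fix q rs assume q: "q < tm_states M \<and> length rs = tm_tapes M \<and> set rs \<subseteq> {..<tm_symbols M}"
    have rB: "reads_of rs x < B" for x
    proof (cases "tape_index x < K")
      case True
      then have "rs ! tape_index x \<in> set rs" using q by (simp add: M_def)
      then have "rs ! tape_index x < B" using q by (auto simp del: nth_mem simp: M_def)
      then show ?thesis using True by (simp add: reads_of_def)
    qed (simp add: reads_of_def B_def)
    have act: "fst (stack_action S (reads_of rs) (tape_of n)) < B \<and>
        snd (stack_action S (reads_of rs) (tape_of n)) \<in> {-1, 0, 1}" if "S \<in> Q" "n < K" for S n
      using stack_action_wf[OF wfQ[OF that(1)]] that(2) rB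
      unfolding action_wf_def by simp
    show "case tm_trans M q rs of (q', as) \<Rightarrow>
       q' < tm_states M \<and> length as = tm_tapes M \<and> set as \<subseteq> {..<tm_symbols M} \<times> {-1, 0, 1}"
    proof (cases "q \<in> enc ` Q \<and> dec q \<noteq> []")
      case True
      then have tr: "tm_trans M q rs = (enc (next_stack (dec q) (reads_of rs)),
             map (\<lambda>n. stack_action (dec q) (reads_of rs) (tape_of n)) [0..<K])"
        by (simp add: M_def trans_def)
      have "set (map (\<lambda>n. stack_action (dec q) (reads_of rs) (tape_of n)) [0..<K]) \<subseteq> {..<B} \<times> {-1, 0, 1}"
      proof
        fix x assume "x \<in> set (map (\<lambda>n. stack_action (dec q) (reads_of rs) (tape_of n)) [0..<K])"
        then obtain n where "n < K" "x = stack_action (dec q) (reads_of rs) (tape_of n)" by auto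
        then show "x \<in> {..<B} \<times> {-1, 0, 1}"
          using act[OF dec_in[of q], of n] True by (simp only: mem_Times_iff lessThan_iff)
      qed
      then show ?thesis using True tr enc_less[OF closed[OF dec_in]] by (auto simp: M_def)
    next
      case False
      then show ?thesis using q by (auto simp: M_def trans_def)
    qed
  qed (auto simp: M_def K_def B_def)
  moreover have "decides_within M w (m' Cell 0 = 1) (real T + 1)"
    if w: "set w \<subseteq> {1, 2, 3}" and run: "runs c (initial_mem w) m' T" and ans: "m' Cell 0 \<in> {1, 2}"
    for w m' T
  proof -
    define cfg0 where "cfg0 = (0::nat, input_tape w # replicate (tm_tapes M - 1) (input_tape []))"
    have reads: "reads_of (map (\<lambda>(i, t). t i) ts) x = heads m x"
      if "represents K B ts m" "tape_index x < K" for ts m x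
      using that by (auto simp: represents_def reads_of_def heads_def tape_view_def fun_eq_iff split: prod.splits)
        (metis add.right_neutral fst_conv snd_conv tape_of_tape_index)
    have step: "\<exists>ts'. tm_step M (enc S, ts) = (enc (next_stack S (heads m)), ts') \<and>
        represents K B ts' (act_mem (stack_action S) m)"
      if "S \<in> Q" "S \<noteq> []" and rep: "represents K B ts m" for S ts m
    proof -
      let ?r = "reads_of (map (\<lambda>(i, t). t i) ts)"
      let ?as = "map (\<lambda>n. stack_action S ?r (tape_of n)) [0..<K]"
      have nh: "enc S \<notin> {1, 2}" by (auto simp: enc_def)
      have nx: "next_stack S ?r = next_stack S (heads m)"
        using next_stack_cong[OF wfQ[OF that(1)]] reads[OF rep] by blast
      have aw: "action_wf K B (stack_action S)" by (rule stack_action_wf[OF wfQ[OF that(1)]])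
      then have ac: "stack_action S ?r x = stack_action S (heads m) x" if "tape_index x < K" for x
        using that reads[OF rep] unfolding action_wf_def by blast
      have hB: "\<forall>x. tape_index x < K \<longrightarrow> heads m x < B"
        using rep by (auto simp: represents_def heads_def tape_view_def fun_eq_iff)
          (metis tape_of_tape_index)
      have aB: "fst (stack_action S (heads m) x) < B" if "tape_index x < K" for x
        using aw hB that unfolding action_wf_def by blast
      let ?ts' = "map2 (\<lambda>(s, d) (i, t). (i + d, t(i := s))) ?as ts"
      have "tm_step M (enc S, ts) = (enc (next_stack S (heads m)), ?ts')"
        using nh that by (auto simp: tm_step_def M_def trans_def dec_enc nx)
      moreover have "represents K B ?ts' (act_mem (stack_action S) m)"
        unfolding represents_def
      proof (intro conjI allI impI)
        show "length ?ts' = K" using rep by (simp add: represents_def)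
        fix n assume n: "n < K"
        obtain i t where it: "ts ! n = (i, t)" by force
        obtain s d where sd: "stack_action S (heads m) (tape_of n) = (s, d)" by force
        have sB: "s < B" using aB[of "tape_of n"] sd n by simp
        have tn: "?ts' ! n = (i + d, t(i := s))"
          using n rep it sd ac[of "tape_of n"] by (simp add: represents_def)
        have vi: "tape_view (i, t) = m (tape_of n)" using rep n it by (auto simp: represents_def)
        show "tape_view (?ts' ! n) = act_mem (stack_action S) m (tape_of n)"
          unfolding tn act_view vi by (simp add: fun_eq_iff act_mem_def sd)
        show "snd (?ts' ! n) j < B" for j
          unfolding tn using rep n it sB by (auto simp: represents_def)
      qed
      ultimately show ?thesis by blast
    qed
    have sim: "\<exists>ts. (tm_step M ^^ k) cfg0 = (enc (fst ((pstep ^^ k) ([c], initial_mem w))), ts) \<and>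
        represents K B ts (snd ((pstep ^^ k) ([c], initial_mem w))) \<and>
        fst ((pstep ^^ k) ([c], initial_mem w)) \<in> Q"
      if "\<forall>i<k. fst ((pstep ^^ i) ([c], initial_mem w)) \<noteq> []" for k
      using that
    proof (induction k)
      case 0
      have "represents K B (snd cfg0) (initial_mem w)"
        unfolding represents_def
      proof (intro conjI allI impI)
        show "length (snd cfg0) = K" by (simp add: cfg0_def M_def K_def)
        fix n assume n: "n < K"
        show "tape_view (snd cfg0 ! n) = initial_mem w (tape_of n)"
        proof (cases "n = 0")
          case False
          then have "tape_of n \<noteq> Inp" by (metis tape_index.simps(1) tape_index_tape_of)
          then show ?thesis using False n
            by (auto simp: cfg0_def initial_mem_def M_def nth_Cons' tape_view_def input_tape_def)
        qed (auto simp: cfg0_def initial_mem_def tape_of_def)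
        have "w ! i < B" if "i < length w" for i
          using w nth_mem[OF that] by (auto simp: B_def)
        then show "snd (snd cfg0 ! n) j < B" for j
          using n by (auto simp: cfg0_def M_def nth_Cons' input_tape_def B_def)
      qed
      moreover have "enc [c] = 0" by (simp add: enc_def)
      moreover have "[c] \<in> Q" using stacks_start[of c "[]"] by (simp add: Q_def)
      ultimately show ?case by (simp add: cfg0_def)
    next
      case (Suc k)
      obtain S m where Sm: "(pstep ^^ k) ([c], initial_mem w) = (S, m)" by force
      then obtain ts where ts: "(tm_step M ^^ k) cfg0 = (enc S, ts)" "represents K B ts m" "S \<in> Q"
        using Suc by auto
      have "S \<noteq> []" using Suc.prems Sm by (metis fst_conv lessI)
      from step[OF ts(3) this ts(2)] show ?case
        using ts(1) Sm closed[OF ts(3)] by (auto simp: pstep_def)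
    qed
    obtain k0 where k0: "k0 \<le> T" "(pstep ^^ k0) ([c], initial_mem w) = ([], m')"
      using run unfolding runs_def by blast
    \<comment> \<open>On the empty stack the program idles while the machine moves on to a halting
      state. Hence the two agree only up to the first time at which the stack is empty.\<close>
    define k where "k = (LEAST i. fst ((pstep ^^ i) ([c], initial_mem w)) = [])"
    have "fst ((pstep ^^ k) ([c], initial_mem w)) = []"
      unfolding k_def by (rule LeastI[of _ k0]) (simp add: k0)
    have kk0: "k \<le> k0" unfolding k_def by (rule Least_le) (simp add: k0)
    have before: "\<forall>i<k. fst ((pstep ^^ i) ([c], initial_mem w)) \<noteq> []"
      unfolding k_def using not_less_Least by blast
    have stay: "(pstep ^^ i) ([], m) = ([], m)" for i m
      by (induction i) (auto simp: pstep_def)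
    obtain m1 where m1: "(pstep ^^ k) ([c], initial_mem w) = ([], m1)"
      using \<open>fst ((pstep ^^ k) ([c], initial_mem w)) = []\<close> by (metis prod.collapse)
    have "(pstep ^^ (k0 - k + k)) ([c], initial_mem w) = ([], m1)"
      unfolding funpow_add using m1 stay by simp
    then have "m1 = m'" using kk0 k0 by simp
    then obtain ts where ts: "(tm_step M ^^ k) cfg0 = (enc [], ts)" "represents K B ts m'" "[] \<in> Q"
      using sim[OF before] m1 by auto
    have "tape_index Cell < K" by (simp add: K_def)
    from reads[OF ts(2) this] have rc: "reads_of (map (\<lambda>(i, t). t i) ts) Cell = m' Cell 0"
      by (simp add: heads_def)
    have nh: "enc [] \<notin> {1, 2}" by (auto simp: enc_def)
    have "fst (tm_step M (enc [], ts)) = (if m' Cell 0 = 1 then 1 else 2)"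
      using nh ts(3) rc by (auto simp: tm_step_def M_def trans_def dec_enc)
    then have "fst (tm_run M w (Suc k)) = (if m' Cell 0 = 1 then 1 else 2)"
      using ts(1) by (simp add: tm_run_def cfg0_def)
    moreover have "real (Suc k) \<le> real T + 1" using kk0 k0 by simp
    ultimately show ?thesis unfolding decides_within_def by blast
  qed
  ultimately show ?thesis by (rule that)
qed


section \<open>Counters\<close>

lemma runs_conv: "runs c m m1 T1 \<Longrightarrow> m1 = m' \<Longrightarrow> T1 \<le> T \<Longrightarrow> runs c m m' T"
  using runs_mono by blast

lemma runs_Seq_exact: "runs c m m1 T1 \<Longrightarrow> runs d m1 m2 T2 \<Longrightarrow> runs (c ;; d) m m2 (Suc (T1 + T2))"
  by (rule runs_Seq) auto

lemma runs_Skip_exact: "runs Skip m m 1"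
  by (rule runs_Skip) simp

text \<open>The value is the distance of the head from a mark on its left. Increment, decrement and
  the test for zero then take a single step each.\<close>

definition ctr :: "nat \<Rightarrow> view" where
  "ctr n j = (if j = - int n then 1 else 0)"

definition mk :: "mem \<Rightarrow> (nat \<Rightarrow> nat) \<Rightarrow> mem" where
  "mk E \<sigma> x = (case x of Cnt v \<Rightarrow> ctr (\<sigma> v) | _ \<Rightarrow> E x)"

definition on_tape :: "tapeid \<Rightarrow> (nat \<Rightarrow> nat \<times> int) \<Rightarrow> action" where
  "on_tape y g r x = (if x = y then g (r y) else (r x, 0))"

lemma act_mem_on_tape:
  "act_mem (on_tape y g) m = m(y := (\<lambda>j. ((m y)(0 := fst (g (m y 0)))) (j + snd (g (m y 0)))))"
  by (auto simp: fun_eq_iff act_mem_def on_tape_def heads_def)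

lemma legal_on_tape:
  assumes "\<And>s. fst (g s) < N \<or> fst (g s) = s" and "\<And>s. snd (g s) \<in> {-1, 0, 1}"
  shows "legal (Act (on_tape y g))"
proof (rule legal_ActI[of "max N (Suc (tape_index y))"])
  fix K B assume *: "max N (Suc (tape_index y)) \<le> K" "max N (Suc (tape_index y)) \<le> B"
  have "fst (g s) < B" if "s < B" for s using assms(1)[of s] * that by auto
  then show "action_wf K B (on_tape y g)"
    using assms(2) * unfolding action_wf_def on_tape_def by auto
qed

lemma mk_Cnt [simp]: "mk E \<sigma> (Cnt v) = ctr (\<sigma> v)"
  and mk_Inp [simp]: "mk E \<sigma> Inp = E Inp"
  and mk_Cell [simp]: "mk E \<sigma> Cell = E Cell"
  and mk_Sim [simp]: "mk E \<sigma> (Sim b j) = E (Sim b j)"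
  by (simp_all add: mk_def)

lemma heads_mk [simp]:
  "heads (mk E \<sigma>) (Cnt v) = (if \<sigma> v = 0 then 1 else 0)"
  "heads (mk E \<sigma>) Inp = E Inp 0"
  "heads (mk E \<sigma>) Cell = E Cell 0"
  "heads (mk E \<sigma>) (Sim b j) = E (Sim b j) 0"
  by (auto simp: heads_def ctr_def)

fun noncounter :: "tapeid \<Rightarrow> bool" where
  "noncounter (Cnt v) = False"
| "noncounter x = True"

lemma mk_noncounter: "noncounter x \<Longrightarrow> mk E \<sigma> x = E x"
  by (cases x) auto

lemma mk_eqI: "(\<And>v. \<sigma> v = \<tau> v) \<Longrightarrow> mk E \<sigma> = mk E \<tau>"
  by (metis ext)

lemma mk_upd_Cnt: "(mk E \<sigma>)(Cnt v := ctr n) = mk E (\<sigma>(v := n))"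
  by (auto simp: fun_eq_iff mk_def split: tapeid.splits)

lemma mk_upd_tape: "noncounter x \<Longrightarrow> (mk E \<sigma>)(x := f) = mk (E(x := f)) \<sigma>"
  by (auto simp: fun_eq_iff mk_def split: tapeid.splits)

definition inc :: "nat \<Rightarrow> prog" where
  "inc v = Act (on_tape (Cnt v) (\<lambda>s. (s, 1)))"

definition dec :: "nat \<Rightarrow> prog" where
  "dec v = Act (on_tape (Cnt v) (\<lambda>s. (s, if s = 1 then 0 else -1)))"

lemma runs_inc: "runs (inc v) (mk E \<sigma>) (mk E (\<sigma>(v := Suc (\<sigma> v)))) 1"
proof -
  have "(\<lambda>j. ctr (\<sigma> v) (j + 1)) = ctr (Suc (\<sigma> v))" by (auto simp: ctr_def fun_eq_iff)
  then show ?thesis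
    unfolding inc_def by (intro runs_Act) (simp_all add: act_mem_on_tape mk_upd_Cnt)
qed

lemma runs_dec: "runs (dec v) (mk E \<sigma>) (mk E (\<sigma>(v := \<sigma> v - 1))) 1"
proof -
  have "(\<lambda>j. ctr (\<sigma> v) (j + (if ctr (\<sigma> v) 0 = 1 then 0 else -1))) = ctr (\<sigma> v - 1)"
    by (auto simp: ctr_def fun_eq_iff)
  then show ?thesis
    unfolding dec_def by (intro runs_Act) (simp_all add: act_mem_on_tape mk_upd_Cnt)
qed

lemma legal_inc: "legal (inc v)" and legal_dec: "legal (dec v)"
  unfolding inc_def dec_def by (rule legal_on_tape[where N = 0]; auto)+

abbreviation is_zero :: "nat \<Rightarrow> reads \<Rightarrow> bool" where
  "is_zero v \<equiv> (\<lambda>r. r (Cnt v) = 1)"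

text \<open>A loop that consumes its counter: \<open>v\<close> is decremented before the body, so
  the body sees the number of iterations after the current one.\<close>

definition Rep :: "nat \<Rightarrow> prog \<Rightarrow> prog" where
  "Rep v c = Loop (\<lambda>r. r (Cnt v) \<noteq> 1) (dec v ;; c)"

lemma legal_Rep: "legal c \<Longrightarrow> legal (Rep v c)"
  unfolding Rep_def by (intro legal_intros legal_dec legal_test_read[of "\<lambda>s. s \<noteq> 1"])

text \<open>\<open>Es i\<close> and \<open>\<sigma>s i\<close> describe the memory after
  \<open>i\<close> iterations, up to the counter \<open>v\<close>: its entry is overwritten wherever
  \<open>\<sigma>s\<close> is used and may be chosen freely. The 3 pays for the test, the sequencing
  and the decrement.\<close>

lemma runs_Rep:
  assumes step: "\<And>i. i < n \<Longrightarrow>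
      runs c (mk (Es i) ((\<sigma>s i)(v := n - Suc i))) (mk (Es (Suc i)) ((\<sigma>s (Suc i))(v := n - Suc i))) T1"
    and m: "m = mk (Es 0) ((\<sigma>s 0)(v := n))" and m': "m' = mk (Es n) ((\<sigma>s n)(v := 0))"
    and T: "n * (T1 + 3) + 1 \<le> T"
  shows "runs (Rep v c) m m' T"
proof -
  define I where "I = (\<lambda>i. mk (Es i) ((\<sigma>s i)(v := n - i)))"
  have "runs (Rep v c) (I 0) (I n) T"
    unfolding Rep_def
  proof (rule runs_Loop_iterate[where ?T1.0 = "T1 + 2"])
    fix i assume i: "i < n"
    have "runs (dec v) (I i) (mk (Es i) ((\<sigma>s i)(v := n - Suc i))) 1"
      unfolding I_def by (rule runs_conv[OF runs_dec]) simp_all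
    moreover have "runs c (mk (Es i) ((\<sigma>s i)(v := n - Suc i))) (I (Suc i)) T1"
      using step[OF i] by (simp add: I_def)
    ultimately have "runs (dec v ;; c) (I i) (I (Suc i)) (T1 + 2)"
      by (rule runs_Seq) simp
    then show "heads (I i) (Cnt v) \<noteq> 1 \<and> runs (dec v ;; c) (I i) (I (Suc i)) (T1 + 2)"
      using i by (simp add: I_def)
  qed (use T in \<open>simp_all add: I_def algebra_simps\<close>)
  then show ?thesis by (simp add: I_def m m')
qed

lemma runs_Rep_inc:
  assumes "u \<noteq> v"
  shows "runs (Rep v (inc u)) (mk E \<sigma>) (mk E (\<sigma>(v := 0, u := \<sigma> u + \<sigma> v))) (4 * \<sigma> v + 1)"
  by (rule runs_Rep[where n = "\<sigma> v" and Es = "\<lambda>_. E" and \<sigma>s = "\<lambda>i. \<sigma>(u := \<sigma> u + i)" and ?T1.0 = 1],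
      rule runs_conv[OF runs_inc]) (use assms in \<open>auto intro!: mk_eqI\<close>)

lemma runs_Rep_dec:
  assumes "u \<noteq> v"
  shows "runs (Rep v (dec u)) (mk E \<sigma>) (mk E (\<sigma>(v := 0, u := \<sigma> u - \<sigma> v))) (4 * \<sigma> v + 1)"
  by (rule runs_Rep[where n = "\<sigma> v" and Es = "\<lambda>_. E" and \<sigma>s = "\<lambda>i. \<sigma>(u := \<sigma> u - i)" and ?T1.0 = 1],
      rule runs_conv[OF runs_dec]) (use assms in \<open>auto intro!: mk_eqI\<close>)

lemma runs_Rep_Skip: "runs (Rep v Skip) (mk E \<sigma>) (mk E (\<sigma>(v := 0))) (4 * \<sigma> v + 1)"
  by (rule runs_Rep[where n = "\<sigma> v" and Es = "\<lambda>_. E" and \<sigma>s = "\<lambda>i. \<sigma>" and ?T1.0 = 1])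
    (auto simp: fun_eq_iff)

lemma runs_Rep_inc2:
  assumes "u \<noteq> v" "t \<noteq> v" "t \<noteq> u"
  shows "runs (Rep v (inc u ;; inc t)) (mk E \<sigma>)
           (mk E (\<sigma>(v := 0, u := \<sigma> u + \<sigma> v, t := \<sigma> t + \<sigma> v))) (6 * \<sigma> v + 1)"
  by (rule runs_Rep[where n = "\<sigma> v" and Es = "\<lambda>_. E" and ?T1.0 = 3
        and \<sigma>s = "\<lambda>i. \<sigma>(u := \<sigma> u + i, t := \<sigma> t + i)"],
      rule runs_conv[OF runs_Seq_exact[OF runs_inc runs_inc]])
    (use assms in \<open>auto intro!: mk_eqI\<close>)

lemma runs_Rep_double:
  assumes "u \<noteq> v"
  shows "runs (Rep v (inc u ;; inc u)) (mk E \<sigma>)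
           (mk E (\<sigma>(v := 0, u := \<sigma> u + 2 * \<sigma> v))) (6 * \<sigma> v + 1)"
  by (rule runs_Rep[where n = "\<sigma> v" and Es = "\<lambda>_. E" and ?T1.0 = 3
        and \<sigma>s = "\<lambda>i. \<sigma>(u := \<sigma> u + 2 * i)"],
      rule runs_conv[OF runs_Seq_exact[OF runs_inc runs_inc]])
    (use assms in \<open>auto intro!: mk_eqI\<close>)

subsection \<open>Arithmetic on counters\<close>

text \<open>The operands are in the counters \<open>d\<close> and \<open>d + 1\<close>, the result goes to \<open>d\<close>.\<close>

definition add_op :: "nat \<Rightarrow> prog" where
  "add_op d = Rep (d + 1) (inc d)"

definition sub_op :: "nat \<Rightarrow> prog" where
  "sub_op d = Rep (d + 1) (dec d)"

definition less_op :: "nat \<Rightarrow> prog" where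
  "less_op d = Rep d (dec (d + 1)) ;; Cond (is_zero (d + 1)) Skip (Rep (d + 1) Skip ;; inc d)"

text \<open>Reading a counter destroys it. Each round therefore moves the second factor both to the
  accumulator \<open>d + 2\<close> and to the copy \<open>d + 3\<close>, from which it is
  restored.\<close>

definition mult_op :: "nat \<Rightarrow> prog" where
  "mult_op d =
     Rep d (Rep (d + 1) (inc (d + 2) ;; inc (d + 3)) ;; Rep (d + 3) (inc (d + 1))) ;;
     Rep (d + 1) Skip ;; Rep (d + 2) (inc d)"

text \<open>While \<open>d\<close> is counted down, the divisor is split between
  \<open>d + 1\<close> and \<open>d + 2\<close>, the latter being the current remainder. When
  \<open>d + 1\<close> is exhausted, it is refilled and the quotient in \<open>d + 3\<close> grows
  by one. A zero divisor gives 0, in accordance with \<open>div\<close>.\<close>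

definition div_op :: "nat \<Rightarrow> prog" where
  "div_op d =
     Cond (is_zero (d + 1)) (Rep d Skip)
      (Rep d (dec (d + 1) ;; inc (d + 2) ;;
          Cond (is_zero (d + 1)) (Rep (d + 2) (inc (d + 1)) ;; inc (d + 3)) Skip) ;;
       Rep (d + 1) Skip ;; Rep (d + 2) Skip ;; Rep (d + 3) (inc d))"

text \<open>The counter \<open>d + 2\<close> flips between 0 and 1 and ends as the parity; every
  flip back to 0 is recorded in \<open>d + 3\<close>.\<close>

definition halve :: "nat \<Rightarrow> prog" where
  "halve d =
     Rep d (Cond (is_zero (d + 2)) (inc (d + 2)) (dec (d + 2) ;; inc (d + 3))) ;;
     Rep (d + 3) (inc d)"

definition shift_op :: "nat \<Rightarrow> prog" where
  "shift_op d = Rep (d + 1) (halve d ;; Rep (d + 2) Skip)"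

lemmas op_defs = add_op_def sub_op_def less_op_def mult_op_def div_op_def halve_def shift_op_def

lemma legal_ops:
  "legal (add_op d)" "legal (sub_op d)" "legal (less_op d)" "legal (mult_op d)" "legal (div_op d)"
  "legal (halve d)" "legal (shift_op d)"
  unfolding op_defs by (intro legal_intros legal_Rep legal_inc legal_dec)+

lemma runs_add_op:
  "runs (add_op d) (mk E \<sigma>) (mk E (\<sigma>(d := \<sigma> d + \<sigma> (d + 1), d + 1 := 0))) (4 * \<sigma> (d + 1) + 1)"
  unfolding add_op_def by (rule runs_conv[OF runs_Rep_inc]) (auto intro!: mk_eqI)

lemma runs_sub_op:
  "runs (sub_op d) (mk E \<sigma>) (mk E (\<sigma>(d := \<sigma> d - \<sigma> (d + 1), d + 1 := 0))) (4 * \<sigma> (d + 1) + 1)"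
  unfolding sub_op_def by (rule runs_conv[OF runs_Rep_dec]) (auto intro!: mk_eqI)

lemma runs_less_op:
  "runs (less_op d) (mk E \<sigma>) (mk E (\<sigma>(d := of_bool (\<sigma> d < \<sigma> (d + 1)), d + 1 := 0)))
     (4 * \<sigma> d + 4 * \<sigma> (d + 1) + 6)"
  unfolding less_op_def
proof (rule runs_Seq[OF runs_Rep_dec runs_Cond[where ?T1.0 = "4 * \<sigma> (d + 1) + 3"]])
  let ?\<sigma> = "\<sigma>(d := 0, d + 1 := \<sigma> (d + 1) - \<sigma> d)"
  let ?\<tau> = "\<sigma>(d := of_bool (\<sigma> d < \<sigma> (d + 1)), d + 1 := 0)"
  { assume "is_zero (d + 1) (heads (mk E ?\<sigma>))"
    then have "?\<sigma> = ?\<tau>" by (auto simp: fun_eq_iff split: if_splits)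
    then show "runs Skip (mk E ?\<sigma>) (mk E ?\<tau>) (4 * \<sigma> (d + 1) + 3)" by auto }
  { assume "\<not> is_zero (d + 1) (heads (mk E ?\<sigma>))"
    then show "runs (Rep (d + 1) Skip ;; inc d) (mk E ?\<sigma>) (mk E ?\<tau>) (4 * \<sigma> (d + 1) + 3)"
      by (intro runs_conv[OF runs_Seq_exact[OF runs_Rep_Skip runs_inc]])
        (auto intro!: mk_eqI split: if_splits) }
qed auto

lemma runs_mult_op:
  assumes "\<sigma> (d + 2) = 0" "\<sigma> (d + 3) = 0"
  shows "runs (mult_op d) (mk E \<sigma>) (mk E (\<sigma>(d := \<sigma> d * \<sigma> (d + 1), d + 1 := 0)))
     (14 * \<sigma> d * \<sigma> (d + 1) + 6 * \<sigma> d + 4 * \<sigma> (d + 1) + 5)"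
proof -
  let ?y = "\<sigma> (d + 1)"
  have "runs (Rep d (Rep (d + 1) (inc (d + 2) ;; inc (d + 3)) ;; Rep (d + 3) (inc (d + 1))))
     (mk E \<sigma>) (mk E (\<sigma>(d := 0, d + 2 := \<sigma> d * ?y))) (\<sigma> d * (10 * ?y + 6) + 1)"
  proof (rule runs_Rep[where n = "\<sigma> d" and Es = "\<lambda>_. E" and ?T1.0 = "10 * ?y + 3"
        and \<sigma>s = "\<lambda>i. \<sigma>(d + 2 := i * ?y)"])
    fix i assume "i < \<sigma> d"
    show "runs (Rep (d + 1) (inc (d + 2) ;; inc (d + 3)) ;; Rep (d + 3) (inc (d + 1)))
       (mk E (\<sigma>(d + 2 := i * ?y, d := \<sigma> d - Suc i)))
       (mk E (\<sigma>(d + 2 := Suc i * ?y, d := \<sigma> d - Suc i))) (10 * ?y + 3)"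
      by (rule runs_conv[OF runs_Seq_exact[OF runs_Rep_inc2 runs_Rep_inc]])
        (use assms in \<open>auto intro!: mk_eqI\<close>)
  qed (use assms in \<open>auto intro!: mk_eqI\<close>)
  then show ?thesis
    unfolding mult_op_def
    by (intro runs_conv[OF runs_Seq_exact[OF _ runs_Seq_exact[OF runs_Rep_Skip runs_Rep_inc]]])
      (use assms in \<open>auto simp: algebra_simps intro!: mk_eqI\<close>)
qed

lemma runs_div_op:
  assumes "\<sigma> (d + 2) = 0" "\<sigma> (d + 3) = 0"
  shows "runs (div_op d) (mk E \<sigma>) (mk E (\<sigma>(d := \<sigma> d div \<sigma> (d + 1), d + 1 := 0)))
     (\<sigma> d * (4 * \<sigma> (d + 1) + 20) + 8 * \<sigma> (d + 1) + 20)"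
proof -
  let ?y = "\<sigma> (d + 1)" and ?x = "\<sigma> d"
  let ?\<tau> = "\<sigma>(d := ?x div ?y, d + 1 := 0)"
  let ?body = "dec (d + 1) ;; inc (d + 2) ;;
          Cond (is_zero (d + 1)) (Rep (d + 2) (inc (d + 1)) ;; inc (d + 3)) Skip"
  have main: "runs (Rep d ?body ;; Rep (d + 1) Skip ;; Rep (d + 2) Skip ;; Rep (d + 3) (inc d))
      (mk E \<sigma>) (mk E ?\<tau>) (?x * (4 * ?y + 20) + 8 * ?y + 19)" if y: "?y > 0"
  proof -
    define \<rho> where "\<rho> = (\<lambda>i. \<sigma>(d + 1 := ?y - i mod ?y, d + 2 := i mod ?y, d + 3 := i div ?y))"
    have "runs (Rep d ?body) (mk E \<sigma>) (mk E ((\<rho> ?x)(d := 0))) (?x * (4 * ?y + 12) + 1)"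
    proof (rule runs_Rep[where n = ?x and Es = "\<lambda>_. E" and ?T1.0 = "4 * ?y + 9" and \<sigma>s = \<rho>])
      fix i assume "i < ?x"
      let ?\<rho> = "(\<rho> i)(d := ?x - Suc i, d + 1 := ?y - i mod ?y - 1, d + 2 := Suc (i mod ?y))"
      have im: "i mod ?y < ?y" using y by simp
      have "runs (Cond (is_zero (d + 1)) (Rep (d + 2) (inc (d + 1)) ;; inc (d + 3)) Skip)
         (mk E ?\<rho>) (mk E ((\<rho> (Suc i))(d := ?x - Suc i))) (4 * ?y + 5)"
      proof (rule runs_Cond[where ?T1.0 = "4 * ?y + 4"])
        assume "is_zero (d + 1) (heads (mk E ?\<rho>))"
        then have "Suc (i mod ?y) = ?y" using im by (simp split: if_splits)
        moreover from this have "Suc i mod ?y = 0" "Suc i div ?y = Suc (i div ?y)"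
          by (simp_all add: mod_Suc div_Suc)
        ultimately show "runs (Rep (d + 2) (inc (d + 1)) ;; inc (d + 3)) (mk E ?\<rho>)
            (mk E ((\<rho> (Suc i))(d := ?x - Suc i))) (4 * ?y + 4)"
          by (intro runs_conv[OF runs_Seq_exact[OF runs_Rep_inc runs_inc]])
            (auto simp: \<rho>_def intro!: mk_eqI)
      next
        assume "\<not> is_zero (d + 1) (heads (mk E ?\<rho>))"
        then have "Suc (i mod ?y) \<noteq> ?y" using im by (simp split: if_splits)
        moreover from this have "Suc i mod ?y = Suc (i mod ?y)" "Suc i div ?y = i div ?y"
          by (simp_all add: mod_Suc div_Suc)
        ultimately have "?\<rho> = (\<rho> (Suc i))(d := ?x - Suc i)"
          by (auto simp: fun_eq_iff \<rho>_def)
        then show "runs Skip (mk E ?\<rho>) (mk E ((\<rho> (Suc i))(d := ?x - Suc i))) (4 * ?y + 4)" by auto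
      qed simp
      then show "runs ?body (mk E ((\<rho> i)(d := ?x - Suc i))) (mk E ((\<rho> (Suc i))(d := ?x - Suc i))) (4 * ?y + 9)"
        by (intro runs_Seq[OF runs_dec runs_Seq[OF runs_inc runs_conv]])
          (auto simp: \<rho>_def intro!: mk_eqI)
    qed (use assms y in \<open>auto simp: \<rho>_def algebra_simps intro!: mk_eqI\<close>)
    moreover have "?x mod ?y \<le> ?y" "?x div ?y \<le> ?x" using y by (simp_all add: less_imp_le)
    moreover from this have "4 * (?x div ?y) \<le> 12 + (?x * 8 + ?y * 4)" by linarith
    ultimately show ?thesis
      by (intro runs_conv[OF runs_Seq_exact[OF _ runs_Seq_exact[OF runs_Rep_Skip
              runs_Seq_exact[OF runs_Rep_Skip runs_Rep_inc]]]])
        (use assms in \<open>auto simp: \<rho>_def algebra_simps intro!: mk_eqI\<close>)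
  qed
  have zero: "runs (Rep d Skip) (mk E \<sigma>) (mk E ?\<tau>) (?x * (4 * ?y + 20) + 8 * ?y + 19)" if "?y = 0"
    by (rule runs_conv[OF runs_Rep_Skip])
      (use that in \<open>auto intro!: mk_eqI\<close>)
  show ?thesis unfolding div_op_def
    by (rule runs_Cond[OF zero main]) (auto split: if_splits)
qed

lemma runs_halve:
  assumes "\<sigma> (d + 2) = 0" "\<sigma> (d + 3) = 0"
  shows "runs (halve d) (mk E \<sigma>) (mk E (\<sigma>(d := \<sigma> d div 2, d + 2 := \<sigma> d mod 2))) (12 * \<sigma> d + 5)"
proof -
  define \<rho> where "\<rho> = (\<lambda>i. \<sigma>(d + 2 := i mod 2, d + 3 := i div 2))"
  have "runs (Rep d (Cond (is_zero (d + 2)) (inc (d + 2)) (dec (d + 2) ;; inc (d + 3))))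
      (mk E \<sigma>) (mk E ((\<rho> (\<sigma> d))(d := 0))) (8 * \<sigma> d + 1)"
  proof (rule runs_Rep[where n = "\<sigma> d" and Es = "\<lambda>_. E" and ?T1.0 = 4 and \<sigma>s = \<rho>])
    fix i
    let ?\<rho> = "\<lambda>i'. (\<rho> i')(d := \<sigma> d - Suc i)"
    show "runs (Cond (is_zero (d + 2)) (inc (d + 2)) (dec (d + 2) ;; inc (d + 3)))
        (mk E (?\<rho> i)) (mk E (?\<rho> (Suc i))) 4"
    proof (rule runs_Cond[where ?T1.0 = 3])
      assume "is_zero (d + 2) (heads (mk E (?\<rho> i)))"
      then have "even i" by (simp add: \<rho>_def even_iff_mod_2_eq_zero split: if_splits)
      then have "Suc i mod 2 = 1" "Suc i div 2 = i div 2" "i mod 2 = 0" by presburger+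
      then show "runs (inc (d + 2)) (mk E (?\<rho> i)) (mk E (?\<rho> (Suc i))) 3"
        by (intro runs_conv[OF runs_inc]) (auto simp: \<rho>_def intro!: mk_eqI)
    next
      assume "\<not> is_zero (d + 2) (heads (mk E (?\<rho> i)))"
      then have "odd i" by (simp add: \<rho>_def even_iff_mod_2_eq_zero split: if_splits)
      then have "Suc i mod 2 = 0" "Suc i div 2 = Suc (i div 2)" "i mod 2 = 1" by presburger+
      then show "runs (dec (d + 2) ;; inc (d + 3)) (mk E (?\<rho> i)) (mk E (?\<rho> (Suc i))) 3"
        by (intro runs_conv[OF runs_Seq_exact[OF runs_dec runs_inc]])
          (auto simp: \<rho>_def intro!: mk_eqI)
    qed simp
  qed (use assms in \<open>auto simp: \<rho>_def intro!: mk_eqI\<close>)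
  then show ?thesis
    unfolding halve_def
    by (intro runs_conv[OF runs_Seq_exact[OF _ runs_Rep_inc]])
      (use assms in \<open>auto simp: \<rho>_def intro!: mk_eqI\<close>)
qed

lemma runs_shift_op:
  assumes "\<sigma> (d + 2) = 0" "\<sigma> (d + 3) = 0"
  shows "runs (shift_op d) (mk E \<sigma>) (mk E (\<sigma>(d := \<sigma> d div 2 ^ \<sigma> (d + 1), d + 1 := 0)))
     (\<sigma> (d + 1) * (12 * \<sigma> d + 20) + 1)"
  unfolding shift_op_def
proof (rule runs_Rep[where n = "\<sigma> (d + 1)" and Es = "\<lambda>_. E" and ?T1.0 = "12 * \<sigma> d + 11"
      and \<sigma>s = "\<lambda>i. \<sigma>(d := \<sigma> d div 2 ^ i)"])
  fix i
  let ?\<rho> = "\<lambda>j. \<sigma>(d := \<sigma> d div 2 ^ j, d + 1 := \<sigma> (d + 1) - Suc i)"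
  have "\<sigma> d div 2 ^ i mod 2 \<le> 1" "\<sigma> d div 2 ^ i \<le> \<sigma> d" by simp_all
  then have "12 * (\<sigma> d div 2 ^ i) + 4 * (\<sigma> d div 2 ^ i mod 2) \<le> 4 + 12 * \<sigma> d" by linarith
  then show "runs (halve d ;; Rep (d + 2) Skip) (mk E (?\<rho> i)) (mk E (?\<rho> (Suc i))) (12 * \<sigma> d + 11)"
    by (intro runs_conv[OF runs_Seq_exact[OF runs_halve runs_Rep_Skip]])
      (use assms in \<open>auto simp: div_mult2_eq[symmetric] mult.commute
        intro!: mk_eqI\<close>)
qed (use assms in \<open>auto simp: algebra_simps intro!: mk_eqI\<close>)


section \<open>Tapes as zippers\<close>

text \<open>\<open>zipper l r\<close>: the word \<open>r\<close> starts under the head, the word \<open>rev l\<close> ends just left of it.\<close>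

definition zipper :: "nat list \<Rightarrow> nat list \<Rightarrow> view" where
  "zipper l r j =
     (if 0 \<le> j then if nat j < length r then r ! nat j else 0
      else if nat (- j - 1) < length l then l ! nat (- j - 1) else 0)"

lemma zipper_0 [simp]: "zipper l (a # r) 0 = a" "zipper l [] 0 = 0"
  by (simp_all add: zipper_def)

lemma zipper_right: "(\<lambda>j. zipper l (a # r) (j + 1)) = zipper (a # l) r"
proof
  fix j :: int
  consider "j \<ge> 0" | "j = -1" | "j < -1" by linarith
  then show "zipper l (a # r) (j + 1) = zipper (a # l) r j"
  proof cases
    case 1
    then have "nat (j + 1) = Suc (nat j)" by linarith
    then show ?thesis using 1 by (simp add: zipper_def)
  next
    case 2
    then show ?thesis by (simp add: zipper_def)
  next
    case 3
    then have "nat (- j - 1) = Suc (nat (- (j + 1) - 1))" by linarith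
    then show ?thesis using 3 by (simp add: zipper_def)
  qed
qed

lemma zipper_left: "(\<lambda>j. zipper (a # l) r (j - 1)) = zipper l (a # r)"
  using zipper_right[of l a r, symmetric] by (simp add: fun_eq_iff)

lemma zipper_blank_left: "zipper [0] r = zipper [] r"
  by (auto simp: zipper_def fun_eq_iff)

lemma zipper_blank_right: "zipper l [0] = zipper l []"
  by (auto simp: zipper_def fun_eq_iff)

lemma zipper_write: "(zipper l (a # r))(0 := b) = zipper l (b # r)"
  by (auto simp: zipper_def fun_eq_iff nth_Cons' )

lemma zipper_input: "zipper [] w = tape_view (input_tape w)"
  by (auto simp: zipper_def fun_eq_iff tape_view_def input_tape_def)

section \<open>Elementary programs on words\<close>

definition mvR :: "tapeid \<Rightarrow> prog" where
  "mvR y = Act (on_tape y (\<lambda>s. (s, 1)))"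

definition mvL :: "tapeid \<Rightarrow> prog" where
  "mvL y = Act (on_tape y (\<lambda>s. (s, -1)))"

text \<open>Staying put on a blank makes it harmless to skip numbers beyond the end of the
  input.\<close>

definition mvR_nonblank :: "tapeid \<Rightarrow> prog" where
  "mvR_nonblank y = Act (on_tape y (\<lambda>s. (s, if s = 0 then 0 else 1)))"

definition put :: "tapeid \<Rightarrow> nat \<Rightarrow> prog" where
  "put y a = Act (on_tape y (\<lambda>s. (a, 1)))"

lemma legal_moves: "legal (mvR y)" "legal (mvL y)" "legal (mvR_nonblank y)" "legal (put y a)"
  unfolding mvR_def mvL_def mvR_nonblank_def put_def
  by (rule legal_on_tape[where N = "Suc a"]; auto)+

lemma runs_move:
  assumes "noncounter y"
  shows "runs (Act (on_tape y (\<lambda>s. (s, f s)))) (mk E \<sigma>) (mk (E(y := (\<lambda>j. E y (j + f (E y 0))))) \<sigma>) 1"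
  by (rule runs_Act) (simp_all add: act_mem_on_tape mk_noncounter[OF assms] mk_upd_tape[OF assms])

lemma runs_mvR:
  "noncounter y \<Longrightarrow>
   runs (mvR y) (mk (E(y := zipper l (a # r))) \<sigma>) (mk (E(y := zipper (a # l) r)) \<sigma>) 1"
  unfolding mvR_def by (rule runs_conv[OF runs_move]) (simp_all add: zipper_right)

lemma runs_mvL:
  "noncounter y \<Longrightarrow>
   runs (mvL y) (mk (E(y := zipper (a # l) r)) \<sigma>) (mk (E(y := zipper l (a # r))) \<sigma>) 1"
  unfolding mvL_def by (rule runs_conv[OF runs_move]) (simp_all add: zipper_left)

lemma runs_mvR_nonblank:
  "noncounter y \<Longrightarrow> a \<noteq> 0 \<Longrightarrow>
   runs (mvR_nonblank y) (mk (E(y := zipper l (a # r))) \<sigma>) (mk (E(y := zipper (a # l) r)) \<sigma>) 1"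
  "noncounter y \<Longrightarrow>
   runs (mvR_nonblank y) (mk (E(y := zipper l [])) \<sigma>) (mk (E(y := zipper l [])) \<sigma>) 1"
  unfolding mvR_nonblank_def by (rule runs_conv[OF runs_move]; simp add: zipper_right)+

lemma runs_put:
  assumes "noncounter y"
  shows "runs (put y a) (mk (E(y := zipper l [])) \<sigma>) (mk (E(y := zipper (a # l) [])) \<sigma>) 1"
proof -
  have "(\<lambda>j. ((zipper l [])(0 := a)) (j + 1)) = zipper (a # l) []"
    using zipper_write[of l 0 "[]" a] zipper_right[of l a "[]"] by (simp add: zipper_blank_right)
  then show ?thesis
    unfolding put_def
    by (intro runs_Act) (simp_all add: act_mem_on_tape mk_noncounter[OF assms] mk_upd_tape[OF assms])
qed

text \<open>The symbol under the head does not depend on the left part of the zipper, so the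
  stopping condition can be stated with an arbitrary \<open>l'\<close>.\<close>

lemma runs_scan:
  assumes y: "noncounter y" and "\<forall>s\<in>set u. P s" and "\<not> P (zipper l' r 0)"
  shows "runs (Loop (\<lambda>h. P (h y)) (mvR y)) (mk (E(y := zipper l (u @ r))) \<sigma>)
           (mk (E(y := zipper (rev u @ l) r)) \<sigma>) (2 * length u + 1)"
  using assms(2)
proof (induction u arbitrary: l)
  case Nil
  have "zipper l r 0 = zipper l' r 0" by (simp add: zipper_def)
  then show ?case using assms(3) y
    by (intro runs_conv[OF runs_Loop_end[of _ _ 1]]) (simp_all add: heads_def mk_noncounter)
next
  case (Cons a u)
  show ?case unfolding append_Cons
    by (rule runs_conv[OF runs_Loop_step[OF _ runs_mvR[OF y] Cons.IH order_refl]])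
      (use Cons.prems in \<open>simp_all add: heads_def mk_noncounter[OF y]\<close>)
qed

text \<open>The initial move to the left allows a start on the blank behind the word; the loop then
  runs to the blank in front of the word, and the last move returns to its first symbol.\<close>

definition rewind :: "tapeid \<Rightarrow> prog" where
  "rewind y = mvL y ;; Loop (\<lambda>h. h y \<noteq> 0) (mvL y) ;; mvR y"

lemma legal_rewind: "legal (rewind y)"
  unfolding rewind_def by (intro legal_intros legal_moves legal_test_read[of "\<lambda>s. s \<noteq> 0"])

lemma runs_rewind:
  assumes y: "noncounter y" and "0 \<notin> set l"
  shows "runs (rewind y) (mk (E(y := zipper l r)) \<sigma>) (mk (E(y := zipper [] (rev l @ r))) \<sigma>)
           (2 * length l + 5)"
proof -
  have left_end: "runs (mvL y) (mk (E(y := zipper [] r)) \<sigma>) (mk (E(y := zipper [] (0 # r))) \<sigma>) 1" for r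
    using runs_mvL[OF y, of E 0 "[]" r \<sigma>] by (simp add: zipper_blank_left)
  have right: "runs (mvR y) (mk (E(y := zipper [] (0 # r))) \<sigma>) (mk (E(y := zipper [] r)) \<sigma>) 1" for r
    using runs_mvR[OF y, of E "[]" 0 r \<sigma>] by (simp add: zipper_blank_left)
  have stop: "runs (Loop (\<lambda>h. h y \<noteq> 0) (mvL y)) (mk (E(y := zipper [] (0 # r))) \<sigma>)
      (mk (E(y := zipper [] (0 # r))) \<sigma>) 1" for r
    by (rule runs_Loop_end) (simp_all add: heads_def mk_noncounter[OF y])
  have loop: "runs (Loop (\<lambda>h. h y \<noteq> 0) (mvL y)) (mk (E(y := zipper l (a # r))) \<sigma>)
      (mk (E(y := zipper [] (0 # rev l @ a # r))) \<sigma>) (2 * length l + 3)"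
    if "0 \<notin> set l" "a \<noteq> 0" for l a r
    using that
  proof (induction l arbitrary: a r)
    case Nil
    show ?case
      by (rule runs_conv[OF runs_Loop_step[OF _ left_end[of "a # r"] stop[of "a # r"] order_refl]])
        (use Nil in \<open>simp_all add: heads_def mk_noncounter[OF y] fun_upd_def\<close>)
  next
    case (Cons b l)
    show ?case
      by (rule runs_conv[OF runs_Loop_step[OF _ runs_mvL[OF y] Cons.IH order_refl]])
        (use Cons.prems in \<open>simp_all add: heads_def mk_noncounter[OF y]\<close>)
  qed
  show ?thesis
  proof (cases l)
    case Nil
    show ?thesis unfolding rewind_def Nil
      by (rule runs_conv[OF runs_Seq_exact[OF left_end runs_Seq_exact[OF stop right]]]) auto
  next
    case (Cons a l')
    show ?thesis unfolding rewind_def Cons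
      by (rule runs_conv[OF runs_Seq_exact[OF runs_mvL[OF y] runs_Seq_exact[OF loop right]]])
        (use assms(2) Cons in auto)
  qed
qed


section \<open>Reading the input\<close>

definition numbers_word :: "nat list \<Rightarrow> nat list" where
  "numbers_word xs = concat (map enc_nat xs)"

definition input_word :: "nat \<Rightarrow> nat list \<Rightarrow> nat list" where
  "input_word n xs = enc_unary n @ numbers_word xs"

lemma set_bin: "set (bin x) \<subseteq> {1, 2}"
proof (induction x rule: bin.induct)
  case (1 n)
  then show ?case by (subst bin.simps) auto
qed

lemma set_numbers_word: "set (numbers_word xs) \<subseteq> {1, 2, 3}"
proof -
  have "set (enc_nat x) \<subseteq> {1, 2, 3}" for x using set_bin[of x] by (auto simp: enc_nat_def)
  then show ?thesis by (simp add: numbers_word_def UN_subset_iff)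
qed

lemma set_input_word: "set (input_word n xs) \<subseteq> {1, 2, 3}"
  using set_numbers_word by (auto simp: input_word_def enc_unary_def)

fun bits_value :: "nat list \<Rightarrow> nat" where
  "bits_value [] = 0"
| "bits_value (a # u) = (a - 1) + 2 * bits_value u"

lemma bits_value_bin: "bits_value (bin x) = x"
proof (induction x rule: bin.induct)
  case (1 n)
  then show ?case by (subst bin.simps) auto
qed

text \<open>Bounds the power of two that \<open>read_bits\<close> builds up in its second counter.
  This is the origin of the requirement \<open>2 * x + 1 \<le> b\<close> on the numbers of the
  input.\<close>

lemma length_bin_le: "2 ^ length (bin x) \<le> 2 * x + 1"
proof -
  have "2 ^ length (bin x) \<le> 2 * x" if "x > 0"
    using that
  proof (induction x rule: bin.induct)
    case (1 n)
    have b: "bin n = (n mod 2 + 1) # bin (n div 2)" using 1 by (subst bin.simps) simp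
    show ?case
    proof (cases "n div 2 = 0")
      case True
      then show ?thesis using 1(2) b by (simp add: bin.simps[of 0])
    next
      case False
      then have "2 ^ length (bin (n div 2)) \<le> 2 * (n div 2)" using 1 by simp
      moreover have "2 * (n div 2) \<le> n" by simp
      ultimately have "2 ^ length (bin (n div 2)) \<le> n" by (rule order_trans)
      then show ?thesis using b by simp
    qed
  qed
  then show ?thesis by (cases "x = 0") (auto simp: bin.simps[of 0] intro: le_SucI)
qed

definition read_unary :: "nat \<Rightarrow> prog" where
  "read_unary d = Loop (\<lambda>h. h Inp = 2) (inc d ;; mvR Inp) ;; rewind Inp"

definition to_numbers :: prog where
  "to_numbers = Loop (\<lambda>h. h Inp = 2) (mvR Inp) ;; mvR Inp"

definition count_numbers :: "nat \<Rightarrow> prog" where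
  "count_numbers d =
     to_numbers ;; Loop (\<lambda>h. h Inp \<noteq> 0) (Cond (\<lambda>h. h Inp = 3) (inc d) Skip ;; mvR Inp) ;; rewind Inp"

text \<open>As the least significant bit comes first, the counter \<open>d + 1\<close> carries the
  current power of two. It is added to \<open>d\<close> when the bit is 1, that is, for the symbol
  2, and doubled in every round.\<close>

definition read_bits :: "nat \<Rightarrow> prog" where
  "read_bits d =
     Loop (\<lambda>h. h Inp \<in> {1, 2})
      (Cond (\<lambda>h. h Inp = 2) (Rep (d + 1) (inc d ;; inc (d + 2)) ;; Rep (d + 2) (inc (d + 1))) Skip ;;
       (Rep (d + 1) (inc (d + 2) ;; inc (d + 2)) ;; Rep (d + 2) (inc (d + 1))) ;; mvR Inp)"

definition read_number :: "nat \<Rightarrow> prog" where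
  "read_number d =
     to_numbers ;; Rep d (Loop (\<lambda>h. h Inp \<in> {1, 2}) (mvR Inp) ;; mvR_nonblank Inp) ;;
     inc (d + 1) ;; read_bits d ;; Rep (d + 1) Skip ;; rewind Inp"

lemma legal_reading: "legal (read_unary d)" "legal (count_numbers d)" "legal (read_number d)"
  unfolding read_unary_def count_numbers_def read_number_def to_numbers_def read_bits_def
  by (intro legal_intros legal_Rep legal_inc legal_dec legal_moves legal_rewind
      legal_test_read[of "\<lambda>s. s \<noteq> 0"] legal_test_read[of "\<lambda>s. s \<in> {1, 2}"])+

lemma runs_read_unary:
  assumes "E Inp = zipper [] (input_word n xs)" "\<sigma> d = 0"
  shows "runs (read_unary d) (mk E \<sigma>) (mk E (\<sigma>(d := n))) (6 * n + 7)"
proof -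
  define R where "R = 3 # numbers_word xs"
  have w: "input_word n xs = replicate n 2 @ R" by (simp add: input_word_def enc_unary_def R_def)
  have "runs (Loop (\<lambda>h. h Inp = 2) (inc d ;; mvR Inp))
     (mk (E(Inp := zipper (replicate 0 2) (replicate (n - 0) 2 @ R))) (\<sigma>(d := 0)))
     (mk (E(Inp := zipper (replicate n 2) (replicate (n - n) 2 @ R))) (\<sigma>(d := n))) (n * 4 + 1)"
  proof (rule runs_Loop_iterate[where ?T1.0 = 3 and
        I = "\<lambda>i. mk (E(Inp := zipper (replicate i 2) (replicate (n - i) 2 @ R))) (\<sigma>(d := i))"])
    fix i assume i: "i < n"
    have e: "replicate (n - i) 2 @ R = 2 # (replicate (n - Suc i) 2 @ R)"
      using i by (metis Suc_diff_Suc append_Cons replicate_Suc)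
    have "runs (inc d ;; mvR Inp) (mk (E(Inp := zipper (replicate i 2) (replicate (n - i) 2 @ R))) (\<sigma>(d := i)))
      (mk (E(Inp := zipper (replicate (Suc i) 2) (replicate (n - Suc i) 2 @ R))) (\<sigma>(d := Suc i))) 3"
      unfolding e by (rule runs_conv[OF runs_Seq_exact[OF runs_inc runs_mvR]]) auto
    then show "heads (mk (E(Inp := zipper (replicate i 2) (replicate (n - i) 2 @ R))) (\<sigma>(d := i))) Inp = 2 \<and>
       runs (inc d ;; mvR Inp) (mk (E(Inp := zipper (replicate i 2) (replicate (n - i) 2 @ R))) (\<sigma>(d := i)))
      (mk (E(Inp := zipper (replicate (Suc i) 2) (replicate (n - Suc i) 2 @ R))) (\<sigma>(d := Suc i))) 3"
      by (simp add: e)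
  qed (simp_all add: R_def)
  then have L: "runs (Loop (\<lambda>h. h Inp = 2) (inc d ;; mvR Inp)) (mk E \<sigma>)
     (mk (E(Inp := zipper (replicate n 2) R)) (\<sigma>(d := n))) (n * 4 + 1)"
    using assms w by (simp add: fun_upd_idem)
  have "E(Inp := zipper [] (rev (replicate n 2) @ R)) = E" using assms w by auto
  then show ?thesis unfolding read_unary_def
    by (intro runs_conv[OF runs_Seq_exact[OF L runs_rewind]]) auto
qed

lemma runs_to_numbers:
  assumes "E Inp = zipper [] (input_word n xs)"
  shows "runs to_numbers (mk E \<sigma>)
     (mk (E(Inp := zipper (rev (enc_unary n)) (numbers_word xs))) \<sigma>) (2 * n + 3)"
proof -
  have e: "mk E \<sigma> = mk (E(Inp := zipper [] (replicate n 2 @ 3 # numbers_word xs))) \<sigma>"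
    using assms by (simp add: input_word_def enc_unary_def fun_upd_idem)
  show ?thesis unfolding to_numbers_def e
    by (rule runs_conv[OF runs_Seq_exact[OF
            runs_scan[where P = "\<lambda>s. s = 2" and l' = "[]" and u = "replicate n 2"] runs_mvR]])
      (auto simp: enc_unary_def)
qed

lemma count_list_numbers_word: "count_list (numbers_word xs) 3 = length xs"
proof -
  have "count_list (enc_nat x) 3 = 1" for x
    using set_bin[of x] by (auto simp: enc_nat_def count_list_0_iff)
  then show ?thesis by (induction xs) (auto simp: numbers_word_def)
qed

lemma back_to_start:
  assumes "E Inp = zipper [] (input_word n xs)" and "rev l @ r = input_word n xs"
  shows "runs (rewind Inp) (mk (E(Inp := zipper l r)) \<sigma>) (mk E \<sigma>) (2 * length (input_word n xs) + 5)"
proof -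
  have "0 \<notin> set l" using set_input_word[of n xs] assms(2)[symmetric] by auto
  moreover have "length l \<le> length (input_word n xs)" using assms(2)[symmetric] by auto
  moreover have "E(Inp := zipper [] (rev l @ r)) = E" using assms by auto
  ultimately show ?thesis by (intro runs_conv[OF runs_rewind]) auto
qed

lemma runs_count_numbers:
  assumes "E Inp = zipper [] (input_word n xs)" "\<sigma> d = 0"
  shows "runs (count_numbers d) (mk E \<sigma>) (mk E (\<sigma>(d := length xs))) (12 * length (input_word n xs) + 12)"
proof -
  let ?c = "Cond (\<lambda>h. h Inp = 3) (inc d) Skip ;; mvR Inp"
  have loop: "runs (Loop (\<lambda>h. h Inp \<noteq> 0) ?c) (mk (E(Inp := zipper l u)) \<sigma>)
     (mk (E(Inp := zipper (rev u @ l) [])) (\<sigma>(d := \<sigma> d + count_list u 3))) (5 * length u + 1)"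
    if "0 \<notin> set u" for u l \<sigma>
    using that
  proof (induction u arbitrary: l \<sigma>)
    case Nil
    show ?case by (rule runs_conv[OF runs_Loop_end[of _ _ 1]]) auto
  next
    case (Cons a u)
    let ?\<sigma> = "\<sigma>(d := \<sigma> d + of_bool (a = 3))"
    have "runs (Cond (\<lambda>h. h Inp = 3) (inc d) Skip) (mk (E(Inp := zipper l (a # u))) \<sigma>)
       (mk (E(Inp := zipper l (a # u))) ?\<sigma>) 2"
    proof (rule runs_Cond[where ?T1.0 = 1])
      assume "heads (mk (E(Inp := zipper l (a # u))) \<sigma>) Inp = 3"
      then show "runs (inc d) (mk (E(Inp := zipper l (a # u))) \<sigma>) (mk (E(Inp := zipper l (a # u))) ?\<sigma>) 1"
        by (intro runs_conv[OF runs_inc]) auto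
    next
      assume "heads (mk (E(Inp := zipper l (a # u))) \<sigma>) Inp \<noteq> 3"
      then show "runs Skip (mk (E(Inp := zipper l (a # u))) \<sigma>) (mk (E(Inp := zipper l (a # u))) ?\<sigma>) 1"
        by (intro runs_conv[OF runs_Skip_exact]) auto
    qed simp
    then have body: "runs ?c (mk (E(Inp := zipper l (a # u))) \<sigma>) (mk (E(Inp := zipper (a # l) u)) ?\<sigma>) 4"
      by (rule runs_Seq[OF _ runs_mvR]) auto
    show ?case
      by (rule runs_conv[OF runs_Loop_step[OF _ body Cons.IH order_refl]])
        (use Cons.prems in \<open>auto intro!: mk_eqI\<close>)
  qed
  have "0 \<notin> set (numbers_word xs)" using set_numbers_word[of xs] by auto
  from loop[OF this, of "rev (enc_unary n)" \<sigma>] have L: "runs (Loop (\<lambda>h. h Inp \<noteq> 0) ?c)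
      (mk (E(Inp := zipper (rev (enc_unary n)) (numbers_word xs))) \<sigma>)
     (mk (E(Inp := zipper (rev (numbers_word xs) @ rev (enc_unary n)) [])) (\<sigma>(d := length xs)))
     (5 * length (numbers_word xs) + 1)"
    using assms(2) by (simp add: count_list_numbers_word)
  show ?thesis unfolding count_numbers_def
    by (rule runs_conv[OF runs_Seq_exact[OF runs_to_numbers[where E = E, OF assms(1)]
          runs_Seq_exact[OF L back_to_start[where E = E, OF assms(1)]]]])
      (auto simp: input_word_def enc_unary_def)
qed

lemma runs_read_bits:
  assumes "set u \<subseteq> {1, 2}" and "zipper l' r 0 \<notin> {1, 2}" and "\<sigma> (d + 2) = 0"
    and "\<sigma> (d + 1) * 2 ^ length u \<le> b"
  shows "runs (read_bits d) (mk (E(Inp := zipper l (u @ r))) \<sigma>)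
     (mk (E(Inp := zipper (rev u @ l) r))
        (\<sigma>(d := \<sigma> d + \<sigma> (d + 1) * bits_value u, d + 1 := \<sigma> (d + 1) * 2 ^ length u)))
     (length u * (24 * b + 12) + 1)"
  using assms(1,3,4)
proof (induction u arbitrary: l \<sigma>)
  case Nil
  have "zipper l r 0 = zipper l' r 0" by (simp add: zipper_def)
  with assms(2) show ?case unfolding read_bits_def
    by (intro runs_conv[OF runs_Loop_end[of _ _ 1]]) auto
next
  case (Cons a u)
  let ?P = "\<sigma> (d + 1)"
  let ?m = "\<lambda>\<sigma>. mk (E(Inp := zipper l ((a # u) @ r))) \<sigma>"
  let ?\<sigma> = "\<sigma>(d := \<sigma> d + ?P * (a - 1))"
  have Pb: "?P \<le> b" "2 * ?P \<le> b"
    using Cons.prems(3) by (auto intro: order_trans[rotated])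
  have 1: "runs (Cond (\<lambda>h. h Inp = 2) (Rep (d + 1) (inc d ;; inc (d + 2)) ;; Rep (d + 2) (inc (d + 1))) Skip)
    (?m \<sigma>) (?m ?\<sigma>) (10 * b + 4)"
  proof (rule runs_Cond[where ?T1.0 = "10 * b + 3"])
    assume "heads (?m \<sigma>) Inp = 2"
    then show "runs (Rep (d + 1) (inc d ;; inc (d + 2)) ;; Rep (d + 2) (inc (d + 1))) (?m \<sigma>) (?m ?\<sigma>) (10 * b + 3)"
      by (intro runs_conv[OF runs_Seq_exact[OF runs_Rep_inc2 runs_Rep_inc]])
        (use Cons.prems Pb in \<open>auto intro!: mk_eqI\<close>)
  next
    assume "heads (?m \<sigma>) Inp \<noteq> 2"
    then have "a = 1" using Cons.prems by auto
    then show "runs Skip (?m \<sigma>) (?m ?\<sigma>) (10 * b + 3)"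
      by (intro runs_conv[OF runs_Skip_exact]) auto
  qed simp
  let ?\<tau> = "?\<sigma>(d + 1 := 2 * ?P)"
  have 2: "runs (Rep (d + 1) (inc (d + 2) ;; inc (d + 2)) ;; Rep (d + 2) (inc (d + 1))) (?m ?\<sigma>) (?m ?\<tau>) (14 * b + 3)"
    by (rule runs_conv[OF runs_Seq_exact[OF runs_Rep_double runs_Rep_inc]])
      (use Cons.prems Pb in \<open>auto intro!: mk_eqI\<close>)
  have 3: "runs (mvR Inp) (?m ?\<tau>) (mk (E(Inp := zipper (a # l) (u @ r))) ?\<tau>) 1"
    unfolding append_Cons by (rule runs_mvR) simp
  note body = runs_Seq_exact[OF 1 runs_Seq_exact[OF 2 3]]
  have "set u \<subseteq> {1, 2}" "?\<tau> (d + 2) = 0" "?\<tau> (d + 1) * 2 ^ length u \<le> b"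
    using Cons.prems by (auto simp: algebra_simps)
  note IH = Cons.IH[OF this, of "a # l"]
  show ?case unfolding read_bits_def
    by (rule runs_conv[OF runs_Loop_step[OF _ body IH[unfolded read_bits_def] order_refl]])
      (use Cons.prems in \<open>auto simp: algebra_simps intro!: mk_eqI\<close>)
qed

definition nth0 :: "nat list \<Rightarrow> nat \<Rightarrow> nat" where
  "nth0 xs i = (if i < length xs then xs ! i else 0)"

lemma runs_read_number:
  assumes E: "E Inp = zipper [] (input_word n xs)" and z: "\<sigma> (d + 1) = 0" "\<sigma> (d + 2) = 0"
    and len: "length (input_word n xs) \<le> b" and xs: "\<forall>x\<in>set xs. 2 * x + 1 \<le> b"
  shows "runs (read_number d) (mk E \<sigma>) (mk E (\<sigma>(d := nth0 xs (\<sigma> d))))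
     (\<sigma> d * (2 * b + 7) + b * (24 * b + 12) + 8 * b + 20)"
proof -
  define Es where "Es = (\<lambda>i. E(Inp :=
    zipper (rev (enc_unary n @ numbers_word (take i xs))) (numbers_word (drop i xs))))"
  have split: "(enc_unary n @ numbers_word (take i xs)) @ numbers_word (drop i xs) = input_word n xs" for i
    by (simp add: input_word_def numbers_word_def flip: concat_append map_append)
  have step: "runs (Loop (\<lambda>h. h Inp \<in> {1, 2}) (mvR Inp) ;; mvR_nonblank Inp)
      (mk (Es i) \<tau>) (mk (Es (Suc i)) \<tau>) (2 * b + 3)" for i \<tau>
  proof (cases "i < length xs")
    case True
    then have d: "numbers_word (drop i xs) = bin (xs ! i) @ 3 # numbers_word (drop (Suc i) xs)"
      by (simp add: numbers_word_def enc_nat_def flip: Cons_nth_drop_Suc)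
    have t: "numbers_word (take (Suc i) xs) = numbers_word (take i xs) @ bin (xs ! i) @ [3]"
      using True by (simp add: numbers_word_def enc_nat_def take_Suc_conv_app_nth)
    have "length (bin (xs ! i)) \<le> b" using split[of i] len d by (metis add_leD1 add_leD2 length_append)
    then show ?thesis unfolding Es_def d t
      by (intro runs_conv[OF runs_Seq_exact[OF
              runs_scan[where P = "\<lambda>s. s \<in> {1, 2}" and l' = "[]" and u = "bin (xs ! i)"]
              runs_mvR_nonblank(1)]])
        (use set_bin in auto)
  next
    case False
    then have e: "Es (Suc i) = Es i"
      "Es i = E(Inp := zipper (rev (enc_unary n @ numbers_word (take i xs))) [])"
      by (simp_all add: Es_def numbers_word_def)
    show ?thesis unfolding e
      by (rule runs_conv[OF runs_Seq_exact[OF runs_Loop_end[of _ _ 1] runs_mvR_nonblank(2)]]) auto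
  qed
  have skip: "runs (Rep d (Loop (\<lambda>h. h Inp \<in> {1, 2}) (mvR Inp) ;; mvR_nonblank Inp))
     (mk (Es 0) \<sigma>) (mk (Es (\<sigma> d)) (\<sigma>(d := 0))) (\<sigma> d * (2 * b + 6) + 1)"
    by (rule runs_Rep[where n = "\<sigma> d" and Es = Es and \<sigma>s = "\<lambda>_. \<sigma>" and ?T1.0 = "2 * b + 3"])
      (use step in auto)
  define i where "i = \<sigma> d"
  \<comment> \<open>Beyond the end of the list both words are empty, and reading no bits yields 0,
    the default value of \<open>nth0\<close>.\<close>
  define bs where "bs = (if i < length xs then bin (xs ! i) else [])"
  define r where "r = (if i < length xs then 3 # numbers_word (drop (Suc i) xs) else [])"
  have dr: "numbers_word (drop i xs) = bs @ r"
    by (simp add: numbers_word_def bs_def r_def enc_nat_def flip: Cons_nth_drop_Suc)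
  have bv: "bits_value bs = nth0 xs i" by (simp add: bs_def nth0_def bits_value_bin)
  have bb: "2 ^ length bs \<le> b"
  proof (cases "i < length xs")
    case True
    then have "2 * (xs ! i) + 1 \<le> b" using xs by simp
    then show ?thesis using length_bin_le[of "xs ! i"] True by (simp add: bs_def)
  next
    case False
    have "1 \<le> length (input_word n xs)" by (simp add: input_word_def enc_unary_def)
    then show ?thesis using False len by (simp add: bs_def)
  qed
  have lb: "length bs \<le> b" using split[of i] len dr by (metis add_leD1 add_leD2 length_append)
  define l where "l = rev (enc_unary n @ numbers_word (take i xs))"
  have Esi: "Es (\<sigma> d) = E(Inp := zipper l (bs @ r))" by (simp add: Es_def l_def dr i_def[symmetric])
  have inc1: "runs (inc (d + 1)) (mk (Es (\<sigma> d)) (\<sigma>(d := 0))) (mk (E(Inp := zipper l (bs @ r))) (\<sigma>(d := 0, d + 1 := 1))) 1"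
    unfolding Esi by (rule runs_conv[OF runs_inc]) (use z in \<open>auto intro!: mk_eqI\<close>)
  have rb: "runs (read_bits d) (mk (E(Inp := zipper l (bs @ r))) (\<sigma>(d := 0, d + 1 := 1)))
      (mk (E(Inp := zipper (rev bs @ l) r)) (\<sigma>(d := nth0 xs i, d + 1 := 2 ^ length bs))) (b * (24 * b + 12) + 1)"
  proof (rule runs_conv[OF runs_read_bits[where l' = "[]" and b = b]])
    show "set bs \<subseteq> {1, 2}" using set_bin by (auto simp: bs_def)
    show "zipper [] r 0 \<notin> {1, 2}" by (simp add: r_def)
    show "length bs * (24 * b + 12) + 1 \<le> b * (24 * b + 12) + 1" using lb by simp
  qed (use z bb in \<open>auto simp: bv intro!: mk_eqI\<close>)
  have cl: "runs (Rep (d + 1) Skip) (mk (E(Inp := zipper (rev bs @ l) r)) (\<sigma>(d := nth0 xs i, d + 1 := 2 ^ length bs)))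
     (mk (E(Inp := zipper (rev bs @ l) r)) (\<sigma>(d := nth0 xs i))) (4 * b + 1)"
    by (rule runs_conv[OF runs_Rep_Skip]) (use z bb in \<open>auto intro!: mk_eqI\<close>)
  have Es0: "Es 0 = E(Inp := zipper (rev (enc_unary n)) (numbers_word xs))" by (simp add: Es_def numbers_word_def)
  have n: "n \<le> b" using len by (simp add: input_word_def enc_unary_def)
  have bk: "runs (rewind Inp) (mk (E(Inp := zipper (rev bs @ l) r)) (\<sigma>(d := nth0 xs i))) (mk E (\<sigma>(d := nth0 xs i)))
     (2 * length (input_word n xs) + 5)"
    by (rule back_to_start[where E = E, OF E]) (use split[of i] in \<open>simp add: l_def dr\<close>)
  show ?thesis unfolding read_number_def
    by (rule runs_conv[OF runs_Seq_exact[OF runs_to_numbers[where E = E, OF E, folded Es0]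
          runs_Seq_exact[OF skip runs_Seq_exact[OF inc1 runs_Seq_exact[OF rb runs_Seq_exact[OF cl bk]]]]]])
      (use n len in \<open>auto simp: i_def algebra_simps\<close>)
qed


section \<open>Arithmetic expressions\<close>

datatype ex =
    Const nat | Var nat | VarCount | NumCount | Num ex
  | Plus ex ex | Minus ex ex | Times ex ex | Divide ex ex | Shift ex ex | Less ex ex

fun eval :: "nat \<Rightarrow> nat list \<Rightarrow> (nat \<Rightarrow> nat) \<Rightarrow> ex \<Rightarrow> nat" where
  "eval n xs \<sigma> (Const k) = k"
| "eval n xs \<sigma> (Var v) = \<sigma> v"
| "eval n xs \<sigma> VarCount = n"
| "eval n xs \<sigma> NumCount = length xs"
| "eval n xs \<sigma> (Num e) = nth0 xs (eval n xs \<sigma> e)"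
| "eval n xs \<sigma> (Plus a b) = eval n xs \<sigma> a + eval n xs \<sigma> b"
| "eval n xs \<sigma> (Minus a b) = eval n xs \<sigma> a - eval n xs \<sigma> b"
| "eval n xs \<sigma> (Times a b) = eval n xs \<sigma> a * eval n xs \<sigma> b"
| "eval n xs \<sigma> (Divide a b) = eval n xs \<sigma> a div eval n xs \<sigma> b"
| "eval n xs \<sigma> (Shift a b) = eval n xs \<sigma> a div 2 ^ eval n xs \<sigma> b"
| "eval n xs \<sigma> (Less a b) = of_bool (eval n xs \<sigma> a < eval n xs \<sigma> b)"

fun vars_below :: "nat \<Rightarrow> ex \<Rightarrow> bool" where
  "vars_below d (Const k) = True"
| "vars_below d (Var v) = (v < d)"
| "vars_below d VarCount = True"
| "vars_below d NumCount = True"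
| "vars_below d (Num e) = vars_below d e"
| "vars_below d (Plus a b) = (vars_below d a \<and> vars_below d b)"
| "vars_below d (Minus a b) = (vars_below d a \<and> vars_below d b)"
| "vars_below d (Times a b) = (vars_below d a \<and> vars_below d b)"
| "vars_below d (Divide a b) = (vars_below d a \<and> vars_below d b)"
| "vars_below d (Shift a b) = (vars_below d a \<and> vars_below d b)"
| "vars_below d (Less a b) = (vars_below d a \<and> vars_below d b)"

lemma vars_below_mono: "vars_below d e \<Longrightarrow> d \<le> d' \<Longrightarrow> vars_below d' e"
  by (induction e) auto

primrec inc_by :: "nat \<Rightarrow> nat \<Rightarrow> prog" where
  "inc_by 0 d = Skip"
| "inc_by (Suc k) d = inc d ;; inc_by k d"

fun code :: "ex \<Rightarrow> nat \<Rightarrow> prog" where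
  "code (Const k) d = inc_by k d"
| "code (Var v) d = Rep v (inc d ;; inc (d + 1)) ;; Rep (d + 1) (inc v)"
| "code VarCount d = read_unary d"
| "code NumCount d = count_numbers d"
| "code (Num e) d = code e d ;; read_number d"
| "code (Plus a b) d = code a d ;; code b (d + 1) ;; add_op d"
| "code (Minus a b) d = code a d ;; code b (d + 1) ;; sub_op d"
| "code (Times a b) d = code a d ;; code b (d + 1) ;; mult_op d"
| "code (Divide a b) d = code a d ;; code b (d + 1) ;; div_op d"
| "code (Shift a b) d = code a d ;; code b (d + 1) ;; shift_op d"
| "code (Less a b) d = code a d ;; code b (d + 1) ;; less_op d"

lemma legal_inc_by: "legal (inc_by k d)"
  by (induction k) (auto intro!: legal_intros legal_inc)

lemma legal_code: "legal (code e d)"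
  by (induction e d rule: code.induct)
    (auto intro!: legal_Seq legal_Rep legal_inc legal_inc_by legal_reading legal_ops
      simp del: One_nat_def)

lemma runs_inc_by: "runs (inc_by k d) (mk E \<sigma>) (mk E (\<sigma>(d := \<sigma> d + k))) (2 * k + 1)"
proof (induction k arbitrary: \<sigma>)
  case 0
  show ?case by (simp add: runs_Skip)
next
  case (Suc k)
  show ?case unfolding inc_by.simps
    by (rule runs_conv[OF runs_Seq_exact[OF runs_inc Suc.IH]]) (auto intro!: mk_eqI)
qed

lemma eval_cong: "vars_below d e \<Longrightarrow> (\<And>v. v < d \<Longrightarrow> \<sigma> v = \<tau> v) \<Longrightarrow> eval n xs \<sigma> e = eval n xs \<tau> e"
  by (induction e) auto

definition input_ok :: "nat \<Rightarrow> nat \<Rightarrow> nat list \<Rightarrow> mem \<Rightarrow> bool" where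
  "input_ok b n xs E \<longleftrightarrow> 2 \<le> b \<and> E Inp = zipper [] (input_word n xs) \<and>
     length (input_word n xs) \<le> b \<and> (\<forall>x\<in>set xs. 2 * x + 1 \<le> b)"

lemma input_ok_mono: "input_ok b n xs E \<Longrightarrow> b \<le> b' \<Longrightarrow> input_ok b' n xs E"
  unfolding input_ok_def by (meson order_trans)

text \<open>All bounds are of the form \<open>b ^ k\<close> with \<open>2 \<le> b\<close>: the exponent depends on the program only.\<close>

definition evaluates :: "ex \<Rightarrow> nat \<Rightarrow> nat \<Rightarrow> bool" where
  "evaluates e d k \<longleftrightarrow> (\<forall>b \<sigma> E n xs. (\<forall>v. \<sigma> v \<le> b) \<longrightarrow> (\<forall>v\<ge>d. \<sigma> v = 0) \<longrightarrow> input_ok b n xs E \<longrightarrow>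
     runs (code e d) (mk E \<sigma>) (mk E (\<sigma>(d := eval n xs \<sigma> e))) (b ^ k) \<and> eval n xs \<sigma> e \<le> b ^ k)"

lemma le_power_self: "2 \<le> b \<Longrightarrow> k \<le> b ^ k" for b k :: nat
  using less_exp[of k] power_mono[of 2 b k] by (meson less_imp_le order_trans zero_le_numeral)

text \<open>Since \<open>2 \<le> b\<close>, the factor 100 is at most \<open>b ^ 7\<close>, and
  \<open>b ^ K + 1 \<le> b ^ Suc K\<close> costs two more powers after squaring.\<close>

lemma quadratic_le_power:
  fixes b :: nat
  assumes "2 \<le> b"
  shows "100 * (b ^ K + 1) ^ 2 \<le> b ^ (2 * K + 9)"
proof -
  have "b ^ K + 1 \<le> 2 * b ^ K" using assms by (simp add: Suc_leI)
  also have "\<dots> \<le> b ^ Suc K" using assms by simp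
  finally have "(b ^ K + 1) ^ 2 \<le> (b ^ Suc K) ^ 2" by (rule power_mono) simp
  moreover have "(100::nat) \<le> b ^ 7"
    using power_mono[of 2 b 7] assms by simp
  ultimately have "100 * (b ^ K + 1) ^ 2 \<le> b ^ 7 * (b ^ Suc K) ^ 2" by (rule mult_le_mono[rotated])
  also have "\<dots> = b ^ (2 * K + 9)"
    unfolding power_mult[symmetric] power_add[symmetric] by (rule arg_cong[of _ _ "power b"]) simp
  finally show ?thesis .
qed

text \<open>During the evaluation of the second operand the counter \<open>d\<close> holds the first
  value, which can be as large as \<open>\<beta> ^ k\<close>. The bound for the second operand is
  therefore used with base \<open>\<beta> ^ Suc k\<close>, and the exponents multiply. The bound
  remains polynomial because the expression is fixed.\<close>

lemma evaluates_binary: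
  assumes a: "evaluates a d k" and b: "evaluates b (d + 1) l" and vb: "vars_below d b"
    and code: "code e d = code a d ;; code b (d + 1) ;; op"
    and ev: "\<And>n xs \<sigma>. eval n xs \<sigma> e = f (eval n xs \<sigma> a) (eval n xs \<sigma> b)"
    and f: "\<And>x y B. x \<le> B \<Longrightarrow> y \<le> B \<Longrightarrow> f x y \<le> (B + 1) ^ 2"
    and op: "\<And>E \<sigma> B. \<sigma> d \<le> B \<Longrightarrow> \<sigma> (d + 1) \<le> B \<Longrightarrow> \<forall>v\<ge>d + 2. \<sigma> v = 0 \<Longrightarrow>
       runs op (mk E \<sigma>) (mk E (\<sigma>(d := f (\<sigma> d) (\<sigma> (d + 1)), d + 1 := 0))) (100 * (B + 1) ^ 2)"
  shows "\<exists>k. evaluates e d k"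
proof -
  define K where "K = Suc k * Suc l"
  have "evaluates e d (2 * K + 11)"
    unfolding evaluates_def
  proof (intro allI impI)
    fix \<beta> :: nat and \<sigma> :: "nat \<Rightarrow> nat" and E n xs
    assume s: "\<forall>v. \<sigma> v \<le> \<beta>" "\<forall>v\<ge>d. \<sigma> v = 0" "input_ok \<beta> n xs E"
    then have b2: "2 \<le> \<beta>" by (simp add: input_ok_def)
    let ?x = "eval n xs \<sigma> a" and ?y = "eval n xs \<sigma> b"
    have ra: "runs (code a d) (mk E \<sigma>) (mk E (\<sigma>(d := ?x))) (\<beta> ^ k)" and xk: "?x \<le> \<beta> ^ k"
      using a s unfolding evaluates_def by blast+
    let ?\<beta> = "\<beta> ^ Suc k"
    have mono: "\<beta> \<le> ?\<beta>" "\<beta> ^ k \<le> ?\<beta>" using b2 by auto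
    have "\<forall>v. (\<sigma>(d := ?x)) v \<le> ?\<beta>" using s(1) xk mono by (auto intro: order_trans)
    moreover have "\<forall>v\<ge>d + 1. (\<sigma>(d := ?x)) v = 0" using s(2) by auto
    moreover have "input_ok ?\<beta> n xs E" using input_ok_mono[OF s(3)] mono by simp
    ultimately have "runs (code b (d + 1)) (mk E (\<sigma>(d := ?x)))
        (mk E (\<sigma>(d := ?x, d + 1 := eval n xs (\<sigma>(d := ?x)) b))) (?\<beta> ^ l) \<and> eval n xs (\<sigma>(d := ?x)) b \<le> ?\<beta> ^ l"
      using b unfolding evaluates_def by blast
    moreover have "eval n xs (\<sigma>(d := ?x)) b = ?y" by (rule eval_cong[OF vb]) auto
    moreover have lK: "?\<beta> ^ l \<le> \<beta> ^ K" unfolding K_def power_mult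
      by (rule power_increasing) (use b2 in auto)
    ultimately have rb: "runs (code b (d + 1)) (mk E (\<sigma>(d := ?x))) (mk E (\<sigma>(d := ?x, d + 1 := ?y))) (\<beta> ^ K)"
      and yK: "?y \<le> \<beta> ^ K" using runs_mono by auto
    have kK: "\<beta> ^ k \<le> \<beta> ^ K" by (rule power_increasing) (use b2 in \<open>auto simp: K_def\<close>)
    have xK: "?x \<le> \<beta> ^ K" using xk kK by (rule order_trans)
    have "runs op (mk E (\<sigma>(d := ?x, d + 1 := ?y)))
       (mk E (\<sigma>(d := ?x, d + 1 := ?y, d := f ?x ?y, d + 1 := 0))) (100 * (\<beta> ^ K + 1) ^ 2)"
      using op[of "\<sigma>(d := ?x, d + 1 := ?y)" "\<beta> ^ K" E] xK yK s(2) by simp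
    moreover have "mk E (\<sigma>(d := ?x, d + 1 := ?y, d := f ?x ?y, d + 1 := 0)) = mk E (\<sigma>(d := f ?x ?y))"
      using s(2) by (auto intro!: mk_eqI)
    ultimately have ro: "runs op (mk E (\<sigma>(d := ?x, d + 1 := ?y))) (mk E (\<sigma>(d := f ?x ?y))) (\<beta> ^ (2 * K + 9))"
      using quadratic_le_power[OF b2] runs_mono by auto
    have KK: "\<beta> ^ K \<le> \<beta> ^ (2 * K + 9)" by (rule power_increasing) (use b2 in auto)
    have "\<beta> ^ 1 \<le> \<beta> ^ (2 * K + 9)" by (rule power_increasing) (use b2 in auto)
    then have "\<beta> ^ k \<le> \<beta> ^ (2 * K + 9)" "\<beta> ^ K \<le> \<beta> ^ (2 * K + 9)" "2 \<le> \<beta> ^ (2 * K + 9)"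
      using kK KK b2 by simp_all
    then have "Suc (\<beta> ^ k + Suc (\<beta> ^ K + \<beta> ^ (2 * K + 9))) \<le> 4 * \<beta> ^ (2 * K + 9)" by linarith
    also have "\<dots> \<le> \<beta> ^ 2 * \<beta> ^ (2 * K + 9)" using power_mono[OF b2, of 2] by simp
    also have "\<dots> = \<beta> ^ (2 * K + 11)"
      unfolding power_add[symmetric] by (rule arg_cong[of _ _ "power \<beta>"]) simp
    finally have time: "Suc (\<beta> ^ k + Suc (\<beta> ^ K + \<beta> ^ (2 * K + 9))) \<le> \<beta> ^ (2 * K + 11)" .
    have "f ?x ?y \<le> (\<beta> ^ K + 1) ^ 2" by (rule f[OF xK yK])
    also have "\<dots> \<le> 100 * (\<beta> ^ K + 1) ^ 2" by simp
    also have "\<dots> \<le> \<beta> ^ (2 * K + 9)" by (rule quadratic_le_power[OF b2])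
    also have "\<dots> \<le> \<beta> ^ (2 * K + 11)" by (rule power_increasing) (use b2 in auto)
    finally show "runs (code e d) (mk E \<sigma>) (mk E (\<sigma>(d := eval n xs \<sigma> e))) (\<beta> ^ (2 * K + 11)) \<and>
        eval n xs \<sigma> e \<le> \<beta> ^ (2 * K + 11)"
      unfolding code ev using runs_Seq[OF ra runs_Seq_exact[OF rb ro] time] by simp
  qed
  then show ?thesis by blast
qed

lemma evaluatesI:
  assumes "\<And>b \<sigma> E n xs. 2 \<le> b \<Longrightarrow> (\<forall>v. \<sigma> v \<le> b) \<Longrightarrow> (\<forall>v\<ge>d. \<sigma> v = 0) \<Longrightarrow> input_ok b n xs E \<Longrightarrow>
     runs (code e d) (mk E \<sigma>) (mk E (\<sigma>(d := eval n xs \<sigma> e))) (100 * (b ^ K + 1) ^ 2) \<and>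
     eval n xs \<sigma> e \<le> 100 * (b ^ K + 1) ^ 2"
  shows "\<exists>k. evaluates e d k"
proof -
  have "evaluates e d (2 * K + 9)"
    unfolding evaluates_def
  proof (intro allI impI)
    fix b :: nat and \<sigma> :: "nat \<Rightarrow> nat" and E n xs
    assume s: "\<forall>v. \<sigma> v \<le> b" "\<forall>v\<ge>d. \<sigma> v = 0" "input_ok b n xs E"
    then have "2 \<le> b" by (simp add: input_ok_def)
    from assms[OF this s] quadratic_le_power[OF this, of K]
    show "runs (code e d) (mk E \<sigma>) (mk E (\<sigma>(d := eval n xs \<sigma> e))) (b ^ (2 * K + 9)) \<and>
       eval n xs \<sigma> e \<le> b ^ (2 * K + 9)"
      using runs_mono order_trans by blast
  qed
  then show ?thesis by blast
qed

lemma nth0_le: "\<forall>x\<in>set xs. 2 * x + 1 \<le> b \<Longrightarrow> nth0 xs i \<le> b"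
proof -
  assume "\<forall>x\<in>set xs. 2 * x + 1 \<le> b"
  then have "i < length xs \<Longrightarrow> 2 * (xs ! i) + 1 \<le> b" by simp
  then show ?thesis by (auto simp: nth0_def)
qed

lemma sq_bounds:
  fixes x y B :: nat
  assumes "x \<le> B" "y \<le> B"
  shows "x \<le> (B + 1) ^ 2" "y \<le> (B + 1) ^ 2" "x * y \<le> (B + 1) ^ 2" "1 \<le> (B + 1) ^ 2" "x + y \<le> (B + 1) ^ 2"
proof -
  have "(B + 1) ^ 2 = B * B + 2 * B + 1" by (simp add: power2_eq_square algebra_simps)
  moreover have "x * y \<le> B * B" using assms by (rule mult_le_mono)
  ultimately show "x \<le> (B + 1) ^ 2" "y \<le> (B + 1) ^ 2" "x * y \<le> (B + 1) ^ 2" "1 \<le> (B + 1) ^ 2" "x + y \<le> (B + 1) ^ 2"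
    using assms by linarith+
qed

theorem code_evaluates: "vars_below d e \<Longrightarrow> \<exists>k. evaluates e d k"
proof (induction e arbitrary: d)
  case (Const c)
  show ?case
  proof (rule evaluatesI[where K = c])
    fix b :: nat and \<sigma> :: "nat \<Rightarrow> nat" and E n xs
    assume b: "2 \<le> b" and s: "\<forall>v\<ge>d. \<sigma> v = 0"
    have "c \<le> b ^ c" using le_power_self[OF b] .
    from sq_bounds[OF this this] have "2 * c + 1 \<le> 100 * (b ^ c + 1) ^ 2" by linarith
    then show "runs (code (Const c) d) (mk E \<sigma>) (mk E (\<sigma>(d := eval n xs \<sigma> (Const c)))) (100 * (b ^ c + 1) ^ 2) \<and>
       eval n xs \<sigma> (Const c) \<le> 100 * (b ^ c + 1) ^ 2"
      using runs_conv[OF runs_inc_by[of c d E \<sigma>]] s by simp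
  qed
next
  case (Var v)
  show ?case
  proof (rule evaluatesI[where K = 1])
    fix b :: nat and \<sigma> :: "nat \<Rightarrow> nat" and E n xs
    assume b: "\<forall>v. \<sigma> v \<le> b" and s: "\<forall>v\<ge>d. \<sigma> v = 0"
    have "\<sigma> v \<le> b" using b by blast
    from sq_bounds[OF this this] have t: "10 * \<sigma> v + 3 \<le> 100 * (b ^ 1 + 1) ^ 2"
      unfolding power_one_right by linarith
    have "runs (Rep v (inc d ;; inc (d + 1)) ;; Rep (d + 1) (inc v)) (mk E \<sigma>) (mk E (\<sigma>(d := \<sigma> v))) (10 * \<sigma> v + 3)"
      by (rule runs_conv[OF runs_Seq_exact[OF runs_Rep_inc2 runs_Rep_inc]])
        (use s Var in \<open>auto intro!: mk_eqI\<close>)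
    then show "runs (code (Var v) d) (mk E \<sigma>) (mk E (\<sigma>(d := eval n xs \<sigma> (Var v)))) (100 * (b ^ 1 + 1) ^ 2) \<and>
       eval n xs \<sigma> (Var v) \<le> 100 * (b ^ 1 + 1) ^ 2"
      using runs_mono[OF _ t] t by simp
  qed
next
  case VarCount
  show ?case
  proof (rule evaluatesI[where K = 1])
    fix b :: nat and \<sigma> :: "nat \<Rightarrow> nat" and E n xs
    assume s: "\<forall>v\<ge>d. \<sigma> v = 0" and i: "input_ok b n xs E"
    have E: "E Inp = zipper [] (input_word n xs)" and n: "n \<le> b"
      using i by (auto simp: input_ok_def input_word_def enc_unary_def)
    from sq_bounds[OF n n] have t: "6 * n + 7 \<le> 100 * (b ^ 1 + 1) ^ 2"
      unfolding power_one_right by linarith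
    show "runs (code VarCount d) (mk E \<sigma>) (mk E (\<sigma>(d := eval n xs \<sigma> VarCount))) (100 * (b ^ 1 + 1) ^ 2) \<and>
       eval n xs \<sigma> VarCount \<le> 100 * (b ^ 1 + 1) ^ 2"
      using runs_mono[OF runs_read_unary[where E = E, OF E] t] s t by simp
  qed
next
  case NumCount
  show ?case
  proof (rule evaluatesI[where K = 1])
    fix b :: nat and \<sigma> :: "nat \<Rightarrow> nat" and E n xs
    assume s: "\<forall>v\<ge>d. \<sigma> v = 0" and i: "input_ok b n xs E"
    have E: "E Inp = zipper [] (input_word n xs)" and l: "length (input_word n xs) \<le> b"
      using i by (auto simp: input_ok_def)
    have "length xs \<le> length (numbers_word xs)"
      by (induction xs) (auto simp: numbers_word_def enc_nat_def)
    then have x: "length xs \<le> b" using l by (simp add: input_word_def)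
    from sq_bounds[OF l x] have t: "12 * length (input_word n xs) + 12 \<le> 100 * (b ^ 1 + 1) ^ 2" 
      "length xs \<le> 100 * (b ^ 1 + 1) ^ 2" unfolding power_one_right by linarith+
    show "runs (code NumCount d) (mk E \<sigma>) (mk E (\<sigma>(d := eval n xs \<sigma> NumCount))) (100 * (b ^ 1 + 1) ^ 2) \<and>
       eval n xs \<sigma> NumCount \<le> 100 * (b ^ 1 + 1) ^ 2"
      using runs_mono[OF runs_count_numbers[where E = E, OF E] t(1)] s t(2) by simp
  qed
next
  case (Num e)
  then obtain k where k: "evaluates e d k" by auto
  show ?case
  proof (rule evaluatesI[where K = "Suc k"])
    fix b :: nat and \<sigma> :: "nat \<Rightarrow> nat" and E n xs
    assume b2: "2 \<le> b" and b: "\<forall>v. \<sigma> v \<le> b" and s: "\<forall>v\<ge>d. \<sigma> v = 0" and i: "input_ok b n xs E"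
    let ?x = "eval n xs \<sigma> e"
    have r: "runs (code e d) (mk E \<sigma>) (mk E (\<sigma>(d := ?x))) (b ^ k)" and x: "?x \<le> b ^ k"
      using k b s i unfolding evaluates_def by blast+
    have E: "E Inp = zipper [] (input_word n xs)" and l: "length (input_word n xs) \<le> b"
      and xs: "\<forall>x\<in>set xs. 2 * x + 1 \<le> b" using i by (auto simp: input_ok_def)
    have "runs (read_number d) (mk E (\<sigma>(d := ?x))) (mk E (\<sigma>(d := ?x, d := nth0 xs ((\<sigma>(d := ?x)) d))))
      ((\<sigma>(d := ?x)) d * (2 * b + 7) + b * (24 * b + 12) + 8 * b + 20)"
      by (rule runs_read_number[where E = E, OF E _ _ l xs]) (use s in auto)
    then have rn: "runs (read_number d) (mk E (\<sigma>(d := ?x))) (mk E (\<sigma>(d := nth0 xs ?x)))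
      (?x * (2 * b + 7) + b * (24 * b + 12) + 8 * b + 20)" by simp
    define B where "B = b ^ Suc k"
    have bB: "b \<le> B" "b ^ k \<le> B" using b2 by (auto simp: B_def)
    then have xB: "?x \<le> B" using x by simp
    have sq: "(B + 1) ^ 2 = B * B + 2 * B + 1" by (simp add: power2_eq_square algebra_simps)
    have "?x * (2 * b + 7) \<le> B * (2 * B + 7)" "b * (24 * b + 12) \<le> B * (24 * B + 12)"
      using xB bB by (auto intro!: mult_le_mono)
    then have "Suc (b ^ k + (?x * (2 * b + 7) + b * (24 * b + 12) + 8 * b + 20)) \<le>
      Suc (B + (B * (2 * B + 7) + B * (24 * B + 12) + 8 * B + 20))" using bB by linarith
    also have "\<dots> \<le> 100 * (B + 1) ^ 2" unfolding sq by (simp add: algebra_simps)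
    finally have t: "Suc (b ^ k + (?x * (2 * b + 7) + b * (24 * b + 12) + 8 * b + 20)) \<le> 100 * (B + 1) ^ 2" .
    have "nth0 xs ?x \<le> B" using nth0_le[OF xs] bB(1) by (rule order_trans)
    then have "nth0 xs ?x \<le> 100 * (B + 1) ^ 2" unfolding sq by simp
    then show "runs (code (Num e) d) (mk E \<sigma>) (mk E (\<sigma>(d := eval n xs \<sigma> (Num e)))) (100 * (b ^ Suc k + 1) ^ 2) \<and>
       eval n xs \<sigma> (Num e) \<le> 100 * (b ^ Suc k + 1) ^ 2"
      using runs_Seq[OF r rn t] by (simp add: B_def)
  qed
next
  case (Plus a b)
  then obtain k l where "evaluates a d k" "evaluates b (d + 1) l"
    by (metis (full_types) less_add_one less_imp_le_nat vars_below_mono vars_below.simps(6))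
  then show ?case
  proof (rule evaluates_binary[where f = "(+)" and op = "add_op d"])
    fix E B and \<sigma> :: "nat \<Rightarrow> nat" assume B: "\<sigma> d \<le> B" "\<sigma> (d + 1) \<le> B" "\<forall>v\<ge>d + 2. \<sigma> v = 0"
    show "runs (add_op d) (mk E \<sigma>) (mk E (\<sigma>(d := \<sigma> d + \<sigma> (d + 1), d + 1 := 0))) (100 * (B + 1) ^ 2)"
      by (rule runs_mono[OF runs_add_op]) (use sq_bounds[OF B(1,2)] in linarith)
  qed (use Plus.prems sq_bounds in auto)
next
  case (Minus a b)
  then obtain k l where "evaluates a d k" "evaluates b (d + 1) l"
    by (metis (full_types) less_add_one less_imp_le_nat vars_below_mono vars_below.simps(7))
  then show ?case
  proof (rule evaluates_binary[where f = "(-)" and op = "sub_op d"])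
    fix E B and \<sigma> :: "nat \<Rightarrow> nat" assume B: "\<sigma> d \<le> B" "\<sigma> (d + 1) \<le> B" "\<forall>v\<ge>d + 2. \<sigma> v = 0"
    show "runs (sub_op d) (mk E \<sigma>) (mk E (\<sigma>(d := \<sigma> d - \<sigma> (d + 1), d + 1 := 0))) (100 * (B + 1) ^ 2)"
      by (rule runs_mono[OF runs_sub_op]) (use sq_bounds[OF B(1,2)] in linarith)
  next
    show "x - y \<le> (B + 1) ^ 2" if "x \<le> B" "y \<le> B" for x y B :: nat
      using sq_bounds[OF that] by linarith
  qed (use Minus.prems in auto)
next
  case (Times a b)
  then obtain k l where "evaluates a d k" "evaluates b (d + 1) l"
    by (metis (full_types) less_add_one less_imp_le_nat vars_below_mono vars_below.simps(8))
  then show ?case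
  proof (rule evaluates_binary[where f = "(*)" and op = "mult_op d"])
    fix E B and \<sigma> :: "nat \<Rightarrow> nat" assume B: "\<sigma> d \<le> B" "\<sigma> (d + 1) \<le> B" "\<forall>v\<ge>d + 2. \<sigma> v = 0"
    show "runs (mult_op d) (mk E \<sigma>) (mk E (\<sigma>(d := \<sigma> d * \<sigma> (d + 1), d + 1 := 0))) (100 * (B + 1) ^ 2)"
    proof (rule runs_mono[OF runs_mult_op])
      have "14 * \<sigma> d * \<sigma> (d + 1) = 14 * (\<sigma> d * \<sigma> (d + 1))" by simp
      then show "14 * \<sigma> d * \<sigma> (d + 1) + 6 * \<sigma> d + 4 * \<sigma> (d + 1) + 5 \<le> 100 * (B + 1) ^ 2"
        using sq_bounds[OF B(1,2)] by linarith
    qed (use B(3) in auto)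
  qed (use Times.prems sq_bounds in auto)
next
  case (Divide a b)
  then obtain k l where "evaluates a d k" "evaluates b (d + 1) l"
    by (metis (full_types) less_add_one less_imp_le_nat vars_below_mono vars_below.simps(9))
  then show ?case
  proof (rule evaluates_binary[where f = "(div)" and op = "div_op d"])
    fix E B and \<sigma> :: "nat \<Rightarrow> nat" assume B: "\<sigma> d \<le> B" "\<sigma> (d + 1) \<le> B" "\<forall>v\<ge>d + 2. \<sigma> v = 0"
    show "runs (div_op d) (mk E \<sigma>) (mk E (\<sigma>(d := \<sigma> d div \<sigma> (d + 1), d + 1 := 0))) (100 * (B + 1) ^ 2)"
    proof (rule runs_mono[OF runs_div_op])
      have "\<sigma> d * (4 * \<sigma> (d + 1) + 20) = 4 * (\<sigma> d * \<sigma> (d + 1)) + 20 * \<sigma> d"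
        by (simp add: algebra_simps)
      then show "\<sigma> d * (4 * \<sigma> (d + 1) + 20) + 8 * \<sigma> (d + 1) + 20 \<le> 100 * (B + 1) ^ 2"
        using sq_bounds[OF B(1,2)] by linarith
    qed (use B(3) in auto)
  next
    show "x div y \<le> (B + 1) ^ 2" if "x \<le> B" "y \<le> B" for x y B :: nat
      using sq_bounds[OF that] div_le_dividend[of x y] by linarith
  qed (use Divide.prems in auto)
next
  case (Shift a b)
  then obtain k l where "evaluates a d k" "evaluates b (d + 1) l"
    by (metis (full_types) less_add_one less_imp_le_nat vars_below_mono vars_below.simps(10))
  then show ?case
  proof (rule evaluates_binary[where f = "\<lambda>x y. x div 2 ^ y" and op = "shift_op d"])
    fix E B and \<sigma> :: "nat \<Rightarrow> nat" assume B: "\<sigma> d \<le> B" "\<sigma> (d + 1) \<le> B" "\<forall>v\<ge>d + 2. \<sigma> v = 0"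
    show "runs (shift_op d) (mk E \<sigma>) (mk E (\<sigma>(d := \<sigma> d div 2 ^ \<sigma> (d + 1), d + 1 := 0))) (100 * (B + 1) ^ 2)"
    proof (rule runs_mono[OF runs_shift_op])
      have "\<sigma> (d + 1) * (12 * \<sigma> d + 20) = 12 * (\<sigma> d * \<sigma> (d + 1)) + 20 * \<sigma> (d + 1)"
        by (simp add: algebra_simps)
      then show "\<sigma> (d + 1) * (12 * \<sigma> d + 20) + 1 \<le> 100 * (B + 1) ^ 2"
        using sq_bounds[OF B(1,2)] by linarith
    qed (use B(3) in auto)
  next
    show "x div 2 ^ y \<le> (B + 1) ^ 2" if "x \<le> B" "y \<le> B" for x y B :: nat
      using sq_bounds[OF that] div_le_dividend[of x "2 ^ y"] by linarith
  qed (use Shift.prems in auto)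
next
  case (Less a b)
  then obtain k l where "evaluates a d k" "evaluates b (d + 1) l"
    by (metis (full_types) less_add_one less_imp_le_nat vars_below_mono vars_below.simps(11))
  then show ?case
  proof (rule evaluates_binary[where f = "\<lambda>x y. of_bool (x < y)" and op = "less_op d"])
    fix E B and \<sigma> :: "nat \<Rightarrow> nat" assume B: "\<sigma> d \<le> B" "\<sigma> (d + 1) \<le> B" "\<forall>v\<ge>d + 2. \<sigma> v = 0"
    show "runs (less_op d) (mk E \<sigma>) (mk E (\<sigma>(d := of_bool (\<sigma> d < \<sigma> (d + 1)), d + 1 := 0))) (100 * (B + 1) ^ 2)"
      by (rule runs_mono[OF runs_less_op]) (use sq_bounds[OF B(1,2)] in linarith)
  qed (use Less.prems in auto)
qed


section \<open>Simulating a Turing machine\<close>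

text \<open>The action idles after halting, and also if the state or a symbol is out of range for
  \<open>M\<close>: well-formedness of an action quantifies over all symbols below \<open>B\<close>,
  among which there may be such values.\<close>

definition sim_act :: "tm \<Rightarrow> bool \<Rightarrow> action" where
  "sim_act M b r x =
     (let rs = map (\<lambda>j. r (Sim b j)) [0..<tm_tapes M]; q = r Cell in
      if q \<in> {1, 2} \<or> \<not> (q < tm_states M \<and> set rs \<subseteq> {..<tm_symbols M}) then (r x, 0)
      else case x of
          Cell \<Rightarrow> (fst (tm_trans M q rs), 0)
        | Sim b' j \<Rightarrow> if b' = b \<and> j < tm_tapes M then snd (tm_trans M q rs) ! j else (r x, 0)
        | _ \<Rightarrow> (r x, 0))"

lemma trans_wf:
  assumes "turing_machine M" "q < tm_states M" "length rs = tm_tapes M" "set rs \<subseteq> {..<tm_symbols M}"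
  shows "fst (tm_trans M q rs) < tm_states M" "length (snd (tm_trans M q rs)) = tm_tapes M"
    and "j < tm_tapes M \<Longrightarrow> fst (snd (tm_trans M q rs) ! j) < tm_symbols M"
    and "j < tm_tapes M \<Longrightarrow> snd (snd (tm_trans M q rs) ! j) \<in> {-1, 0, 1}"
proof -
  obtain q' as where t: "tm_trans M q rs = (q', as)" by force
  have "case tm_trans M q rs of (q', as) \<Rightarrow>
           q' < tm_states M \<and> length as = tm_tapes M \<and> set as \<subseteq> {..<tm_symbols M} \<times> {-1, 0, 1}"
    by (rule conjunct2[OF conjunct2[OF conjunct2[OF assms(1)[unfolded turing_machine_def]]],
          THEN spec, THEN spec, THEN mp]) (use assms in blast)
  then have *: "q' < tm_states M" "length as = tm_tapes M" "set as \<subseteq> {..<tm_symbols M} \<times> {-1, 0, 1}"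
    by (auto simp: t)
  then show "fst (tm_trans M q rs) < tm_states M" "length (snd (tm_trans M q rs)) = tm_tapes M"
    by (auto simp: t)
  assume "j < tm_tapes M"
  then have "as ! j \<in> {..<tm_symbols M} \<times> {-1, 0, 1}" using * by (metis nth_mem subsetD)
  then show "fst (snd (tm_trans M q rs) ! j) < tm_symbols M" "snd (snd (tm_trans M q rs) ! j) \<in> {-1, 0, 1}"
    by (auto simp: t mem_Times_iff)
qed

lemma legal_sim:
  assumes M: "turing_machine M"
  shows "legal (Act (sim_act M b))"
proof (rule legal_ActI[of "tm_states M + tm_symbols M + 3 * tm_tapes M + 5"])
  fix K B assume KB: "tm_states M + tm_symbols M + 3 * tm_tapes M + 5 \<le> K"
    "tm_states M + tm_symbols M + 3 * tm_tapes M + 5 \<le> B"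
  have idx: "tape_index Cell < K" "\<And>j. j < tm_tapes M \<Longrightarrow> tape_index (Sim b j) < K"
    using KB by auto
  show "action_wf K B (sim_act M b)"
    unfolding action_wf_def
  proof (intro conjI allI impI)
    fix r r' :: reads and x assume eq: "\<forall>x. tape_index x < K \<longrightarrow> r x = r' x" and x: "tape_index x < K"
    have m: "map (\<lambda>j. r (Sim b j)) [0..<tm_tapes M] = map (\<lambda>j. r' (Sim b j)) [0..<tm_tapes M]"
      using eq idx by auto
    have c: "r Cell = r' Cell" "r x = r' x" using eq idx x by auto
    show "sim_act M b r x = sim_act M b r' x"
      unfolding sim_act_def Let_def m c by (rule refl)
  next
    fix r :: reads and x assume r: "\<forall>x. tape_index x < K \<longrightarrow> r x < B" and x: "tape_index x < K"
    let ?rs = "map (\<lambda>j. r (Sim b j)) [0..<tm_tapes M]" and ?q = "r Cell"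
    have rx: "r x < B" using r x by blast
    have "fst (sim_act M b r x) < B \<and> snd (sim_act M b r x) \<in> {-1, 0, 1}"
    proof (cases "?q \<in> {1, 2} \<or> \<not> (?q < tm_states M \<and> set ?rs \<subseteq> {..<tm_symbols M})")
      case True
      then have "sim_act M b r x = (r x, 0)" unfolding sim_act_def Let_def by (simp only: if_True)
      then show ?thesis using rx by simp
    next
      case False
      then have q: "?q < tm_states M" and s: "set ?rs \<subseteq> {..<tm_symbols M}" by blast+
      note wf = trans_wf[OF M q _ s]
      have c: "sim_act M b r x = (case x of
          Cell \<Rightarrow> (fst (tm_trans M ?q ?rs), 0)
        | Sim b' j \<Rightarrow> if b' = b \<and> j < tm_tapes M then snd (tm_trans M ?q ?rs) ! j else (r x, 0)
        | _ \<Rightarrow> (r x, 0))" unfolding sim_act_def Let_def using False by (simp only: if_False)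
      have le: "tm_states M \<le> B" "tm_symbols M \<le> B" using KB by simp_all
      have "fst (tm_trans M ?q ?rs) < B" using less_le_trans[OF wf(1) le(1)] by simp
      moreover have "fst (snd (tm_trans M ?q ?rs) ! j) < B" if "j < tm_tapes M" for j
        using less_le_trans[OF wf(3) le(2)] that by simp
      ultimately show ?thesis unfolding c
        using rx wf(4) by (cases x) auto
    qed
    then show "fst (sim_act M b r x) < B" "snd (sim_act M b r x) \<in> {-1, 0, 1}" by blast+
  qed
qed

definition sim_step :: "tm \<Rightarrow> bool \<Rightarrow> mem \<Rightarrow> mem" where
  "sim_step M b E = act_mem (sim_act M b) E"

lemma sim_step_apply:
  "sim_step M b E x i =
     ((E x)(0 := fst (sim_act M b (heads E) x))) (i + snd (sim_act M b (heads E) x))"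
  by (simp add: sim_step_def act_mem_def)

lemma runs_sim: "runs (Act (sim_act M b)) (mk E \<sigma>) (mk (sim_step M b E) \<sigma>) 1"
proof (rule runs_Act)
  have "sim_act M b (heads (mk E \<sigma>)) x = sim_act M b (heads E) x" if "noncounter x" for x
    using that unfolding sim_act_def by (cases x) (simp_all add: heads_def Let_def)
  moreover have "sim_act M b r (Cnt v) = (r (Cnt v), 0)" for r v
    by (simp add: sim_act_def Let_def)
  ultimately have "mk (sim_step M b E) \<sigma> x j = act_mem (sim_act M b) (mk E \<sigma>) x j" for x j
    by (cases x) (simp_all add: sim_step_def act_mem_def heads_def)
  then show "mk (sim_step M b E) \<sigma> = act_mem (sim_act M b) (mk E \<sigma>)" by blast
qed simp

definition simulates :: "tm \<Rightarrow> bool \<Rightarrow> mem \<Rightarrow> config \<Rightarrow> bool" where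
  "simulates M b E cfg \<longleftrightarrow> E Cell 0 = fst cfg \<and> fst cfg < tm_states M \<and> length (snd cfg) = tm_tapes M \<and>
     (\<forall>j<tm_tapes M. E (Sim b j) = tape_view (snd cfg ! j) \<and> (\<forall>i. snd (snd cfg ! j) i < tm_symbols M))"

lemma simulates_step:
  assumes M: "turing_machine M" and sim: "simulates M b E cfg"
  shows "simulates M b (sim_step M b E) (tm_step M cfg)"
proof -
  obtain q ts where cfg: "cfg = (q, ts)" by force
  let ?rs = "map (\<lambda>j. heads E (Sim b j)) [0..<tm_tapes M]"
  have len: "length ts = tm_tapes M" and q: "heads E Cell = q" "q < tm_states M"
    using sim by (auto simp: simulates_def cfg heads_def)
  have v: "E (Sim b j) = tape_view (ts ! j)" "snd (ts ! j) i < tm_symbols M" if "j < tm_tapes M" for j i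
    using sim that by (auto simp: simulates_def cfg)
  have rs: "?rs = map (\<lambda>(i, t). t i) ts"
    by (rule nth_equalityI) (auto simp: len heads_def v tape_view_def split: prod.splits)
  have sub: "set ?rs \<subseteq> {..<tm_symbols M}"
    using v by (auto simp: heads_def tape_view_def)
  show ?thesis
  proof (cases "q \<in> {1, 2}")
    case True
    then have "sim_act M b (heads E) x = (heads E x, 0)" for x unfolding sim_act_def Let_def q(1) by auto
    then have "sim_step M b E = E" unfolding sim_step_def act_mem_def heads_def by (auto simp: fun_eq_iff)
    moreover have "tm_step M cfg = cfg" using True by (auto simp: tm_step_def cfg)
    ultimately show ?thesis using sim by simp
  next
    case False
    obtain q' as where t: "tm_trans M q ?rs = (q', as)" by force
    note wf = trans_wf[OF M q(2) _ sub, unfolded t, simplified]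
    have a: "sim_act M b (heads E) Cell = (q', 0)"
      "sim_act M b (heads E) (Sim b j) = as ! j" if "j < tm_tapes M" for j
      using False sub q that unfolding sim_act_def Let_def by (auto simp: t)
    have a0: "sim_act M b (heads E) Cell = (q', 0)"
      using False sub q unfolding sim_act_def Let_def by (auto simp: t)
    have st: "tm_step M cfg = (q', map2 (\<lambda>(s, d) (i, t). (i + d, t(i := s))) as ts)"
      using False t unfolding tm_step_def cfg rs by auto
    have tape: "sim_step M b E (Sim b j) = tape_view (map2 (\<lambda>(s, d) (i, t). (i + d, t(i := s))) as ts ! j) \<and>
        (\<forall>i. snd (map2 (\<lambda>(s, d) (i, t). (i + d, t(i := s))) as ts ! j) i < tm_symbols M)"
      if j: "j < tm_tapes M" for j
    proof -
      obtain i t where it: "ts ! j = (i, t)" by force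
      obtain s d where sd: "as ! j = (s, d)" by force
      have n: "map2 (\<lambda>(s, d) (i, t). (i + d, t(i := s))) as ts ! j = (i + d, t(i := s))"
        using j wf len it sd by simp
      have "s < tm_symbols M" using wf(3)[of j] j sd by (metis fst_conv)
      then show ?thesis unfolding n act_view
        using v[OF j] a(2)[OF j] by (auto simp: sim_step_def act_mem_def fun_eq_iff it sd)
    qed
    show ?thesis unfolding simulates_def st
      using tape wf len a0 by (auto simp: sim_step_def act_mem_def)
  qed
qed

definition start_config :: "tm \<Rightarrow> nat list \<Rightarrow> config" where
  "start_config M w = (0, input_tape w # replicate (tm_tapes M - 1) (input_tape []))"

lemma simulates_start:
  assumes M: "turing_machine M" and w: "set w \<subseteq> {1, 2, 3}"
    and E: "E Cell 0 = 0" "E (Sim b 0) = zipper [] w" "\<And>j. 0 < j \<Longrightarrow> E (Sim b j) = (\<lambda>_. 0)"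
  shows "simulates M b E (start_config M w)"
proof -
  have T: "1 \<le> tm_tapes M" "4 \<le> tm_symbols M" "3 \<le> tm_states M" using M by (auto simp: turing_machine_def)
  have wi: "w ! i < tm_symbols M" if "i < length w" for i
    using w nth_mem[OF that] T(2) by auto
  have "E (Sim b j) = tape_view (snd (start_config M w) ! j) \<and> (\<forall>i. snd (snd (start_config M w) ! j) i < tm_symbols M)"
    if j: "j < tm_tapes M" for j
  proof (cases j)
    case 0
    then show ?thesis using E(2) wi T by (auto simp: start_config_def zipper_input input_tape_def)
  next
    case (Suc i)
    then show ?thesis using E(3)[of j] j T
      by (auto simp: start_config_def tape_view_def input_tape_def)
  qed
  then show ?thesis using E(1) T by (auto simp: simulates_def start_config_def)
qed

lemma simulates_run:
  assumes "turing_machine M" "simulates M b E (start_config M w)"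
  shows "simulates M b ((sim_step M b ^^ k) E) (tm_run M w k)"
  by (induction k) (use assms simulates_step in \<open>auto simp: tm_run_def start_config_def\<close>)

lemma tm_run_halted:
  assumes "fst (tm_run M w k) \<in> {1, 2}" "k \<le> l"
  shows "tm_run M w l = tm_run M w k"
  using assms(2)
proof (induction l rule: dec_induct)
  case (step l)
  then have "tm_run M w (Suc l) = tm_step M (tm_run M w k)" by (simp add: tm_run_def)
  also have "\<dots> = tm_run M w k"
    using assms(1) by (cases "tm_run M w k") (auto simp: tm_step_def)
  finally show ?case .
qed simp

lemma sim_step_other:
  "x \<noteq> Cell \<Longrightarrow> (\<And>j. x \<noteq> Sim b j) \<Longrightarrow> (sim_step M b ^^ k) E x = E x"
proof (induction k)
  case (Suc k)
  have "sim_act M b r x = (r x, 0)" for r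
    using Suc.prems unfolding sim_act_def Let_def by (cases x) auto
  then show ?case using Suc by (simp add: sim_step_apply heads_def fun_eq_iff)
qed simp

lemma sim_step_Cell: "\<forall>j. j \<noteq> 0 \<longrightarrow> E Cell j = 0 \<Longrightarrow> j \<noteq> 0 \<Longrightarrow> (sim_step M b ^^ k) E Cell j = 0"
proof (induction k arbitrary: j)
  case (Suc k)
  have "snd (sim_act M b r Cell) = 0" for r
    unfolding sim_act_def Let_def by auto
  then show ?case using Suc by (simp add: sim_step_apply)
qed simp

text \<open>A step writes only under the head and shifts the contents by at most one cell, so the
  radius of the nonblank region grows by at most one. This tells how far the tapes have to be erased
  after a trial run.\<close>

lemma sim_step_radius:
  assumes M: "turing_machine M" and "\<And>j i. R < \<bar>i\<bar> \<Longrightarrow> E (Sim b j) i = 0" and "0 \<le> R"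
  shows "R + int k < \<bar>i\<bar> \<Longrightarrow> (sim_step M b ^^ k) E (Sim b j) i = 0"
proof (induction k arbitrary: i j)
  case (Suc k)
  let ?E = "(sim_step M b ^^ k) E" and ?r = "heads ((sim_step M b ^^ k) E)"
  let ?rs = "map (\<lambda>j. ?r (Sim b j)) [0..<tm_tapes M]"
  have "snd (sim_act M b ?r (Sim b j)) \<in> {-1, 0, 1}"
  proof (cases "?r Cell \<in> {1, 2} \<or> \<not> (?r Cell < tm_states M \<and> set ?rs \<subseteq> {..<tm_symbols M}) \<or> \<not> j < tm_tapes M")
    case True
    then have "sim_act M b ?r (Sim b j) = (?r (Sim b j), 0)" unfolding sim_act_def Let_def by auto
    then show ?thesis by simp
  next
    case False
    then have q: "?r Cell < tm_states M" and s: "set ?rs \<subseteq> {..<tm_symbols M}" and j: "j < tm_tapes M" by blast+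
    have "sim_act M b ?r (Sim b j) = snd (tm_trans M (?r Cell) ?rs) ! j"
      using False unfolding sim_act_def Let_def by auto
    then show ?thesis using trans_wf(4)[OF M q _ s j] by simp
  qed
  then have "R + int k < \<bar>i + snd (sim_act M b ?r (Sim b j))\<bar>" "i + snd (sim_act M b ?r (Sim b j)) \<noteq> 0"
    using Suc.prems assms(3) by auto
  moreover have "(sim_step M b ^^ Suc k) E (Sim b j) i =
      ((?E (Sim b j))(0 := fst (sim_act M b ?r (Sim b j)))) (i + snd (sim_act M b ?r (Sim b j)))"
    unfolding funpow.simps comp_apply by (rule sim_step_apply)
  ultimately show ?case using Suc.IH by simp
qed (use assms in auto)


subsection \<open>Erasing the tapes of the second machine\<close>

definition all_right :: prog where
  "all_right = Act (\<lambda>r x. (r x, if \<exists>j. x = Sim False j then 1 else 0))"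

definition all_erase :: prog where
  "all_erase = Act (\<lambda>r x. if \<exists>j. x = Sim False j then (0, -1) else (r x, 0))"

definition set_cell :: prog where
  "set_cell = Act (on_tape Cell (\<lambda>_. (0, 0)))"

lemma legal_all: "legal all_right" "legal all_erase" "legal set_cell"
proof -
  show "legal all_right" "legal all_erase" unfolding all_right_def all_erase_def
    by (rule legal_ActI[of 1]; auto simp: action_wf_def)+
  show "legal set_cell" unfolding set_cell_def by (rule legal_on_tape[where N = 1]) auto
qed

definition with_sims :: "mem \<Rightarrow> (nat \<Rightarrow> view) \<Rightarrow> mem" where
  "with_sims E f x = (case x of Sim False j \<Rightarrow> f j | _ \<Rightarrow> E x)"

lemma runs_all_right:
  "runs all_right (mk (with_sims E f) \<sigma>) (mk (with_sims E (\<lambda>j i. f j (i + 1))) \<sigma>) 1"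
  unfolding all_right_def
  by (rule runs_Act)
    (auto simp: fun_eq_iff act_mem_def heads_def mk_def with_sims_def split: tapeid.splits bool.splits)

lemma runs_all_erase:
  "runs all_erase (mk (with_sims E f) \<sigma>) (mk (with_sims E (\<lambda>j i. ((f j)(0 := 0)) (i - 1))) \<sigma>) 1"
  unfolding all_erase_def
  by (rule runs_Act)
    (auto simp: fun_eq_iff act_mem_def heads_def mk_def with_sims_def split: tapeid.splits bool.splits)

lemma runs_shift_all:
  "runs (Rep d all_right) (mk (with_sims E f) \<sigma>)
     (mk (with_sims E (\<lambda>j i. f j (i + int (\<sigma> d)))) (\<sigma>(d := 0))) (4 * \<sigma> d + 1)"
  by (rule runs_Rep[where n = "\<sigma> d" and Es = "\<lambda>k. with_sims E (\<lambda>j i. f j (i + int k))"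
        and \<sigma>s = "\<lambda>_. \<sigma>" and ?T1.0 = 1], rule runs_conv[OF runs_all_right])
    (auto simp: algebra_simps)

lemma runs_erase_all:
  "runs (Rep d all_erase) (mk (with_sims E f) \<sigma>)
     (mk (with_sims E (\<lambda>j i. if 0 < i \<and> i \<le> int (\<sigma> d) then 0 else f j (i - int (\<sigma> d)))) (\<sigma>(d := 0))) (4 * \<sigma> d + 1)"
proof (rule runs_Rep[where n = "\<sigma> d"
        and Es = "\<lambda>k. with_sims E (\<lambda>j i. if 0 < i \<and> i \<le> int k then 0 else f j (i - int k))"
        and \<sigma>s = "\<lambda>_. \<sigma>" and ?T1.0 = 1])
  fix k
  have "(\<lambda>j i. ((\<lambda>i. if 0 < i \<and> i \<le> int k then 0 else f j (i - int k))(0 := 0)) (i - 1)) =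
     (\<lambda>j i. if 0 < i \<and> i \<le> int (Suc k) then 0 else f j (i - int (Suc k)))"
    by (auto simp: fun_eq_iff algebra_simps)
  then show "runs all_erase (mk (with_sims E (\<lambda>j i. if 0 < i \<and> i \<le> int k then 0 else f j (i - int k))) (\<sigma>(d := \<sigma> d - Suc k)))
     (mk (with_sims E (\<lambda>j i. if 0 < i \<and> i \<le> int (Suc k) then 0 else f j (i - int (Suc k)))) (\<sigma>(d := \<sigma> d - Suc k))) 1"
    using runs_all_erase[of E "\<lambda>j i. if 0 < i \<and> i \<le> int k then 0 else f j (i - int k)"] by simp
next
  show "mk (with_sims E f) \<sigma> = mk (with_sims E (\<lambda>j i. if 0 < i \<and> i \<le> int 0 then 0 else f j (i - int 0))) (\<sigma>(d := \<sigma> d))"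
    by (intro arg_cong2[of _ _ _ _ mk] arg_cong[of _ _ "with_sims E"]) (auto simp: fun_eq_iff)
qed simp_all


section \<open>Choosing the number of groups\<close>

lemma evaluatesD:
  assumes "evaluates e d k" "\<forall>v. \<sigma> v \<le> b" "\<forall>v\<ge>d. \<sigma> v = 0" "input_ok b n xs E" "k \<le> K"
  shows "runs (code e d) (mk E \<sigma>) (mk E (\<sigma>(d := eval n xs \<sigma> e))) (b ^ K)" "eval n xs \<sigma> e \<le> b ^ K"
proof -
  have "2 \<le> b" using assms(4) by (simp add: input_ok_def)
  then have le: "b ^ k \<le> b ^ K" using assms(5) by (intro power_increasing) auto
  have *: "runs (code e d) (mk E \<sigma>) (mk E (\<sigma>(d := eval n xs \<sigma> e))) (b ^ k) \<and> eval n xs \<sigma> e \<le> b ^ k"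
    using assms(1-4) unfolding evaluates_def by blast
  show "runs (code e d) (mk E \<sigma>) (mk E (\<sigma>(d := eval n xs \<sigma> e))) (b ^ K)"
    using * le runs_mono by blast
  show "eval n xs \<sigma> e \<le> b ^ K" using * le by linarith
qed

lemma hundred_times_power:
  fixes b :: nat
  assumes "2 \<le> b" "T \<le> 100 * b ^ k"
  shows "T \<le> b ^ (k + 7)"
proof -
  have "(100::nat) \<le> b ^ 7" using power_mono[OF assms(1), of 7] by simp
  then have "100 * b ^ k \<le> b ^ 7 * b ^ k" by (rule mult_le_mono1)
  with assms(2) have "T \<le> b ^ 7 * b ^ k" by (rule order_trans)
  then show ?thesis unfolding power_add by (simp only: mult.commute)
qed

text \<open>The argument \<open>3 (p + 1) + 14\<close> is the pathwidth bound for
  \<open>p + 1\<close> groups; if the machine halts on it within \<open>n\<close> steps, the value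
  of \<open>f\<close> there is linear in \<open>n\<close>. The condition on the square keeps the
  width below \<open>sqrt n\<close>, so that products of the width with \<open>log n\<close> stay
  sublinear.\<close>

definition next_width :: "tm \<Rightarrow> nat \<Rightarrow> nat \<Rightarrow> nat" where
  "next_width F n p =
     p + of_bool ((p + 1) * (p + 1) \<le> n \<and> fst (tm_run F (replicate (3 * (p + 1) + 14) 2) n) \<in> {1, 2})"

text \<open>The start value 1 is accepted without a test: for it \<open>f\<close> contributes only
  the constant \<open>f 17\<close>. A rejected candidate is rejected again in all later rounds, so
  \<open>n\<close> rounds do no harm.\<close>

definition width_of :: "tm \<Rightarrow> nat \<Rightarrow> nat" where
  "width_of F n = (next_width F n ^^ n) 1"

abbreviation width_ex :: ex where
  "width_ex \<equiv> Plus (Times (Const 3) (Plus (Var 2) (Const 1))) (Const 14)"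

abbreviation radius_ex :: ex where
  "radius_ex \<equiv> Plus width_ex (Var 0)"

text \<open>The next trial needs blank tapes. All heads of the second machine move right by a radius
  that bounds the run and then erase twice that distance plus one cell on the way back;
  \<open>Cell\<close> is reset by itself.\<close>

definition try_width :: "tm \<Rightarrow> prog" where
  "try_width F =
     code width_ex 4 ;; Rep 4 (put (Sim False 0) 2) ;; rewind (Sim False 0) ;;
     code (Var 0) 4 ;; Rep 4 (Act (sim_act F False)) ;;
     Cond (\<lambda>h. h Cell \<in> {1, 2}) (inc 2) Skip ;; set_cell ;;
     code radius_ex 4 ;; Rep 4 all_right ;;
     code (Plus radius_ex (Plus radius_ex (Const 1))) 4 ;; Rep 4 all_erase"

definition width_search :: "tm \<Rightarrow> prog" where
  "width_search F =
     code (Var 0) 3 ;;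
     Rep 3 (code (Less (Times (Plus (Var 2) (Const 1)) (Plus (Var 2) (Const 1))) (Plus (Var 0) (Const 1))) 4 ;;
       Cond (is_zero 4) Skip (dec 4 ;; try_width F))"

lemma legal_width_search: "turing_machine F \<Longrightarrow> legal (width_search F)"
  unfolding width_search_def try_width_def
  by (intro legal_intros legal_Rep legal_inc legal_dec legal_code legal_moves legal_rewind
      legal_all legal_sim legal_test_read[of "\<lambda>s. s \<in> {1, 2}"])

lemma runs_set_cell:
  "runs set_cell (mk E \<sigma>) (mk (E(Cell := (E Cell)(0 := 0))) \<sigma>) 1"
  unfolding set_cell_def by (rule runs_Act) (auto simp: act_mem_on_tape mk_def fun_eq_iff split: tapeid.splits)

lemma runs_try_width:
  assumes F: "turing_machine F"
  shows "\<exists>k. \<forall>b \<sigma> E n xs. (\<forall>v. \<sigma> v \<le> b) \<longrightarrow> (\<forall>v\<ge>4. \<sigma> v = 0) \<longrightarrow> input_ok b n xs E \<longrightarrow> \<sigma> 0 = n \<longrightarrow>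
     E Cell = (\<lambda>_. 0) \<longrightarrow> (\<forall>j. E (Sim False j) = (\<lambda>_. 0)) \<longrightarrow>
     runs (try_width F) (mk E \<sigma>)
       (mk E (\<sigma>(2 := \<sigma> 2 + of_bool (fst (tm_run F (replicate (3 * (\<sigma> 2 + 1) + 14) 2) n) \<in> {1, 2})))) (b ^ k)"
proof -
  let ?e1 = width_ex and ?e2 = "Var 0" and ?e3 = radius_ex and ?e4 = "Plus radius_ex (Plus radius_ex (Const 1))"
  obtain k1 k2 k3 k4 where ks: "evaluates ?e1 4 k1" "evaluates ?e2 4 k2" "evaluates ?e3 4 k3" "evaluates ?e4 4 k4"
    using code_evaluates[of 4 ?e1] code_evaluates[of 4 ?e2] code_evaluates[of 4 ?e3] code_evaluates[of 4 ?e4]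
    by auto
  define K where "K = k1 + k2 + k3 + k4"
  have kK: "k1 \<le> K" "k2 \<le> K" "k3 \<le> K" "k4 \<le> K" by (auto simp: K_def)
  show ?thesis
  proof (intro exI[of _ "2 * K + 7"] allI impI)
    fix b :: nat and \<sigma> :: "nat \<Rightarrow> nat" and E n xs
    assume s: "\<forall>v. \<sigma> v \<le> b" "\<forall>v\<ge>4. \<sigma> v = 0" "input_ok b n xs E" "\<sigma> 0 = n"
      and E: "E Cell = (\<lambda>_. 0)" "\<forall>j. E (Sim False j) = (\<lambda>_. 0)"
    have b2: "2 \<le> b" using s by (simp add: input_ok_def)
    \<comment> \<open>The new width can exceed \<open>b\<close> by one, so the later evaluations are
      measured with \<open>b ^ 2\<close>.\<close>
    define B where "B = b ^ 2"
    define X where "X = B ^ K"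
    have "2 * b \<le> b * b" using b2 by simp
    then have bB: "b + 1 \<le> B" "b \<le> B" using b2 unfolding B_def power2_eq_square by linarith+
    have "b ^ 0 \<le> B ^ K" using bB b2 by simp
    then have X1: "1 \<le> X" by (simp add: X_def)
    have ok: "input_ok B n xs E'" if "E' Inp = E Inp" for E'
      using input_ok_mono[OF s(3) bB(2)] that by (simp add: input_ok_def)
    define x where "x = 3 * (\<sigma> 2 + 1) + 14"
    define w where "w = replicate x (2::nat)"
    have sB: "\<forall>v. \<sigma> v \<le> B" using s(1) bB(2) by (meson order_trans)
    have ev: "eval n xs \<sigma> ?e1 = x" "eval n xs \<sigma> ?e2 = n" using s(4) by (simp_all add: x_def)
    note c1 = evaluatesD[OF ks(1) sB s(2) ok[of E, OF refl] kK(1), folded X_def, unfolded ev]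
    let ?S = "Sim False 0"
    have E0: "E = E(?S := zipper (replicate 0 2) [])"
      using E(2) by (auto simp: fun_eq_iff zipper_def)
    have c2: "runs (Rep 4 (put ?S 2)) (mk E (\<sigma>(4 := x))) (mk (E(?S := zipper (replicate x 2) [])) \<sigma>) (4 * x + 1)"
    proof (rule runs_Rep[where n = x and Es = "\<lambda>i. E(?S := zipper (replicate i 2) [])" and \<sigma>s = "\<lambda>_. \<sigma>" and ?T1.0 = 1])
      show "runs (put ?S 2) (mk (E(?S := zipper (replicate i 2) [])) (\<sigma>(4 := x - Suc i)))
         (mk (E(?S := zipper (replicate (Suc i) 2) [])) (\<sigma>(4 := x - Suc i))) 1" for i
        using runs_put[of ?S 2 E "replicate i 2" "\<sigma>(4 := x - Suc i)"] by simp
      show "mk E (\<sigma>(4 := x)) = mk (E(?S := zipper (replicate 0 2) [])) (\<sigma>(4 := x))" using E0 by simp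
      show "mk (E(?S := zipper (replicate x 2) [])) \<sigma> = mk (E(?S := zipper (replicate x 2) [])) (\<sigma>(4 := 0))"
        using s(2) by (auto intro!: mk_eqI)
    qed simp
    define E2 where "E2 = E(?S := zipper [] w)"
    have c3: "runs (rewind ?S) (mk (E(?S := zipper (replicate x 2) [])) \<sigma>) (mk E2 \<sigma>) (2 * x + 5)"
      by (rule runs_conv[OF runs_rewind]) (auto simp: E2_def w_def)
    have okE2: "input_ok B n xs E2" by (rule ok) (simp add: E2_def)
    note c4 = evaluatesD[OF ks(2) sB s(2) okE2 kK(2), folded X_def, unfolded ev]
    define E3 where "E3 = (sim_step F False ^^ n) E2"
    have c5: "runs (Rep 4 (Act (sim_act F False))) (mk E2 (\<sigma>(4 := n))) (mk E3 \<sigma>) (4 * n + 1)"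
    proof (rule runs_Rep[where n = n and Es = "\<lambda>i. (sim_step F False ^^ i) E2" and \<sigma>s = "\<lambda>_. \<sigma>" and ?T1.0 = 1])
      show "runs (Act (sim_act F False)) (mk ((sim_step F False ^^ i) E2) (\<sigma>(4 := n - Suc i)))
         (mk ((sim_step F False ^^ Suc i) E2) (\<sigma>(4 := n - Suc i))) 1" for i
        using runs_sim[of F False "(sim_step F False ^^ i) E2"] by simp
      show "mk E3 \<sigma> = mk ((sim_step F False ^^ n) E2) (\<sigma>(4 := 0))"
        unfolding E3_def using s(2) by (auto intro!: mk_eqI)
    qed simp_all
    have "simulates F False E2 (start_config F w)"
      by (rule simulates_start[OF F]) (use E in \<open>auto simp: E2_def w_def\<close>)
    from simulates_run[OF F this, of n] have cell: "E3 Cell 0 = fst (tm_run F w n)"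
      by (simp add: simulates_def E3_def)
    define \<tau> where "\<tau> = \<sigma>(2 := \<sigma> 2 + of_bool (fst (tm_run F w n) \<in> {1, 2}))"
    have c6: "runs (Cond (\<lambda>h. h Cell \<in> {1, 2}) (inc 2) Skip) (mk E3 \<sigma>) (mk E3 \<tau>) 2"
    proof (rule runs_Cond[where ?T1.0 = 1])
      assume "heads (mk E3 \<sigma>) Cell \<in> {1, 2}"
      then show "runs (inc 2) (mk E3 \<sigma>) (mk E3 \<tau>) 1"
        by (intro runs_conv[OF runs_inc]) (auto simp: \<tau>_def cell)
    next
      assume "heads (mk E3 \<sigma>) Cell \<notin> {1, 2}"
      then show "runs Skip (mk E3 \<sigma>) (mk E3 \<tau>) 1"
        by (intro runs_conv[OF runs_Skip_exact]) (auto simp: \<tau>_def cell)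
    qed simp
    define f where "f = (\<lambda>j. E3 (Sim False j))"
    have oth: "E3 y = E y" if "y \<noteq> Cell" "\<And>j. y \<noteq> Sim False j" for y
      using sim_step_other[OF that, where M = F and k = n and E = E2] that by (simp add: E3_def E2_def)
    have "(E3 Cell)(0 := 0) = E Cell"
      using sim_step_Cell[where E = E2 and M = F and b = False and k = n] E(1) by (auto simp: fun_eq_iff E3_def E2_def)
    then have E4: "E3(Cell := (E3 Cell)(0 := 0)) = with_sims E f"
      using oth by (auto simp: fun_eq_iff with_sims_def f_def split: tapeid.splits bool.splits)
    have c7: "runs set_cell (mk E3 \<tau>) (mk (with_sims E f) \<tau>) 1"
      using runs_set_cell[of E3 \<tau>] by (simp only: E4)
    have tB: "\<forall>v. \<tau> v \<le> B"
    proof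
      fix v
      have "\<tau> v \<le> \<sigma> v + 1" by (simp add: \<tau>_def)
      also have "\<dots> \<le> b + 1" using s(1) by simp
      also have "\<dots> \<le> B" by (rule bB)
      finally show "\<tau> v \<le> B" .
    qed
    have t4: "\<forall>v\<ge>4. \<tau> v = 0" using s(2) by (auto simp: \<tau>_def)
    have inp: "input_ok B n xs (with_sims E g)" for g by (rule ok) (simp add: with_sims_def)
    \<comment> \<open>Computed with the new width in \<open>\<tau>\<close>, possibly larger than the
      old one; all that matters is \<open>x + n \<le> R\<close>.\<close>
    define R where "R = 3 * (\<tau> 2 + 1) + 14 + \<tau> 0"
    have R: "eval n xs \<tau> ?e3 = R" "eval n xs \<tau> ?e4 = 2 * R + 1" by (simp_all add: R_def)
    note c8 = evaluatesD[OF ks(3) tB t4 inp[of f] kK(3), folded X_def, unfolded R]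
    define g where "g = (\<lambda>j i. f j (i + int R))"
    have c9: "runs (Rep 4 all_right) (mk (with_sims E f) (\<tau>(4 := R))) (mk (with_sims E g) \<tau>) (4 * R + 1)"
      by (rule runs_conv[OF runs_shift_all]) (use t4 in \<open>auto simp: g_def intro!: mk_eqI\<close>)
    note c10 = evaluatesD[OF ks(4) tB t4 inp[of g] kK(4), folded X_def, unfolded R]
    have rad: "f j i = 0" if "int R < \<bar>i\<bar>" for j i
    proof -
      have "E2 (Sim False j) i = 0" if "int x < \<bar>i\<bar>" for j i
        using that E(2) by (auto simp: E2_def w_def zipper_def)
      from sim_step_radius[OF F, where E = E2 and b = False and R = "int x" and k = n and i = i and j = j, OF this]
      have "int x + int n < \<bar>i\<bar> \<Longrightarrow> E3 (Sim False j) i = 0" by (simp add: E3_def)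
      moreover have "x + n \<le> R" using s(4) by (simp add: x_def R_def \<tau>_def)
      ultimately show ?thesis using that by (simp add: f_def)
    qed
    have we: "with_sims E (\<lambda>j i. if 0 < i \<and> i \<le> int (2 * R + 1) then 0 else g j (i - int (2 * R + 1))) = E"
    proof -
      \<comment> \<open>A cell outside the erased range \<open>1, ..., 2 R + 1\<close> has distance
        more than \<open>R\<close> from the position of the head after the trial run, hence it was
        blank already.\<close>
      have "(if 0 < i \<and> i \<le> int (2 * R + 1) then 0 else g j (i - int (2 * R + 1))) = 0" for j i
        using rad[of "i - int (2 * R + 1) + int R" j] by (auto simp: g_def)
      then show ?thesis using E(2)
        by (auto simp: fun_eq_iff with_sims_def split: tapeid.splits bool.splits)
    qed
    have "\<tau>(4 := 0) = \<tau>" using t4 by auto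
    then have c11: "runs (Rep 4 all_erase) (mk (with_sims E g) (\<tau>(4 := 2 * R + 1))) (mk E \<tau>) (4 * (2 * R + 1) + 1)"
      using runs_erase_all[of 4 E g "\<tau>(4 := 2 * R + 1)"] by (simp only: fun_upd_same fun_upd_upd we)
    have "runs (try_width F) (mk E \<sigma>) (mk E \<tau>) (100 * X)"
      unfolding try_width_def
      by (rule runs_conv[OF runs_Seq_exact[OF c1(1) runs_Seq_exact[OF c2 runs_Seq_exact[OF c3
           runs_Seq_exact[OF c4(1) runs_Seq_exact[OF c5 runs_Seq_exact[OF c6 runs_Seq_exact[OF c7
           runs_Seq_exact[OF c8(1) runs_Seq_exact[OF c9 runs_Seq_exact[OF c10(1) c11]]]]]]]]]]])
        (use c1(2) c4(2) c8(2) c10(2) X1 in auto)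
    then have "runs (try_width F) (mk E \<sigma>) (mk E \<tau>) (b ^ (2 * K + 7))"
      by (rule runs_mono) (rule hundred_times_power[OF b2], simp add: X_def B_def power_mult)
    then show "runs (try_width F) (mk E \<sigma>)
       (mk E (\<sigma>(2 := \<sigma> 2 + of_bool (fst (tm_run F (replicate (3 * (\<sigma> 2 + 1) + 14) 2) n) \<in> {1, 2})))) (b ^ (2 * K + 7))"
      by (simp add: \<tau>_def w_def x_def)
  qed
qed

lemma next_width_le: "next_width F n p \<le> Suc p"
  by (simp add: next_width_def)

lemma next_width_iterate_le: "(next_width F n ^^ i) 1 \<le> Suc i"
proof (induction i)
  case (Suc i)
  then show ?case using next_width_le[of F n "(next_width F n ^^ i) 1"] by simp
qed simp

lemma runs_width_search:
  assumes F: "turing_machine F"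
  shows "\<exists>k. \<forall>b \<sigma> E n xs. (\<forall>v. \<sigma> v \<le> b) \<longrightarrow> (\<forall>v\<ge>3. \<sigma> v = 0) \<longrightarrow> input_ok b n xs E \<longrightarrow> \<sigma> 0 = n \<longrightarrow>
     \<sigma> 2 = 1 \<longrightarrow> n + 2 \<le> b \<longrightarrow> E Cell = (\<lambda>_. 0) \<longrightarrow> (\<forall>j. E (Sim False j) = (\<lambda>_. 0)) \<longrightarrow>
     runs (width_search F) (mk E \<sigma>) (mk E (\<sigma>(2 := width_of F n))) (b ^ k)"
proof -
  let ?e = "Less (Times (Plus (Var 2) (Const 1)) (Plus (Var 2) (Const 1))) (Plus (Var 0) (Const 1))"
  obtain k1 k2 where ks: "evaluates (Var 0) 3 k1" "evaluates ?e 4 k2"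
    using code_evaluates[of 3 "Var 0"] code_evaluates[of 4 ?e] by auto
  obtain k3 where k3: "\<And>b \<sigma> E n xs. (\<forall>v. \<sigma> v \<le> b) \<Longrightarrow> (\<forall>v\<ge>4. \<sigma> v = 0) \<Longrightarrow> input_ok b n xs E \<Longrightarrow> \<sigma> 0 = n \<Longrightarrow>
     E Cell = (\<lambda>_. 0) \<Longrightarrow> (\<forall>j. E (Sim False j) = (\<lambda>_. 0)) \<Longrightarrow>
     runs (try_width F) (mk E \<sigma>)
       (mk E (\<sigma>(2 := \<sigma> 2 + of_bool (fst (tm_run F (replicate (3 * (\<sigma> 2 + 1) + 14) 2) n) \<in> {1, 2})))) (b ^ k3)"
    using runs_try_width[OF F] by blast
  define K where "K = k1 + k2 + k3 + 1"
  show ?thesis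
  proof (intro exI[of _ "K + 1 + 7"] allI impI)
    fix b :: nat and \<sigma> :: "nat \<Rightarrow> nat" and E n xs
    assume s: "\<forall>v. \<sigma> v \<le> b" "\<forall>v\<ge>3. \<sigma> v = 0" "input_ok b n xs E" "\<sigma> 0 = n" "\<sigma> 2 = 1" and nb: "n + 2 \<le> b"
      and E: "E Cell = (\<lambda>_. 0)" "\<forall>j. E (Sim False j) = (\<lambda>_. 0)"
    have b2: "2 \<le> b" using s by (simp add: input_ok_def)
    note c1 = evaluatesD[OF ks(1) s(1,2,3), of K, simplified, unfolded s(4)]
    let ?try = "Cond (is_zero 4) Skip (dec 4 ;; try_width F)"
    have body: "runs (code ?e 4 ;; ?try) (mk E \<tau>) (mk E (\<tau>(2 := next_width F n (\<tau> 2)))) (2 * b ^ K + 5)"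
      if t: "\<forall>v. \<tau> v \<le> b" "\<forall>v\<ge>4. \<tau> v = 0" "\<tau> 0 = n" for \<tau>
    proof -
      let ?c = "(\<tau> 2 + 1) * (\<tau> 2 + 1) \<le> n"
      have ev: "eval n xs \<tau> ?e = of_bool ?c" by (simp add: t(3) less_Suc_eq_le)
      have d1: "runs (code ?e 4) (mk E \<tau>) (mk E (\<tau>(4 := of_bool ?c))) (b ^ K)"
        using evaluatesD(1)[OF ks(2) t(1,2) s(3), of K] ev by (simp add: K_def)
      have tw: "runs (try_width F) (mk E \<tau>)
       (mk E (\<tau>(2 := \<tau> 2 + of_bool (fst (tm_run F (replicate (3 * (\<tau> 2 + 1) + 14) 2) n) \<in> {1, 2})))) (b ^ K)"
        by (rule runs_mono[OF k3[OF t(1,2) s(3) t(3) E]], rule power_increasing) (use b2 in \<open>auto simp: K_def\<close>)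
      have "runs ?try (mk E (\<tau>(4 := of_bool ?c))) (mk E (\<tau>(2 := next_width F n (\<tau> 2)))) (b ^ K + 3)"
      proof (rule runs_Cond[where ?T1.0 = "b ^ K + 2"])
        assume "is_zero 4 (heads (mk E (\<tau>(4 := of_bool ?c))))"
        then have nc: "\<not> ?c" by (simp split: if_splits)
        then have "\<tau>(4 := of_bool ?c) = \<tau>(2 := next_width F n (\<tau> 2))"
          using t(2) by (auto simp: fun_eq_iff next_width_def)
        then show "runs Skip (mk E (\<tau>(4 := of_bool ?c))) (mk E (\<tau>(2 := next_width F n (\<tau> 2)))) (b ^ K + 2)" by auto
      next
        assume "\<not> is_zero 4 (heads (mk E (\<tau>(4 := of_bool ?c))))"
        then have c: ?c by (simp split: if_splits)
        have "runs (dec 4) (mk E (\<tau>(4 := of_bool ?c))) (mk E \<tau>) 1"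
          by (rule runs_conv[OF runs_dec]) (use t(2) c in \<open>auto intro!: mk_eqI\<close>)
        from runs_Seq_exact[OF this tw]
        show "runs (dec 4 ;; try_width F) (mk E (\<tau>(4 := of_bool ?c))) (mk E (\<tau>(2 := next_width F n (\<tau> 2)))) (b ^ K + 2)"
          by (rule runs_conv) (use c in \<open>auto simp: next_width_def\<close>)
      qed simp
      from runs_Seq_exact[OF d1 this] show ?thesis by (rule runs_mono) simp
    qed
    have c2: "runs (Rep 3 (code ?e 4 ;; ?try)) (mk E (\<sigma>(3 := n))) (mk E (\<sigma>(2 := width_of F n))) (n * (2 * b ^ K + 8) + 1)"
    proof (rule runs_Rep[where n = n and Es = "\<lambda>_. E" and \<sigma>s = "\<lambda>i. \<sigma>(2 := (next_width F n ^^ i) 1)"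
          and ?T1.0 = "2 * b ^ K + 5"])
      fix i assume i: "i < n"
      let ?\<tau> = "\<sigma>(2 := (next_width F n ^^ i) 1, 3 := n - Suc i)"
      have "\<forall>v. ?\<tau> v \<le> b"
        using s(1) nb i next_width_iterate_le[of i F n] by (auto intro: order_trans[OF next_width_iterate_le])
      moreover have "\<forall>v\<ge>4. ?\<tau> v = 0" "?\<tau> 0 = n" using s by auto
      ultimately show "runs (code ?e 4 ;; ?try) (mk E ?\<tau>)
         (mk E (\<sigma>(2 := (next_width F n ^^ Suc i) 1, 3 := n - Suc i))) (2 * b ^ K + 5)"
        by (intro runs_conv[OF body]) (auto intro!: mk_eqI)
    qed (use s in \<open>auto simp: width_of_def intro!: mk_eqI\<close>)
    have "n * (2 * b ^ K + 8) \<le> b * (2 * b ^ K + 8)" using nb by (intro mult_le_mono1) simp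
    also have "\<dots> = 2 * b ^ (K + 1) + 8 * b" by (simp add: algebra_simps)
    finally have n: "n * (2 * b ^ K + 8) \<le> 2 * b ^ (K + 1) + 8 * b" .
    have "b ^ 1 \<le> b ^ (K + 1)" "b ^ K \<le> b ^ (K + 1)" by (rule power_increasing; use b2 in simp)+
    then have "Suc (b ^ K + (n * (2 * b ^ K + 8) + 1)) \<le> 100 * b ^ (K + 1)"
      using n b2 unfolding power_one_right by linarith
    from hundred_times_power[OF b2 this] show "runs (width_search F) (mk E \<sigma>) (mk E (\<sigma>(2 := width_of F n))) (b ^ (K + 1 + 7))"
      unfolding width_search_def using runs_mono[OF runs_Seq_exact[OF c1(1) c2]] by (simp add: K_def)
  qed
qed


section \<open>Writing the output\<close>

text \<open>The output tape is tape 0 of the machine simulated afterwards, so writing the instance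
  prepares the input of the simulation.\<close>

abbreviation Out :: tapeid where "Out \<equiv> Sim True 0"

definition with_out :: "mem \<Rightarrow> nat list \<Rightarrow> mem" where
  "with_out E w = E(Out := zipper (rev w) [])"

definition emits :: "prog \<Rightarrow> nat \<Rightarrow> (nat \<Rightarrow> nat list \<Rightarrow> (nat \<Rightarrow> nat) \<Rightarrow> nat list) \<Rightarrow> nat \<Rightarrow> bool" where
  "emits c d f k \<longleftrightarrow> (\<forall>b \<sigma> E n xs w. (\<forall>v. \<sigma> v \<le> b) \<longrightarrow> (\<forall>v\<ge>d. \<sigma> v = 0) \<longrightarrow> input_ok b n xs E \<longrightarrow>
     runs c (mk (with_out E w) \<sigma>) (mk (with_out E (w @ f n xs \<sigma>)) \<sigma>) (b ^ k) \<and>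
     length (f n xs \<sigma>) \<le> b ^ k)"

lemma emitsD:
  assumes "emits c d f k" "\<forall>v. \<sigma> v \<le> b" "\<forall>v\<ge>d. \<sigma> v = 0" "input_ok b n xs E" "k \<le> K"
  shows "runs c (mk (with_out E w) \<sigma>) (mk (with_out E (w @ f n xs \<sigma>)) \<sigma>) (b ^ K)"
    and "length (f n xs \<sigma>) \<le> b ^ K"
proof -
  have "2 \<le> b" using assms(4) by (simp add: input_ok_def)
  then have le: "b ^ k \<le> b ^ K" using assms(5) by (intro power_increasing) auto
  have *: "runs c (mk (with_out E w) \<sigma>) (mk (with_out E (w @ f n xs \<sigma>)) \<sigma>) (b ^ k)"
    "length (f n xs \<sigma>) \<le> b ^ k" using assms(1-4) unfolding emits_def by blast+
  show "runs c (mk (with_out E w) \<sigma>) (mk (with_out E (w @ f n xs \<sigma>)) \<sigma>) (b ^ K)"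
    using runs_mono[OF *(1) le] .
  show "length (f n xs \<sigma>) \<le> b ^ K" using *(2) le by (rule order_trans)
qed

lemma input_ok_with_out: "input_ok b n xs (with_out E w) = input_ok b n xs E"
  by (simp add: input_ok_def with_out_def)

lemma runs_put_out: "runs (put Out a) (mk (with_out E w) \<sigma>) (mk (with_out E (w @ [a])) \<sigma>) 1"
  unfolding with_out_def using runs_put[of Out a E "rev w" \<sigma>] by simp

lemma emits_Seq:
  assumes "emits c d f k" "emits c' d f' k'"
  shows "\<exists>k. emits (c ;; c') d (\<lambda>n xs \<sigma>. f n xs \<sigma> @ f' n xs \<sigma>) k"
proof (rule exI[of _ "k + k' + 7"], unfold emits_def, intro allI impI)
  fix b :: nat and \<sigma> :: "nat \<Rightarrow> nat" and E n xs w
  assume s: "\<forall>v. \<sigma> v \<le> b" "\<forall>v\<ge>d. \<sigma> v = 0" "input_ok b n xs E"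
  then have b2: "2 \<le> b" by (simp add: input_ok_def)
  then have "1 \<le> b ^ (k + k')" by simp
  then have "Suc (b ^ (k + k') + b ^ (k + k')) \<le> 100 * b ^ (k + k')" by linarith
  note t = hundred_times_power[OF b2 this]
  have "length (f n xs \<sigma> @ f' n xs \<sigma>) \<le> 100 * b ^ (k + k')"
    using emitsD(2)[OF assms(1) s, of "k + k'"] emitsD(2)[OF assms(2) s, of "k + k'"] by simp
  note l = hundred_times_power[OF b2 this]
  show "runs (c ;; c') (mk (with_out E w) \<sigma>) (mk (with_out E (w @ f n xs \<sigma> @ f' n xs \<sigma>)) \<sigma>) (b ^ (k + k' + 7)) \<and>
      length (f n xs \<sigma> @ f' n xs \<sigma>) \<le> b ^ (k + k' + 7)"
    using runs_Seq[OF emitsD(1)[OF assms(1) s, of "k + k'"] emitsD(1)[OF assms(2) s, of "k + k'"] t] l by simp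
qed

definition emit_unary :: "ex \<Rightarrow> nat \<Rightarrow> prog" where
  "emit_unary e d = code e d ;; Rep d (put Out 2) ;; put Out 3"

definition emit_bin :: "nat \<Rightarrow> prog" where
  "emit_bin d = Loop (\<lambda>h. h (Cnt d) \<noteq> 1)
     (halve d ;; Cond (is_zero (d + 2)) (put Out 1) (dec (d + 2) ;; put Out 2))"

definition emit_nat :: "ex \<Rightarrow> nat \<Rightarrow> prog" where
  "emit_nat e d = code e d ;; emit_bin d ;; put Out 3"

definition emit_if :: "ex \<Rightarrow> nat \<Rightarrow> prog \<Rightarrow> prog" where
  "emit_if e d c = code e d ;; Cond (is_zero d) Skip (Rep d Skip ;; c)"

text \<open>The counter \<open>d\<close> is the loop variable, \<open>d + 1\<close> the number of remaining iterations.\<close>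

definition emit_for :: "ex \<Rightarrow> nat \<Rightarrow> prog \<Rightarrow> prog" where
  "emit_for e d c = code e (d + 1) ;; Rep (d + 1) (c ;; inc d) ;; Rep d Skip"

lemma legal_emit:
  "legal (emit_unary e d)" "legal (emit_nat e d)" "legal c \<Longrightarrow> legal (emit_if e d c)"
  "legal c \<Longrightarrow> legal (emit_for e d c)"
  unfolding emit_unary_def emit_nat_def emit_bin_def emit_if_def emit_for_def
  by (intro legal_intros legal_Rep legal_inc legal_dec legal_code legal_moves legal_ops
      legal_test_read[of "\<lambda>s. s \<noteq> 1"] | assumption)+

lemma emits_unary:
  assumes "vars_below d e"
  shows "\<exists>k. emits (emit_unary e d) d (\<lambda>n xs \<sigma>. enc_unary (eval n xs \<sigma> e)) k"
proof -
  obtain k where k: "evaluates e d k" using code_evaluates[OF assms] by blast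
  show ?thesis
  proof (rule exI[of _ "k + 7"], unfold emits_def, intro allI impI)
    fix b :: nat and \<sigma> :: "nat \<Rightarrow> nat" and E n xs w
    assume s: "\<forall>v. \<sigma> v \<le> b" "\<forall>v\<ge>d. \<sigma> v = 0" "input_ok b n xs E"
    then have b2: "2 \<le> b" by (simp add: input_ok_def)
    let ?x = "eval n xs \<sigma> e"
    note c1 = evaluatesD[OF k s(1,2) s(3)[folded input_ok_with_out[of b n xs E w]] order_refl]
    have c2: "runs (Rep d (put Out 2)) (mk (with_out E w) (\<sigma>(d := ?x))) (mk (with_out E (w @ replicate ?x 2)) \<sigma>) (4 * ?x + 1)"
    proof (rule runs_Rep[where n = ?x and Es = "\<lambda>i. with_out E (w @ replicate i 2)" and \<sigma>s = "\<lambda>_. \<sigma>" and ?T1.0 = 1])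
      show "runs (put Out 2) (mk (with_out E (w @ replicate i 2)) (\<sigma>(d := ?x - Suc i)))
        (mk (with_out E (w @ replicate (Suc i) 2)) (\<sigma>(d := ?x - Suc i))) 1" for i
        using runs_put_out[of 2 E "w @ replicate i 2"] by (simp add: replicate_append_same)
    qed (use s in \<open>auto intro!: mk_eqI\<close>)
    have "1 \<le> b ^ k" using b2 by simp
    then have "Suc (b ^ k + Suc (4 * ?x + 1 + 1)) \<le> 100 * b ^ k" using c1(2) by linarith
    note t = hundred_times_power[OF b2 this]
    have "length (enc_unary ?x) \<le> b ^ (k + 7)" using t by (simp add: enc_unary_def)
    then show "runs (emit_unary e d) (mk (with_out E w) \<sigma>) (mk (with_out E (w @ enc_unary ?x)) \<sigma>) (b ^ (k + 7)) \<and>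
        length (enc_unary ?x) \<le> b ^ (k + 7)"
      unfolding emit_unary_def
      using runs_Seq[OF c1(1) runs_Seq_exact[OF c2 runs_put_out] t] by (simp add: enc_unary_def)
  qed
qed

lemma runs_emit_bin:
  assumes "\<sigma> (d + 2) = 0" "\<sigma> (d + 3) = 0"
  shows "runs (emit_bin d) (mk (with_out E w) \<sigma>) (mk (with_out E (w @ bin (\<sigma> d))) (\<sigma>(d := 0)))
     (\<sigma> d * (12 * \<sigma> d + 12) + 1)"
  using assms
proof (induction "\<sigma> d" arbitrary: \<sigma> w rule: less_induct)
  case less
  let ?c = "Cond (is_zero (d + 2)) (put Out 1) (dec (d + 2) ;; put Out 2)"
  show ?case
  proof (cases "\<sigma> d = 0")
    case True
    then have "bin (\<sigma> d) = []" "\<sigma>(d := 0) = \<sigma>" by (auto simp: bin.simps)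
    then show ?thesis unfolding emit_bin_def using True by (auto intro!: runs_Loop_end)
  next
    case False
    let ?x = "\<sigma> d"
    have bin: "bin ?x = (?x mod 2 + 1) # bin (?x div 2)" using False by (subst bin.simps) simp
    let ?\<sigma> = "\<sigma>(d := ?x div 2, d + 2 := ?x mod 2)" and ?\<tau> = "\<sigma>(d := ?x div 2)"
    have "runs ?c (mk (with_out E w) ?\<sigma>) (mk (with_out E (w @ [?x mod 2 + 1])) ?\<tau>) 4"
    proof (rule runs_Cond[where ?T1.0 = 3])
      assume "is_zero (d + 2) (heads (mk (with_out E w) ?\<sigma>))"
      then have "?x mod 2 = 0" by (simp split: if_splits)
      then show "runs (put Out 1) (mk (with_out E w) ?\<sigma>) (mk (with_out E (w @ [?x mod 2 + 1])) ?\<tau>) 3"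
        by (intro runs_conv[OF runs_put_out]) (use less.prems in \<open>auto intro!: mk_eqI\<close>)
    next
      assume "\<not> is_zero (d + 2) (heads (mk (with_out E w) ?\<sigma>))"
      then have x: "?x mod 2 = 1" by (simp split: if_splits)
      then have "?x mod 2 + 1 = 2" by simp
      then show "runs (dec (d + 2) ;; put Out 2) (mk (with_out E w) ?\<sigma>) (mk (with_out E (w @ [?x mod 2 + 1])) ?\<tau>) 3"
        by (intro runs_conv[OF runs_Seq_exact[OF runs_dec runs_put_out]]) (use less.prems x in \<open>auto simp: numeral_2_eq_2 intro!: mk_eqI\<close>)
    qed simp
    from runs_Seq_exact[OF runs_halve[OF less.prems] this]
    have body: "runs (halve d ;; ?c) (mk (with_out E w) \<sigma>) (mk (with_out E (w @ [?x mod 2 + 1])) ?\<tau>) (12 * ?x + 10)"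
      by (rule runs_mono) simp
    have "?\<tau> d < \<sigma> d" "?\<tau> (d + 2) = 0" "?\<tau> (d + 3) = 0" using False less.prems by auto
    note IH = less.hyps[OF this, of "w @ [?x mod 2 + 1]"]
    have "?\<tau> d * (12 * ?\<tau> d + 12) \<le> (?x - 1) * (12 * ?x + 12)"
      by (rule mult_le_mono) (use False in auto)
    moreover have "(?x - 1) * (12 * ?x + 12) + (12 * ?x + 12) = ?x * (12 * ?x + 12)"
      using False by (cases ?x) auto
    ultimately have t: "Suc (12 * ?x + 10 + (?\<tau> d * (12 * ?\<tau> d + 12) + 1)) \<le> ?x * (12 * ?x + 12) + 1"
      by linarith
    have h: "heads (mk (with_out E w) \<sigma>) (Cnt d) \<noteq> 1" using False by simp
    show ?thesis unfolding emit_bin_def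
      by (rule runs_conv[OF runs_Loop_step[where b = "\<lambda>h. h (Cnt d) \<noteq> 1",
              OF _ body IH[unfolded emit_bin_def] t]])
        (use h in \<open>auto simp: bin intro!: mk_eqI\<close>)
  qed
qed

lemma length_bin_le_self: "length (bin x) \<le> x"
proof (induction x rule: bin.induct)
  case (1 n)
  show ?case
  proof (cases "n = 0")
    case False
    then have "length (bin (n div 2)) \<le> n div 2" using 1 by simp
    moreover have "bin n = (n mod 2 + 1) # bin (n div 2)" using False by (subst bin.simps) simp
    ultimately show ?thesis using False by simp
  qed (simp add: bin.simps)
qed

lemma emits_nat:
  assumes "vars_below d e"
  shows "\<exists>k. emits (emit_nat e d) d (\<lambda>n xs \<sigma>. enc_nat (eval n xs \<sigma> e)) k"
proof -
  obtain k where k: "evaluates e d k" using code_evaluates[OF assms] by blast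
  show ?thesis
  proof (rule exI[of _ "2 * k + 7"], unfold emits_def, intro allI impI)
    fix b :: nat and \<sigma> :: "nat \<Rightarrow> nat" and E n xs w
    assume s: "\<forall>v. \<sigma> v \<le> b" "\<forall>v\<ge>d. \<sigma> v = 0" "input_ok b n xs E"
    then have b2: "2 \<le> b" by (simp add: input_ok_def)
    let ?x = "eval n xs \<sigma> e"
    note c1 = evaluatesD[OF k s(1,2) s(3)[folded input_ok_with_out[of b n xs E w]] order_refl]
    have c2: "runs (emit_bin d) (mk (with_out E w) (\<sigma>(d := ?x))) (mk (with_out E (w @ bin ?x)) \<sigma>) (?x * (12 * ?x + 12) + 1)"
      by (rule runs_conv[OF runs_emit_bin]) (use s in \<open>auto intro!: mk_eqI\<close>)
    have "?x * ?x \<le> b ^ k * b ^ k" using c1(2) by (rule mult_le_mono[OF _ c1(2)])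
    then have "?x * ?x \<le> b ^ (2 * k)" by (simp add: mult_2 power_add)
    moreover have "1 \<le> b ^ (2 * k)" "b ^ k \<le> b ^ (2 * k)" using b2 by (auto intro: power_increasing)
    ultimately have "Suc (b ^ k + Suc (?x * (12 * ?x + 12) + 1 + 1)) \<le> 100 * b ^ (2 * k)"
      using c1(2) by (simp add: algebra_simps)
    note t = hundred_times_power[OF b2 this]
    have "?x \<le> ?x * (12 * ?x + 12)" by simp
    moreover have "length (enc_nat ?x) = length (bin ?x) + 1" by (simp add: enc_nat_def)
    ultimately have "length (enc_nat ?x) \<le> b ^ (2 * k + 7)"
      using t length_bin_le_self[of ?x] by linarith
    then show "runs (emit_nat e d) (mk (with_out E w) \<sigma>) (mk (with_out E (w @ enc_nat ?x)) \<sigma>) (b ^ (2 * k + 7)) \<and>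
        length (enc_nat ?x) \<le> b ^ (2 * k + 7)"
      unfolding emit_nat_def
      using runs_Seq[OF c1(1) runs_Seq_exact[OF c2 runs_put_out] t] by (simp add: enc_nat_def)
  qed
qed

lemma emits_if:
  assumes e: "vars_below d e" and c: "emits c d f l"
  shows "\<exists>k. emits (emit_if e d c) d (\<lambda>n xs \<sigma>. if eval n xs \<sigma> e = 0 then [] else f n xs \<sigma>) k"
proof -
  obtain k where k: "evaluates e d k" using code_evaluates[OF e] by blast
  show ?thesis
  proof (rule exI[of _ "k + l + 7"], unfold emits_def, intro allI impI)
    fix b :: nat and \<sigma> :: "nat \<Rightarrow> nat" and E n xs w
    assume s: "\<forall>v. \<sigma> v \<le> b" "\<forall>v\<ge>d. \<sigma> v = 0" "input_ok b n xs E"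
    then have b2: "2 \<le> b" by (simp add: input_ok_def)
    define X where "X = b ^ (k + l)"
    have "1 \<le> X" using b2 by (simp add: X_def)
    let ?x = "eval n xs \<sigma> e" and ?w = "if eval n xs \<sigma> e = 0 then [] else f n xs \<sigma>"
    note c1 = evaluatesD[OF k s(1,2) s(3)[folded input_ok_with_out[of b n xs E w]], of "k + l", simplified, folded X_def]
    note c2 = emitsD(1)[OF c s, of "k + l" w, simplified, folded X_def]
      emitsD(2)[OF c s, of "k + l", simplified, folded X_def]
    have c3: "runs (Rep d Skip) (mk (with_out E w) (\<sigma>(d := ?x))) (mk (with_out E w) \<sigma>) (4 * X + 1)"
      by (rule runs_conv[OF runs_Rep_Skip]) (use s c1(2) in \<open>auto intro!: mk_eqI\<close>)
    have "runs (Cond (is_zero d) Skip (Rep d Skip ;; c)) (mk (with_out E w) (\<sigma>(d := ?x)))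
       (mk (with_out E (w @ ?w)) \<sigma>) (5 * X + 3)"
    proof (rule runs_Cond[where ?T1.0 = "5 * X + 2"])
      assume "is_zero d (heads (mk (with_out E w) (\<sigma>(d := ?x))))"
      then have "?x = 0" by (simp split: if_splits)
      then show "runs Skip (mk (with_out E w) (\<sigma>(d := ?x))) (mk (with_out E (w @ ?w)) \<sigma>) (5 * X + 2)"
        by (intro runs_conv[OF runs_Skip_exact]) (use s in \<open>auto intro!: mk_eqI\<close>)
    next
      assume "\<not> is_zero d (heads (mk (with_out E w) (\<sigma>(d := ?x))))"
      then have "?x \<noteq> 0" by (simp split: if_splits)
      then show "runs (Rep d Skip ;; c) (mk (with_out E w) (\<sigma>(d := ?x))) (mk (with_out E (w @ ?w)) \<sigma>) (5 * X + 2)"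
        using runs_Seq_exact[OF c3 c2(1)] by simp
    qed simp
    from runs_Seq_exact[OF c1(1) this]
    have "runs (emit_if e d c) (mk (with_out E w) \<sigma>) (mk (with_out E (w @ ?w)) \<sigma>) (100 * X)"
      unfolding emit_if_def by (rule runs_mono) (use \<open>1 \<le> X\<close> in linarith)
    moreover have X: "100 * X \<le> b ^ (k + l + 7)" by (rule hundred_times_power[OF b2]) (simp add: X_def)
    moreover have "length ?w \<le> X" using c2(2) by simp
    then have "length ?w \<le> b ^ (k + l + 7)" using X by linarith
    ultimately show "runs (emit_if e d c) (mk (with_out E w) \<sigma>) (mk (with_out E (w @ ?w)) \<sigma>) (b ^ (k + l + 7)) \<and>
        length ?w \<le> b ^ (k + l + 7)"
      using runs_mono by blast
  qed
qed

text \<open>While the body runs, the counter \<open>d + 1\<close> holds the number of remaining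
  iterations. Scratch space therefore starts at \<open>d + 2\<close>, and \<open>cong\<close> says
  that the emitted word depends neither on \<open>d + 1\<close> nor on the scratch counters.\<close>

lemma emits_for:
  assumes e: "vars_below d e" and c: "emits c (d + 2) f l"
    and cong: "\<And>n xs \<sigma> \<tau>. (\<And>v. v < d + 1 \<Longrightarrow> \<sigma> v = \<tau> v) \<Longrightarrow> f n xs \<sigma> = f n xs \<tau>"
  shows "\<exists>k. emits (emit_for e d c) d
     (\<lambda>n xs \<sigma>. concat (map (\<lambda>i. f n xs (\<sigma>(d := i))) [0..<eval n xs \<sigma> e])) k"
proof -
  obtain k where k: "evaluates e (d + 1) k" using code_evaluates[OF vars_below_mono[OF e, of "d + 1"]] by auto
  define K where "K = Suc k * Suc l + Suc k"
  show ?thesis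
  proof (rule exI[of _ "K + 7"], unfold emits_def, intro allI impI)
    fix b :: nat and \<sigma> :: "nat \<Rightarrow> nat" and E n xs w
    assume s: "\<forall>v. \<sigma> v \<le> b" "\<forall>v\<ge>d. \<sigma> v = 0" "input_ok b n xs E"
    then have b2: "2 \<le> b" by (simp add: input_ok_def)
    let ?x = "eval n xs \<sigma> e"
    let ?out = "\<lambda>i. concat (map (\<lambda>i. f n xs (\<sigma>(d := i))) [0..<i])"
    define B where "B = b ^ Suc k"
    have bB: "b \<le> B" "b ^ k \<le> B" using b2 by (auto simp: B_def)
    have s1: "\<forall>v\<ge>d + 1. \<sigma> v = 0" using s(2) by simp
    note c1 = evaluatesD[OF k s(1) s1 s(3)[folded input_ok_with_out[of b n xs E w]] order_refl]
    have xB: "?x \<le> B" using c1(2) bB(2) by (rule order_trans)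
    have body: "runs (c ;; inc d) (mk (with_out E (w @ ?out i)) (\<sigma>(d := i, d + 1 := ?x - Suc i)))
        (mk (with_out E (w @ ?out (Suc i))) (\<sigma>(d := Suc i, d + 1 := ?x - Suc i))) (B ^ Suc l + 2)"
      if i: "i < ?x" for i
    proof -
      let ?\<tau> = "\<sigma>(d := i, d + 1 := ?x - Suc i)"
      have "\<forall>v. ?\<tau> v \<le> B" using s(1) bB xB i by (auto intro: order_trans)
      moreover have "\<forall>v\<ge>d + 2. ?\<tau> v = 0" using s(2) by auto
      moreover have "input_ok B n xs E" using input_ok_mono[OF s(3) bB(1)] .
      ultimately have "runs c (mk (with_out E (w @ ?out i)) ?\<tau>)
          (mk (with_out E ((w @ ?out i) @ f n xs ?\<tau>)) ?\<tau>) (B ^ Suc l)"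
        by (rule emitsD(1)[OF c]) simp
      moreover have "f n xs ?\<tau> = f n xs (\<sigma>(d := i))" by (rule cong) auto
      ultimately have "runs c (mk (with_out E (w @ ?out i)) ?\<tau>)
          (mk (with_out E (w @ ?out (Suc i))) ?\<tau>) (B ^ Suc l)" by simp
      from runs_Seq_exact[OF this runs_inc] show ?thesis
        by (rule runs_conv) (auto intro!: mk_eqI)
    qed
    have c2: "runs (Rep (d + 1) (c ;; inc d)) (mk (with_out E w) (\<sigma>(d + 1 := ?x)))
       (mk (with_out E (w @ ?out ?x)) (\<sigma>(d := ?x))) (?x * (B ^ Suc l + 5) + 1)"
    proof (rule runs_Rep[where n = ?x and Es = "\<lambda>i. with_out E (w @ ?out i)" and \<sigma>s = "\<lambda>i. \<sigma>(d := i)"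
          and ?T1.0 = "B ^ Suc l + 2"])
      show "mk (with_out E w) (\<sigma>(d + 1 := ?x)) = mk (with_out E (w @ ?out 0)) (\<sigma>(d := 0, d + 1 := ?x))"
        using s by (auto intro!: mk_eqI)
      show "mk (with_out E (w @ ?out ?x)) (\<sigma>(d := ?x)) = mk (with_out E (w @ ?out ?x)) (\<sigma>(d := ?x, d + 1 := 0))"
        using s by (auto intro!: mk_eqI)
    qed (use body in auto)
    have c3: "runs (Rep d Skip) (mk (with_out E (w @ ?out ?x)) (\<sigma>(d := ?x))) (mk (with_out E (w @ ?out ?x)) \<sigma>) (4 * B + 1)"
      by (rule runs_conv[OF runs_Rep_Skip]) (use s xB in \<open>auto intro!: mk_eqI\<close>)
    define Y where "Y = B ^ Suc l * B"
    have BY: "B \<le> Y" "1 \<le> Y" "b ^ k \<le> Y" using b2 bB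
      by (auto simp: Y_def B_def intro: order_trans[of _ B])
    have "?x * (B ^ Suc l + 5) \<le> B * (B ^ Suc l + 5)" using xB by (rule mult_le_mono1)
    also have "\<dots> = Y + 5 * B" by (simp add: Y_def algebra_simps)
    finally have "Suc (b ^ k + Suc (?x * (B ^ Suc l + 5) + 1 + (4 * B + 1))) \<le> 100 * Y" using BY by linarith
    moreover have "Y = b ^ K" unfolding Y_def B_def K_def power_add power_mult[symmetric] by simp
    ultimately have "Suc (b ^ k + Suc (?x * (B ^ Suc l + 5) + 1 + (4 * B + 1))) \<le> 100 * b ^ K" by simp
    note t = hundred_times_power[OF b2 this]
    have "length (f n xs (\<sigma>(d := i))) \<le> B ^ Suc l" if "i < ?x" for i
    proof (rule emitsD(2)[OF c])
      show "\<forall>v. (\<sigma>(d := i)) v \<le> B" using s(1) bB xB that by (auto intro: order_trans)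
      show "\<forall>v\<ge>d + 2. (\<sigma>(d := i)) v = 0" using s(2) by auto
      show "input_ok B n xs E" using input_ok_mono[OF s(3) bB(1)] .
    qed simp
    note item = this
    have "length (?out i) \<le> i * B ^ Suc l" if "i \<le> ?x" for i
      using that
    proof (induction i)
      case (Suc i)
      then have "i \<le> ?x" "i < ?x" by simp_all
      note IH = Suc.IH[OF this(1)] item[OF this(2)]
      have out: "?out (Suc i) = ?out i @ f n xs (\<sigma>(d := i))" by simp
      show ?case using IH unfolding out length_append mult_Suc by linarith
    qed simp
    from this[of ?x] have "length (?out ?x) \<le> ?x * (B ^ Suc l + 5)" by (simp add: algebra_simps)
    then have "length (?out ?x) \<le> b ^ (K + 7)" using t by linarith
    then show "runs (emit_for e d c) (mk (with_out E w) \<sigma>) (mk (with_out E (w @ ?out ?x)) \<sigma>) (b ^ (K + 7)) \<and>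
        length (?out ?x) \<le> b ^ (K + 7)"
      unfolding emit_for_def using runs_Seq[OF c1(1) runs_Seq_exact[OF c2 c3] t] by blast
  qed
qed


section \<open>The machine for 3-SAT\<close>

text \<open>Finer than \<open>vars_below\<close>: the counters 6 and 8 of the two output loops lie
  below the scratch counters, but must not occur in the emitted expressions.\<close>

fun ex_vars :: "ex \<Rightarrow> nat set" where
  "ex_vars (Const k) = {}"
| "ex_vars (Var v) = {v}"
| "ex_vars VarCount = {}"
| "ex_vars NumCount = {}"
| "ex_vars (Num e) = ex_vars e"
| "ex_vars (Plus a b) = ex_vars a \<union> ex_vars b"
| "ex_vars (Minus a b) = ex_vars a \<union> ex_vars b"
| "ex_vars (Times a b) = ex_vars a \<union> ex_vars b"
| "ex_vars (Divide a b) = ex_vars a \<union> ex_vars b"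
| "ex_vars (Shift a b) = ex_vars a \<union> ex_vars b"
| "ex_vars (Less a b) = ex_vars a \<union> ex_vars b"

lemma eval_cong_vars: "(\<And>v. v \<in> ex_vars e \<Longrightarrow> \<sigma> v = \<tau> v) \<Longrightarrow> eval n xs \<sigma> e = eval n xs \<tau> e"
proof (induction e)
  case (Num e)
  then show ?case by (metis eval.simps(5) ex_vars.simps(5))
qed auto

lemma vars_below_iff: "vars_below d e \<longleftrightarrow> ex_vars e \<subseteq> {..<d}"
  by (induction e) auto

text \<open>A blank tape is not \<open>ctr 0\<close>; every counter first gets its mark, all in one
  step.\<close>

definition init_counters :: prog where
  "init_counters = Act (\<lambda>r x. case x of Cnt v \<Rightarrow> (1, 0) | _ \<Rightarrow> (r x, 0))"

lemma runs_init_counters: "runs init_counters (initial_mem w) (mk (initial_mem w) (\<lambda>_. 0)) 1"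
  unfolding init_counters_def
  by (rule runs_Act)
    (auto simp: fun_eq_iff act_mem_def heads_def mk_def initial_mem_def ctr_def split: tapeid.splits)

lemma legal_init_counters: "legal init_counters"
  unfolding init_counters_def
  by (rule legal_ActI[of 2]) (auto simp: action_wf_def split: tapeid.splits)

definition prepare :: "tm \<Rightarrow> prog" where
  "prepare F =
     init_counters ;; code VarCount 0 ;; code NumCount 1 ;; inc 2 ;; width_search F ;;
     code (Plus (Divide (Var 0) (Var 2)) (Const 1)) 3 ;; inc 4 ;; code (Var 3) 5 ;;
     Rep 5 (Rep 4 (inc 6 ;; inc 6) ;; Rep 6 (inc 4))"

definition params :: "tm \<Rightarrow> nat \<Rightarrow> nat list \<Rightarrow> nat \<Rightarrow> nat" where
  "params F n xs = (\<lambda>_. 0)(0 := n, 1 := length xs, 2 := width_of F n,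
     3 := n div width_of F n + 1, 4 := 2 ^ (n div width_of F n + 1))"

lemma legal_prepare: "turing_machine F \<Longrightarrow> legal (prepare F)"
  unfolding prepare_def
  by (intro legal_intros legal_Rep legal_inc legal_code legal_init_counters legal_width_search)

text \<open>Collects everything in which the running time of the reduction is polynomial. The last
  bound concerns \<open>q\<close>, the number of values of a group.\<close>

definition size_ok :: "tm \<Rightarrow> nat \<Rightarrow> nat list \<Rightarrow> nat \<Rightarrow> bool" where
  "size_ok F n xs b \<longleftrightarrow> n + 2 \<le> b \<and> length (input_word n xs) \<le> b \<and> (\<forall>x\<in>set xs. 2 * x + 1 \<le> b) \<and>
     2 ^ (n div width_of F n + 1) \<le> b"

lemma input_ok_initial:
  "size_ok F n xs b \<Longrightarrow> input_ok b n xs (initial_mem (input_word n xs))"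
  by (simp add: size_ok_def input_ok_def initial_mem_def zipper_input)

lemma length_xs_le: "size_ok F n xs b \<Longrightarrow> length xs \<le> b"
proof -
  have "length xs \<le> length (numbers_word xs)"
    by (induction xs) (auto simp: numbers_word_def enc_nat_def)
  then show "size_ok F n xs b \<Longrightarrow> length xs \<le> b" by (simp add: size_ok_def input_word_def)
qed

lemma width_of_le: "width_of F n \<le> Suc n"
  unfolding width_of_def by (rule next_width_iterate_le)

lemma params_le: "size_ok F n xs b \<Longrightarrow> params F n xs v \<le> b"
  using length_xs_le[of F n xs b] width_of_le[of F n]
  by (auto simp: params_def size_ok_def intro: order_trans[of _ "n + 1"] order_trans[of _ n])

lemma runs_prepare:
  assumes F: "turing_machine F"
  shows "\<exists>k. \<forall>n xs b. size_ok F n xs b \<longrightarrow>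
     runs (prepare F) (initial_mem (input_word n xs)) (mk (initial_mem (input_word n xs)) (params F n xs)) (b ^ k)"
proof -
  let ?es = "Plus (Divide (Var 0) (Var 2)) (Const 1)"
  obtain k1 k2 k4 k5 where ks: "evaluates VarCount 0 k1" "evaluates NumCount 1 k2"
    "evaluates ?es 3 k4" "evaluates (Var 3) 5 k5"
    using code_evaluates[of 0 VarCount] code_evaluates[of 1 NumCount] code_evaluates[of 3 ?es]
      code_evaluates[of 5 "Var 3"] by auto
  obtain k3 where k3: "\<And>b \<sigma> E n xs. (\<forall>v. \<sigma> v \<le> b) \<Longrightarrow> (\<forall>v\<ge>3. \<sigma> v = 0) \<Longrightarrow> input_ok b n xs E \<Longrightarrow> \<sigma> 0 = n \<Longrightarrow>
     \<sigma> 2 = 1 \<Longrightarrow> n + 2 \<le> b \<Longrightarrow> E Cell = (\<lambda>_. 0) \<Longrightarrow> (\<forall>j. E (Sim False j) = (\<lambda>_. 0)) \<Longrightarrow>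
     runs (width_search F) (mk E \<sigma>) (mk E (\<sigma>(2 := width_of F n))) (b ^ k3)"
    using runs_width_search[OF F] by blast
  define K where "K = k1 + k2 + k3 + k4 + k5 + 2"
  show ?thesis
  proof (intro exI[of _ "K + 7"] allI impI)
    fix n xs b assume sz: "size_ok F n xs b"
    let ?E = "initial_mem (input_word n xs)"
    have ok: "input_ok b n xs ?E" using input_ok_initial[OF sz] .
    then have b2: "2 \<le> b" by (simp add: input_ok_def)
    have nb: "n + 2 \<le> b" using sz by (simp add: size_ok_def)
    define p where "p = width_of F n"
    define s where "s = n div p + 1"
    have sb: "s \<le> b" using nb by (auto simp: s_def intro: order_trans[of _ "n + 1"])
    have pb: "p \<le> b" using width_of_le[of F n] nb by (simp add: p_def)
    have qb: "2 ^ s \<le> b" using sz by (simp add: size_ok_def s_def p_def)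
    have lb: "length xs \<le> b" by (rule length_xs_le[OF sz])
    let ?\<sigma>1 = "(\<lambda>_. 0)(0 := n)" and ?\<sigma>2 = "(\<lambda>_. 0)(0 := n, 1 := length xs)"
    let ?\<sigma>3 = "?\<sigma>2(2 := 1)" and ?\<sigma>4 = "?\<sigma>2(2 := p)"
    let ?\<sigma>5 = "?\<sigma>4(3 := s)"
    let ?\<sigma>6 = "?\<sigma>5(4 := 1)"
    have c1: "runs (code VarCount 0) (mk ?E (\<lambda>_. 0)) (mk ?E ?\<sigma>1) (b ^ K)"
      using evaluatesD(1)[OF ks(1) _ _ ok, of "\<lambda>_. 0" K] by (simp add: K_def)
    have c2: "runs (code NumCount 1) (mk ?E ?\<sigma>1) (mk ?E ?\<sigma>2) (b ^ K)"
      using evaluatesD(1)[OF ks(2) _ _ ok, of ?\<sigma>1 K] nb by (simp add: K_def)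
    have c3: "runs (inc 2) (mk ?E ?\<sigma>2) (mk ?E ?\<sigma>3) 1"
      by (rule runs_conv[OF runs_inc]) auto
    have c4: "runs (width_search F) (mk ?E ?\<sigma>3) (mk ?E ?\<sigma>4) (b ^ K)"
    proof (rule runs_conv[OF k3])
      show "b ^ k3 \<le> b ^ K" by (rule power_increasing) (use b2 in \<open>auto simp: K_def\<close>)
      show "input_ok b n xs ?E" by (rule ok)
    qed (use nb lb in \<open>auto simp: initial_mem_def p_def\<close>)
    have c5: "runs (code ?es 3) (mk ?E ?\<sigma>4) (mk ?E ?\<sigma>5) (b ^ K)"
      using evaluatesD(1)[OF ks(3) _ _ ok, of ?\<sigma>4 K] nb lb pb by (simp add: K_def s_def)
    have c6: "runs (inc 4) (mk ?E ?\<sigma>5) (mk ?E ?\<sigma>6) 1"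
      by (rule runs_conv[OF runs_inc]) auto
    have c7: "runs (code (Var 3) 5) (mk ?E ?\<sigma>6) (mk ?E (?\<sigma>6(5 := s))) (b ^ K)"
      using evaluatesD(1)[OF ks(4) _ _ ok, of ?\<sigma>6 K] nb lb pb sb b2 by (simp add: K_def)
    have c8: "runs (Rep 5 (Rep 4 (inc 6 ;; inc 6) ;; Rep 6 (inc 4))) (mk ?E (?\<sigma>6(5 := s)))
       (mk ?E (?\<sigma>5(4 := 2 ^ s))) (s * (14 * b + 6) + 1)"
    proof (rule runs_Rep[where n = s and Es = "\<lambda>_. ?E" and \<sigma>s = "\<lambda>i. ?\<sigma>5(4 := 2 ^ i)" and ?T1.0 = "14 * b + 3"])
      fix i assume "i < s"
      then have "(2::nat) ^ i \<le> 2 ^ s" by (intro power_increasing) auto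
      then have "2 ^ i \<le> b" using qb by (rule order_trans)
      then show "runs (Rep 4 (inc 6 ;; inc 6) ;; Rep 6 (inc 4)) (mk ?E (?\<sigma>5(4 := 2 ^ i, 5 := s - Suc i)))
          (mk ?E (?\<sigma>5(4 := 2 ^ Suc i, 5 := s - Suc i))) (14 * b + 3)"
        by (intro runs_conv[OF runs_Seq_exact[OF runs_Rep_double runs_Rep_inc]]) (auto intro!: mk_eqI)
    qed (auto intro!: mk_eqI)
    have "s * (14 * b + 6) \<le> b * (14 * b + 6)" using sb by (rule mult_le_mono1)
    also have "\<dots> = 14 * b ^ 2 + 6 * b" by (simp add: power2_eq_square algebra_simps)
    finally have t8: "s * (14 * b + 6) \<le> 14 * b ^ 2 + 6 * b" .
    have "b ^ 2 \<le> b ^ K" "b ^ 1 \<le> b ^ K" "b ^ 0 \<le> b ^ K"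
      by (rule power_increasing; use b2 in \<open>simp add: K_def\<close>)+
    then have "Suc (1 + Suc (b ^ K + Suc (b ^ K + Suc (1 + Suc (b ^ K + Suc (b ^ K + Suc (1 + Suc (b ^ K +
        (s * (14 * b + 6) + 1))))))))) \<le> 100 * b ^ K"
      using t8 unfolding power_one_right power_0 by linarith
    note t = hundred_times_power[OF b2 this]
    have "?\<sigma>5(4 := 2 ^ s) = params F n xs" by (simp add: params_def s_def p_def)
    with runs_mono[OF runs_Seq_exact[OF runs_init_counters runs_Seq_exact[OF c1 runs_Seq_exact[OF c2
          runs_Seq_exact[OF c3 runs_Seq_exact[OF c4 runs_Seq_exact[OF c5 runs_Seq_exact[OF c6
          runs_Seq_exact[OF c7 c8]]]]]]]] t]
    show "runs (prepare F) (initial_mem (input_word n xs)) (mk ?E (params F n xs)) (b ^ (K + 7))"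
      unfolding prepare_def by simp
  qed
qed

text \<open>The counters 5 and 7 run over the two ends of a possible arc; a loop occupies two
  counters. Budget and costs are integers, so every encoded rational is completed by the denominator
  1.\<close>

definition output_prog :: "ex \<Rightarrow> ex \<Rightarrow> ex \<Rightarrow> ex \<Rightarrow> ex \<Rightarrow> prog" where
  "output_prog eP eV eB eA eH =
     emit_unary eP 5 ;; emit_unary eV 5 ;; emit_nat eB 5 ;; emit_nat (Const 1) 5 ;;
     emit_for eV 5 (emit_for eV 7 (emit_if eA 9
       (emit_nat (Var 5) 9 ;; emit_nat (Var 7) 9 ;; emit_nat eH 9 ;; emit_nat (Const 1) 9)))"

definition output_word :: "ex \<Rightarrow> ex \<Rightarrow> ex \<Rightarrow> ex \<Rightarrow> ex \<Rightarrow> nat \<Rightarrow> nat list \<Rightarrow> (nat \<Rightarrow> nat) \<Rightarrow> nat list" where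
  "output_word eP eV eB eA eH n xs \<sigma> =
     enc_unary (eval n xs \<sigma> eP) @ enc_unary (eval n xs \<sigma> eV) @ enc_nat (eval n xs \<sigma> eB) @ enc_nat 1 @
     concat (map (\<lambda>u. concat (map (\<lambda>v.
        if eval n xs (\<sigma>(5 := u, 7 := v)) eA = 0 then []
        else enc_nat u @ enc_nat v @ enc_nat (eval n xs (\<sigma>(5 := u, 7 := v)) eH) @ enc_nat 1)
       [0..<eval n xs \<sigma> eV])) [0..<eval n xs \<sigma> eV])"

lemma legal_output: "legal (output_prog eP eV eB eA eH)"
  unfolding output_prog_def by (intro legal_Seq legal_emit)

lemma emits_output:
  assumes v: "ex_vars eP \<subseteq> {..<5}" "ex_vars eV \<subseteq> {..<5}" "ex_vars eB \<subseteq> {..<5}"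
    and a: "ex_vars eA \<subseteq> {0, 1, 2, 3, 4, 5, 7}" "ex_vars eH \<subseteq> {0, 1, 2, 3, 4, 5, 7}"
  shows "\<exists>k. emits (output_prog eP eV eB eA eH) 5 (output_word eP eV eB eA eH) k"
proof -
  have vb: "vars_below 5 eP" "vars_below 5 eV" "vars_below 7 eV" "vars_below 5 eB" "vars_below 5 (Const 1)"
    "vars_below 9 eA" "vars_below 9 eH" "vars_below 9 (Var 5)" "vars_below 9 (Var 7)" "vars_below 9 (Const 1)"
    using v a by (auto simp: vars_below_iff)
  let ?g = "\<lambda>n xs \<sigma>. enc_nat (eval n xs \<sigma> (Var 5)) @ enc_nat (eval n xs \<sigma> (Var 7)) @
     enc_nat (eval n xs \<sigma> eH) @ enc_nat (eval n xs \<sigma> (Const 1))"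
  let ?h = "\<lambda>n xs \<sigma>. if eval n xs \<sigma> eA = 0 then [] else ?g n xs \<sigma>"
  let ?in = "\<lambda>n xs \<sigma>. concat (map (\<lambda>i. ?h n xs (\<sigma>(7 := i))) [0..<eval n xs \<sigma> eV])"
  let ?out = "\<lambda>n xs \<sigma>. concat (map (\<lambda>i. ?in n xs (\<sigma>(5 := i))) [0..<eval n xs \<sigma> eV])"
  let ?arc = "emit_nat (Var 5) 9 ;; emit_nat (Var 7) 9 ;; emit_nat eH 9 ;; emit_nat (Const 1) 9"
  have "\<exists>k. emits ?arc 9 ?g k"
  proof -
    obtain k1 k2 k3 k4 where k: "emits (emit_nat (Var 5) 9) 9 (\<lambda>n xs \<sigma>. enc_nat (eval n xs \<sigma> (Var 5))) k1"
      "emits (emit_nat (Var 7) 9) 9 (\<lambda>n xs \<sigma>. enc_nat (eval n xs \<sigma> (Var 7))) k2"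
      "emits (emit_nat eH 9) 9 (\<lambda>n xs \<sigma>. enc_nat (eval n xs \<sigma> eH)) k3"
      "emits (emit_nat (Const 1) 9) 9 (\<lambda>n xs \<sigma>. enc_nat (eval n xs \<sigma> (Const 1))) k4"
      using emits_nat[OF vb(7)] emits_nat[OF vb(8)] emits_nat[OF vb(9)] emits_nat[OF vb(10)] by blast
    from emits_Seq[OF k(3,4)] obtain l1 where l1: "emits (emit_nat eH 9 ;; emit_nat (Const 1) 9) 9
      (\<lambda>n xs \<sigma>. enc_nat (eval n xs \<sigma> eH) @ enc_nat (eval n xs \<sigma> (Const 1))) l1" by blast
    from emits_Seq[OF k(2) l1] obtain l2 where l2: "emits (emit_nat (Var 7) 9 ;; emit_nat eH 9 ;; emit_nat (Const 1) 9) 9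
      (\<lambda>n xs \<sigma>. enc_nat (eval n xs \<sigma> (Var 7)) @ enc_nat (eval n xs \<sigma> eH) @ enc_nat (eval n xs \<sigma> (Const 1))) l2" by blast
    show ?thesis by (rule emits_Seq[OF k(1) l2])
  qed
  then have i: "\<exists>k. emits (emit_if eA 9 ?arc) 9 ?h k" using emits_if[OF vb(6)] by blast
  have cong: "eval n xs \<sigma> e = eval n xs \<tau> e" if "ex_vars e \<subseteq> A" "\<And>v. v \<in> A \<Longrightarrow> \<sigma> v = \<tau> v" for n xs \<sigma> \<tau> e A
    by (rule eval_cong_vars) (use that in blast)
  have nums: "(7::nat) + 2 = 9" "(5::nat) + 2 = 7" by simp_all
  have hcong: "?h n xs \<sigma> = ?h n xs \<tau>" if "\<And>v. v < 7 + 1 \<Longrightarrow> \<sigma> v = \<tau> v" for n xs \<sigma> \<tau>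
  proof -
    have "eval n xs \<sigma> eA = eval n xs \<tau> eA" "eval n xs \<sigma> eH = eval n xs \<tau> eH"
      by (rule cong[OF a(1)] cong[OF a(2)]; use that in auto)+
    then show ?thesis using that by simp
  qed
  have f1: "\<exists>k. emits (emit_for eV 7 (emit_if eA 9 ?arc)) 7 ?in k"
  proof -
    obtain k where "emits (emit_if eA 9 ?arc) (7 + 2) ?h k" using i unfolding nums by blast
    from emits_for[where f = ?h, OF vb(3) this hcong] show ?thesis .
  qed
  have icong: "?in n xs \<sigma> = ?in n xs \<tau>" if "\<And>v. v < 5 + 1 \<Longrightarrow> \<sigma> v = \<tau> v" for n xs \<sigma> \<tau>
  proof -
    have "eval n xs (\<sigma>(7 := i)) eA = eval n xs (\<tau>(7 := i)) eA" "eval n xs (\<sigma>(7 := i)) eH = eval n xs (\<tau>(7 := i)) eH" for i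
      by (rule cong[OF a(1)] cong[OF a(2)]; use that in auto)+
    then have h: "?h n xs (\<sigma>(7 := i)) = ?h n xs (\<tau>(7 := i))" for i
      using that by (cases "eval n xs (\<tau>(7 := i)) eA = 0") simp_all
    have "eval n xs \<sigma> eV = eval n xs \<tau> eV" by (rule cong[OF v(2)]) (use that in auto)
    then show ?thesis by (simp only: h)
  qed
  have f2: "\<exists>k. emits (emit_for eV 5 (emit_for eV 7 (emit_if eA 9 ?arc))) 5 ?out k"
  proof -
    obtain k where "emits (emit_for eV 7 (emit_if eA 9 ?arc)) (5 + 2) ?in k" using f1 unfolding nums by blast
    from emits_for[where f = ?in, OF vb(2) this icong] show ?thesis .
  qed
  let ?all = "\<lambda>n xs \<sigma>. enc_unary (eval n xs \<sigma> eP) @ enc_unary (eval n xs \<sigma> eV) @ enc_nat (eval n xs \<sigma> eB) @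
     enc_nat (eval n xs \<sigma> (Const 1)) @ ?out n xs \<sigma>"
  obtain k where "emits (output_prog eP eV eB eA eH) 5 ?all k"
  proof -
    obtain k1 k2 k3 k4 k5 where k: "emits (emit_unary eP 5) 5 (\<lambda>n xs \<sigma>. enc_unary (eval n xs \<sigma> eP)) k1"
      "emits (emit_unary eV 5) 5 (\<lambda>n xs \<sigma>. enc_unary (eval n xs \<sigma> eV)) k2"
      "emits (emit_nat eB 5) 5 (\<lambda>n xs \<sigma>. enc_nat (eval n xs \<sigma> eB)) k3"
      "emits (emit_nat (Const 1) 5) 5 (\<lambda>n xs \<sigma>. enc_nat (eval n xs \<sigma> (Const 1))) k4"
      "emits (emit_for eV 5 (emit_for eV 7 (emit_if eA 9 ?arc))) 5 ?out k5"
      using emits_unary[OF vb(1)] emits_unary[OF vb(2)] emits_nat[OF vb(4)] emits_nat[OF vb(5)] f2 by blast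
    obtain l1 where l1: "emits (emit_nat (Const 1) 5 ;; emit_for eV 5 (emit_for eV 7 (emit_if eA 9 ?arc))) 5
      (\<lambda>n xs \<sigma>. enc_nat (eval n xs \<sigma> (Const 1)) @ ?out n xs \<sigma>) l1"
      using emits_Seq[OF k(4,5)] by blast
    obtain l2 where l2: "emits (emit_nat eB 5 ;; emit_nat (Const 1) 5 ;; emit_for eV 5 (emit_for eV 7 (emit_if eA 9 ?arc))) 5
      (\<lambda>n xs \<sigma>. enc_nat (eval n xs \<sigma> eB) @ enc_nat (eval n xs \<sigma> (Const 1)) @ ?out n xs \<sigma>) l2"
      using emits_Seq[OF k(3) l1] by blast
    obtain l3 where l3: "emits (emit_unary eV 5 ;; emit_nat eB 5 ;; emit_nat (Const 1) 5 ;;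
        emit_for eV 5 (emit_for eV 7 (emit_if eA 9 ?arc))) 5
      (\<lambda>n xs \<sigma>. enc_unary (eval n xs \<sigma> eV) @ enc_nat (eval n xs \<sigma> eB) @ enc_nat (eval n xs \<sigma> (Const 1)) @ ?out n xs \<sigma>) l3"
      using emits_Seq[OF k(2) l2] by blast
    show ?thesis using emits_Seq[OF k(1) l3] that unfolding output_prog_def by blast
  qed
  moreover have "?all n xs \<sigma> = output_word eP eV eB eA eH n xs \<sigma>" for n xs \<sigma>
  proof -
    have "eval n xs (\<sigma>(5 := i)) eV = eval n xs \<sigma> eV" for i by (rule cong[OF v(2)]) auto
    then show ?thesis by (simp add: output_word_def cong: if_cong)
  qed
  ultimately show ?thesis by auto
qed

definition main_prog :: "tm \<Rightarrow> tm \<Rightarrow> ex \<Rightarrow> ex \<Rightarrow> ex \<Rightarrow> ex \<Rightarrow> ex \<Rightarrow> prog" where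
  "main_prog M F eP eV eB eA eH =
     prepare F ;; output_prog eP eV eB eA eH ;; rewind Out ;;
     Loop (\<lambda>h. h Cell \<notin> {1, 2}) (Act (sim_act M True))"

lemma set_output_word: "set (output_word eP eV eB eA eH n xs \<sigma>) \<subseteq> {1, 2, 3}"
proof -
  have "set (enc_nat x) \<subseteq> {1, 2, 3}" "set (enc_unary x) \<subseteq> {1, 2, 3}" for x
    using set_bin[of x] by (auto simp: enc_nat_def enc_unary_def)
  then show ?thesis
    unfolding output_word_def set_append set_concat set_map by (auto simp: UN_subset_iff)
qed

text \<open>The factor 2 is the price of the simulation loop: one step for its test and one for the
  action. All that precedes the simulation is polynomial in \<open>b\<close>.\<close>

theorem reduction_machine:
  assumes M: "turing_machine M" and F: "turing_machine F"
    and v: "ex_vars eP \<subseteq> {..<5}" "ex_vars eV \<subseteq> {..<5}" "ex_vars eB \<subseteq> {..<5}"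
    and a: "ex_vars eA \<subseteq> {0, 1, 2, 3, 4, 5, 7}" "ex_vars eH \<subseteq> {0, 1, 2, 3, 4, 5, 7}"
  obtains N k where "turing_machine N"
    and "\<And>n xs b. size_ok F n xs b \<Longrightarrow> length (output_word eP eV eB eA eH n xs (params F n xs)) \<le> b ^ k"
    and "\<And>n xs b ans T. size_ok F n xs b \<Longrightarrow>
      decides_within M (output_word eP eV eB eA eH n xs (params F n xs)) ans T \<Longrightarrow>
      decides_within N (input_word n xs) ans (real (b ^ k) + 2 * T)"
proof -
  let ?W = "\<lambda>n xs. output_word eP eV eB eA eH n xs (params F n xs)"
  have "legal (main_prog M F eP eV eB eA eH)"
    unfolding main_prog_def
    by (intro legal_intros legal_prepare[OF F] legal_output legal_rewind legal_sim[OF M]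
        legal_test_read[of "\<lambda>s. s \<notin> {1, 2}"])
  then obtain N where N: "turing_machine N"
    "\<And>w m' T. set w \<subseteq> {1, 2, 3} \<Longrightarrow> runs (main_prog M F eP eV eB eA eH) (initial_mem w) m' T \<Longrightarrow> m' Cell 0 \<in> {1, 2} \<Longrightarrow>
           decides_within N w (m' Cell 0 = 1) (real T + 1)"
    by (rule legal_compile) blast
  obtain k1 where k1: "\<And>n xs b. size_ok F n xs b \<Longrightarrow>
     runs (prepare F) (initial_mem (input_word n xs)) (mk (initial_mem (input_word n xs)) (params F n xs)) (b ^ k1)"
    using runs_prepare[OF F] by blast
  obtain k2 where k2: "emits (output_prog eP eV eB eA eH) 5 (output_word eP eV eB eA eH) k2"
    using emits_output[OF v a] by blast
  define K where "K = k1 + k2"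
  have p0: "\<forall>u\<ge>5. params F n xs u = 0" for n xs by (auto simp: params_def)
  have len: "length (?W n xs) \<le> b ^ K" if "size_ok F n xs b" for n xs b
    by (rule emitsD(2)[OF k2 _ p0 input_ok_initial[OF that]]) (use params_le[OF that] in \<open>auto simp: K_def\<close>)
  have KK: "b ^ K \<le> b ^ (K + 7)" if "2 \<le> b" for b :: nat
    using that by (intro power_increasing) auto
  show ?thesis
  proof (rule that[of N "K + 7"])
    show "turing_machine N" by (rule N)
    show "length (?W n xs) \<le> b ^ (K + 7)" if "size_ok F n xs b" for n xs b
      by (rule order_trans[OF len[OF that] KK]) (use that in \<open>simp add: size_ok_def\<close>)
    fix n xs b ans T
    assume sz: "size_ok F n xs b" and dec: "decides_within M (?W n xs) ans T"
    let ?E = "initial_mem (input_word n xs)" and ?\<sigma> = "params F n xs"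
    have ok: "input_ok b n xs ?E" using input_ok_initial[OF sz] .
    then have b2: "2 \<le> b" by (simp add: input_ok_def)
    have c1: "runs (prepare F) ?E (mk ?E ?\<sigma>) (b ^ K)"
      by (rule runs_mono[OF k1[OF sz]], rule power_increasing) (use b2 in \<open>auto simp: K_def\<close>)
    have "with_out ?E [] = ?E" by (auto simp: with_out_def fun_eq_iff zipper_def initial_mem_def)
    then have c2: "runs (output_prog eP eV eB eA eH) (mk ?E ?\<sigma>) (mk (with_out ?E (?W n xs)) ?\<sigma>) (b ^ K)"
      using emitsD(1)[OF k2 _ p0[of n xs] ok, of K "[]"] params_le[OF sz] by (simp add: K_def)
    define E1 where "E1 = ?E(Out := zipper [] (?W n xs))"
    have "0 \<notin> set (?W n xs)" using set_output_word[of eP eV eB eA eH n xs ?\<sigma>] by auto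
    then have c3: "runs (rewind Out) (mk (with_out ?E (?W n xs)) ?\<sigma>) (mk E1 ?\<sigma>) (2 * b ^ K + 5)"
      unfolding with_out_def E1_def
      by (intro runs_conv[OF runs_rewind]) (use len[OF sz] in auto)
    have sim0: "simulates M True E1 (start_config M (?W n xs))"
      by (rule simulates_start[OF M set_output_word]) (auto simp: E1_def initial_mem_def)
    obtain t where t: "real t \<le> T" "fst (tm_run M (?W n xs) t) = (if ans then 1 else 2)"
      using dec unfolding decides_within_def by blast
    \<comment> \<open>The simulation stops at the first halting state, possibly before
      \<open>t\<close>. The answer is the same, since a halted machine no longer changes.\<close>
    define l where "l = (LEAST i. fst (tm_run M (?W n xs) i) \<in> {1, 2})"
    have ht: "fst (tm_run M (?W n xs) t) \<in> {1, 2}" using t by auto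
    have l1: "fst (tm_run M (?W n xs) l) \<in> {1, 2}" unfolding l_def by (rule LeastI) (rule ht)
    have lt: "l \<le> t" unfolding l_def by (rule Least_le) (rule ht)
    have before: "fst (tm_run M (?W n xs) i) \<notin> {1, 2}" if "i < l" for i
      using not_less_Least[of i "\<lambda>i. fst (tm_run M (?W n xs) i) \<in> {1, 2}"] that unfolding l_def by blast
    have cell: "((sim_step M True ^^ i) E1) Cell 0 = fst (tm_run M (?W n xs) i)" for i
      using simulates_run[OF M sim0, of i] by (simp add: simulates_def)
    define m' where "m' = mk ((sim_step M True ^^ l) E1) ?\<sigma>"
    have c4: "runs (Loop (\<lambda>h. h Cell \<notin> {1, 2}) (Act (sim_act M True))) (mk E1 ?\<sigma>) m' (2 * l + 1)"
    proof -
      have "runs (Loop (\<lambda>h. h Cell \<notin> {1, 2}) (Act (sim_act M True)))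
         (mk ((sim_step M True ^^ 0) E1) ?\<sigma>) (mk ((sim_step M True ^^ l) E1) ?\<sigma>) (2 * l + 1)"
      proof (rule runs_Loop_iterate[where I = "\<lambda>i. mk ((sim_step M True ^^ i) E1) ?\<sigma>" and ?T1.0 = 1])
        fix i assume "i < l"
        then show "heads (mk ((sim_step M True ^^ i) E1) ?\<sigma>) Cell \<notin> {1, 2} \<and>
          runs (Act (sim_act M True)) (mk ((sim_step M True ^^ i) E1) ?\<sigma>) (mk ((sim_step M True ^^ Suc i) E1) ?\<sigma>) 1"
          using before[of i] runs_sim[of M True "(sim_step M True ^^ i) E1" ?\<sigma>] by (simp add: cell)
      next
        show "\<not> heads (mk ((sim_step M True ^^ l) E1) ?\<sigma>) Cell \<notin> {1, 2}" using l1 by (simp add: cell)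
      qed simp
      then show ?thesis by (simp add: m'_def)
    qed
    have run: "runs (main_prog M F eP eV eB eA eH) ?E m' (20 * b ^ K + 2 * l)"
      unfolding main_prog_def
    proof (rule runs_mono[OF runs_Seq_exact[OF c1 runs_Seq_exact[OF c2 runs_Seq_exact[OF c3 c4]]]])
      have "1 \<le> b ^ K" using b2 by simp
      then show "Suc (b ^ K + Suc (b ^ K + Suc (2 * b ^ K + 5 + (2 * l + 1)))) \<le> 20 * b ^ K + 2 * l" by linarith
    qed
    have m'c: "m' Cell 0 = fst (tm_run M (?W n xs) l)" by (simp add: m'_def cell)
    have "tm_run M (?W n xs) t = tm_run M (?W n xs) l" by (rule tm_run_halted[OF l1 lt])
    then have m'a: "m' Cell 0 = (if ans then 1 else 2)" using t(2) m'c by simp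
    have "decides_within N (input_word n xs) (m' Cell 0 = 1) (real (20 * b ^ K + 2 * l) + 1)"
      by (rule N(2)[OF set_input_word run]) (use m'a in auto)
    moreover have "(m' Cell 0 = 1) = ans" using m'a by simp
    moreover have "real (20 * b ^ K + 2 * l) + 1 \<le> real (b ^ (K + 7)) + 2 * T"
    proof -
      have "1 \<le> b ^ K" using b2 by simp
      then have "20 * b ^ K + 1 \<le> b ^ (K + 7)" by (intro hundred_times_power[OF b2]) linarith
      then have "real (20 * b ^ K + 1) \<le> real (b ^ (K + 7))" by (rule of_nat_mono)
      moreover have "real l \<le> T" using lt t(1) by linarith
      ultimately show ?thesis by simp
    qed
    ultimately show "decides_within N (input_word n xs) ans (real (b ^ (K + 7)) + 2 * T)"
      by (auto simp: decides_within_def intro: order_trans)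
  qed
qed


section \<open>The graph of the reduction\<close>

text \<open>
  A vertex is a quadruple \<open>(k, c, g, i)\<close>: kind, column, group, index. There is a column for every
  literal occurrence of the formula. The kinds 0, 1, 2 are the vertices \<open>x\<^sub>i, y\<^sub>i, z\<^sub>i\<close> of the chain of
  group \<open>g < p\<close> in column \<open>c\<close>; for \<open>g = p\<close> and \<open>i = 0\<close> they form the detour of the column. Kind 3
  with \<open>i = 0\<close> is the junction in front of the chain, for \<open>g = p\<close> the junction of a clause
  (\<open>c mod 3 = 0\<close>). Kind 4 is the hub, and for \<open>g = p\<close> the two token vertices of a clause. All other
  quadruples are junk, connected to the hub only.

  Leaving a heavy vertex costs 1, and the budget is the number of heavy vertices; so every heavy
  vertex is visited exactly once. Since \<open>y\<^sub>i\<close> has only the neighbours \<open>x\<^sub>i\<close> and \<open>z\<^sub>i\<close>, a chain is passed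
  by \<open>t\<close> walks of the form \<open>x\<^sub>i y\<^sub>i z\<^sub>i\<close> for \<open>i < t\<close> and a single walk
  \<open>z\<^sub>t y\<^sub>t x\<^sub>t z\<^sub>t\<^sub>+\<^sub>1 y\<^sub>t\<^sub>+\<^sub>1 \<dots> z\<^sub>q\<^sub>-\<^sub>1\<close>. Hence the flow through a group is \<open>t + 1\<close>, where \<open>t < q\<close> is the
  same in all columns and encodes the values of the variables of the group. The detour of a column
  can be made in front of \<open>z\<^sub>t\<close> only if \<open>t\<close> satisfies the literal of the column. Otherwise the
  detour has to be visited, in the opposite direction, by one of the two tokens of the clause.
\<close>

type_synonym vx = "nat \<times> nat \<times> nat \<times> nat"

locale tsp_reduction =
  fixes p q M :: nat and grp :: "nat \<Rightarrow> nat" and tst :: "nat \<Rightarrow> nat \<Rightarrow> bool"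
  assumes p_pos: "1 \<le> p" and q_ge: "2 \<le> q" and M3: "3 dvd M" and grp_less: "\<And>c. c < M \<Longrightarrow> grp c < p"
begin

definition box :: "vx set" where
  "box = {..<5} \<times> {..M} \<times> {..p} \<times> {..<q}"

lemma in_box [simp]: "(k, c, g, i) \<in> box \<longleftrightarrow> k < 5 \<and> c \<le> M \<and> g \<le> p \<and> i < q"
  by (auto simp: box_def)

lemma finite_box: "finite box"
  by (simp add: box_def)

definition hub :: vx where
  "hub = (4, 0, 0, 0)"

definition triple :: "nat \<Rightarrow> nat \<Rightarrow> nat \<Rightarrow> bool" where
  "triple c g i \<longleftrightarrow> c < M \<and> (g < p \<and> i + 1 < q \<or> g = p \<and> i = 0)"

definition token :: "vx \<Rightarrow> bool" where
  "token = (\<lambda>(k, c, g, i). k = 4 \<and> c < M \<and> c mod 3 = 0 \<and> g = p \<and> i < 2)"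

definition heavy :: "vx \<Rightarrow> bool" where
  "heavy = (\<lambda>(k, c, g, i).
     k < 3 \<and> triple c g i \<or> k = 2 \<and> c < M \<and> g < p \<and> i + 1 = q \<or> token (k, c, g, i))"

definition light :: "vx \<Rightarrow> bool" where
  "light = (\<lambda>(k, c, g, i). k = 3 \<and> i = 0 \<and> (g < p \<or> g = p \<and> c < M \<and> c mod 3 = 0))"

definition junk :: "vx \<Rightarrow> bool" where
  "junk a \<longleftrightarrow> \<not> heavy a \<and> \<not> light a \<and> a \<noteq> hub"

definition from_hub :: "vx \<Rightarrow> bool" where
  "from_hub = (\<lambda>(k, c, g, i).
     junk (k, c, g, i) \<or> token (k, c, g, i) \<or> k = 3 \<and> c = 0 \<and> g < p \<and> i = 0)"

definition to_hub :: "vx \<Rightarrow> bool" where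
  "to_hub = (\<lambda>(k, c, g, i).
     junk (k, c, g, i) \<or> k = 0 \<and> c < M \<and> g = p \<and> i = 0 \<or>
     k = 3 \<and> c < M \<and> c mod 3 = 0 \<and> g = p \<and> i = 0 \<or> k = 3 \<and> c = M \<and> g < p \<and> i = 0)"

definition arc :: "vx \<Rightarrow> vx \<Rightarrow> bool" where
  "arc = (\<lambda>(k, c, g, i) (k', c', g', i').
     c = c' \<and> g = g' \<and> i = i' \<and> triple c g i \<and>
       (k = 0 \<and> k' = 1 \<or> k = 1 \<and> k' = 0 \<or> k = 1 \<and> k' = 2 \<or> k = 2 \<and> k' = 1) \<or>
     c = c' \<and> g = g' \<and> c < M \<and> g < p \<and> k = 0 \<and> k' = 2 \<and> i' = i + 1 \<or>
     c = c' \<and> g = g' \<and> c < M \<and> g < p \<and> k = 3 \<and> i = 0 \<and> (k' = 0 \<and> i' + 1 < q \<or> k' = 2) \<or>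
     c' = c + 1 \<and> g = g' \<and> c < M \<and> g < p \<and> k = 2 \<and> k' = 3 \<and> i' = 0 \<or>
     c = c' \<and> c < M \<and> g = grp c \<and> g' = p \<and> k = 3 \<and> k' = 0 \<and> i = 0 \<and> i' = 0 \<or>
     c = c' \<and> c < M \<and> g = p \<and> g' = grp c \<and> k = 2 \<and> k' = 2 \<and> i = 0 \<and> tst c i' \<or>
     g = p \<and> g' = p \<and> c' < M \<and> c = c' - c' mod 3 \<and> k = 3 \<and> k' = 2 \<and> i = 0 \<and> i' = 0 \<or>
     token (k, c, g, i) \<and> k' = 3 \<and> c' = c \<and> g' = p \<and> i' = 0 \<or>
     (k, c, g, i) = hub \<and> from_hub (k', c', g', i') \<or>
     (k', c', g', i') = hub \<and> to_hub (k, c, g, i))"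

lemmas arc_defs = arc_def to_hub_def from_hub_def junk_def hub_def heavy_def light_def triple_def token_def

lemma grp_ne: "c < M \<Longrightarrow> grp c \<noteq> p"
  using grp_less[of c] by simp

lemma not_heavy_hub: "\<not> heavy hub"
  using p_pos by (auto simp: heavy_def hub_def triple_def token_def)

lemma arc_irrefl: "\<not> arc a a"
  by (cases a) (use p_pos in \<open>auto simp: arc_defs dest: grp_ne\<close>)

text \<open>\<open>c' - c' mod 3\<close> is the first of the three columns of the clause to which
  the column \<open>c'\<close> belongs.\<close>

lemma mod3_cases: "c = c' - c' mod 3 \<longleftrightarrow> c mod 3 = 0 \<and> (c' = c \<or> c' = c + 1 \<or> c' = c + 2)" for c c' :: nat
proof -
  have "c' - c' mod 3 = 3 * (c' div 3)" by (simp add: minus_mod_eq_mult_div)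
  moreover have "c = 3 * (c' div 3) \<longleftrightarrow> c mod 3 = 0 \<and> (c' = c \<or> c' = c + 1 \<or> c' = c + 2)" by presburger
  ultimately show ?thesis by simp
qed

section \<open>Neighbourhoods of the vertices\<close>

lemma out_y: "triple c g i \<Longrightarrow> arc (1, c, g, i) b \<Longrightarrow> b \<in> {(0, c, g, i), (2, c, g, i)}"
  and in_y: "triple c g i \<Longrightarrow> arc b (1, c, g, i) \<Longrightarrow> b \<in> {(0, c, g, i), (2, c, g, i)}"
  by (cases b; auto simp: arc_defs)+

lemma out_x: "triple c g i \<Longrightarrow> g < p \<Longrightarrow> arc (0, c, g, i) b \<Longrightarrow> b \<in> {(1, c, g, i), (2, c, g, i + 1)}"
  and in_x: "triple c g i \<Longrightarrow> g < p \<Longrightarrow> arc b (0, c, g, i) \<Longrightarrow> b \<in> {(3, c, g, 0), (1, c, g, i)}"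
  by (cases b; auto simp: arc_defs)+

lemma out_z: "c < M \<Longrightarrow> g < p \<Longrightarrow> i < q \<Longrightarrow> arc (2, c, g, i) b \<Longrightarrow> b \<in> {(1, c, g, i), (3, c + 1, g, 0)}"
  and in_z: "c < M \<Longrightarrow> g < p \<Longrightarrow> i < q \<Longrightarrow> arc b (2, c, g, i) \<Longrightarrow>
    b \<in> {(3, c, g, 0), (2, c, p, 0), (0, c, g, i - 1), (1, c, g, i)}"
  by (cases b; auto simp: arc_defs)+

lemma in_detour_x: "c < M \<Longrightarrow> arc b (0, c, p, 0) \<Longrightarrow> b \<in> {(3, c, grp c, 0), (1, c, p, 0)}"
  and in_detour_z: "c < M \<Longrightarrow> arc b (2, c, p, 0) \<Longrightarrow> b \<in> {(1, c, p, 0), (3, c - c mod 3, p, 0)}"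
  by (cases b; auto simp: arc_defs dest: grp_ne)+

lemma out_detour_z: "c < M \<Longrightarrow> b \<in> box \<Longrightarrow> arc (2, c, p, 0) b \<Longrightarrow>
    b \<in> insert (1, c, p, 0) ((\<lambda>i. (2, c, grp c, i)) ` {..<q})"
  by (cases b) (auto simp: arc_defs)

lemma out_token: "token a \<Longrightarrow> arc a b \<Longrightarrow> b = (3, fst (snd a), p, 0)"
  by (cases a; cases b) (use p_pos in \<open>auto simp: arc_defs\<close>)

lemma in_clause: "c < M \<Longrightarrow> c mod 3 = 0 \<Longrightarrow> arc b (3, c, p, 0) \<Longrightarrow> b \<in> {(4, c, p, 0), (4, c, p, 1)}"
  by (cases b; auto simp: arc_defs less_2_cases_iff)

lemma out_clause:
  assumes "c < M" "c mod 3 = 0" "arc (3, c, p, 0) b"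
  shows "b \<in> {(2, c, p, 0), (2, c + 1, p, 0), (2, c + 2, p, 0), hub}"
proof -
  obtain k' c' g' i' where b: "b = (k', c', g', i')" by (cases b)
  from assms have "g' = p \<and> c = c' - c' mod 3 \<and> k' = 2 \<and> i' = 0 \<or> b = hub"
    by (auto simp: b arc_defs dest: grp_ne)
  then show ?thesis by (auto simp: mod3_cases b)
qed

lemma out_junction: "c < M \<Longrightarrow> g < p \<Longrightarrow> b \<in> box \<Longrightarrow> arc (3, c, g, 0) b \<Longrightarrow>
    b \<in> insert (0, c, p, 0) ((\<lambda>i. (0, c, g, i)) ` {..<q} \<union> (\<lambda>i. (2, c, g, i)) ` {..<q})"
  by (cases b) (auto simp: arc_defs)

lemma in_junction: "g < p \<Longrightarrow> b \<in> box \<Longrightarrow> arc b (3, c + 1, g, 0) \<Longrightarrow>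
    b \<in> (\<lambda>i. (2, c, g, i)) ` {..<q}"
  by (cases b) (auto simp: arc_defs)

lemma M_mult: "c < M \<Longrightarrow> c mod 3 = 0 \<Longrightarrow> c + 2 < M"
  using M3 by presburger

text \<open>A nonincreasing 0-1 sequence is a block of ones followed by zeros, so its sum is the
  position of the drop.\<close>

lemma sum_zero_one_decreasing:
  fixes D :: "nat \<Rightarrow> nat"
  assumes "\<And>j. Suc j < q \<Longrightarrow> D (Suc j) \<le> D j" "\<And>j. j < q \<Longrightarrow> D j \<le> 1" "i < q" "D i = 0" "i = 0 \<or> D (i - 1) = 1"
  shows "(\<Sum>j<q. D j) = i"
proof -
  have one: "D (i - 1 - j) = 1" if "j < i" for j
    using that
  proof (induction j)
    case 0
    then show ?case using assms(5) by simp
  next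
    case (Suc j)
    then have "Suc (i - 1 - Suc j) = i - 1 - j" by simp
    then have "D (i - 1 - j) \<le> D (i - 1 - Suc j)" using assms(1)[of "i - 1 - Suc j"] assms(3) by simp
    then show ?case using Suc assms(2)[of "i - 1 - Suc j"] assms(3) by simp
  qed
  have a: "D j = 1" if "j < i" for j using one[of "i - 1 - j"] that by simp
  have z: "D (i + j) = 0" if "i + j < q" for j
    using that
  proof (induction j)
    case (Suc j)
    then show ?case using assms(1)[of "i + j"] by simp
  qed (use assms in simp)
  have "(\<Sum>j<q. D j) = (\<Sum>j<i. D j) + (\<Sum>j=i..<q. D j)"
    using assms(3) by (simp add: lessThan_atLeast0 sum.atLeastLessThan_concat)
  also have "(\<Sum>j<i. D j) = i" using a by simp
  also have "(\<Sum>j=i..<q. D j) = 0" using z by (auto simp: le_iff_add)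
  finally show ?thesis by simp
qed

text \<open>Of the walk only the multiplicities \<open>N a b\<close> of its arcs are kept: they are
  balanced at every vertex, and every nonempty set without the hub is left by some arc. The
  directions in which the \<open>y\<close> vertices of a chain are passed form a sequence
  \<open>1 ... 1 0 ... 0\<close>, and balance at the junctions makes its number of ones the same in
  all columns.\<close>

theorem flow_sound:
  fixes N :: "vx \<Rightarrow> vx \<Rightarrow> nat"
  assumes supp: "\<And>a b. N a b \<noteq> 0 \<Longrightarrow> a \<in> box \<and> b \<in> box \<and> arc a b"
    and bal: "\<And>a. a \<in> box \<Longrightarrow> (\<Sum>b\<in>box. N a b) = (\<Sum>b\<in>box. N b a)"
    and hv: "\<And>a. a \<in> box \<Longrightarrow> heavy a \<Longrightarrow> (\<Sum>b\<in>box. N a b) = 1"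
    and conn: "\<And>C. C \<subseteq> box \<Longrightarrow> C \<noteq> {} \<Longrightarrow> hub \<notin> C \<Longrightarrow> \<exists>a\<in>C. \<exists>b. b \<notin> C \<and> N a b \<noteq> 0"
  shows "\<exists>t. (\<forall>g<p. t g < q) \<and> (\<forall>c<M. c mod 3 = 0 \<longrightarrow> (\<exists>l<3. tst (c + l) (t (grp (c + l)))))"
proof -
  have nz: "N a b = 0" "N b a = 0" if "b \<notin> box" for a b using supp[of a b] supp[of b a] that by blast+
  have na: "N a b = 0" if "\<not> arc a b" for a b using supp[of a b] that by blast
  have OUT: "(\<Sum>b\<in>box. N a b) = (\<Sum>b\<in>S. N a b)"
    if "finite S" "\<And>b. b \<in> box \<Longrightarrow> arc a b \<Longrightarrow> b \<in> S" for a S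
  proof -
    have "(\<Sum>b\<in>box. N a b) = (\<Sum>b\<in>box \<union> S. N a b)"
      by (rule sum.mono_neutral_left) (use nz that(1) finite_box in \<open>blast+\<close>)
    also have "\<dots> = (\<Sum>b\<in>S. N a b)"
      by (rule sum.mono_neutral_right) (use na that finite_box in \<open>blast+\<close>)
    finally show ?thesis .
  qed
  have IN: "(\<Sum>b\<in>box. N b a) = (\<Sum>b\<in>S. N b a)"
    if "finite S" "\<And>b. b \<in> box \<Longrightarrow> arc b a \<Longrightarrow> b \<in> S" for a S
  proof -
    have "(\<Sum>b\<in>box. N b a) = (\<Sum>b\<in>box \<union> S. N b a)"
      by (rule sum.mono_neutral_left) (use nz that(1) finite_box in \<open>blast+\<close>)
    also have "\<dots> = (\<Sum>b\<in>S. N b a)"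
      by (rule sum.mono_neutral_right) (use na that finite_box in \<open>blast+\<close>)
    finally show ?thesis .
  qed
  have hvI: "(\<Sum>b\<in>box. N b a) = 1" if "a \<in> box" "heavy a" for a
    using hv[OF that] bal[OF that(1)] by simp
  have OUT1: "(\<Sum>b\<in>S. N a b) = 1"
    if "finite S" "\<And>b. b \<in> box \<Longrightarrow> arc a b \<Longrightarrow> b \<in> S" "a \<in> box" "heavy a" for a S
    using OUT[OF that(1,2)] hv[OF that(3,4)] by simp
  have IN1: "(\<Sum>b\<in>S. N b a) = 1"
    if "finite S" "\<And>b. b \<in> box \<Longrightarrow> arc b a \<Longrightarrow> b \<in> S" "a \<in> box" "heavy a" for a S
    using IN[OF that(1,2)] hvI[OF that(3,4)] by simp
  \<comment> \<open>Otherwise each of the two vertices would spend its only departure on the other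
    one, and nothing would leave the pair, contrary to \<open>conn\<close>.\<close>
  have no_return: "\<not> (N a b = 1 \<and> N b a = 1)"
    if ab: "a \<in> box" "b \<in> box" "heavy a" "heavy b" "a \<noteq> b" for a b
  proof
    assume n: "N a b = 1 \<and> N b a = 1"
    have "hub \<notin> {a, b}" using ab(3,4) not_heavy_hub by blast
    moreover have "{a, b} \<subseteq> box" "{a, b} \<noteq> {}" using ab(1,2) by simp_all
    ultimately obtain e f where ef: "e \<in> {a, b}" "f \<notin> {a, b}" "N e f \<noteq> 0" using conn[of "{a, b}"] by blast
    define e' where "e' = (if e = a then b else a)"
    have "f \<in> box" "e \<in> box" "heavy e" using supp[OF ef(3)] ef(1) ab by blast+
    have "e' \<in> box" "e' \<noteq> f" "N e e' = 1" using ef ab n by (auto simp: e'_def split: if_splits)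
    have "N e e' + N e f = (\<Sum>b\<in>{e', f}. N e b)" using \<open>e' \<noteq> f\<close> by simp
    also have "\<dots> \<le> (\<Sum>b\<in>box. N e b)"
      by (rule sum_mono2) (use finite_box \<open>e' \<in> box\<close> \<open>f \<in> box\<close> in auto)
    also have "\<dots> = 1" by (rule hv) fact+
    finally show False using ef(3) \<open>N e e' = 1\<close> by simp
  qed
  have box_triple: "(k, c, g, i) \<in> box \<and> heavy (k, c, g, i)" if "triple c g i" "k < 3" for k c g i
    using that q_ge by (auto simp: heavy_def triple_def)
  \<comment> \<open>1 if the triple is passed from \<open>x\<close> to \<open>z\<close>, and 0 if it
    is passed from \<open>z\<close> to \<open>x\<close>.\<close>
  define D where "D = (\<lambda>c g i. N (1, c, g, i) (2, c, g, i))"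
  have tri: "N (0, c, g, i) (1, c, g, i) = D c g i \<and> N (2, c, g, i) (1, c, g, i) = 1 - D c g i \<and>
      N (1, c, g, i) (0, c, g, i) = 1 - D c g i \<and> D c g i \<le> 1" if t: "triple c g i" for c g i
  proof -
    let ?x = "(0, c, g, i)" and ?y = "(1, c, g, i)" and ?z = "(2, c, g, i)"
    have b: "?x \<in> box" "?y \<in> box" "?z \<in> box" "heavy ?x" "heavy ?y" "heavy ?z"
      using box_triple[OF t, of 0] box_triple[OF t, of 1] box_triple[OF t, of 2] by simp_all
    have "(\<Sum>b\<in>{?x, ?z}. N ?y b) = 1" by (rule OUT1[OF _ out_y[OF t]]) (use b in simp_all)
    moreover have "(\<Sum>b\<in>{?x, ?z}. N b ?y) = 1" by (rule IN1[OF _ in_y[OF t]]) (use b in simp_all)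
    moreover have "\<not> (N ?x ?y = 1 \<and> N ?y ?x = 1)" "\<not> (N ?z ?y = 1 \<and> N ?y ?z = 1)"
      by (rule no_return; use b in simp)+
    ultimately show ?thesis by (auto simp: D_def)
  qed
  \<comment> \<open>The chain of a group has no triple with index \<open>q - 1\<close>, so the
    sequence always ends with 0.\<close>
  have D_zero: "D c g i = 0" if "g < p" "q \<le> i + 1" for c g i
    using supp[of "(1, c, g, i)" "(2, c, g, i)"] that by (auto simp: D_def arc_defs)
  have blk: "N (0, c, g, i) (2, c, g, i + 1) = 1 - D c g i \<and> N (3, c, g, 0) (0, c, g, i) = D c g i"
    if c: "c < M" "g < p" "i + 1 < q" for c g i
  proof -
    have t: "triple c g i" using c by (simp add: triple_def)
    have "(\<Sum>b\<in>{(1, c, g, i), (2, c, g, i + 1)}. N (0, c, g, i) b) = 1"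
      by (rule OUT1[OF _ out_x[OF t c(2)]]) (use box_triple[OF t, of 0] in simp_all)
    moreover have "(\<Sum>b\<in>{(3, c, g, 0), (1, c, g, i)}. N b (0, c, g, i)) = 1"
      by (rule IN1[OF _ in_x[OF t c(2)]]) (use box_triple[OF t, of 0] in simp_all)
    ultimately show ?thesis using tri[OF t] by auto
  qed
  have hz: "(2, c, g, i) \<in> box \<and> heavy (2, c, g, i)" if "c < M" "g < p" "i < q" for c g i
    using that by (cases "i + 1 = q") (auto simp: heavy_def triple_def)
  \<comment> \<open>Entries into \<open>z_i\<close> that do not come from the chain: straight from
    the junction, or out of the detour of the column.\<close>
  define e where "e = (\<lambda>c g i. N (3, c, g, 0) (2, c, g, i) + N (2, c, p, 0) (2, c, g, i))"
  have zin: "e c g i + (if i = 0 then 0 else 1 - D c g (i - 1)) + D c g i = 1"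
    if c: "c < M" "g < p" "i < q" for c g i
  proof -
    let ?S = "{(3, c, g, 0), (2, c, p, 0), (0, c, g, i - 1), (1, c, g, i)}"
    have "(\<Sum>b\<in>?S. N b (2, c, g, i)) = 1"
      by (rule IN1[OF _ in_z[OF c]]) (use hz[OF c] in simp_all)
    moreover have "N (0, c, g, i - 1) (2, c, g, i) = (if i = 0 then 0 else 1 - D c g (i - 1))"
    proof (cases "i = 0")
      case True
      then show ?thesis using supp[of "(0, c, g, i - 1)" "(2, c, g, i)"] c by (auto simp: arc_defs)
    next
      case False
      then show ?thesis using blk[of c g "i - 1"] c by simp
    qed
    ultimately show ?thesis using c by (simp add: e_def D_def)
  qed
  have zout: "N (2, c, g, i) (3, c + 1, g, 0) = (if i + 1 = q then 1 else D c g i)"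
    if c: "c < M" "g < p" "i < q" for c g i
  proof -
    have "(\<Sum>b\<in>{(1, c, g, i), (3, c + 1, g, 0)}. N (2, c, g, i) b) = 1"
      by (rule OUT1[OF _ out_z[OF c]]) (use hz[OF c] in simp_all)
    moreover have "N (2, c, g, i) (1, c, g, i) = (if i + 1 = q then 0 else 1 - D c g i)"
    proof (cases "i + 1 = q")
      case True
      then show ?thesis using supp[of "(2, c, g, i)" "(1, c, g, i)"] c by (auto simp: arc_defs)
    next
      case False
      then have t: "triple c g i" using c by (simp add: triple_def)
      then show ?thesis using tri[OF t] False by simp
    qed
    moreover have "D c g i \<le> 1" using zin[OF c] by simp
    ultimately show ?thesis by auto
  qed
  define T where "T = (\<lambda>c g. \<Sum>i<q. D c g i)"
  have Dlast: "(\<Sum>i<q. if i + 1 = q then 1 else D c g i) = T c g + 1" if "g < p" for c g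
  proof -
    obtain q' where q': "q = Suc q'" using q_ge by (cases q) auto
    show ?thesis using D_zero[OF that, of q' c] by (simp add: T_def q')
  qed
  \<comment> \<open>By \<open>zin\<close>, \<open>e\<close> at \<open>i\<close> is the drop of
    \<open>D\<close> from \<open>i - 1\<close> to \<open>i\<close>, with the value 1 in front of
    index 0. The sum telescopes to \<open>1 - D (q - 1) = 1\<close>.\<close>
  have esum: "(\<Sum>i<q. e c g i) = 1" if c: "c < M" "g < p" for c g
  proof -
    have "(\<Sum>i<n. e c g i) + D c g (n - 1) = 1" if "1 \<le> n" "n \<le> q" for n
      using that
    proof (induction n rule: dec_induct)
      case base
      then show ?case using zin[OF c, of 0] by simp
    next
      case (step n)
      then show ?case using zin[OF c, of n] zin[OF c, of "n - 1"] by simp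
    qed
    from this[of q] show ?thesis using q_ge D_zero[OF c(2), of "q - 1"] by simp
  qed
  define \<delta> where "\<delta> = (\<lambda>c. D c p 0)"
  have trip: "triple c p 0" if "c < M" for c using that by (simp add: triple_def)
  have det: "N (3, c, grp c, 0) (0, c, p, 0) = \<delta> c \<and> N (3, c - c mod 3, p, 0) (2, c, p, 0) = 1 - \<delta> c \<and>
     (\<Sum>i<q. N (2, c, p, 0) (2, c, grp c, i)) = \<delta> c \<and> \<delta> c \<le> 1" if c: "c < M" for c
  proof -
    have "(\<Sum>b\<in>{(3, c, grp c, 0), (1, c, p, 0)}. N b (0, c, p, 0)) = 1"
      by (rule IN1[OF _ in_detour_x[OF c]]) (use box_triple[OF trip[OF c], of 0] in simp_all)
    moreover have "(\<Sum>b\<in>{(1, c, p, 0), (3, c - c mod 3, p, 0)}. N b (2, c, p, 0)) = 1"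
      by (rule IN1[OF _ in_detour_z[OF c]]) (use box_triple[OF trip[OF c], of 2] in simp_all)
    moreover have "(\<Sum>b\<in>insert (1, c, p, 0) ((\<lambda>i. (2, c, grp c, i)) ` {..<q}). N (2, c, p, 0) b) = 1"
      by (rule OUT1[OF _ out_detour_z[OF c]]) (use box_triple[OF trip[OF c], of 2] in simp_all)
    then have "N (2, c, p, 0) (1, c, p, 0) + (\<Sum>i<q. N (2, c, p, 0) (2, c, grp c, i)) = 1"
      by (subst (asm) sum.insert) (auto simp: sum.reindex inj_on_def)
    moreover have "N (1, c, p, 0) (2, c, p, 0) = D c p 0" by (simp add: D_def)
    ultimately show ?thesis using tri[OF trip[OF c]] by (auto simp: \<delta>_def)
  qed
  have L_out: "(\<Sum>b\<in>box. N (3, c, g, 0) b) = T c g + 1" if c: "c < M" "g < p" for c g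
  proof -
    let ?A = "(\<lambda>i. (0, c, g, i)) ` {..<q}" and ?B = "(\<lambda>i. (2, c, g, i)) ` {..<q}"
    have "(\<Sum>b\<in>box. N (3, c, g, 0) b) = (\<Sum>b\<in>insert (0, c, p, 0) (?A \<union> ?B). N (3, c, g, 0) b)"
      by (rule OUT[OF _ out_junction[OF c]]) auto
    also have "\<dots> = N (3, c, g, 0) (0, c, p, 0) + (\<Sum>b\<in>?A \<union> ?B. N (3, c, g, 0) b)"
      by (rule sum.insert) (use c in auto)
    also have "(\<Sum>b\<in>?A \<union> ?B. N (3, c, g, 0) b) = (\<Sum>b\<in>?A. N (3, c, g, 0) b) + (\<Sum>b\<in>?B. N (3, c, g, 0) b)"
      by (rule sum.union_disjoint) auto
    also have "(\<Sum>b\<in>?A. N (3, c, g, 0) b) = (\<Sum>i<q. N (3, c, g, 0) (0, c, g, i))"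
      by (simp add: sum.reindex inj_on_def)
    also have "\<dots> = T c g" unfolding T_def
    proof (rule sum.cong)
      fix i assume "i \<in> {..<q}"
      show "N (3, c, g, 0) (0, c, g, i) = D c g i"
      proof (cases "i + 1 < q")
        case True
        then show ?thesis using blk[OF c] by simp
      next
        case False
        then show ?thesis using D_zero[OF c(2), of i c] supp[of "(3, c, g, 0)" "(0, c, g, i)"] c
          by (auto simp: arc_defs)
      qed
    qed simp
    also have "(\<Sum>b\<in>?B. N (3, c, g, 0) b) = (\<Sum>i<q. N (3, c, g, 0) (2, c, g, i))"
      by (simp add: sum.reindex inj_on_def)
    finally have s: "(\<Sum>b\<in>box. N (3, c, g, 0) b) =
       N (3, c, g, 0) (0, c, p, 0) + (T c g + (\<Sum>i<q. N (3, c, g, 0) (2, c, g, i)))" .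
    have e1: "(\<Sum>i<q. N (3, c, g, 0) (2, c, g, i)) + (\<Sum>i<q. N (2, c, p, 0) (2, c, g, i)) = 1"
      using esum[OF c] by (simp add: e_def sum.distrib)
    \<comment> \<open>The flow that the junction sends into the detour is the flow that the detour
      gives back to the chain: both are \<open>\<delta> c\<close> for the group of the column, and
      both vanish for the other groups. So the detour does not change the total.\<close>
    have "N (3, c, g, 0) (0, c, p, 0) = (\<Sum>i<q. N (2, c, p, 0) (2, c, g, i))"
    proof (cases "g = grp c")
      case True
      then show ?thesis using det[OF c(1)] by simp
    next
      case False
      then have "N (3, c, g, 0) (0, c, p, 0) = 0" using supp[of "(3, c, g, 0)" "(0, c, p, 0)"] c
        by (auto simp: arc_defs)
      moreover have "N (2, c, p, 0) (2, c, g, i) = 0" for i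
        using supp[of "(2, c, p, 0)" "(2, c, g, i)"] c False by (auto simp: arc_defs)
      ultimately show ?thesis by simp
    qed
    then show ?thesis using s e1 by simp
  qed
  have L_in: "(\<Sum>b\<in>box. N b (3, c + 1, g, 0)) = T c g + 1" if c: "c < M" "g < p" for c g
  proof -
    have "(\<Sum>b\<in>box. N b (3, c + 1, g, 0)) = (\<Sum>b\<in>(\<lambda>i. (2, c, g, i)) ` {..<q}. N b (3, c + 1, g, 0))"
      by (rule IN[OF _ in_junction[OF c(2)]]) auto
    also have "\<dots> = (\<Sum>i<q. N (2, c, g, i) (3, c + 1, g, 0))" by (simp add: sum.reindex inj_on_def)
    also have "\<dots> = (\<Sum>i<q. if i + 1 = q then 1 else D c g i)"
      by (rule sum.cong) (use zout[OF c] in auto)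
    finally show ?thesis using Dlast[OF c(2)] by simp
  qed
  have T_const: "T c g = T 0 g" if "c < M" "g < p" for c g
    using that(1)
  proof (induction c)
    case (Suc c)
    have "T (c + 1) g + 1 = T c g + 1"
      using L_out[of "c + 1" g] L_in[of c g] bal[of "(3, c + 1, g, 0)"] Suc.prems that(2) q_ge by auto
    then show ?case using Suc by simp
  qed simp
  have dec1: "D c g (Suc j) \<le> D c g j" if "c < M" "g < p" "Suc j < q" for c g j
    using zin[OF that(1,2), of "Suc j"] zin[OF that(1,2), of j] that by auto
  have dec2: "D c g i \<le> 1" if "c < M" "g < p" "i < q" for c g i
    using zin[OF that] by linarith
  \<comment> \<open>A detour in forward direction ends in some \<open>z_i\<close> and makes
    \<open>e\<close> nonzero there. So \<open>i\<close> is the position of the drop, that is, the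
    value carried by the group, and the arc used exists only if this value passes the test.\<close>
  have tst: "tst c (T 0 (grp c))" if c: "c < M" and d: "\<delta> c = 1" for c
  proof -
    have g: "grp c < p" by (rule grp_less[OF c])
    have "(\<Sum>i<q. N (2, c, p, 0) (2, c, grp c, i)) \<noteq> 0" using det[OF c] d by simp
    then obtain i where i: "i < q" "N (2, c, p, 0) (2, c, grp c, i) \<noteq> 0"
      by (meson lessThan_iff sum.not_neutral_contains_not_neutral)
    have ts: "tst c i" using supp[OF i(2)] g by (auto simp: arc_defs)
    have "e c (grp c) i \<noteq> 0" using i(2) by (simp add: e_def)
    moreover have "i - 1 < q" using i(1) by simp
    from zin[OF c g this] have "D c (grp c) (i - 1) \<le> 1" by linarith
    ultimately have "D c (grp c) i = 0 \<and> (i = 0 \<or> D c (grp c) (i - 1) = 1)"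
      using zin[OF c g i(1)] by (cases "i = 0") auto
    then have "T c (grp c) = i"
      unfolding T_def using dec1[OF c g] dec2[OF c g] i(1) by (intro sum_zero_one_decreasing) auto
    then show ?thesis using ts T_const[OF c g] by simp
  qed
  have T_less: "T 0 g < q" if "g < p" "0 < M" for g
  proof -
    obtain q' where q': "q = Suc q'" using q_ge by (cases q) auto
    have "T 0 g = (\<Sum>i<q'. D 0 g i)" using D_zero[OF that(1), of q' 0] by (simp add: T_def q')
    also have "\<dots> \<le> (\<Sum>i<q'. 1)"
      by (rule sum_mono) (use dec2[OF that(2,1)] q' in auto)
    finally show ?thesis by (simp add: q')
  qed
  \<comment> \<open>If all three detours were passed backwards, the junction of the clause would
    have to send out three units, while its two tokens bring in only two.\<close>
  have cl: "\<exists>l<3. \<delta> (c + l) = 1" if c: "c < M" "c mod 3 = 0" for c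
  proof (rule ccontr)
    assume "\<not> ?thesis"
    then have "\<delta> (c + l) \<noteq> 1" if "l < 3" for l using that by blast
    from this[of 0] this[of 1] this[of 2] have no: "\<delta> c \<noteq> 1" "\<delta> (c + 1) \<noteq> 1" "\<delta> (c + 2) \<noteq> 1" by simp_all
    have M2: "c + 1 < M" "c + 2 < M" using M_mult[OF c] by auto
    have m: "(c + 1) - (c + 1) mod 3 = c" "(c + 2) - (c + 2) mod 3 = c" "c - c mod 3 = c" using c(2) by presburger+
    have x: "N (3, c, p, 0) (2, c, p, 0) = 1" "N (3, c, p, 0) (2, c + 1, p, 0) = 1" "N (3, c, p, 0) (2, c + 2, p, 0) = 1"
      using det[OF c(1)] det[OF M2(1)] det[OF M2(2)] no unfolding m by auto
    have rt: "N (4, c, p, i) (3, c, p, 0) = 1" if "i < 2" for i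
    proof -
      have t: "token (4, c, p, i)" using c that by (simp add: token_def)
      have "(4, c, p, i) \<in> box" "heavy (4, c, p, i)" using c that q_ge t by (auto simp: heavy_def)
      then have "(\<Sum>b\<in>{(3, c, p, 0)}. N (4, c, p, i) b) = 1"
        by (intro OUT1) (use out_token[OF t] in auto)
      then show ?thesis by simp
    qed
    have "(\<Sum>b\<in>box. N b (3, c, p, 0)) = (\<Sum>b\<in>{(4, c, p, 0), (4, c, p, 1)}. N b (3, c, p, 0))"
      by (rule IN) (use in_clause[OF c] in auto)
    also have "\<dots> = 2" using rt[of 0] rt[of 1] by simp
    finally have i2: "(\<Sum>b\<in>box. N b (3, c, p, 0)) = 2" .
    have "(\<Sum>b\<in>box. N (3, c, p, 0) b) = (\<Sum>b\<in>{(2, c, p, 0), (2, c + 1, p, 0), (2, c + 2, p, 0), hub}. N (3, c, p, 0) b)"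
      by (rule OUT) (use out_clause[OF c] in auto)
    also have "\<dots> \<ge> 3" using x by (simp add: hub_def)
    finally have "3 \<le> (\<Sum>b\<in>box. N (3, c, p, 0) b)" .
    moreover have "(3, c, p, 0) \<in> box" using c q_ge by simp
    note bal[OF this]
    ultimately show False using i2 by linarith
  qed
  show ?thesis
  proof (cases "M = 0")
    case True
    then show ?thesis using q_ge by (intro exI[of _ "\<lambda>_. 0"]) auto
  next
    case False
    show ?thesis
    proof (intro exI[of _ "T 0"] conjI allI impI)
      show "T 0 g < q" if "g < p" for g using T_less[OF that] False by simp
      fix c assume c: "c < M" "c mod 3 = 0"
      from cl[OF c] obtain l where "l < 3" "\<delta> (c + l) = 1" by blast
      moreover have "c + l < M" using M_mult[OF c] \<open>l < 3\<close> by simp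
      ultimately show "\<exists>l<3. tst (c + l) (T 0 (grp (c + l)))" using tst[of "c + l"] by blast
    qed
  qed
qed

end


section \<open>Closed walks and arc multiplicities\<close>

text \<open>Arrivals and departures cancel at each inner visit; the two correction terms belong to
  the ends of the walk.\<close>

lemma pcas_count:
  "pcas u w v \<Longrightarrow> count_list (map fst w) x + of_bool (x = v) = count_list (map snd w) x + of_bool (x = u)"
  by (induction w arbitrary: u) (auto split: if_splits)

lemma sum_count_fst:
  assumes "finite A" "snd ` set w \<subseteq> A"
  shows "(\<Sum>v\<in>A. count_list w (u, v)) = count_list (map fst w) u"
  using assms(2)
proof (induction w)
  case (Cons e w)
  obtain a b where e: "e = (a, b)" by force
  have "(\<Sum>v\<in>A. count_list (e # w) (u, v)) = (\<Sum>v\<in>A. count_list w (u, v) + (if v = b then of_bool (a = u) else 0))"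
    by (rule sum.cong) (auto simp: e)
  also have "\<dots> = count_list (map fst w) u + of_bool (a = u)"
    using Cons assms(1) by (simp add: sum.distrib e)
  finally show ?case by (auto simp: e)
qed simp

lemma sum_count_snd:
  assumes "finite A" "fst ` set w \<subseteq> A"
  shows "(\<Sum>v\<in>A. count_list w (v, u)) = count_list (map snd w) u"
  using assms(2)
proof (induction w)
  case (Cons e w)
  obtain a b where e: "e = (a, b)" by force
  have "(\<Sum>v\<in>A. count_list (e # w) (v, u)) = (\<Sum>v\<in>A. count_list w (v, u) + (if v = a then of_bool (b = u) else 0))"
    by (rule sum.cong) (auto simp: e)
  also have "\<dots> = count_list (map snd w) u + of_bool (b = u)"
    using Cons assms(1) by (simp add: sum.distrib e)
  finally show ?case by (auto simp: e)
qed simp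

lemma length_filter_fst:
  assumes "finite A" "fst ` set w \<subseteq> A"
  shows "length (filter (\<lambda>e. P (fst e)) w) = (\<Sum>x\<in>{x \<in> A. P x}. count_list (map fst w) x)"
  using assms(2)
proof (induction w)
  case (Cons e w)
  have "(\<Sum>x\<in>{x \<in> A. P x}. count_list (map fst (e # w)) x) =
     (\<Sum>x\<in>{x \<in> A. P x}. count_list (map fst w) x + (if x = fst e then 1 else 0))"
    by (rule sum.cong) auto
  also have "\<dots> = length (filter (\<lambda>e. P (fst e)) w) + of_bool (P (fst e))"
    using Cons assms(1) by (simp add: sum.distrib)
  finally show ?case by simp
qed simp

lemma pawalk_verts_closed:
  "pcas u w v \<Longrightarrow> u \<in> C \<Longrightarrow> \<forall>e\<in>set w. fst e \<in> C \<longrightarrow> snd e \<in> C \<Longrightarrow> set (pawalk_verts u w) \<subseteq> C"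
  by (induction w arbitrary: u) auto

lemma pcas_end_closed:
  "pcas u w v \<Longrightarrow> x \<in> set (pawalk_verts u w) \<Longrightarrow> x \<in> C \<Longrightarrow> \<forall>e\<in>set w. fst e \<in> C \<longrightarrow> snd e \<in> C \<Longrightarrow> v \<in> C"
proof (induction w arbitrary: u x)
  case (Cons e w)
  show ?case
  proof (cases "x = fst e")
    case True
    then have "snd e \<in> C" using Cons.prems by simp
    moreover have "pcas (snd e) w v" using Cons.prems by simp
    moreover have "snd e \<in> set (pawalk_verts (snd e) w)" by (cases w) (use Cons.prems in auto)
    ultimately show ?thesis using Cons.prems(4) Cons.IH[of "snd e" "snd e"] by simp
  next
    case False
    then show ?thesis using Cons.prems Cons.IH[of "snd e" x] by auto
  qed
qed simp

text \<open>If no arc left \<open>C\<close>, the walk would stay in \<open>C\<close> after visiting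
  \<open>x\<close>, so its end \<open>u\<close> would be in \<open>C\<close>. But \<open>u\<close>
  is also its start, hence the whole walk would be in \<open>C\<close>.\<close>

lemma closed_walk_leaves:
  assumes "pcas u w u" "x \<in> set (pawalk_verts u w)" "x \<in> C" "y \<in> set (pawalk_verts u w)" "y \<notin> C"
  shows "\<exists>e\<in>set w. fst e \<in> C \<and> snd e \<notin> C"
proof (rule ccontr)
  assume "\<not> ?thesis"
  then have c: "\<forall>e\<in>set w. fst e \<in> C \<longrightarrow> snd e \<in> C" by blast
  have "u \<in> C" by (rule pcas_end_closed[OF assms(1,2,3) c])
  then show False using pawalk_verts_closed[OF assms(1) _ c] assms(4,5) by blast
qed

lemma set_pawalk_verts: "pcas u w v \<Longrightarrow> set (pawalk_verts u w) = insert v (fst ` set w)"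
  by (induction w arbitrary: u) auto

lemma sum_eq_card_imp:
  fixes f :: "'a \<Rightarrow> nat"
  assumes "finite A" "\<And>x. x \<in> A \<Longrightarrow> 1 \<le> f x" "sum f A \<le> card A" "x \<in> A"
  shows "f x = 1"
proof (rule ccontr)
  assume "f x \<noteq> 1"
  then have "sum (\<lambda>_. 1) A < sum f A"
    using assms by (intro sum_strict_mono_ex1) (auto intro!: bexI[of _ x] simp: le_neq_implies_less)
  then show False using assms(3) by simp
qed


section \<open>The instance\<close>

text \<open>The arc list is defined by nested loops, in the order in which the machine writes it;
  distinctness and lookup are easier for a filtered product.\<close>

lemma concat_if_product:
  "concat (map (\<lambda>u. concat (map (\<lambda>v. if P u v then [f u v] else []) ys)) xs) =
   map (\<lambda>(u, v). f u v) (filter (\<lambda>(u, v). P u v) (List.product xs ys))"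
proof (induction xs)
  case (Cons a xs)
  have "concat (map (\<lambda>v. if P a v then [f a v] else []) ys) =
     map (\<lambda>(u, v). f u v) (filter (\<lambda>(u, v). P u v) (map (Pair a) ys))"
    by (induction ys) auto
  then show ?case using Cons by simp
qed simp

context tsp_reduction
begin

section \<open>Vertex numbers in mixed radix\<close>

definition vnum :: "vx \<Rightarrow> nat" where
  "vnum = (\<lambda>(k, c, g, i). 5 * ((c * (p + 1) + g) * q + i) + k)"

definition coords :: "nat \<Rightarrow> vx" where
  "coords u = (u mod 5, u div 5 div q div (p + 1), u div 5 div q mod (p + 1), u div 5 mod q)"

definition vcount :: nat where
  "vcount = 5 * ((M + 1) * (p + 1) * q)"

lemma vnum_coords [simp]: "vnum (coords u) = u"
proof -
  have "(u div 5 div q div (p + 1) * (p + 1) + u div 5 div q mod (p + 1)) = u div 5 div q"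
    by (rule div_mult_mod_eq)
  moreover have "u div 5 div q * q + u div 5 mod q = u div 5" by (rule div_mult_mod_eq)
  moreover have "5 * (u div 5) + u mod 5 = u" by simp
  ultimately show ?thesis by (simp only: vnum_def coords_def prod.case)
qed

lemma coords_vnum: "a \<in> box \<Longrightarrow> coords (vnum a) = a"
proof (cases a)
  case (fields k c g i)
  assume "a \<in> box"
  then have *: "k < 5" "g < p + 1" "i < q" using fields by auto
  have dm: "(a * b + r) div b = a" "(a * b + r) mod b = r" if "r < b" for a b r :: nat
    using that by simp_all
  have "(5 * ((c * (p + 1) + g) * q + i) + k) div 5 = (c * (p + 1) + g) * q + i"
    "(5 * ((c * (p + 1) + g) * q + i) + k) mod 5 = k"
    using dm[OF *(1), of "(c * (p + 1) + g) * q + i"] by (simp_all only: mult.commute[of 5])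
  moreover note dm[OF *(3), of "c * (p + 1) + g"] dm[OF *(2), of c]
  ultimately show ?thesis unfolding fields coords_def vnum_def prod.case by (simp only:)
qed

lemma coords_in_box: "coords u \<in> box \<longleftrightarrow> u < vcount"
proof -
  have "coords u \<in> box \<longleftrightarrow> u div 5 div q div (p + 1) \<le> M"
    using q_ge by (auto simp: coords_def less_Suc_eq_le[symmetric])
  also have "\<dots> \<longleftrightarrow> u div 5 div q div (p + 1) < M + 1" by linarith
  also have "\<dots> \<longleftrightarrow> u < vcount"
    using q_ge by (simp only: vcount_def div_less_iff_less_mult mult.assoc mult.commute)
  finally show ?thesis .
qed

lemma vnum_less: "a \<in> box \<Longrightarrow> vnum a < vcount"
  using coords_in_box[of "vnum a"] coords_vnum by simp

lemma bij_vnum: "bij_betw vnum box {..<vcount}"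
  by (rule bij_betw_byWitness[where f' = coords])
    (auto simp: coords_vnum coords_in_box vnum_less simp del: in_box split_paired_All)

text \<open>The three summands count the heavy vertices: \<open>3 (q - 1) + 1\<close> in each of the
  \<open>M p\<close> chains, 3 in each detour, and 2 tokens for each of the \<open>M div 3\<close>
  clauses.\<close>

definition budget_nat :: nat where
  "budget_nat = M * p * (3 * (q - 1) + 1) + 3 * M + 2 * (M div 3)"

definition inst :: atsp_instance where
  "inst = \<lparr> num_verts = vcount,
     arc_costs = concat (map (\<lambda>u. concat (map (\<lambda>v.
        if arc (coords u) (coords v) then [((u, v), of_bool (heavy (coords u)))] else [])
        [0..<vcount])) [0..<vcount]),
     budget = of_nat budget_nat \<rparr>"

lemma arc_costs_inst:
  "arc_costs inst = map (\<lambda>e. (e, of_bool (heavy (coords (fst e)))))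
     (filter (\<lambda>(u, v). arc (coords u) (coords v)) (List.product [0..<vcount] [0..<vcount]))"
  unfolding inst_def atsp_instance.simps concat_if_product by (rule map_cong) auto

lemma parcs_inst: "parcs (atsp_digraph inst) = {(u, v). u < vcount \<and> v < vcount \<and> arc (coords u) (coords v)}"
  by (auto simp: atsp_digraph_def arc_costs_inst image_image)

lemma pverts_inst: "pverts (atsp_digraph inst) = {..<vcount}"
  by (simp add: atsp_digraph_def inst_def)

lemma arc_cost_inst: "e \<in> parcs (atsp_digraph inst) \<Longrightarrow> arc_cost inst e = of_bool (heavy (coords (fst e)))"
  unfolding arc_cost_def arc_costs_inst map_of_map_restrict parcs_inst by auto

lemma inst_ok: "is_atsp_instance inst"
proof -
  have "pair_digraph (atsp_digraph inst)"
  proof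
    show "finite (parcs (atsp_digraph inst))"
      by (rule finite_subset[of _ "{..<vcount} \<times> {..<vcount}"]) (auto simp: parcs_inst)
    show "\<And>e. e \<in> parcs (atsp_digraph inst) \<Longrightarrow> fst e \<noteq> snd e"
      by (auto simp: parcs_inst arc_irrefl)
  qed (auto simp: parcs_inst pverts_inst)
  moreover have "distinct (map fst (arc_costs inst))"
    unfolding arc_costs_inst by (simp add: comp_def distinct_product)
  moreover have "1 \<le> num_verts inst" using q_ge by (simp add: inst_def vcount_def)
  moreover have "0 \<le> budget inst" by (simp add: inst_def)
  ultimately show ?thesis unfolding is_atsp_instance_def by (simp add: arc_cost_inst)
qed

lemma card_clauses: "card {c. c < M \<and> c mod 3 = 0} = M div 3"
proof -
  have "{c. c < M \<and> c mod 3 = 0} = (\<lambda>j. 3 * j) ` {..<M div 3}"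
    using M3 by (auto simp: image_iff elim!: dvdE)
  then show ?thesis by (simp add: card_image inj_on_def)
qed

lemma card_heavy: "card {a \<in> box. heavy a} = budget_nat"
proof -
  let ?A1 = "{..<3::nat} \<times> {..<M} \<times> {..<p} \<times> {..<q - 1}"
  let ?A2 = "{2::nat} \<times> {..<M} \<times> {..<p} \<times> {q - 1}"
  let ?A3 = "{..<3::nat} \<times> {..<M} \<times> {p} \<times> {0::nat}"
  let ?A4 = "{4::nat} \<times> {c. c < M \<and> c mod 3 = 0} \<times> {p} \<times> {..<2::nat}"
  have "{a \<in> box. heavy a} = (?A1 \<union> ?A2) \<union> (?A3 \<union> ?A4)"
    using q_ge by (auto simp: heavy_def triple_def token_def)
  then have "card {a \<in> box. heavy a} = card (?A1 \<union> ?A2) + card (?A3 \<union> ?A4)"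
    by (simp only:) (rule card_Un_disjoint, auto)
  also have "card (?A1 \<union> ?A2) = card ?A1 + card ?A2"
    by (rule card_Un_disjoint) auto
  also have "card (?A3 \<union> ?A4) = card ?A3 + card ?A4"
    by (rule card_Un_disjoint) auto
  finally show ?thesis
    by (simp add: card_cartesian_product card_clauses budget_nat_def algebra_simps)
qed

text \<open>Every vertex is left at least once, and each departure from a heavy vertex costs 1. The
  budget then allows exactly one departure from each of them, which is the hypothesis
  \<open>hv\<close> of \<open>flow_sound\<close>.\<close>

theorem yes_sound:
  assumes "atsp_yes inst"
  shows "\<exists>t. (\<forall>g<p. t g < q) \<and> (\<forall>c<M. c mod 3 = 0 \<longrightarrow> (\<exists>l<3. tst (c + l) (t (grp (c + l)))))"
proof -
  obtain u w where w: "u < vcount" "set w \<subseteq> parcs (atsp_digraph inst)" "pcas u w u"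
    "{..<vcount} \<subseteq> set (pawalk_verts u w)" "sum_list (map (arc_cost inst) w) \<le> of_nat budget_nat"
    using assms unfolding atsp_yes_def Let_def pre_digraph.awalk_def cas_with_proj_eq awalk_verts_with_proj_eq
    by (auto simp: pverts_inst) (simp add: inst_def)
  have sub: "fst ` set w \<subseteq> {..<vcount}" "snd ` set w \<subseteq> {..<vcount}" using w(2) by (auto simp: parcs_inst)
  \<comment> \<open>A second vertex excludes the empty walk, so that every visited vertex is the
    tail of an arc of the walk.\<close>
  have v2: "2 \<le> vcount" using q_ge by (simp add: vcount_def)
  have "w \<noteq> []"
  proof
    assume "w = []"
    then have "{..<vcount} \<subseteq> {u}" using w(4) by simp
    then have "card {..<vcount} \<le> card {u}" by (intro card_mono) auto
    then show False using v2 by simp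
  qed
  then have "u \<in> fst ` set w" using w(3) by (cases w) auto
  then have visited: "{..<vcount} \<subseteq> fst ` set w" using w(4) set_pawalk_verts[OF w(3)] by auto
  let ?n = "\<lambda>x. count_list (map fst w) x"
  have pos: "1 \<le> ?n x" if "x < vcount" for x
    using visited that count_list_0_iff[of "map fst w" x] by (force simp: Suc_le_eq)
  have cost: "sum_list (map (arc_cost inst) w) = of_nat (length (filter (\<lambda>e. heavy (coords (fst e))) w))"
    using w(2) by (induction w) (auto simp: arc_cost_inst)
  define N where "N = (\<lambda>a b. if a \<in> box \<and> b \<in> box then count_list w (vnum a, vnum b) else 0)"
  have Nout: "(\<Sum>b\<in>box. N a b) = ?n (vnum a)" if a: "a \<in> box" for a
  proof -
    have "(\<Sum>b\<in>box. N a b) = (\<Sum>b\<in>box. count_list w (vnum a, vnum b))"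
      by (rule sum.cong) (use a in \<open>simp_all add: N_def\<close>)
    also have "\<dots> = (\<Sum>v<vcount. count_list w (vnum a, v))"
      by (rule sum.reindex_bij_betw[OF bij_vnum])
    also have "\<dots> = ?n (vnum a)" by (rule sum_count_fst) (use sub in auto)
    finally show ?thesis .
  qed
  have Nin: "(\<Sum>b\<in>box. N b a) = count_list (map snd w) (vnum a)" if a: "a \<in> box" for a
  proof -
    have "(\<Sum>b\<in>box. N b a) = (\<Sum>b\<in>box. count_list w (vnum b, vnum a))"
      by (rule sum.cong) (use a in \<open>simp_all add: N_def\<close>)
    also have "\<dots> = (\<Sum>v<vcount. count_list w (v, vnum a))"
      by (rule sum.reindex_bij_betw[OF bij_vnum])
    also have "\<dots> = count_list (map snd w) (vnum a)" by (rule sum_count_snd) (use sub in auto)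
    finally show ?thesis .
  qed
  show ?thesis
  proof (rule flow_sound[of N])
    fix a b assume "N a b \<noteq> 0"
    then have ab: "a \<in> box" "b \<in> box" "count_list w (vnum a, vnum b) \<noteq> 0"
      by (auto simp: N_def simp del: in_box split: if_splits)
    then have "(vnum a, vnum b) \<in> parcs (atsp_digraph inst)" using w(2) by (meson count_notin subsetD)
    then show "a \<in> box \<and> b \<in> box \<and> arc a b" using ab by (simp add: parcs_inst coords_vnum)
  next
    fix a assume "a \<in> box"
    then show "(\<Sum>b\<in>box. N a b) = (\<Sum>b\<in>box. N b a)"
      using pcas_count[OF w(3), of "vnum a"] by (simp add: Nout Nin)
  next
    fix a assume a: "a \<in> box" "heavy a"
    let ?H = "{x \<in> {..<vcount}. heavy (coords x)}"
    have "of_nat (length (filter (\<lambda>e. heavy (coords (fst e))) w)) \<le> (of_nat budget_nat :: rat)"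
      using w(5) cost by simp
    then have "length (filter (\<lambda>e. heavy (coords (fst e))) w) \<le> budget_nat" by (simp only: of_nat_le_iff)
    moreover have "length (filter (\<lambda>e. heavy (coords (fst e))) w) = (\<Sum>x\<in>?H. ?n x)"
      by (rule length_filter_fst) (use sub in auto)
    moreover have "budget_nat = card ?H"
    proof -
      have "bij_betw vnum {a \<in> box. heavy a} ?H"
        by (rule bij_betw_byWitness[where f' = coords])
          (auto simp: coords_vnum coords_in_box vnum_less simp del: in_box split_paired_All)
      then show ?thesis using card_heavy bij_betw_same_card by fastforce
    qed
    ultimately have "?n (vnum a) = 1"
      by (intro sum_eq_card_imp[of ?H]) (use pos a vnum_less coords_vnum in auto)
    then show "(\<Sum>b\<in>box. N a b) = 1" using Nout[OF a(1)] by simp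
  next
    fix C assume C: "C \<subseteq> box" "C \<noteq> {}" "hub \<notin> C"
    then obtain x where x: "x \<in> C" by blast
    have hub: "hub \<in> box" using p_pos q_ge by (simp add: hub_def)
    have inj: "inj_on vnum box" using bij_vnum by (simp add: bij_betw_def)
    obtain e where e: "e \<in> set w" "fst e \<in> vnum ` C" "snd e \<notin> vnum ` C"
    proof -
      have "vnum x \<in> set (pawalk_verts u w)" "vnum hub \<in> set (pawalk_verts u w)"
        using w(4) vnum_less x C(1) hub by blast+
      moreover have "vnum hub \<notin> vnum ` C" using inj C hub by (meson inj_on_image_mem_iff)
      ultimately show ?thesis using closed_walk_leaves[OF w(3), of "vnum x" "vnum ` C" "vnum hub"] x that by blast
    qed
    then obtain a where a: "a \<in> C" "fst e = vnum a" by blast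
    have "snd e < vcount" using sub e(1) by blast
    then have b: "coords (snd e) \<in> box" by (simp only: coords_in_box)
    have "e = (vnum a, vnum (coords (snd e)))" using a by (simp add: prod_eq_iff)
    then have "count_list w (vnum a, vnum (coords (snd e))) \<noteq> 0" using e(1) by (metis count_list_0_iff)
    moreover have "a \<in> box" using a(1) C(1) by blast
    ultimately have "N a (coords (snd e)) \<noteq> 0" using b unfolding N_def by (simp only: simp_thms if_True)
    moreover have "coords (snd e) \<notin> C" using e(3) by (metis imageI vnum_coords)
    ultimately show "\<exists>a\<in>C. \<exists>b. b \<notin> C \<and> N a b \<noteq> 0" using a(1) by blast
  qed
qed

end

section \<open>Walks as lists of vertices\<close>

fun arcs_of :: "'a list \<Rightarrow> ('a \<times> 'a) list" where
  "arcs_of (x # y # zs) = (x, y) # arcs_of (y # zs)"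
| "arcs_of zs = []"

lemma pcas_arcs_of: "zs \<noteq> [] \<Longrightarrow> pcas (hd zs) (arcs_of zs) (last zs)"
  by (induction zs rule: arcs_of.induct) auto

lemma set_arcs_of: "successively P zs \<Longrightarrow> (x, y) \<in> set (arcs_of zs) \<Longrightarrow> P x y \<and> x \<in> set zs \<and> y \<in> set zs"
  by (induction zs rule: arcs_of.induct) auto

lemma map_fst_arcs_of: "map fst (arcs_of zs) = butlast zs"
  by (induction zs rule: arcs_of.induct) auto

lemma pcas_append: "pcas u w x \<Longrightarrow> pcas x w' v \<Longrightarrow> pcas u (w @ w') v"
  by (induction w arbitrary: u) auto

lemma arcs_of_map: "arcs_of (map f zs) = map (\<lambda>(x, y). (f x, f y)) (arcs_of zs)"
  by (induction zs rule: arcs_of.induct) auto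

lemma sum_thirds: "(\<Sum>c<3 * m. f c) = (\<Sum>j<m. f (3 * j) + f (3 * j + 1) + f (3 * j + 2))" for f :: "nat \<Rightarrow> nat"
proof (induction m)
  case (Suc m)
  have "{..<3 * Suc m} = insert (3 * m + 2) (insert (3 * m + 1) (insert (3 * m) {..<3 * m}))" by auto
  then show ?case using Suc by simp
qed simp

lemma sum_list_map_concat: "(\<Sum>x\<leftarrow>concat xss. f x) = (\<Sum>xs\<leftarrow>xss. \<Sum>x\<leftarrow>xs. f x)" for f :: "'a \<Rightarrow> nat"
  by (induction xss) auto

lemma other_thirds:
  fixes a b :: nat
  assumes "a < 3" "b < 3" "b \<noteq> a"
  shows "\<exists>i<2. (a + 1 + i) mod 3 = b"
proof -
  have "a = 0 \<or> a = 1 \<or> a = 2" "b = 0 \<or> b = 1 \<or> b = 2" using assms by linarith+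
  then have "(a + 1 + 0) mod 3 = b \<or> (a + 1 + 1) mod 3 = b" using assms(3) by (elim disjE) simp_all
  then show ?thesis by (metis one_less_numeral_iff semiring_norm(76) zero_less_numeral)
qed

context tsp_reduction
begin

definition hub_loop :: "vx list \<Rightarrow> bool" where
  "hub_loop vs \<longleftrightarrow> set vs \<subseteq> box \<and> successively arc (hub # vs @ [hub])"

definition walk_of :: "vx list list \<Rightarrow> (nat \<times> nat) list" where
  "walk_of loops = concat (map (\<lambda>vs. arcs_of (map vnum (hub # vs @ [hub]))) loops)"

lemma hub_in_box: "hub \<in> box"
  using p_pos q_ge by (simp add: hub_def)

text \<open>Loops at the hub can be concatenated freely. As the cost of an arc depends only on its
  tail and the hub is free of charge, the total cost is the number of heavy entries of the
  loops.\<close>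

lemma yes_if_loops:
  assumes loops: "\<And>vs. vs \<in> set loops \<Longrightarrow> hub_loop vs"
    and cover: "\<And>a. a \<in> box \<Longrightarrow> a \<noteq> hub \<Longrightarrow> \<exists>vs\<in>set loops. a \<in> set vs"
    and cost: "(\<Sum>vs\<leftarrow>loops. length (filter heavy vs)) \<le> budget_nat"
  shows "atsp_yes inst"
proof -
  let ?w = "walk_of loops" and ?h = "vnum hub"
  have one: "pcas ?h (arcs_of (map vnum (hub # vs @ [hub]))) ?h" for vs
    using pcas_arcs_of[of "map vnum (hub # vs @ [hub])"] by simp
  have walk: "pcas ?h (walk_of ls) ?h" for ls
  proof (induction ls)
    case (Cons vs ls)
    have "walk_of (vs # ls) = arcs_of (map vnum (hub # vs @ [hub])) @ walk_of ls" by (simp add: walk_of_def)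
    then show ?case using pcas_append[OF one[of vs] Cons.IH] by (simp only:)
  qed (simp add: walk_of_def)
  have arcs: "set (arcs_of (map vnum (hub # vs @ [hub]))) \<subseteq> parcs (atsp_digraph inst)" if "vs \<in> set loops" for vs
  proof
    fix e assume "e \<in> set (arcs_of (map vnum (hub # vs @ [hub])))"
    then obtain a b where ab: "e = (vnum a, vnum b)" "(a, b) \<in> set (arcs_of (hub # vs @ [hub]))"
      unfolding arcs_of_map by auto
    have "arc a b" "a \<in> box" "b \<in> box"
      using loops[OF that] set_arcs_of[OF _ ab(2), of arc] hub_in_box unfolding hub_loop_def by auto
    then show "e \<in> parcs (atsp_digraph inst)" by (simp add: ab parcs_inst vnum_less coords_vnum)
  qed
  have sub: "set ?w \<subseteq> parcs (atsp_digraph inst)" using arcs by (auto simp: walk_of_def)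
  have fsts: "map fst (arcs_of (map vnum (hub # vs @ [hub]))) = map vnum (hub # vs)" for vs
    unfolding map_fst_arcs_of by (simp add: butlast_append)
  have vis: "{..<vcount} \<subseteq> set (pawalk_verts ?h ?w)"
  proof
    fix x assume x: "x \<in> {..<vcount}"
    show "x \<in> set (pawalk_verts ?h ?w)"
    proof (cases "coords x = hub")
      case True
      then have "x = ?h" by (metis vnum_coords)
      then show ?thesis using set_pawalk_verts[OF walk] by simp
    next
      case False
      have "coords x \<in> box" using x by (simp add: coords_in_box)
      then obtain vs where vs: "vs \<in> set loops" "coords x \<in> set vs" using cover False by blast
      then have "x \<in> set (map fst (arcs_of (map vnum (hub # vs @ [hub]))))"
        unfolding fsts by (metis image_eqI list.set_intros(2) set_map vnum_coords)
      then have "x \<in> fst ` set ?w" using vs(1) by (auto simp: walk_of_def)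
      then show ?thesis using set_pawalk_verts[OF walk] by simp
    qed
  qed
  have "sum_list (map (arc_cost inst) ?w) = of_nat (\<Sum>vs\<leftarrow>loops. length (filter heavy vs))"
  proof -
    have c: "sum_list (map (arc_cost inst) (arcs_of (map vnum (hub # vs @ [hub])))) = of_nat (length (filter heavy vs))"
      if "vs \<in> set loops" for vs
    proof -
      have box: "set vs \<subseteq> box" using loops[OF that] by (simp add: hub_loop_def)
      have "map (arc_cost inst) (arcs_of (map vnum (hub # vs @ [hub]))) =
         map (\<lambda>x. of_bool (heavy (coords x))) (map fst (arcs_of (map vnum (hub # vs @ [hub]))))"
        using arcs[OF that] by (auto simp: arc_cost_inst)
      also have "\<dots> = map (\<lambda>a. of_bool (heavy a)) (hub # vs)"
        unfolding fsts using box hub_in_box coords_vnum by (auto simp del: in_box)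
      finally have "sum_list (map (arc_cost inst) (arcs_of (map vnum (hub # vs @ [hub])))) =
         (\<Sum>a\<leftarrow>vs. of_bool (heavy a))" by (simp add: not_heavy_hub)
      also have "\<dots> = of_nat (length (filter heavy vs))" by (induction vs) auto
      finally show ?thesis .
    qed
    then show ?thesis unfolding walk_of_def by (induction loops) auto
  qed
  then have "sum_list (map (arc_cost inst) ?w) \<le> budget inst"
    using cost by (simp add: inst_def)
  then show ?thesis
    unfolding atsp_yes_def Let_def pre_digraph.awalk_def cas_with_proj_eq awalk_verts_with_proj_eq
    using walk sub vis vnum_less[OF hub_in_box] by (auto simp: pverts_inst intro!: exI[of _ ?h] exI[of _ ?w])
qed

section \<open>The walk given by a satisfying assignment\<close>

definition detour :: "nat \<Rightarrow> vx list" where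
  "detour c = [(0, c, p, 0), (1, c, p, 0), (2, c, p, 0)]"

definition back_block :: "nat \<Rightarrow> nat \<Rightarrow> nat \<Rightarrow> vx list" where
  "back_block c g i = [(2, c, g, i), (1, c, g, i), (0, c, g, i)]"

text \<open>The \<open>k\<close>-th of the \<open>t + 1\<close> walks through the channel of
  \<open>g\<close>, restricted to column \<open>c\<close>. Only the walk \<open>k = t\<close> can
  take the detour, because it alone enters the chain at a \<open>z\<close> vertex.\<close>

definition passage :: "bool \<Rightarrow> nat \<Rightarrow> nat \<Rightarrow> nat \<Rightarrow> nat \<Rightarrow> vx list" where
  "passage d t c g k =
     (if k < t then [(0, c, g, k), (1, c, g, k), (2, c, g, k)]
      else (if d then detour c else []) @ concat (map (back_block c g) [t..<q - 1]) @ [(2, c, g, q - 1)])"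

lemma arc_block:
  assumes "triple c g i"
  shows "arc (0, c, g, i) (1, c, g, i)" "arc (1, c, g, i) (0, c, g, i)" "arc (1, c, g, i) (2, c, g, i)"
    "arc (2, c, g, i) (1, c, g, i)"
  using assms by (simp_all add: arc_def)

text \<open>The claim about the first vertex is carried along in order to connect the list to the
  block in front of it, and later to the junction or the detour.\<close>

lemma successively_back:
  assumes c: "c < M" "g < p" and j: "j \<le> q - 1"
  shows "successively arc (concat (map (back_block c g) [j..<q - 1]) @ [(2, c, g, q - 1), (3, c + 1, g, 0)]) \<and>
    hd (concat (map (back_block c g) [j..<q - 1]) @ [(2, c, g, q - 1), (3, c + 1, g, 0)]) = (2, c, g, j)"
  using j
proof (induction j rule: inc_induct)
  case base
  then show ?case using c by (simp add: arc_def)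
next
  case (step j)
  define R where "R = concat (map (back_block c g) [Suc j..<q - 1]) @ [(2, c, g, q - 1), (3, c + 1, g, 0)]"
  have t: "triple c g j" using c step by (simp add: triple_def)
  have "[j..<q - 1] = j # [Suc j..<q - 1]" using step by (simp add: upt_conv_Cons)
  then have e: "concat (map (back_block c g) [j..<q - 1]) @ [(2, c, g, q - 1), (3, c + 1, g, 0)] =
     (2, c, g, j) # (1, c, g, j) # (0, c, g, j) # R" by (simp add: back_block_def R_def)
  have a: "arc (0, c, g, j) (2, c, g, Suc j)" using c by (simp add: arc_def)
  have R: "successively arc R" "hd R = (2, c, g, Suc j)" using step.IH by (simp_all only: R_def)
  show ?case unfolding e using R a arc_block[OF t] by (cases R) auto
qed

lemma successively_passage:
  assumes c: "c < M" "g < p" and t: "t < q" "k \<le> t" and d: "d \<Longrightarrow> g = grp c \<and> tst c t"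
  shows "successively arc ((3, c, g, 0) # passage d t c g k @ [(3, c + 1, g, 0)])"
proof (cases "k < t")
  case True
  then have "triple c g k" using c t by (simp add: triple_def)
  moreover have "arc (3, c, g, 0) (0, c, g, k)" "arc (2, c, g, k) (3, c + 1, g, 0)" using c t True by (simp_all add: arc_def)
  ultimately show ?thesis using True arc_block[of c g k] by (simp add: passage_def)
next
  case False
  define R where "R = concat (map (back_block c g) [t..<q - 1]) @ [(2, c, g, q - 1), (3, c + 1, g, 0)]"
  have e: "(3, c, g, 0) # passage d t c g k @ [(3, c + 1, g, 0)] = ((3, c, g, 0) # (if d then detour c else [])) @ R"
    using False by (simp add: passage_def R_def)
  have "t \<le> q - 1" using t by simp
  from successively_back[OF c this] have R: "successively arc R" "hd R = (2, c, g, t)" by (simp_all only: R_def)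
  have tr: "triple c p 0" using c by (simp add: triple_def)
  have "successively arc ((3, c, g, 0) # (if d then detour c else [])) \<and>
      arc (last ((3, c, g, 0) # (if d then detour c else []))) (2, c, g, t)"
  proof (cases d)
    case True
    then have "arc (3, c, g, 0) (0, c, p, 0)" "arc (2, c, p, 0) (2, c, g, t)" using d c by (simp_all add: arc_def)
    then show ?thesis using True arc_block[OF tr] by (simp add: detour_def)
  next
    case False
    have "arc (3, c, g, 0) (2, c, g, t)" using c by (simp add: arc_def)
    then show ?thesis using False by simp
  qed
  then show ?thesis unfolding e successively_append_iff using R by auto
qed

definition channel :: "(nat \<Rightarrow> bool) \<Rightarrow> nat \<Rightarrow> nat \<Rightarrow> nat \<Rightarrow> vx list" where
  "channel d t g k = concat (map (\<lambda>c. (3, c, g, 0) # passage (d c) t c g k) [0..<M]) @ [(3, M, g, 0)]"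

lemma set_passage: "c < M \<Longrightarrow> g < p \<Longrightarrow> t < q \<Longrightarrow> k \<le> t \<Longrightarrow> set (passage d t c g k) \<subseteq> box"
  using q_ge by (auto simp: passage_def detour_def back_block_def)

lemma hub_loop_channel:
  assumes g: "g < p" and t: "t < q" "k \<le> t" and d: "\<And>c. c < M \<Longrightarrow> d c \<Longrightarrow> g = grp c \<and> tst c t"
  shows "hub_loop (channel d t g k)"
proof -
  have pre: "successively arc (hub # concat (map (\<lambda>c. (3, c, g, 0) # passage (d c) t c g k) [0..<m]) @ [(3, m, g, 0)])"
    if "m \<le> M" for m
    using that
  proof (induction m)
    case 0
    then show ?case using g by (simp add: arc_def from_hub_def hub_def)
  next
    case (Suc m)
    let ?X = "hub # concat (map (\<lambda>c. (3, c, g, 0) # passage (d c) t c g k) [0..<m])"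
    let ?Y = "passage (d m) t m g k @ [(3, Suc m, g, 0)]"
    have IH: "successively arc (?X @ [(3, m, g, 0)])" using Suc by simp
    have Y: "successively arc ((3, m, g, 0) # ?Y)"
      using successively_passage[of m g t k "d m"] Suc.prems g t d[of m] by simp
    have "successively arc ((?X @ [(3, m, g, 0)]) @ ?Y)"
      unfolding successively_append_iff[of arc "?X @ [(3, m, g, 0)]"]
      using IH Y by (auto simp: successively_Cons)
    then show ?case by simp
  qed
  have "arc (3, M, g, 0) hub" using g by (simp add: arc_def to_hub_def hub_def)
  then have "successively arc ((hub # channel d t g k) @ [hub])"
    unfolding successively_append_iff using pre[of M] by (simp add: channel_def)
  moreover have "set (channel d t g k) \<subseteq> box"
  proof
    fix a assume "a \<in> set (channel d t g k)"
    then have "(\<exists>c\<le>M. a = (3, c, g, 0)) \<or> (\<exists>c<M. a \<in> set (passage (d c) t c g k))"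
      by (auto simp: channel_def)
    then show "a \<in> box"
    proof
      assume "\<exists>c\<le>M. a = (3, c, g, 0)"
      then show ?thesis using g q_ge by auto
    next
      assume "\<exists>c<M. a \<in> set (passage (d c) t c g k)"
      then show ?thesis using set_passage[OF _ g t] by blast
    qed
  qed
  ultimately show ?thesis by (simp add: hub_loop_def)
qed

definition token_loop :: "nat \<Rightarrow> nat \<Rightarrow> nat \<Rightarrow> vx list" where
  "token_loop c c' i = [(4, c, p, i), (3, c, p, 0), (2, c', p, 0), (1, c', p, 0), (0, c', p, 0)]"

lemma hub_loop_token:
  assumes "c < M" "c mod 3 = 0" "c' < M" "c = c' - c' mod 3" "i < 2"
  shows "hub_loop (token_loop c c' i)"
proof -
  have t: "triple c' p 0" using assms by (simp add: triple_def)
  have "arc hub (4, c, p, i)" "arc (4, c, p, i) (3, c, p, 0)" "arc (0, c', p, 0) hub"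
    using assms by (simp_all add: arc_def from_hub_def to_hub_def token_def hub_def)
  moreover have "arc (3, c, p, 0) (2, c', p, 0)" using assms by (simp add: arc_def)
  ultimately show ?thesis using assms arc_block[OF t] q_ge by (simp add: hub_loop_def token_loop_def)
qed

lemma hub_loop_junk: "a \<in> box \<Longrightarrow> junk a \<Longrightarrow> hub_loop [a]"
  by (cases a) (simp add: hub_loop_def arc_def from_hub_def to_hub_def hub_def)

lemma heavy_passage:
  assumes c: "c < M" "g < p" and t: "t < q" "k \<le> t"
  shows "length (filter heavy (passage d t c g k)) =
    (if k < t then 3 else 3 * of_bool d + 3 * (q - 1 - t) + 1)"
proof -
  have h: "heavy (k, c, g, i)" if "k < 3" "i + 1 < q" for k i using c that by (simp add: heavy_def triple_def)
  have "length (filter heavy (concat (map (back_block c g) [j..<q - 1]))) = 3 * (q - 1 - j)" if "j \<le> q - 1" for j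
    using that
  proof (induction j rule: inc_induct)
    case (step j)
    have "[j..<q - 1] = j # [Suc j..<q - 1]" using step by (simp add: upt_conv_Cons)
    then show ?case using step h[of _ j] by (simp add: back_block_def)
  qed simp
  moreover have "heavy (2, c, g, q - 1)" using c q_ge by (simp add: heavy_def)
  moreover have "length (filter heavy (detour c)) = 3" using c by (simp add: detour_def heavy_def triple_def)
  ultimately show ?thesis using t h[of _ k] by (auto simp: passage_def)
qed

text \<open>In each column the \<open>t\<close> forward triples, the \<open>q - 1 - t\<close>
  backward ones and the last \<open>z\<close> vertex are exactly the chain. Its contribution is thus
  independent of \<open>t\<close>; each detour adds three vertices.\<close>

lemma heavy_channel:
  assumes g: "g < p" and t: "t < q"
  shows "(\<Sum>k<Suc t. length (filter heavy (channel d t g k))) =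
    M * (3 * (q - 1) + 1) + 3 * (\<Sum>c<M. of_bool (d c))"
proof -
  have nl: "\<not> heavy (3, c, g, 0)" for c by (simp add: heavy_def token_def)
  have "length (filter heavy (channel d t g k)) = (\<Sum>c<M. length (filter heavy (passage (d c) t c g k)))" for k
    by (simp add: channel_def nl filter_concat length_concat comp_def interv_sum_list_conv_sum_set_nat lessThan_atLeast0)
  then have "(\<Sum>k<Suc t. length (filter heavy (channel d t g k))) =
     (\<Sum>c<M. \<Sum>k<Suc t. length (filter heavy (passage (d c) t c g k)))"
    by (simp only: sum.swap[of _ "{..<M}"])
  also have "\<dots> = (\<Sum>c<M. (3 * (q - 1) + 1) + 3 * of_bool (d c))"
  proof (rule sum.cong)
    fix c assume "c \<in> {..<M}"
    then have "(\<Sum>k<Suc t. length (filter heavy (passage (d c) t c g k))) =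
       (\<Sum>k<Suc t. if k < t then 3 else 3 * of_bool (d c) + 3 * (q - 1 - t) + 1)"
      by (intro sum.cong) (use heavy_passage g t in auto)
    also have "\<dots> = 3 * t + (3 * of_bool (d c) + 3 * (q - 1 - t) + 1)" by simp
    also have "\<dots> = (3 * (q - 1) + 1) + 3 * of_bool (d c)" using t by simp
    finally show "(\<Sum>k<Suc t. length (filter heavy (passage (d c) t c g k))) = (3 * (q - 1) + 1) + 3 * of_bool (d c)" .
  qed simp
  also have "\<dots> = M * (3 * (q - 1) + 1) + 3 * (\<Sum>c<M. of_bool (d c))"
    by (simp only: sum.distrib sum_distrib_left[symmetric] sum_constant card_lessThan of_nat_id)
      (simp add: algebra_simps)
  finally show ?thesis .
qed

text \<open>For each clause one satisfied literal is selected, and its detour is made by the last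
  walk of its group. The tokens pass the two remaining detours backwards, and every junk vertex gets
  a loop of its own.\<close>

theorem yes_complete:
  assumes t: "\<And>g. g < p \<Longrightarrow> t g < q"
    and sat: "\<And>c. c < M \<Longrightarrow> c mod 3 = 0 \<Longrightarrow> \<exists>l<3. tst (c + l) (t (grp (c + l)))"
  shows "atsp_yes inst"
proof -
  define l where "l = (\<lambda>c. SOME l. l < 3 \<and> tst (c + l) (t (grp (c + l))))"
  have l: "l c < 3 \<and> tst (c + l c) (t (grp (c + l c)))" if "c < M" "c mod 3 = 0" for c
    unfolding l_def by (rule someI_ex) (use sat[OF that] in blast)
  define sel where "sel = (\<lambda>c. c mod 3 = l (c - c mod 3))"
  define d where "d = (\<lambda>g c. sel c \<and> grp c = g)"
  \<comment> \<open>The two columns of the clause that are not selected are at the offsets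
    \<open>l + 1\<close> and \<open>l + 2\<close> modulo 3.\<close>
  define oth where "oth = (\<lambda>c i. c + (l c + 1 + i) mod 3)"
  define cs where "cs = filter (\<lambda>c. c mod 3 = 0) [0..<M]"
  obtain js where js: "set js = {a \<in> box. junk a}"
    using finite_list[of "{a \<in> box. junk a}"] finite_box by auto
  define chs where "chs = concat (map (\<lambda>g. map (channel (d g) (t g) g) [0..<Suc (t g)]) [0..<p])"
  define toks where "toks = concat (map (\<lambda>c. [token_loop c (oth c 0) 0, token_loop c (oth c 1) 1]) cs)"
  define loops where "loops = chs @ toks @ map (\<lambda>a. [a]) js"
  have base: "c - c mod 3 < M" "(c - c mod 3) mod 3 = 0" if "c < M" for c :: nat
    using that by (auto simp: minus_mod_eq_mult_div)
  have sel_tst: "tst c (t (grp c))" if "c < M" "sel c" for c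
  proof -
    have "c - c mod 3 + l (c - c mod 3) = c" using that(2) by (simp add: sel_def)
    then show ?thesis using l[OF base[OF that(1)]] by simp
  qed
  have oth: "oth c i < M \<and> c = oth c i - oth c i mod 3" if "c < M" "c mod 3 = 0" for c i
  proof -
    have "(l c + 1 + i) mod 3 < 3" by simp
    then show ?thesis using that M_mult[OF that] unfolding mod3_cases oth_def by linarith
  qed
  have chs: "set chs = (\<Union>g\<in>{0..<p}. channel (d g) (t g) g ` {0..<Suc (t g)})"
    by (simp add: chs_def del: upt_Suc)
  have cs: "set cs = {c. c < M \<and> c mod 3 = 0}" by (auto simp: cs_def)
  show ?thesis
  proof (rule yes_if_loops[of loops])
    fix vs assume "vs \<in> set loops"
    then consider "vs \<in> set chs" | "vs \<in> set toks" | a where "a \<in> set js" "vs = [a]"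
      by (auto simp: loops_def simp del: split_paired_All split_paired_Ex)
    then show "hub_loop vs"
    proof cases
      case 1
      then obtain g k where "g \<in> {0..<p}" "k \<in> {0..<Suc (t g)}" "vs = channel (d g) (t g) g k"
        unfolding chs by blast
      then show ?thesis using t sel_tst by (auto intro!: hub_loop_channel simp: d_def)
    next
      case 2
      then obtain c where "c \<in> set cs" "vs = token_loop c (oth c 0) 0 \<or> vs = token_loop c (oth c 1) 1"
        by (auto simp: toks_def)
      then obtain i where i: "c \<in> set cs" "i < 2" "vs = token_loop c (oth c i) i"
        using zero_less_numeral one_less_numeral_iff semiring_norm(76) by blast
      then have c: "c < M" "c mod 3 = 0" using cs by auto
      from oth[OF c, of i] show ?thesis unfolding i(3) by (intro hub_loop_token[OF c _ _ i(2)]) blast+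
    next
      case 3
      then show ?thesis using js hub_loop_junk by blast
    qed
  next
    fix a assume a: "a \<in> box" "a \<noteq> hub"
    have ch: "\<exists>vs\<in>set loops. a \<in> set vs" if "g < p" "k \<le> t g" "a \<in> set (channel (d g) (t g) g k)" for g k
    proof -
      have "channel (d g) (t g) g k \<in> set loops" 
      proof -
        have "g \<in> {0..<p}" "k \<in> {0..<Suc (t g)}" using that by auto
        then have "channel (d g) (t g) g k \<in> set chs" unfolding chs by blast
        then show ?thesis by (simp add: loops_def)
      qed
      then show ?thesis using that(3) by blast
    qed
    have pas: "\<exists>vs\<in>set loops. a \<in> set vs" if "g < p" "k \<le> t g" "c < M" "a \<in> set (passage (d g c) (t g) c g k)" for g k c
      by (rule ch[OF that(1,2)]) (use that(3,4) in \<open>auto simp: channel_def\<close>)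
    have tk: "\<exists>vs\<in>set loops. a \<in> set vs" if "c < M" "c mod 3 = 0" "i < 2" "a \<in> set (token_loop c (oth c i) i)" for c i
    proof -
      have "i = 0 \<or> i = 1" using that(3) by auto
      then have "token_loop c (oth c i) i \<in> set loops" using that cs by (auto simp: loops_def toks_def)
      then show ?thesis using that(4) by blast
    qed
    obtain k c g i where kcgi: "a = (k, c, g, i)" by (cases a)
    have bx: "k < 5" "c \<le> M" "g \<le> p" "i < q" using a kcgi by auto
    consider "junk a" | "k < 3" "c < M" "g < p" "i + 1 < q" | "k < 3" "c < M" "g = p" "i = 0"
      | "k = 2" "c < M" "g < p" "i + 1 = q" | "token a" | "k = 3" "i = 0" "g < p"
      | "k = 3" "i = 0" "g = p" "c < M" "c mod 3 = 0"
      using a by (auto simp: kcgi junk_def heavy_def light_def triple_def)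
    then show "\<exists>vs\<in>set loops. a \<in> set vs"
    proof cases
      case 1
      then have "[a] \<in> set loops" using js a by (auto simp: loops_def simp del: in_box)
      then show ?thesis by force
    next
      case 2
      then have k: "k = 0 \<or> k = 1 \<or> k = 2" by auto
      show ?thesis
      proof (cases "i < t g")
        case True
        show ?thesis by (rule pas[of g i c]) (use True 2 k in \<open>auto simp: passage_def kcgi\<close>)
      next
        case False
        show ?thesis
          by (rule pas[of g "t g" c]) (use False 2 k in \<open>auto simp: passage_def kcgi back_block_def intro!: bexI[of _ i]\<close>)
      qed
    next
      case 3
      then have k: "k = 0 \<or> k = 1 \<or> k = 2" by auto
      show ?thesis
      proof (cases "sel c")
        case True
        then have "d (grp c) c" by (simp add: d_def)
        then show ?thesis
          by (intro pas[of "grp c" "t (grp c)" c]) (use 3 k grp_less in \<open>auto simp: passage_def kcgi detour_def\<close>)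
      next
        case False
        let ?c = "c - c mod 3"
        note lc = l[OF base[OF 3(2)]]
        have "\<exists>i<2. (l ?c + 1 + i) mod 3 = c mod 3"
          by (rule other_thirds) (use lc False in \<open>simp_all add: sel_def\<close>)
        then obtain i' where i': "i' < 2" "(l ?c + 1 + i') mod 3 = c mod 3" by blast
        then have "oth ?c i' = c" by (simp add: oth_def)
        then show ?thesis
          by (intro tk[of ?c i']) (use base[OF 3(2)] i' 3 k in \<open>auto simp: token_loop_def kcgi\<close>)
      qed
    next
      case 4
      have "i = q - 1" using 4 by simp
      then show ?thesis by (intro pas[of g "t g" c]) (use 4 in \<open>auto simp: passage_def kcgi\<close>)
    next
      case 5
      then show ?thesis by (intro tk[of c i]) (auto simp: token_def kcgi token_loop_def)
    next
      case 6
      show ?thesis by (rule ch[of g 0]) (use 6 bx in \<open>auto simp: channel_def kcgi\<close>)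
    next
      case 7
      show ?thesis by (rule tk[of c 0]) (use 7 in \<open>auto simp: kcgi token_loop_def\<close>)
    qed
  next
    have tok: "length (filter heavy (token_loop c c' i)) \<le> 4" for c c' i
      by (simp add: token_loop_def heavy_def token_def)
    have "(\<Sum>vs\<leftarrow>toks. length (filter heavy vs)) \<le> 8 * length cs"
      unfolding toks_def
    proof (induction cs)
      case (Cons c cs)
      then show ?case using tok[of c "oth c 0" 0] tok[of c "oth c 1" 1] by simp
    qed simp
    moreover have "length cs = M div 3"
    proof -
      have "length cs = card (set cs)" by (simp add: cs_def distinct_card[symmetric])
      then show ?thesis using card_clauses cs by simp
    qed
    moreover have "(\<Sum>vs\<leftarrow>map (\<lambda>a. [a]) js. length (filter heavy vs)) = 0"
      using js by (auto simp: junk_def simp del: split_paired_All)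
    moreover have "(\<Sum>vs\<leftarrow>chs. length (filter heavy vs)) = M * p * (3 * (q - 1) + 1) + 3 * (M div 3)"
    proof -
      have "(\<Sum>vs\<leftarrow>chs. length (filter heavy vs)) = (\<Sum>g<p. \<Sum>k<Suc (t g). length (filter heavy (channel (d g) (t g) g k)))"
        unfolding chs_def sum_list_map_concat map_map comp_def
        by (simp add: interv_sum_list_conv_sum_set_nat lessThan_atLeast0 del: upt_Suc)
      also have "\<dots> = (\<Sum>g<p. M * (3 * (q - 1) + 1) + 3 * (\<Sum>c<M. of_bool (d g c)))"
        by (rule sum.cong) (use heavy_channel t in auto)
      also have "\<dots> = p * (M * (3 * (q - 1) + 1)) + 3 * (\<Sum>g<p. \<Sum>c<M. of_bool (d g c))"
        by (simp only: sum.distrib sum_distrib_left[symmetric] sum_constant card_lessThan of_nat_id)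
      (simp add: algebra_simps)
      also have "(\<Sum>g<p. \<Sum>c<M. of_bool (d g c)) = (\<Sum>c<M. \<Sum>g<p. of_bool (d g c) :: nat)" by (rule sum.swap)
      also have "\<dots> = (\<Sum>c<M. of_bool (sel c))"
      proof (rule sum.cong)
        fix c assume "c \<in> {..<M}"
        then have "grp c < p" using grp_less by simp
        have "(\<Sum>g<p. of_bool (d g c)) = (\<Sum>g<p. if g = grp c then of_bool (sel c) else (0::nat))"
          by (rule sum.cong) (auto simp: d_def)
        also have "\<dots> = of_bool (sel c)" using \<open>grp c < p\<close> by simp
        finally show "(\<Sum>g<p. of_bool (d g c)) = (of_bool (sel c) :: nat)" .
      qed simp
      also have "\<dots> = M div 3"
      proof -
        obtain m where m: "M = 3 * m" using M3 by blast
        have "(\<Sum>c<M. of_bool (sel c)) = (\<Sum>j<m. of_bool (sel (3 * j)) + of_bool (sel (3 * j + 1)) + of_bool (sel (3 * j + 2)) :: nat)"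
          unfolding m by (rule sum_thirds)
        also have "\<dots> = (\<Sum>j<m. 1)"
        proof (rule sum.cong)
          fix j assume "j \<in> {..<m}"
          then have "l (3 * j) < 3" using l[of "3 * j"] m by simp
          then have "l (3 * j) = 0 \<or> l (3 * j) = 1 \<or> l (3 * j) = 2" by linarith
          moreover have "3 * j mod 3 = 0" "(3 * j + 1) mod 3 = 1" "(3 * j + 2) mod 3 = 2" by presburger+
          ultimately show "of_bool (sel (3 * j)) + of_bool (sel (3 * j + 1)) + of_bool (sel (3 * j + 2)) = (1::nat)"
            unfolding sel_def by auto
        qed simp
        finally show ?thesis by (simp add: m)
      qed
      finally show ?thesis by (simp add: algebra_simps)
    qed
    \<comment> \<open>Per clause: 3 vertices of the selected detour and 8 of the two token loops,
      against 9 detour vertices and 2 tokens in the budget.\<close>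
    moreover have "3 * (M div 3) + 8 * (M div 3) \<le> 3 * M + 2 * (M div 3)" by simp
    ultimately show "(\<Sum>vs\<leftarrow>loops. length (filter heavy vs)) \<le> budget_nat"
      unfolding loops_def map_append sum_list_append budget_nat_def by linarith
  qed
qed

end


section \<open>Pathwidth of the graph\<close>

text \<open>When bags are the points of a line and vertices are intervals, the bags containing a
  vertex are automatically consecutive. It remains to let the intervals of adjacent vertices
  meet.\<close>

lemma interval_path_decomposition:
  fixes G :: "'a pair_pre_digraph" and lo hi :: "'a \<Rightarrow> nat"
  assumes "\<And>v. v \<in> pverts G \<Longrightarrow> lo v \<le> hi v \<and> lo v < n" "0 < n"
    and "\<And>u v. (u, v) \<in> parcs G \<Longrightarrow> u \<in> pverts G \<and> v \<in> pverts G \<and>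
           (\<exists>x<n. lo u \<le> x \<and> x \<le> hi u \<and> lo v \<le> x \<and> x \<le> hi v)"
  shows "path_decomposition G (map (\<lambda>x. {v \<in> pverts G. lo v \<le> x \<and> x \<le> hi v}) [0..<n])"
  unfolding path_decomposition_def
proof (intro conjI)
  let ?B = "\<lambda>x. {v \<in> pverts G. lo v \<le> x \<and> x \<le> hi v}"
  show "map ?B [0..<n] \<noteq> []" using assms(2) by simp
  show "\<Union> (set (map ?B [0..<n])) = pverts G"
  proof (intro equalityI subsetI)
    fix v assume "v \<in> pverts G"
    then have "v \<in> ?B (lo v)" "lo v < n" using assms(1) by auto
    then show "v \<in> \<Union> (set (map ?B [0..<n]))" by auto
  qed auto
  show "\<forall>(u, v)\<in>parcs G. \<exists>B\<in>set (map ?B [0..<n]). u \<in> B \<and> v \<in> B"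
  proof (clarify)
    fix u v assume "(u, v) \<in> parcs G"
    then obtain x where "x < n" "u \<in> ?B x" "v \<in> ?B x" using assms(3) by blast
    then show "\<exists>B\<in>set (map ?B [0..<n]). u \<in> B \<and> v \<in> B" by auto
  qed
  show "\<forall>i j k. i \<le> j \<and> j \<le> k \<and> k < length (map ?B [0..<n]) \<longrightarrow>
      map ?B [0..<n] ! i \<inter> map ?B [0..<n] ! k \<subseteq> map ?B [0..<n] ! j"
    by auto
qed

lemma digraph_pathwidth_le:
  assumes "path_decomposition (mk_symmetric (with_proj D)) Bs" "\<And>B. B \<in> set Bs \<Longrightarrow> card B \<le> w + 1"
  shows "digraph_pathwidth D \<le> w"
proof -
  have "Bs \<noteq> []" using assms(1) by (simp add: path_decomposition_def)
  then have "Max (card ` set Bs) \<le> w + 1" using assms(2) by (intro Max.boundedI) auto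
  then have "decomposition_width Bs \<le> w" by (simp add: decomposition_width_def)
  moreover have "digraph_pathwidth D \<le> decomposition_width Bs"
    unfolding digraph_pathwidth_def pathwidth_def by (rule Least_le) (use assms(1) in blast)
  ultimately show ?thesis by simp
qed

context tsp_reduction
begin

definition slot :: "nat \<Rightarrow> nat \<Rightarrow> nat \<Rightarrow> nat" where
  "slot c g i = (c * (p + 1) + g) * q + i"

text \<open>Slots are swept column by column, then by group and index, and the interval of a vertex
  contains its own slot. A junction starts a column early, to meet the \<open>z\<close> vertices
  leading to it; \<open>z_i\<close> starts one slot early, to meet \<open>x_(i-1)\<close>; the
  vertices of a detour stay for their whole column.\<close>

definition first_bag :: "vx \<Rightarrow> nat" where
  "first_bag = (\<lambda>(k, c, g, i).
     if (k, c, g, i) = hub then 0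
     else if k = 3 \<and> i = 0 then slot c g 0 - (p + 1) * q
     else if k = 2 \<and> g < p then slot c g i - 1
     else if k < 3 \<and> g = p \<and> i = 0 then slot c 0 0
     else slot c g i)"

text \<open>A junction stays for two further columns because the junction of a clause leads to the
  detours of all three columns of the clause.\<close>

definition last_bag :: "vx \<Rightarrow> nat" where
  "last_bag = (\<lambda>(k, c, g, i).
     if (k, c, g, i) = hub then (M + 1) * (p + 1) * q
     else if k = 3 \<and> i = 0 then slot c g 0 + 2 * (p + 1) * q
     else if k < 3 \<and> g = p \<and> i = 0 then slot c p (q - 1)
     else slot c g i)"

lemma slot_less: "c \<le> M \<Longrightarrow> g \<le> p \<Longrightarrow> i < q \<Longrightarrow> slot c g i < (M + 1) * (p + 1) * q"
proof -
  assume *: "c \<le> M" "g \<le> p" "i < q"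
  have "c * (p + 1) + g < (c + 1) * (p + 1)" using *(2) by simp
  also have "\<dots> \<le> (M + 1) * (p + 1)" using *(1) by (intro mult_le_mono1) simp
  finally have "c * (p + 1) + g + 1 \<le> (M + 1) * (p + 1)" by simp
  then have "(c * (p + 1) + g + 1) * q \<le> (M + 1) * (p + 1) * q" by (rule mult_le_mono1)
  moreover have "slot c g i < (c * (p + 1) + g + 1) * q" using *(3) by (simp add: slot_def)
  ultimately show ?thesis by linarith
qed

lemma slot_mono: "g \<le> g' \<Longrightarrow> i < q \<Longrightarrow> slot c g i \<le> slot c g' (q - 1)"
  unfolding slot_def by (intro add_mono mult_le_mono1) auto

lemma slot_start: "slot c 0 0 \<le> slot c g i"
  unfolding slot_def by (simp add: trans_le_add1)

lemma slot_Suc_column: "slot (c + 1) g 0 = slot c g 0 + (p + 1) * q"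
  by (simp add: slot_def algebra_simps)

lemma own_bag:
  assumes "(k, c, g, i) \<in> box"
  shows "first_bag (k, c, g, i) \<le> slot c g i \<and> slot c g i \<le> last_bag (k, c, g, i)"
  using assms slot_less[of c g i] slot_start[of c g i] slot_mono[of g p i c]
  by (auto simp: first_bag_def last_bag_def slot_def)

text \<open>In each case the slot of one end lies in the interval of the other end. By
  \<open>own_bag\<close> this slot is a common bag.\<close>

lemma arc_common_bag:
  assumes "arc a b" "a \<in> box" "b \<in> box"
  shows "\<exists>x<(M + 1) * (p + 1) * q. first_bag a \<le> x \<and> x \<le> last_bag a \<and> first_bag b \<le> x \<and> x \<le> last_bag b"
proof -
  obtain k c g i where a: "a = (k, c, g, i)" by (cases a)
  obtain k' c' g' i' where b: "b = (k', c', g', i')" by (cases b)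
  have bx: "c \<le> M" "g \<le> p" "i < q" "c' \<le> M" "g' \<le> p" "i' < q" using assms by (auto simp: a b)
  note oa = own_bag[OF assms(2)[unfolded a]] and ob = own_bag[OF assms(3)[unfolded b]]
  have sa: "slot c g i < (M + 1) * (p + 1) * q" and sb: "slot c' g' i' < (M + 1) * (p + 1) * q"
    using slot_less bx by auto
  have A: ?thesis if "first_bag b \<le> slot c g i \<and> slot c g i \<le> last_bag b"
    using that oa sa unfolding a by blast
  have B: ?thesis if "first_bag a \<le> slot c' g' i' \<and> slot c' g' i' \<le> last_bag a"
    using that ob sb unfolding b by blast
  have junction: "first_bag (3, c, g, 0) \<le> slot c g j \<and> slot c g j \<le> last_bag (3, c, g, 0)" if "j < q" for c g j
  proof -
    have "j \<le> 2 * (p + 1) * q" using that by simp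
    then show ?thesis by (simp add: first_bag_def last_bag_def hub_def slot_def)
  qed
  have detour: "first_bag (k, c, p, 0) \<le> slot c g j \<and> slot c g j \<le> last_bag (k, c, p, 0)"
    if "g \<le> p" "j < q" "k < 3" for k c g j
    using that slot_start[of c g j] slot_mono[OF that(1,2), of c]
    by (auto simp: first_bag_def last_bag_def hub_def)
  have "c = c' \<and> g = g' \<and> i = i' \<or>
    c = c' \<and> g = g' \<and> g < p \<and> k = 0 \<and> k' = 2 \<and> i' = i + 1 \<or>
    c = c' \<and> g = g' \<and> k = 3 \<and> i = 0 \<or>
    c' = c + 1 \<and> g = g' \<and> k = 2 \<and> k' = 3 \<and> i' = 0 \<or>
    c = c' \<and> g' = p \<and> k' = 0 \<and> i' = 0 \<or>
    c = c' \<and> g = p \<and> k = 2 \<and> i = 0 \<or>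
    g = p \<and> g' = p \<and> c = c' - c' mod 3 \<and> k = 3 \<and> i = 0 \<and> i' = 0 \<or>
    k' = 3 \<and> c' = c \<and> g' = p \<and> g = p \<and> i' = 0 \<or>
    a = hub \<or>
    b = hub"
    using assms(1) unfolding arc_def a b prod.case token_def by (elim disjE conjE) simp_all
  then show ?thesis
  proof (elim disjE conjE)
    assume "c = c'" "g = g'" "i = i'"
    then show ?thesis using A ob by (simp add: b)
  next
    assume *: "c = c'" "g = g'" "g < p" "k = 0" "k' = 2" "i' = i + 1"
    show ?thesis by (rule A) (use * in \<open>simp add: b first_bag_def last_bag_def hub_def slot_def\<close>)
  next
    assume *: "c = c'" "g = g'" "k = 3" "i = 0"
    show ?thesis by (rule B) (use junction[of i' c g] * bx in \<open>simp add: a\<close>)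
  next
    assume *: "c' = c + 1" "g = g'" "k = 2" "k' = 3" "i' = 0"
    show ?thesis
    proof (rule A)
      have "first_bag b = slot c g 0" "last_bag b = slot c g 0 + (p + 1) * q + 2 * (p + 1) * q"
        using * slot_Suc_column[of c g] by (simp_all add: b first_bag_def last_bag_def hub_def)
      moreover have "q \<le> (p + 1) * q" by simp
      ultimately show "first_bag b \<le> slot c g i \<and> slot c g i \<le> last_bag b"
        using bx by (simp add: slot_def)
    qed
  next
    assume *: "c = c'" "g' = p" "k' = 0" "i' = 0"
    show ?thesis by (rule A) (use detour[of g i 0 c] * bx in \<open>simp add: b\<close>)
  next
    assume *: "c = c'" "g = p" "k = 2" "i = 0"
    show ?thesis by (rule B) (use detour[of g' i' 2 c] * bx in \<open>simp add: a\<close>)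
  next
    assume *: "g = p" "g' = p" "c = c' - c' mod 3" "k = 3" "i = 0" "i' = 0"
    show ?thesis
    proof (rule B)
      have c': "c' \<le> c + 2" "c \<le> c'" using *(3) by (auto simp: mod3_cases)
      have "slot c' p 0 \<le> slot (c + 2) p 0" using c' unfolding slot_def by (intro add_mono mult_le_mono) auto
      also have "slot (c + 2) p 0 = slot c p 0 + 2 * (p + 1) * q" by (simp add: slot_def algebra_simps)
      finally have u: "slot c' p 0 \<le> slot c p 0 + 2 * (p + 1) * q" .
      have "slot c p 0 \<le> slot c' p 0" using c' unfolding slot_def by (intro add_mono mult_le_mono) auto
      then show "first_bag a \<le> slot c' g' i' \<and> slot c' g' i' \<le> last_bag a"
        using * u by (simp add: a first_bag_def last_bag_def hub_def)
    qed
  next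
    assume *: "k' = 3" "c' = c" "g' = p" "g = p" "i' = 0"
    show ?thesis by (rule A) (use junction[of i c p] * bx in \<open>simp add: b\<close>)
  next
    assume *: "a = hub"
    show ?thesis by (rule B) (use sb * in \<open>simp add: first_bag_def last_bag_def hub_def\<close>)
  next
    assume *: "b = hub"
    show ?thesis by (rule A) (use sa * in \<open>simp add: first_bag_def last_bag_def hub_def\<close>)
  qed
qed

text \<open>A bag contains at most the hub, the 5 vertices of its own slot, the \<open>z\<close>
  vertex of the next slot, \<open>3 p + 4\<close> junctions and the 3 vertices of the detour of its
  column. This is the origin of \<open>3 p + 14\<close>.\<close>

lemma card_bag: "card {v \<in> {..<vcount}. first_bag (coords v) \<le> x \<and> x \<le> last_bag (coords v)} \<le> 3 * p + 14"
proof -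
  \<comment> \<open>\<open>y\<close> is the number of the block of \<open>q\<close> slots, one for
    each column and group, that contains \<open>x\<close>; \<open>z\<close> is the column. Junctions
    reach from \<open>p + 1\<close> blocks before their own to \<open>2 (p + 1)\<close> blocks after
    it.\<close>
  define y where "y = x div q"
  define z where "z = x div ((p + 1) * q)"
  let ?A1 = "{vnum hub}" and ?A2 = "(\<lambda>k. 5 * x + k) ` {..<5}" and ?A3 = "{5 * (x + 1) + 2}"
  let ?A4 = "(\<lambda>s. 5 * (s * q) + 3) ` {y - 2 * (p + 1)..y + (p + 1)}"
  let ?A5 = "(\<lambda>k. 5 * ((z * (p + 1) + p) * q) + k) ` {..<3}"
  have q0: "0 < q" using q_ge by simp
  have "{v \<in> {..<vcount}. first_bag (coords v) \<le> x \<and> x \<le> last_bag (coords v)} \<subseteq> ?A1 \<union> ?A2 \<union> ?A3 \<union> ?A4 \<union> ?A5"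
  proof
    fix v assume "v \<in> {v \<in> {..<vcount}. first_bag (coords v) \<le> x \<and> x \<le> last_bag (coords v)}"
    then have v: "v < vcount" "first_bag (coords v) \<le> x" "x \<le> last_bag (coords v)" by auto
    obtain k c g i where cv: "coords v = (k, c, g, i)" by (cases "coords v")
    have "coords v \<in> box" using v(1) by (simp only: coords_in_box)
    then have bx: "k < 5" "c \<le> M" "g \<le> p" "i < q" by (auto simp: cv)
    have vn: "v = 5 * slot c g i + k" using vnum_coords[of v] by (simp add: cv vnum_def slot_def)
    consider "coords v = hub" | "coords v \<noteq> hub" "k = 3" "i = 0"
      | "coords v \<noteq> hub" "k = 2" "g < p" | "coords v \<noteq> hub" "k < 3" "g = p" "i = 0"
      | "first_bag (coords v) = slot c g i" "last_bag (coords v) = slot c g i"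
      by (fastforce simp: cv first_bag_def last_bag_def)
    then show "v \<in> ?A1 \<union> ?A2 \<union> ?A3 \<union> ?A4 \<union> ?A5"
    proof cases
      case 1
      then have "v = vnum hub" by (metis vnum_coords)
      then show ?thesis by blast
    next
      case 2
      define s where "s = c * (p + 1) + g"
      have sl: "slot c g 0 = s * q" by (simp add: slot_def s_def)
      have f: "s * q - (p + 1) * q \<le> x" and l: "x \<le> s * q + 2 * (p + 1) * q"
        using v 2 unfolding cv by (simp_all add: first_bag_def last_bag_def sl)
      have "(s - (p + 1)) * q \<le> x" using f by (simp add: diff_mult_distrib)
      then have "s - (p + 1) \<le> y" unfolding y_def using q0 by (simp add: less_eq_div_iff_mult_less_eq)
      moreover have "x \<le> (s + 2 * (p + 1)) * q" using l by (simp add: algebra_simps)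
      then have "x div q \<le> (s + 2 * (p + 1)) * q div q" by (rule div_le_mono)
      then have "y \<le> s + 2 * (p + 1)" using q0 by (simp add: y_def)
      ultimately have "s \<in> {y - 2 * (p + 1)..y + (p + 1)}" by auto
      moreover have "v = 5 * (s * q) + 3" using vn 2 sl by simp
      ultimately show ?thesis by blast
    next
      case 3
      then have "slot c g i - 1 \<le> x" "x \<le> slot c g i"
        using v unfolding cv by (simp_all add: first_bag_def last_bag_def)
      then have "slot c g i = x \<or> slot c g i = x + 1" by linarith
      then show ?thesis using vn 3 by auto
    next
      case 4
      then have f: "slot c 0 0 \<le> x" and l: "x \<le> slot c p (q - 1)"
        using v unfolding cv by (auto simp: first_bag_def last_bag_def)
      have "x < (c + 1) * ((p + 1) * q)"
      proof -
        have "slot c p (q - 1) < (c * (p + 1) + p + 1) * q" using q0 by (simp add: slot_def)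
        also have "\<dots> = (c + 1) * ((p + 1) * q)" by (simp add: algebra_simps)
        finally show ?thesis using l by linarith
      qed
      moreover have "c * ((p + 1) * q) \<le> x" using f by (simp add: slot_def algebra_simps)
      ultimately have "z = c" unfolding z_def by (intro div_nat_eqI) (simp_all add: mult.commute)
      then have "v = 5 * ((z * (p + 1) + p) * q) + k" using vn 4 by (simp add: slot_def)
      then show ?thesis using 4 by blast
    next
      case 5
      then have "slot c g i = x" using v by simp
      then have "v = 5 * x + k" using vn by simp
      then show ?thesis using bx(1) by blast
    qed
  qed
  then have "card {v \<in> {..<vcount}. first_bag (coords v) \<le> x \<and> x \<le> last_bag (coords v)} \<le>
      card (?A1 \<union> ?A2 \<union> ?A3 \<union> ?A4 \<union> ?A5)" by (intro card_mono) auto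
  also have "\<dots> \<le> card ?A1 + card ?A2 + card ?A3 + card ?A4 + card ?A5"
    by (intro order_trans[OF card_Un_le] add_mono order_refl)
  also have "\<dots> \<le> 1 + 5 + 1 + (3 * p + 4) + 3"
  proof (intro add_mono)
    show "card ?A2 \<le> 5" "card ?A5 \<le> 3" using card_image_le[of "{..<5}"] card_image_le[of "{..<3}"] by force+
    have "card ?A4 \<le> card {y - 2 * (p + 1)..y + (p + 1)}" by (rule card_image_le) simp
    also have "\<dots> \<le> 3 * p + 4" by simp
    finally show "card ?A4 \<le> 3 * p + 4" .
  qed simp_all
  finally show ?thesis by simp
qed

theorem pathwidth_inst: "digraph_pathwidth (atsp_digraph inst) \<le> 3 * p + 14"
proof -
  let ?G = "mk_symmetric (with_proj (atsp_digraph inst))"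
  let ?n = "(M + 1) * (p + 1) * q"
  let ?lo = "\<lambda>v. first_bag (coords v)" and ?hi = "\<lambda>v. last_bag (coords v)"
  have "path_decomposition ?G (map (\<lambda>x. {v \<in> pverts ?G. ?lo v \<le> x \<and> x \<le> ?hi v}) [0..<?n])"
  proof (rule interval_path_decomposition)
    show "0 < ?n" using q_ge by simp
    fix v assume "v \<in> pverts ?G"
    then have "coords v \<in> box" by (simp add: pverts_inst coords_in_box)
    moreover obtain k c g i where cv: "coords v = (k, c, g, i)" by (cases "coords v")
    ultimately have b: "(k, c, g, i) \<in> box" by simp
    show "?lo v \<le> ?hi v \<and> ?lo v < ?n"
      using own_bag[OF b] slot_less[of c g i] b unfolding cv by auto
  next
    fix u v assume "(u, v) \<in> parcs ?G"
    then have uv: "u < vcount \<and> v < vcount \<and> (arc (coords u) (coords v) \<or> arc (coords v) (coords u))"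
      by (auto simp: parcs_mk_symmetric parcs_inst)
    then have bx: "coords u \<in> box" "coords v \<in> box" by (simp_all only: coords_in_box)
    have "\<exists>x<?n. ?lo u \<le> x \<and> x \<le> ?hi u \<and> ?lo v \<le> x \<and> x \<le> ?hi v"
      using uv arc_common_bag[OF _ bx] arc_common_bag[OF _ bx(2,1)] by blast
    then show "u \<in> pverts ?G \<and> v \<in> pverts ?G \<and> (\<exists>x<?n. ?lo u \<le> x \<and> x \<le> ?hi u \<and> ?lo v \<le> x \<and> x \<le> ?hi v)"
      using uv by (simp add: pverts_inst)
  qed
  then show ?thesis
  proof (rule digraph_pathwidth_le)
    fix B assume "B \<in> set (map (\<lambda>x. {v \<in> pverts ?G. ?lo v \<le> x \<and> x \<le> ?hi v}) [0..<?n])"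
    then obtain x where "B = {v \<in> {..<vcount}. ?lo v \<le> x \<and> x \<le> ?hi v}" by (auto simp: pverts_inst)
    then show "card B \<le> 3 * p + 14 + 1" using card_bag[of x] by simp
  qed
qed

end


section \<open>The reduction as arithmetic expressions\<close>

text \<open>With nonzero as truth, conjunction is simply \<open>Times\<close>; negation and
  disjunction are comparisons.\<close>

definition truth :: "nat \<Rightarrow> nat list \<Rightarrow> (nat \<Rightarrow> nat) \<Rightarrow> ex \<Rightarrow> bool" where
  "truth n xs \<sigma> e \<longleftrightarrow> eval n xs \<sigma> e \<noteq> 0"

text \<open>Subtraction is truncated, so the two differences vanish together only for equal
  values.\<close>

definition eEq :: "ex \<Rightarrow> ex \<Rightarrow> ex" where
  "eEq a b = Less (Plus (Minus a b) (Minus b a)) (Const 1)"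
definition eNot :: "ex \<Rightarrow> ex" where
  "eNot a = Less a (Const 1)"
definition eOr :: "ex \<Rightarrow> ex \<Rightarrow> ex" where
  "eOr a b = Less (Const 0) (Plus a b)"
definition eMod :: "ex \<Rightarrow> ex \<Rightarrow> ex" where
  "eMod a b = Minus a (Times (Divide a b) b)"

lemma truth_eEq: "truth n xs \<sigma> (eEq a b) \<longleftrightarrow> eval n xs \<sigma> a = eval n xs \<sigma> b"
  and truth_Times: "truth n xs \<sigma> (Times a b) \<longleftrightarrow> truth n xs \<sigma> a \<and> truth n xs \<sigma> b"
  and truth_eOr: "truth n xs \<sigma> (eOr a b) \<longleftrightarrow> truth n xs \<sigma> a \<or> truth n xs \<sigma> b"
  and truth_eNot: "truth n xs \<sigma> (eNot a) \<longleftrightarrow> \<not> truth n xs \<sigma> a"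
  and eval_eMod: "eval n xs \<sigma> (eMod a b) = eval n xs \<sigma> a mod eval n xs \<sigma> b"
  by (auto simp: truth_def eEq_def eOr_def eNot_def eMod_def minus_div_mult_eq_mod)

lemma truth_Less: "truth n xs \<sigma> (Less a b) \<longleftrightarrow> eval n xs \<sigma> a < eval n xs \<sigma> b"
  by (simp add: truth_def)

text \<open>The counters 1 to 4 contain the number \<open>M\<close> of columns, \<open>p\<close>, the group size \<open>s\<close> and \<open>q = 2\<^sup>s\<close>.\<close>

abbreviation eM :: ex where "eM \<equiv> Var 1"
abbreviation ep :: ex where "ep \<equiv> Var 2"
abbreviation es :: ex where "es \<equiv> Var 3"
abbreviation eq :: ex where "eq \<equiv> Var 4"

definition eK :: "ex \<Rightarrow> ex" where "eK x = eMod x (Const 5)"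
definition eI :: "ex \<Rightarrow> ex" where "eI x = eMod (Divide x (Const 5)) eq"
definition eG :: "ex \<Rightarrow> ex" where "eG x = eMod (Divide (Divide x (Const 5)) eq) (Plus ep (Const 1))"
definition eC :: "ex \<Rightarrow> ex" where "eC x = Divide (Divide (Divide x (Const 5)) eq) (Plus ep (Const 1))"

definition eGrp :: "ex \<Rightarrow> ex" where
  "eGrp c = Divide (Divide (Num c) (Const 2)) es"

definition eTst :: "ex \<Rightarrow> ex \<Rightarrow> ex" where
  "eTst c i = eEq (eMod (Shift i (eMod (Divide (Num c) (Const 2)) es)) (Const 2)) (eMod (Num c) (Const 2))"

definition eTriple :: "ex \<Rightarrow> ex \<Rightarrow> ex \<Rightarrow> ex" where
  "eTriple c g i = Times (Less c eM)
     (eOr (Times (Less g ep) (Less (Plus i (Const 1)) eq)) (Times (eEq g ep) (eEq i (Const 0))))"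

definition eToken :: "ex \<Rightarrow> ex \<Rightarrow> ex \<Rightarrow> ex \<Rightarrow> ex" where
  "eToken k c g i = Times (eEq k (Const 4)) (Times (Less c eM)
     (Times (eEq (eMod c (Const 3)) (Const 0)) (Times (eEq g ep) (Less i (Const 2)))))"

definition eHeavy :: "ex \<Rightarrow> ex \<Rightarrow> ex \<Rightarrow> ex \<Rightarrow> ex" where
  "eHeavy k c g i =
     eOr (Times (Less k (Const 3)) (eTriple c g i))
       (eOr (Times (eEq k (Const 2)) (Times (Less c eM) (Times (Less g ep) (eEq (Plus i (Const 1)) eq))))
          (eToken k c g i))"

definition eLight :: "ex \<Rightarrow> ex \<Rightarrow> ex \<Rightarrow> ex \<Rightarrow> ex" where
  "eLight k c g i = Times (eEq k (Const 3)) (Times (eEq i (Const 0))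
     (eOr (Less g ep) (Times (eEq g ep) (Times (Less c eM) (eEq (eMod c (Const 3)) (Const 0))))))"

definition eHub :: "ex \<Rightarrow> ex \<Rightarrow> ex \<Rightarrow> ex \<Rightarrow> ex" where
  "eHub k c g i = Times (eEq k (Const 4)) (Times (eEq c (Const 0)) (Times (eEq g (Const 0)) (eEq i (Const 0))))"

definition eJunk :: "ex \<Rightarrow> ex \<Rightarrow> ex \<Rightarrow> ex \<Rightarrow> ex" where
  "eJunk k c g i = Times (eNot (eHeavy k c g i)) (Times (eNot (eLight k c g i)) (eNot (eHub k c g i)))"

definition eFromHub :: "ex \<Rightarrow> ex \<Rightarrow> ex \<Rightarrow> ex \<Rightarrow> ex" where
  "eFromHub k c g i = eOr (eJunk k c g i) (eOr (eToken k c g i)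
     (Times (eEq k (Const 3)) (Times (eEq c (Const 0)) (Times (Less g ep) (eEq i (Const 0))))))"

definition eToHub :: "ex \<Rightarrow> ex \<Rightarrow> ex \<Rightarrow> ex \<Rightarrow> ex" where
  "eToHub k c g i = eOr (eJunk k c g i)
     (eOr (Times (eEq k (Const 0)) (Times (Less c eM) (Times (eEq g ep) (eEq i (Const 0)))))
     (eOr (Times (eEq k (Const 3)) (Times (Less c eM) (Times (eEq (eMod c (Const 3)) (Const 0))
              (Times (eEq g ep) (eEq i (Const 0))))))
          (Times (eEq k (Const 3)) (Times (eEq c eM) (Times (Less g ep) (eEq i (Const 0)))))))"

definition eArc :: "ex \<Rightarrow> ex \<Rightarrow> ex \<Rightarrow> ex \<Rightarrow> ex \<Rightarrow> ex \<Rightarrow> ex \<Rightarrow> ex \<Rightarrow> ex" where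
  "eArc k c g i k' c' g' i' =
     eOr (Times (eEq c c') (Times (eEq g g') (Times (eEq i i') (Times (eTriple c g i)
           (eOr (Times (eEq k (Const 0)) (eEq k' (Const 1)))
           (eOr (Times (eEq k (Const 1)) (eEq k' (Const 0)))
           (eOr (Times (eEq k (Const 1)) (eEq k' (Const 2)))
                (Times (eEq k (Const 2)) (eEq k' (Const 1))))))))))
     (eOr (Times (eEq c c') (Times (eEq g g') (Times (Less c eM) (Times (Less g ep)
           (Times (eEq k (Const 0)) (Times (eEq k' (Const 2)) (eEq i' (Plus i (Const 1)))))))))
     (eOr (Times (eEq c c') (Times (eEq g g') (Times (Less c eM) (Times (Less g ep)
           (Times (eEq k (Const 3)) (Times (eEq i (Const 0))
           (eOr (Times (eEq k' (Const 0)) (Less (Plus i' (Const 1)) eq)) (eEq k' (Const 2)))))))))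
     (eOr (Times (eEq c' (Plus c (Const 1))) (Times (eEq g g') (Times (Less c eM) (Times (Less g ep)
           (Times (eEq k (Const 2)) (Times (eEq k' (Const 3)) (eEq i' (Const 0))))))))
     (eOr (Times (eEq c c') (Times (Less c eM) (Times (eEq g (eGrp c)) (Times (eEq g' ep)
           (Times (eEq k (Const 3)) (Times (eEq k' (Const 0)) (Times (eEq i (Const 0)) (eEq i' (Const 0)))))))))
     (eOr (Times (eEq c c') (Times (Less c eM) (Times (eEq g ep) (Times (eEq g' (eGrp c))
           (Times (eEq k (Const 2)) (Times (eEq k' (Const 2)) (Times (eEq i (Const 0)) (eTst c i'))))))))
     (eOr (Times (eEq g ep) (Times (eEq g' ep) (Times (Less c' eM) (Times (eEq c (Minus c' (eMod c' (Const 3))))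
           (Times (eEq k (Const 3)) (Times (eEq k' (Const 2)) (Times (eEq i (Const 0)) (eEq i' (Const 0)))))))))
     (eOr (Times (eToken k c g i) (Times (eEq k' (Const 3)) (Times (eEq c' c) (Times (eEq g' ep) (eEq i' (Const 0))))))
     (eOr (Times (eHub k c g i) (eFromHub k' c' g' i'))
          (Times (eHub k' c' g' i') (eToHub k c g i))))))))))"

abbreviation arc_ex :: ex where
  "arc_ex \<equiv> eArc (eK (Var 5)) (eC (Var 5)) (eG (Var 5)) (eI (Var 5)) (eK (Var 7)) (eC (Var 7)) (eG (Var 7)) (eI (Var 7))"

abbreviation heavy_ex :: ex where
  "heavy_ex \<equiv> eHeavy (eK (Var 5)) (eC (Var 5)) (eG (Var 5)) (eI (Var 5))"

definition count_ex :: ex where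
  "count_ex = Times (Const 5) (Times (Times (Plus eM (Const 1)) (Plus ep (Const 1))) eq)"

definition budget_ex :: ex where
  "budget_ex = Plus (Plus (Times (Times eM ep) (Plus (Times (Const 3) (Minus eq (Const 1))) (Const 1)))
     (Times (Const 3) eM)) (Times (Const 2) (Divide eM (Const 3)))"

definition bound_ex :: ex where
  "bound_ex = Plus (Times (Const 3) ep) (Const 14)"

lemmas ex_defs = eK_def eC_def eG_def eI_def eGrp_def eTst_def eTriple_def eToken_def eHeavy_def eLight_def
  eHub_def eJunk_def eFromHub_def eToHub_def eArc_def

lemma ex_vars_ex:
  "ex_vars arc_ex \<subseteq> {0, 1, 2, 3, 4, 5, 7}" "ex_vars heavy_ex \<subseteq> {0, 1, 2, 3, 4, 5, 7}"
  "ex_vars count_ex \<subseteq> {..<5}" "ex_vars budget_ex \<subseteq> {..<5}" "ex_vars bound_ex \<subseteq> {..<5}"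
  by (simp_all add: ex_defs eEq_def eOr_def eNot_def eMod_def count_ex_def budget_ex_def bound_ex_def)

lemma enc_nonneg_rat_nat: "enc_nonneg_rat (of_nat k) = enc_nat k @ enc_nat 1"
proof -
  have "quotient_of (of_nat k) = (int k, 1)" using quotient_of_int[of "int k"] by simp
  then show ?thesis by (simp add: enc_nonneg_rat_def)
qed

lemma concat_map_if:
  "concat (map h (concat (map (\<lambda>u. concat (map (\<lambda>v. if P u v then [f u v] else []) ys)) xs))) =
   concat (map (\<lambda>u. concat (map (\<lambda>v. if P u v then h (f u v) else []) ys)) xs)"
proof (induction xs)
  case (Cons a xs)
  have "concat (map h (concat (map (\<lambda>v. if P a v then [f a v] else []) ys))) =
     concat (map (\<lambda>v. if P a v then h (f a v) else []) ys)"
    by (induction ys) auto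
  then show ?case using Cons by simp
qed simp

text \<open>An entry is \<open>2 v + b\<close> for a variable \<open>v\<close> with sign
  \<open>b\<close>; a group consists of \<open>s\<close> consecutive variables.\<close>

definition group_of :: "nat list \<Rightarrow> nat \<Rightarrow> nat \<Rightarrow> nat" where
  "group_of xs s c = nth0 xs c div 2 div s"

text \<open>The bit with number \<open>v mod s\<close> of the group value \<open>i\<close> is the
  truth value of \<open>v\<close>; it is compared with the sign of the literal.\<close>

definition literal_test :: "nat list \<Rightarrow> nat \<Rightarrow> nat \<Rightarrow> nat \<Rightarrow> bool" where
  "literal_test xs s c i \<longleftrightarrow> i div 2 ^ (nth0 xs c div 2 mod s) mod 2 = nth0 xs c mod 2"

locale sat_reduction = tsp_reduction p q M "group_of xs s" "literal_test xs s" for p q M xs s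
begin

text \<open>The expressions copy the definitions of the graph connective by connective, so after
  unfolding both sides coincide literally.\<close>

lemma truth_arc:
  assumes "\<sigma> 1 = M" "\<sigma> 2 = p" "\<sigma> 3 = s" "\<sigma> 4 = q"
  shows "truth n xs \<sigma> arc_ex \<longleftrightarrow> arc (coords (\<sigma> 5)) (coords (\<sigma> 7))"
    and "truth n xs \<sigma> heavy_ex \<longleftrightarrow> heavy (coords (\<sigma> 5))"
  by (simp_all only: ex_defs truth_eEq truth_Times truth_eOr truth_eNot eval_eMod truth_Less eval.simps
      assms arc_defs coords_def prod.case prod.inject group_of_def literal_test_def)

lemma output_word_eq:
  assumes \<sigma>: "\<sigma> 1 = M" "\<sigma> 2 = p" "\<sigma> 3 = s" "\<sigma> 4 = q"
  shows "output_word bound_ex count_ex budget_ex arc_ex heavy_ex n xs \<sigma> = enc_atsp (3 * p + 14) inst"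
proof -
  have c: "eval n xs \<sigma> count_ex = vcount" "eval n xs \<sigma> budget_ex = budget_nat" "eval n xs \<sigma> bound_ex = 3 * p + 14"
    by (simp_all only: count_ex_def budget_ex_def bound_ex_def vcount_def budget_nat_def eval.simps \<sigma>)
  have a: "eval n xs (\<sigma>(5 := u, 7 := v)) arc_ex = 0 \<longleftrightarrow> \<not> arc (coords u) (coords v)" for u v
    proof -
    have "truth n xs (\<sigma>(5 := u, 7 := v)) arc_ex \<longleftrightarrow> arc (coords u) (coords v)"
      using truth_arc(1)[of "\<sigma>(5 := u, 7 := v)" n] \<sigma> by simp
    then show ?thesis unfolding truth_def by blast
  qed
  \<comment> \<open>The value is written as the cost of the arc, so being nonzero is not enough. It
    is 0 or 1 because \<open>eOr\<close> is a comparison.\<close>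
  have h: "eval n xs (\<sigma>(5 := u, 7 := v)) heavy_ex = of_bool (heavy (coords u))" for u v
  proof -
    have "eval n xs \<tau> heavy_ex = of_bool (truth n xs \<tau> heavy_ex)" for \<tau>
      unfolding eHeavy_def eOr_def truth_def by simp
    then show ?thesis using truth_arc(2)[of "\<sigma>(5 := u, 7 := v)" n] \<sigma> by simp
  qed
  have b: "enc_nonneg_rat (of_bool P) = enc_nat (of_bool P) @ enc_nat 1" for P
    using enc_nonneg_rat_nat[of "of_bool P"] by simp
  have inner: "(if eval n xs (\<sigma>(5 := u, 7 := v)) arc_ex = 0 then []
        else enc_nat u @ enc_nat v @ enc_nat (eval n xs (\<sigma>(5 := u, 7 := v)) heavy_ex) @ enc_nat 1) =
     (if arc (coords u) (coords v) then enc_nat u @ enc_nat v @ enc_nonneg_rat (of_bool (heavy (coords u))) else [])"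
    for u v using a[of u v] h[of u v] b[of "heavy (coords u)"] by (simp only: if_not_P if_P not_not split: if_split) blast
  show ?thesis
    unfolding output_word_def enc_atsp_def c inner
    by (simp add: inst_def enc_nonneg_rat_nat concat_map_if cong: if_cong)
qed

end


section \<open>Correctness of the reduction\<close>

definition literal_code :: "literal \<Rightarrow> nat" where
  "literal_code = (\<lambda>(v, b). 2 * v + of_bool b)"

definition codes :: "cnf \<Rightarrow> nat list" where
  "codes F = map literal_code (concat F)"

lemma enc_cnf_eq: "enc_cnf n F = input_word n (codes F)"
proof -
  have "map (\<lambda>(v, b). enc_nat (2 * v + of_bool b)) ls = map enc_nat (map literal_code ls)" for ls
    by (auto simp: literal_code_def)
  then show ?thesis by (simp only: enc_cnf_def input_word_def numbers_word_def codes_def)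
qed

lemma length_concat_3: "\<forall>C\<in>set F. length C = 3 \<Longrightarrow> length (concat F) = 3 * length F"
  by (induction F) auto

lemma nth_concat_3:
  "\<forall>C\<in>set F. length C = 3 \<Longrightarrow> j < length F \<Longrightarrow> l < 3 \<Longrightarrow> concat F ! (3 * j + l) = F ! j ! l"
proof (induction F arbitrary: j)
  case (Cons C F)
  show ?case
  proof (cases j)
    case 0
    then show ?thesis using Cons.prems by (simp add: nth_append)
  next
    case (Suc j')
    then have "concat F ! (3 * j' + l) = F ! j' ! l" using Cons by simp
    moreover have "3 * j + l - 3 = 3 * j' + l" "\<not> 3 * j + l < 3" using Suc by simp_all
    ultimately show ?thesis using Cons.prems Suc by (simp add: nth_append)
  qed
qed simp

lemma exists_bits: "\<exists>t<2 ^ s. \<forall>k<s. t div 2 ^ k mod 2 = (of_bool (\<beta> k) :: nat)"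
proof -
  define t :: nat where "t = horner_sum of_bool 2 (map \<beta> [0..<s])"
  have "t < 2 ^ s" using horner_sum_of_bool_2_less[of "map \<beta> [0..<s]", where 'a = nat] by (simp add: t_def)
  moreover have "t div 2 ^ k mod 2 = of_bool (\<beta> k)" if "k < s" for k
  proof -
    have "bit t k \<longleftrightarrow> \<beta> k" using that by (simp add: t_def bit_horner_sum_bit_iff)
    then show ?thesis by (simp add: bit_iff_odd mod_2_eq_odd)
  qed
  ultimately show ?thesis by blast
qed

text \<open>Assignments correspond to group values through binary digits: the variable
  \<open>v\<close> is the digit \<open>v mod s\<close> of \<open>t (v div s)\<close>.\<close>

lemma sat_iff_flow:
  assumes F: "is_3cnf n F" and s: "0 < s" and np: "n \<le> s * p"
  defines "xs \<equiv> codes F"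
  shows "satisfiable F \<longleftrightarrow> (\<exists>t. (\<forall>g<p. t g < 2 ^ s) \<and>
     (\<forall>c<length xs. c mod 3 = 0 \<longrightarrow> (\<exists>l<3. literal_test xs s (c + l) (t (group_of xs s (c + l))))))"
    (is "_ \<longleftrightarrow> (\<exists>t. ?ok t)")
proof -
  have F3: "\<forall>C\<in>set F. length C = 3" and Fv: "\<And>C v b. C \<in> set F \<Longrightarrow> (v, b) \<in> set C \<Longrightarrow> v < n"
    using F by (auto simp: is_3cnf_def)
  have len: "length xs = 3 * length F" by (simp add: xs_def codes_def length_concat_3[OF F3])
  have nth: "nth0 xs (3 * j + l) = literal_code (F ! j ! l)" if "j < length F" "l < 3" for j l
  proof -
    have "3 * j + l < length (concat F)" using that length_concat_3[OF F3] by simp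
    then show ?thesis
      using nth_concat_3[OF F3 that] by (simp add: nth0_def xs_def codes_def)
  qed
  have lit: "literal_test xs s (3 * j + l) i \<longleftrightarrow> i div 2 ^ (v mod s) mod 2 = of_bool b"
    "group_of xs s (3 * j + l) = v div s"
    if "j < length F" "l < 3" "F ! j ! l = (v, b)" for j l v b i
    using nth[OF that(1,2)] that(3) by (auto simp: literal_test_def group_of_def literal_code_def)
  have cols: "(\<forall>c<length xs. c mod 3 = 0 \<longrightarrow> P c) \<longleftrightarrow> (\<forall>j<length F. P (3 * j))" for P
    unfolding len by (metis dvd_imp_mod_0 dvd_triv_left mod_0_imp_dvd dvdE mult_less_cancel1 zero_less_numeral)
  show ?thesis
  proof
    assume "satisfiable F"
    then obtain \<alpha> where \<alpha>: "\<And>C. C \<in> set F \<Longrightarrow> \<exists>(v, b)\<in>set C. \<alpha> v = b" unfolding satisfiable_def by blast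
    have "\<exists>t<2 ^ s. \<forall>k<s. t div 2 ^ k mod 2 = (of_bool (\<alpha> (g * s + k)) :: nat)" for g by (rule exists_bits)
    then obtain t where t: "\<And>g. t g < 2 ^ s" "\<And>g k. k < s \<Longrightarrow> t g div 2 ^ k mod 2 = (of_bool (\<alpha> (g * s + k)) :: nat)"
      by metis
    have "\<exists>l<3. literal_test xs s (3 * j + l) (t (group_of xs s (3 * j + l)))" if j: "j < length F" for j
    proof -
      obtain v b where vb: "(v, b) \<in> set (F ! j)" "\<alpha> v = b" using \<alpha>[of "F ! j"] j by auto
      then obtain l where l: "l < 3" "F ! j ! l = (v, b)"
        using F3 j by (metis in_set_conv_nth nth_mem)
      have "t (v div s) div 2 ^ (v mod s) mod 2 = of_bool b" using t(2)[of "v mod s" "v div s"] s vb(2) by simp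
      then show ?thesis using lit[OF j l] l(1) by auto
    qed
    then show "\<exists>t. ?ok t" unfolding cols using t(1) by blast
  next
    assume "\<exists>t. ?ok t"
    then obtain t where t: "\<And>j. j < length F \<Longrightarrow> \<exists>l<3. literal_test xs s (3 * j + l) (t (group_of xs s (3 * j + l)))"
      unfolding cols by blast
    define \<alpha> where "\<alpha> = (\<lambda>v. t (v div s) div 2 ^ (v mod s) mod 2 = 1)"
    have "\<exists>(v, b)\<in>set C. \<alpha> v = b" if C: "C \<in> set F" for C
    proof -
      obtain j where j: "j < length F" "C = F ! j" using C by (metis in_set_conv_nth)
      obtain l where l: "l < 3" "literal_test xs s (3 * j + l) (t (group_of xs s (3 * j + l)))" using t[OF j(1)] by blast
      obtain v b where vb: "F ! j ! l = (v, b)" by force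
      have "t (v div s) div 2 ^ (v mod s) mod 2 = of_bool b" using l(2) lit[OF j(1) l(1) vb] by simp
      then have "\<alpha> v = b" by (cases b) (auto simp: \<alpha>_def)
      moreover have "(v, b) \<in> set C" using vb l(1) F3 C j(2) by (metis nth_mem)
      ultimately show ?thesis by blast
    qed
    then show "satisfiable F" unfolding satisfiable_def by blast
  qed
qed

text \<open>The \<open>+ 1\<close> in the group size makes \<open>s * p\<close> exceed
  \<open>n\<close>, so that \<open>p\<close> groups accommodate all variables.\<close>

lemma sat_reduction_codes:
  assumes F: "is_3cnf n F" and p: "1 \<le> p"
  shows "sat_reduction p (2 ^ (n div p + 1)) (length (codes F)) (codes F) (n div p + 1)"
proof
  let ?s = "n div p + 1" and ?xs = "codes F"
  have F3: "\<forall>C\<in>set F. length C = 3" and Fv: "\<And>C v b. C \<in> set F \<Longrightarrow> (v, b) \<in> set C \<Longrightarrow> v < n"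
    using F by (auto simp: is_3cnf_def)
  show "1 \<le> p" by (rule p)
  show "(2::nat) \<le> 2 ^ ?s" by simp
  show "3 dvd length ?xs" by (simp add: codes_def length_concat_3[OF F3])
  fix c assume c: "c < length ?xs"
  obtain v b where vb: "concat F ! c = (v, b)" by force
  have "concat F ! c \<in> set (concat F)" using c by (intro nth_mem) (simp add: codes_def)
  then have "v < n" using vb Fv by auto
  also have "n < ?s * p" using p by (metis Suc_eq_plus1 dividend_less_div_times less_le_trans add.commute mult_Suc zero_less_one)
  finally have "v < ?s * p" .
  then have "v div ?s < p" by (simp add: div_less_iff_less_mult mult.commute)
  moreover have "nth0 ?xs c = literal_code (v, b)" using c vb by (simp add: nth0_def codes_def)
  ultimately show "group_of ?xs ?s c < p" by (simp add: group_of_def literal_code_def)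
qed

theorem reduction_correct:
  assumes F: "is_3cnf n F" and p: "1 \<le> p" and M: "solves_atsp_bounded_pathwidth M T"
    and \<sigma>: "\<sigma> 1 = length (codes F)" "\<sigma> 2 = p" "\<sigma> 3 = n div p + 1" "\<sigma> 4 = 2 ^ (n div p + 1)"
  defines "W \<equiv> output_word bound_ex count_ex budget_ex arc_ex heavy_ex n (codes F) \<sigma>"
  shows "decides_within M W (satisfiable F) (T (3 * p + 14) (length W))"
proof -
  let ?s = "n div p + 1"
  interpret sat_reduction p "2 ^ ?s" "length (codes F)" "codes F" ?s
    by (rule sat_reduction_codes[OF F p])
  have W: "W = enc_atsp (3 * p + 14) inst" unfolding W_def by (rule output_word_eq[OF \<sigma>])
  have "n \<le> ?s * p" using p by (metis Suc_eq_plus1 dividend_less_div_times less_imp_le add.commute mult_Suc less_le_trans zero_less_one)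
  then have "satisfiable F \<longleftrightarrow> (\<exists>t. (\<forall>g<p. t g < 2 ^ ?s) \<and> (\<forall>c<length (codes F). c mod 3 = 0 \<longrightarrow>
      (\<exists>l<3. literal_test (codes F) ?s (c + l) (t (group_of (codes F) ?s (c + l))))))"
    by (intro sat_iff_flow[OF F]) simp_all
  also have "\<dots> \<longleftrightarrow> atsp_yes inst"
  proof
    assume "\<exists>t. (\<forall>g<p. t g < 2 ^ ?s) \<and> (\<forall>c<length (codes F). c mod 3 = 0 \<longrightarrow>
      (\<exists>l<3. literal_test (codes F) ?s (c + l) (t (group_of (codes F) ?s (c + l)))))"
    then obtain t where t: "\<forall>g<p. t g < 2 ^ ?s" "\<forall>c<length (codes F). c mod 3 = 0 \<longrightarrow>
      (\<exists>l<3. literal_test (codes F) ?s (c + l) (t (group_of (codes F) ?s (c + l))))" by blast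
    show "atsp_yes inst" by (rule yes_complete[of t]) (simp only: t(1), rule t(2)[rule_format])
  qed (rule yes_sound)
  finally show ?thesis
    using M inst_ok pathwidth_inst unfolding solves_atsp_bounded_pathwidth_def W by simp
qed


section \<open>The value of a computable function is bounded by the running time\<close>

text \<open>A head moves right by at most one cell per step, so after \<open>k\<close> steps nothing
  is written at \<open>length w + k\<close> or beyond. The ranges of state and symbols belong to the
  invariant because transitions are constrained only within them.\<close>

lemma tm_run_extent:
  assumes M: "turing_machine M" and w: "set w \<subseteq> {1, 2, 3}"
  shows "\<exists>q ts. tm_run M w k = (q, ts) \<and> q < tm_states M \<and> length ts = tm_tapes M \<and>
    (\<forall>(i, t)\<in>set ts. i \<le> int k \<and> (\<forall>j. t j < tm_symbols M) \<and> (\<forall>j\<ge>int (length w + k). t j = 0))"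
proof (induction k)
  case 0
  have 4: "4 \<le> tm_symbols M" "3 \<le> tm_states M" "1 \<le> tm_tapes M"
    using M by (auto simp: turing_machine_def)
  have "w ! nat j < tm_symbols M" if "0 \<le> j" "j < int (length w)" for j
  proof -
    have "w ! nat j \<in> set w" using that by simp
    then show ?thesis using w 4 by auto
  qed
  then show ?case using 4 by (auto simp: tm_run_def input_tape_def)
next
  case (Suc k)
  then obtain q ts where r: "tm_run M w k = (q, ts)" "q < tm_states M" and l: "length ts = tm_tapes M"
    and ts: "\<And>i t. (i, t) \<in> set ts \<Longrightarrow>
      i \<le> int k \<and> (\<forall>j. t j < tm_symbols M) \<and> (\<forall>j\<ge>int (length w + k). t j = 0)"
    by blast
  have step: "tm_run M w (Suc k) = tm_step M (q, ts)" using r by (simp add: tm_run_def)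
  show ?case
  proof (cases "q \<in> {1, 2}")
    case True
    then have "tm_run M w (Suc k) = (q, ts)" using step by (auto simp: tm_step_def)
    then show ?thesis using r l ts by fastforce
  next
    case False
    let ?rs = "map (\<lambda>(i, t). t i) ts"
    have rs: "length ?rs = tm_tapes M" "set ?rs \<subseteq> {..<tm_symbols M}"
      using l ts by auto
    obtain q' as where a: "tm_trans M q ?rs = (q', as)" by force
    note wf = trans_wf[OF M r(2) rs, unfolded a fst_conv snd_conv]
    let ?ts = "map2 (\<lambda>(s, d) (i, t). (i + d, t(i := s))) as ts"
    have "tm_run M w (Suc k) = (q', ?ts)"
      unfolding step tm_step_def prod.case a if_not_P[OF False] ..
    moreover have all: "i' \<le> int (Suc k) \<and> (\<forall>j. t' j < tm_symbols M) \<and> (\<forall>j\<ge>int (length w + Suc k). t' j = 0)"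
      if el: "(i', t') \<in> set ?ts" for i' t'
    proof -
      from el[unfolded in_set_conv_nth] obtain m where m: "m < length ?ts" "?ts ! m = (i', t')" by (elim exE conjE)
      obtain s d where sd: "as ! m = (s, d)" by force
      obtain i t where it: "ts ! m = (i, t)" by force
      have ml: "m < tm_tapes M" using m(1) l by simp
      have "?ts ! m = (i + d, t(i := s))" using m(1) sd it by simp
      then have e: "i' = i + d" "t' = t(i := s)" using m(2) by simp_all
      have "(i, t) \<in> set ts" using it ml l by (metis nth_mem)
      then have "i \<le> int k" "\<forall>j. t j < tm_symbols M" "\<forall>j\<ge>int (length w + k). t j = 0" using ts by blast+
      moreover have "d \<in> {-1, 0, 1}" "s < tm_symbols M" using wf(3,4)[OF ml] sd by auto
      ultimately show ?thesis unfolding e by auto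
    qed
    moreover have "length ?ts = tm_tapes M" using wf(2) l by simp
    moreover have "\<forall>(i, t)\<in>set ?ts. i \<le> int (Suc k) \<and> (\<forall>j. t j < tm_symbols M) \<and>
      (\<forall>j\<ge>int (length w + Suc k). t j = 0)"
      by (intro ballI, rule case_prodI2, hypsubst) (rule all)
    ultimately show ?thesis using wf(1) by blast
  qed
qed

text \<open>A unary value is at most the extent of its tape. The configuration after
  \<open>n\<close> steps is the one that carries the value, since a halted machine does not
  change.\<close>

lemma computable_bound:
  assumes "computable f"
  obtains F where "turing_machine F" "\<And>x. \<exists>k. fst (tm_run F (replicate x 2) k) \<in> {1, 2}"
    and "\<And>x n. fst (tm_run F (replicate x 2) n) \<in> {1, 2} \<Longrightarrow> f x \<le> x + n"
proof -
  obtain F where F: "turing_machine F"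
    and h: "\<And>x. \<exists>k. fst (tm_run F (replicate x 2) k) \<in> {1, 2} \<and>
      (\<forall>i<f x. snd (last (snd (tm_run F (replicate x 2) k))) (int i) = 2)"
    using assms unfolding computable_def Let_def by blast
  have "f x \<le> x + n" if n: "fst (tm_run F (replicate x 2) n) \<in> {1, 2}" for x n
  proof (rule ccontr)
    assume c: "\<not> f x \<le> x + n"
    let ?r = "tm_run F (replicate x 2)"
    obtain k where k: "fst (?r k) \<in> {1, 2}" "\<forall>i<f x. snd (last (snd (?r k))) (int i) = 2"
      using h[of x] by blast
    have "?r n = ?r k"
      using tm_run_halted[OF n, of "max n k"] tm_run_halted[OF k(1), of "max n k"] by simp
    moreover obtain q ts where r: "?r n = (q, ts)" "length ts = tm_tapes F"
      "\<And>i t. (i, t) \<in> set ts \<Longrightarrow> \<forall>j\<ge>int (x + n). t j = 0"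
      using tm_run_extent[OF F, of "replicate x 2" n] by fastforce
    moreover have "last ts \<in> set ts" using r(2) F by (intro last_in_set) (auto simp: turing_machine_def)
    ultimately have "snd (last (snd (?r k))) (int (x + n)) = 0"
      by (metis order_refl prod.collapse snd_conv)
    moreover have "snd (last (snd (?r k))) (int (x + n)) = 2" using k(2) c by (metis not_le)
    ultimately show False by simp
  qed
  then show ?thesis using that F h by blast
qed


section \<open>The chosen width tends to infinity\<close>

lemma width_of_ge: "1 \<le> width_of F n"
proof -
  have "1 \<le> (next_width F n ^^ i) 1" for i by (induction i) (auto simp: next_width_def)
  then show ?thesis by (simp add: width_of_def)
qed

text \<open>Every increment has passed the test for the value it leads to, so the test holds for the
  last value unless there was no increment.\<close>

lemma width_of_cases:
  "width_of F n = 1 \<or> width_of F n * width_of F n \<le> n \<and>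
     fst (tm_run F (replicate (3 * width_of F n + 14) 2) n) \<in> {1, 2}"
proof -
  have "(next_width F n ^^ i) 1 = 1 \<or> (next_width F n ^^ i) 1 * (next_width F n ^^ i) 1 \<le> n \<and>
     fst (tm_run F (replicate (3 * (next_width F n ^^ i) 1 + 14) 2) n) \<in> {1, 2}" for i
  proof (induction i)
    case (Suc i)
    let ?p = "(next_width F n ^^ i) 1"
    have "(next_width F n ^^ Suc i) 1 = next_width F n ?p" by simp
    moreover have "next_width F n ?p = ?p \<or> next_width F n ?p = ?p + 1 \<and> (?p + 1) * (?p + 1) \<le> n \<and>
      fst (tm_run F (replicate (3 * (?p + 1) + 14) 2) n) \<in> {1, 2}"
      unfolding next_width_def by (cases "(?p + 1) * (?p + 1) \<le> n \<and>
      fst (tm_run F (replicate (3 * (?p + 1) + 14) 2) n) \<in> {1, 2}") simp_all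
    ultimately show ?case using Suc by metis
  qed simp
  then show ?thesis unfolding width_of_def .
qed

text \<open>For fixed \<open>X\<close>, all candidates up to \<open>X\<close> pass as soon as
  \<open>n\<close> exceeds finitely many halting times and \<open>X * X\<close>; then
  \<open>n \<ge> X\<close> rounds climb up to \<open>X\<close>.\<close>

lemma width_of_at_top:
  assumes h: "\<And>x. \<exists>k. fst (tm_run F (replicate x 2) k) \<in> {1, 2}"
  shows "filterlim (width_of F) at_top sequentially"
  unfolding filterlim_at_top
proof
  fix X :: nat
  have "\<forall>\<^sub>F n in sequentially. fst (tm_run F (replicate x 2) n) \<in> {1, 2}" for x
  proof -
    obtain k where k: "fst (tm_run F (replicate x 2) k) \<in> {1, 2}" using h by blast
    then show ?thesis
      unfolding eventually_sequentially using tm_run_halted[OF k] by (intro exI[of _ k]) metis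
  qed
  then have "\<forall>\<^sub>F n in sequentially. \<forall>x\<in>{..X}. fst (tm_run F (replicate (3 * x + 14) 2) n) \<in> {1, 2}"
    by (intro eventually_ball_finite) auto
  then show "\<forall>\<^sub>F n in sequentially. X \<le> width_of F n"
    using eventually_ge_at_top[of "X * X"] eventually_ge_at_top[of X]
  proof eventually_elim
    case (elim n)
    have "min (Suc i) X \<le> (next_width F n ^^ i) 1" for i
    proof (induction i)
      case (Suc i)
      let ?p = "(next_width F n ^^ i) 1"
      show ?case
      proof (cases "X \<le> ?p")
        case True
        moreover have "?p \<le> next_width F n ?p" by (simp add: next_width_def)
        ultimately show ?thesis by simp
      next
        case False
        then have "?p + 1 \<le> X" by simp
        then have "(?p + 1) * (?p + 1) \<le> X * X" by (rule mult_le_mono) (rule \<open>?p + 1 \<le> X\<close>)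
        then have "(?p + 1) * (?p + 1) \<le> n" using elim(2) by linarith
        moreover have "fst (tm_run F (replicate (3 * (?p + 1) + 14) 2) n) \<in> {1, 2}"
          using elim(1) \<open>?p + 1 \<le> X\<close> by blast
        ultimately have "next_width F n ?p = ?p + 1" unfolding next_width_def by simp
        then show ?thesis using Suc by simp
      qed
    qed simp
    from this[of n] show ?case using elim(3) by (simp add: width_of_def)
  qed
qed


section \<open>Size of the formula\<close>

text \<open>Clauses are not repeated, so there are at most as many as triples of the
  \<open>2 n\<close> literals.\<close>

lemma length_3cnf:
  assumes "is_3cnf n F"
  shows "length F \<le> (2 * n) ^ 3"
proof -
  let ?L = "{..<n} \<times> (UNIV :: bool set)"
  have "set F \<subseteq> {C. set C \<subseteq> ?L \<and> length C = 3}" using assms by (auto simp: is_3cnf_def)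
  then have "card (set F) \<le> card {C. set C \<subseteq> ?L \<and> length C = 3}"
    by (intro card_mono) (simp_all add: finite_lists_length_eq)
  also have "\<dots> = (2 * n) ^ 3" by (simp add: card_lists_length_eq card_cartesian_product mult.commute)
  finally show ?thesis using assms by (simp add: is_3cnf_def distinct_card)
qed

text \<open>The second factor is \<open>q\<close>; the first one generously covers the length of the
  formula and the codes of its literals.\<close>

definition size_bound :: "tm \<Rightarrow> nat \<Rightarrow> nat" where
  "size_bound G n = (n + 10) ^ 10 * 2 ^ (n div width_of G n + 1)"

lemma size_ok_codes:
  assumes F: "is_3cnf n F"
  shows "size_ok G n (codes F) (size_bound G n)"
proof -
  let ?b = "(n + 10) ^ 10 * 2 ^ (n div width_of G n + 1)"
  have code: "x < 2 * n" if x: "x \<in> set (codes F)" for x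
  proof -
    obtain C v b where "C \<in> set F" "(v, b) \<in> set C" "x = 2 * v + of_bool b"
      using x by (force simp: codes_def literal_code_def)
    then show ?thesis using F by (cases b) (fastforce simp: is_3cnf_def)+
  qed
  have "length (codes F) = 3 * length F"
    using F by (simp add: codes_def length_concat_3 is_3cnf_def)
  then have l: "length (codes F) \<le> 24 * n ^ 3" using length_3cnf[OF F] by (simp add: power_mult_distrib)
  have "length (numbers_word xs) \<le> length xs * (2 * n)" if "\<forall>x\<in>set xs. x < 2 * n" for xs
    using that
  proof (induction xs)
    case (Cons x xs)
    then have "length (enc_nat x) \<le> 2 * n" using length_bin_le_self[of x] by (simp add: enc_nat_def)
    then show ?case using Cons by (simp add: numbers_word_def)
  qed (simp add: numbers_word_def)
  then have "length (numbers_word (codes F)) \<le> length (codes F) * (2 * n)" using code by blast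
  also have "\<dots> \<le> 24 * n ^ 3 * (2 * n)" using l by (rule mult_le_mono1)
  also have "\<dots> = 48 * n ^ 4" by (simp add: power4_eq_xxxx power3_eq_cube)
  finally have w: "length (input_word n (codes F)) \<le> n + 1 + 48 * n ^ 4"
    by (simp add: input_word_def enc_unary_def)
  have "n ^ 4 \<le> (n + 10) ^ 4" by (rule power_mono) auto
  moreover have "n + 10 \<le> (n + 10) ^ 4" using self_le_power[of "n + 10" 4] by simp
  ultimately have "n + 1 + 48 * n ^ 4 + 4 * n + 10 \<le> 1000 * (n + 10) ^ 4" by linarith
  also have "(1000::nat) * (n + 10) ^ 4 \<le> (n + 10) ^ 6 * (n + 10) ^ 4"
  proof (rule mult_le_mono1)
    have "(1000::nat) \<le> 10 ^ 6" by simp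
    also have "\<dots> \<le> (n + 10) ^ 6" by (rule power_mono) auto
    finally show "1000 \<le> (n + 10) ^ 6" .
  qed
  also have "\<dots> = (n + 10) ^ 10" by (simp add: power_add[symmetric])
  also have "\<dots> \<le> ?b" by simp
  finally have b: "n + 1 + 48 * n ^ 4 + 4 * n + 10 \<le> ?b" .
  have "2 * x + 1 \<le> ?b" if "x \<in> set (codes F)" for x using code[OF that] b by linarith
  moreover have "(1::nat) \<le> (n + 10) ^ 10" by simp
  then have "2 ^ (n div width_of G n + 1) \<le> ?b" by (metis mult_le_mono1 mult_1)
  moreover have "n + 2 \<le> ?b" "length (input_word n (codes F)) \<le> ?b" using w b by linarith+
  ultimately show ?thesis unfolding size_ok_def size_bound_def by blast
qed


section \<open>The running time is subexponential\<close>

lemma log_two_div_tendsto: "((\<lambda>n. log 2 (8 * real n + c) / real n) \<longlonglongrightarrow> 0)"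
  by real_asymp

lemma sqrt_log_div_tendsto:
  "((\<lambda>n. k * ((3 * sqrt (real n) + c) * (10 * log 2 (real n + 10) + 1)) / real n) \<longlonglongrightarrow> 0)"
proof -
  have "((\<lambda>n. ((3 * sqrt (real n) + c) * (10 * log 2 (real n + 10) + 1)) / real n) \<longlonglongrightarrow> 0)"
    by real_asymp
  from tendsto_mult_right_zero[OF this, of k] show ?thesis by simp
qed

text \<open>\<open>h\<close> is taken at the pathwidth bound, but the saving is per group. Since
  \<open>(3 p + 14) / p\<close> converges, the quotient by \<open>p\<close> still tends to
  0.\<close>

lemma smallo_affine:
  fixes h :: "nat \<Rightarrow> real"
  assumes h: "h \<in> o(\<lambda>p. real p)"
  shows "((\<lambda>p. (1 + \<bar>h (3 * p + 14)\<bar>) / real p) \<longlonglongrightarrow> 0)"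
proof -
  have "(\<lambda>p. h p / real p) \<longlonglongrightarrow> 0" by (rule smalloD_tendsto[OF h])
  moreover have "filterlim (\<lambda>p::nat. 3 * p + 14) at_top sequentially"
    by (rule filterlim_subseq) (simp add: strict_mono_def)
  ultimately have "(\<lambda>p. h (3 * p + 14) / real (3 * p + 14)) \<longlonglongrightarrow> 0"
    by (rule filterlim_compose)
  then have "(\<lambda>p. \<bar>h (3 * p + 14) / real (3 * p + 14)\<bar>) \<longlonglongrightarrow> 0" by (rule tendsto_rabs_zero)
  moreover have "(\<lambda>p. real (3 * p + 14) / real p) \<longlonglongrightarrow> 3" by real_asymp
  ultimately have "(\<lambda>p. \<bar>h (3 * p + 14) / real (3 * p + 14)\<bar> * (real (3 * p + 14) / real p)) \<longlonglongrightarrow> 0 * 3"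
    by (rule tendsto_mult)
  moreover have "(\<lambda>p. 1 / real p) \<longlonglongrightarrow> 0" by real_asymp
  ultimately have "(\<lambda>p. 1 / real p + \<bar>h (3 * p + 14) / real (3 * p + 14)\<bar> * (real (3 * p + 14) / real p)) \<longlonglongrightarrow> 0 + 0 * 3"
    by (intro tendsto_add)
  moreover have "\<bar>h (3 * p + 14) / real (3 * p + 14)\<bar> * (real (3 * p + 14) / real p) = \<bar>h (3 * p + 14)\<bar> / real p" for p
    by (simp add: abs_divide del: of_nat_add of_nat_mult)
  ultimately show ?thesis by (simp only: add_divide_distrib) simp
qed

text \<open>A bound valid for every \<open>p\<close>: the finitely many exceptions are absorbed by
  the constant.\<close>

lemma smallo_le_affine:
  fixes h :: "nat \<Rightarrow> real"
  assumes h: "h \<in> o(\<lambda>p. real p)"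
  obtains C where "0 \<le> C" "\<And>p. \<bar>h p\<bar> \<le> real p + C"
proof -
  have "\<forall>\<^sub>F p in sequentially. norm (h p) \<le> 1 * norm (real p)" by (rule landau_o.smallD[OF h]) simp
  then obtain p0 where p0: "\<And>p. p \<ge> p0 \<Longrightarrow> \<bar>h p\<bar> \<le> real p" unfolding eventually_sequentially by auto
  have "\<bar>h p\<bar> \<le> real p + (\<Sum>i<p0. \<bar>h i\<bar>)" for p
  proof (cases "p < p0")
    case True
    then have "\<bar>h p\<bar> \<le> (\<Sum>i<p0. \<bar>h i\<bar>)" by (intro member_le_sum) auto
    then show ?thesis by simp
  next
    case False
    moreover have "0 \<le> (\<Sum>i<p0. \<bar>h i\<bar>)" by (intro sum_nonneg) auto
    ultimately show ?thesis using p0[of p] by linarith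
  qed
  then show ?thesis using that[of "\<Sum>i<p0. \<bar>h i\<bar>"] by (simp add: sum_nonneg)
qed

text \<open>\<open>B\<close> bounds the time of the reduction and also the length of the instance it
  writes; the factor 2 is that of the simulation. The absolute value is taken because
  \<open>h\<close> may be negative.\<close>

definition total_time :: "(nat \<Rightarrow> nat) \<Rightarrow> (nat \<Rightarrow> real) \<Rightarrow> tm \<Rightarrow> nat \<Rightarrow> nat \<Rightarrow> real" where
  "total_time f h G k n = (let P = 3 * width_of G n + 14; B = real (size_bound G n ^ k) in
     B + 2 * (real (f P) * B powr \<bar>h P\<bar>))"

lemma total_time_ge: "1 \<le> total_time f h G k n"
proof -
  have "1 \<le> size_bound G n ^ k" by (simp add: size_bound_def)
  then have "1 \<le> real (size_bound G n ^ k)" by linarith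
  moreover have "0 \<le> real (f P) * real (size_bound G n ^ k) powr \<bar>h P\<bar>" for P by simp
  ultimately show ?thesis unfolding total_time_def Let_def by (smt (verit))
qed

text \<open>As \<open>B \<ge> 1\<close>, both summands of the time are dominated by multiples of
  \<open>B powr (1 + |h P|)\<close>, whose logarithm splits into factors.\<close>

lemma log_total_time_le:
  assumes P: "P = 3 * width_of G n + 14"
  shows "log 2 (total_time f h G k n) \<le> log 2 (1 + 2 * real (f P)) +
     (1 + \<bar>h P\<bar>) * (real k * (10 * log 2 (real n + 10) + (real n / real (width_of G n) + 1)))"
proof -
  define b where "b = real (size_bound G n)"
  define B where "B = b ^ k"
  have "1 \<le> size_bound G n" by (simp add: size_bound_def)
  then have b1: "1 \<le> b" unfolding b_def by linarith
  then have B1: "1 \<le> B" by (simp add: B_def)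
  have "B powr 1 \<le> B powr (1 + \<bar>h P\<bar>)" "B powr \<bar>h P\<bar> \<le> B powr (1 + \<bar>h P\<bar>)"
    using B1 by (intro powr_mono; simp)+
  then have "B + 2 * (real (f P) * B powr \<bar>h P\<bar>) \<le> B powr (1 + \<bar>h P\<bar>) + 2 * (real (f P) * B powr (1 + \<bar>h P\<bar>))"
    using B1 by (intro add_mono mult_left_mono) auto
  then have "total_time f h G k n \<le> (1 + 2 * real (f P)) * B powr (1 + \<bar>h P\<bar>)"
    by (simp add: total_time_def Let_def P B_def b_def algebra_simps)
  then have "log 2 (total_time f h G k n) \<le> log 2 ((1 + 2 * real (f P)) * B powr (1 + \<bar>h P\<bar>))"
    using total_time_ge[of f h G k n] by (intro log_mono) auto
  also have "\<dots> = log 2 (1 + 2 * real (f P)) + (1 + \<bar>h P\<bar>) * (real k * log 2 b)"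
    using B1 b1 by (subst log_mult_pos) (auto simp: log_powr B_def log_nat_power)
  also have "log 2 b = 10 * log 2 (real n + 10) + real (n div width_of G n + 1)"
    by (simp add: b_def size_bound_def log_mult_pos log_nat_power add.commute)
  finally have le: "log 2 (total_time f h G k n) \<le> log 2 (1 + 2 * real (f P)) +
     (1 + \<bar>h P\<bar>) * (real k * (10 * log 2 (real n + 10) + real (n div width_of G n + 1)))" .
  have "real (n div width_of G n + 1) \<le> real n / real (width_of G n) + 1"
    using of_nat_mono[OF div_times_less_eq_dividend[of n "width_of G n"], where 'a = real] width_of_ge[of G n]
    by (simp add: field_simps)
  then have "(1 + \<bar>h P\<bar>) * (real k * (10 * log 2 (real n + 10) + real (n div width_of G n + 1))) \<le>
     (1 + \<bar>h P\<bar>) * (real k * (10 * log 2 (real n + 10) + (real n / real (width_of G n) + 1)))"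
    by (intro mult_left_mono add_left_mono) auto
  then show ?thesis using le by linarith
qed

text \<open>Divided by \<open>n\<close>, three terms remain. \<open>f\<close> contributes the
  logarithm of a linear function; \<open>1 + |h P|\<close>, of order at most \<open>sqrt n\<close>,
  meets a logarithm; and its product with \<open>n / p\<close> becomes
  \<open>(1 + |h (3 p + 14)|) / p\<close>, which vanishes because \<open>p\<close> tends to
  infinity.\<close>

lemma log_total_time_smallo:
  assumes h: "h \<in> o(\<lambda>p. real p)"
    and G: "\<And>x. \<exists>k. fst (tm_run G (replicate x 2) k) \<in> {1, 2}"
    and f: "\<And>x n. fst (tm_run G (replicate x 2) n) \<in> {1, 2} \<Longrightarrow> f x \<le> x + n"
  shows "(\<lambda>n. log 2 (total_time f h G k n)) \<in> o(\<lambda>n. real n)"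
proof -
  obtain C where C: "0 \<le> C" "\<And>p. \<bar>h p\<bar> \<le> real p + C" using smallo_le_affine[OF h] by blast
  define u where "u = (\<lambda>p. (1 + \<bar>h (3 * p + 14)\<bar>) / real p)"
  have "u \<longlonglongrightarrow> 0" unfolding u_def by (rule smallo_affine[OF h])
  then have "(\<lambda>n. u (width_of G n)) \<longlonglongrightarrow> 0"
    by (rule filterlim_compose) (rule width_of_at_top[OF G])
  then have u: "(\<lambda>n. real k * u (width_of G n)) \<longlonglongrightarrow> 0" by (rule tendsto_mult_right_zero)
  define R where "R = (\<lambda>n. log 2 (8 * real n + (35 + 2 * real (f 17))) / real n +
     real k * ((3 * sqrt (real n) + (18 + C)) * (10 * log 2 (real n + 10) + 1)) / real n +
     real k * u (width_of G n))"
  have "R \<longlonglongrightarrow> 0 + 0 + 0"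
    unfolding R_def by (intro tendsto_add log_two_div_tendsto sqrt_log_div_tendsto u)
  then have R0: "R \<longlonglongrightarrow> 0" by simp
  have le: "log 2 (total_time f h G k n) / real n \<le> R n" if n: "1 \<le> n" for n
  proof -
    define p where "p = width_of G n"
    define P where "P = 3 * p + 14"
    have p1: "1 \<le> p" using width_of_ge by (simp add: p_def)
    \<comment> \<open>For width 1 the argument is \<open>17 = 3 + 14\<close>. Otherwise the trial
      run gives \<open>f P \<le> P + n\<close>, where \<open>P \<le> 3 (n + 1) + 14\<close>.\<close>
    have "f P \<le> 4 * n + 17 + f 17"
      using width_of_cases[of G n, folded p_def, folded P_def]
    proof
      assume "p = 1"
      then show ?thesis by (simp add: P_def)
    next
      assume "p * p \<le> n \<and> fst (tm_run G (replicate P 2) n) \<in> {1, 2}"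
      then have "f P \<le> P + n" using f by blast
      moreover have "p \<le> Suc n" using width_of_le by (simp add: p_def)
      ultimately show ?thesis by (simp add: P_def)
    qed
    then have "real (f P) \<le> real (4 * n + 17 + f 17)" by (rule of_nat_mono)
    then have fP: "log 2 (1 + 2 * real (f P)) \<le> log 2 (8 * real n + (35 + 2 * real (f 17)))"
      by (intro log_mono) auto
    have "p * p \<le> n" using width_of_cases[of G n, folded p_def] n by auto
    then have "real p \<le> sqrt (real n)" by (intro real_le_rsqrt) (simp add: power2_eq_square flip: of_nat_mult)
    then have hP: "1 + \<bar>h P\<bar> \<le> 3 * sqrt (real n) + (18 + C)" using C(2)[of P] by (simp add: P_def)
    have l0: "0 \<le> 10 * log 2 (real n + 10) + 1" by (simp add: zero_le_log_cancel_iff)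
    have "log 2 (total_time f h G k n) \<le> log 2 (1 + 2 * real (f P)) +
       (1 + \<bar>h P\<bar>) * (real k * (10 * log 2 (real n + 10) + (real n / real p + 1)))"
      by (rule log_total_time_le[of P G n, folded p_def]) (simp add: P_def)
    also have "\<dots> = log 2 (1 + 2 * real (f P)) +
       real k * ((1 + \<bar>h P\<bar>) * (10 * log 2 (real n + 10) + 1)) + real k * (u p * real n)"
      using p1 by (simp add: u_def P_def algebra_simps add_divide_distrib)
    also have "\<dots> \<le> log 2 (8 * real n + (35 + 2 * real (f 17))) +
       real k * ((3 * sqrt (real n) + (18 + C)) * (10 * log 2 (real n + 10) + 1)) + real k * (u p * real n)"
      by (intro add_mono order_refl fP mult_left_mono[OF mult_right_mono[OF hP l0]]) simp
    finally have "log 2 (total_time f h G k n) / real n \<le> (log 2 (8 * real n + (35 + 2 * real (f 17))) +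
       real k * ((3 * sqrt (real n) + (18 + C)) * (10 * log 2 (real n + 10) + 1)) + real k * (u p * real n)) / real n"
      using n by (intro divide_right_mono) auto
    also have "\<dots> = R n" using n by (simp add: R_def p_def add_divide_distrib)
    finally show ?thesis .
  qed
  have "(\<lambda>n. log 2 (total_time f h G k n) / real n) \<longlonglongrightarrow> 0"
  proof (rule tendsto_sandwich[where f = "\<lambda>_. 0" and h = R])
    show "(\<lambda>_. 0 :: real) \<longlonglongrightarrow> 0" by (rule tendsto_const)
    show "R \<longlonglongrightarrow> 0" by (rule R0)
    show "\<forall>\<^sub>F n in sequentially. 0 \<le> log 2 (total_time f h G k n) / real n"
      by (intro always_eventually allI divide_nonneg_nonneg zero_le_log_cancel_iff[THEN iffD2])
        (auto intro: order.strict_trans2[OF zero_less_one] total_time_ge)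
    show "\<forall>\<^sub>F n in sequentially. log 2 (total_time f h G k n) / real n \<le> R n"
      using eventually_ge_at_top[of 1] by eventually_elim (rule le)
  qed
  moreover have "\<forall>\<^sub>F n in sequentially. real n \<noteq> 0"
    using eventually_gt_at_top[of 0] by eventually_elim simp
  ultimately show ?thesis by (rule smalloI_tendsto)
qed

lemma decides_within_mono: "decides_within M w a T \<Longrightarrow> T \<le> T' \<Longrightarrow> decides_within M w a T'"
  unfolding decides_within_def by (meson order_trans)

theorem theorem1p2:
  fixes f :: "nat \<Rightarrow> nat"
  assumes "ETH" and "computable f"
  shows "\<not> (\<exists>M h. turing_machine M \<and> h \<in> o(\<lambda>p. real p) \<and>
    solves_atsp_bounded_pathwidth M (\<lambda>p n. real (f p) * real n powr h p))"
proof
  assume "\<exists>M h. turing_machine M \<and> h \<in> o(\<lambda>p. real p) \<and>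
    solves_atsp_bounded_pathwidth M (\<lambda>p n. real (f p) * real n powr h p)"
  then obtain M and h :: "nat \<Rightarrow> real" where M: "turing_machine M" and h: "h \<in> o(\<lambda>p. real p)"
    and solves: "solves_atsp_bounded_pathwidth M (\<lambda>p n. real (f p) * real n powr h p)" by blast
  obtain G where G: "turing_machine G" "\<And>x. \<exists>k. fst (tm_run G (replicate x 2) k) \<in> {1, 2}"
    and f: "\<And>x n. fst (tm_run G (replicate x 2) n) \<in> {1, 2} \<Longrightarrow> f x \<le> x + n"
    by (rule computable_bound[OF assms(2)]) blast
  let ?W = "\<lambda>n xs. output_word bound_ex count_ex budget_ex arc_ex heavy_ex n xs (params G n xs)"
  obtain N k where N: "turing_machine N"
    and len: "\<And>n xs b. size_ok G n xs b \<Longrightarrow> length (?W n xs) \<le> b ^ k"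
    and dec: "\<And>n xs b ans T. size_ok G n xs b \<Longrightarrow> decides_within M (?W n xs) ans T \<Longrightarrow>
       decides_within N (input_word n xs) ans (real (b ^ k) + 2 * T)"
    by (rule reduction_machine[OF M G(1) ex_vars_ex(5,3,4,1,2)]) blast
  \<comment> \<open>The exponent that contradicts \<open>ETH\<close> is \<open>log 2\<close> of the
    total time.\<close>
  have "decides_within N (enc_cnf n F) (satisfiable F) (2 powr log 2 (total_time f h G k n))"
    if F: "is_3cnf n F" for n F
  proof -
    let ?p = "width_of G n" and ?b = "size_bound G n" and ?w = "?W n (codes F)"
    let ?P = "3 * ?p + 14"
    note ok = size_ok_codes[OF F, of G]
    have "decides_within M ?w (satisfiable F) (real (f ?P) * real (length ?w) powr h ?P)"
      by (rule reduction_correct[OF F width_of_ge solves]) (simp_all add: params_def)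
    from dec[OF ok this] have "decides_within N (enc_cnf n F) (satisfiable F)
       (real (?b ^ k) + 2 * (real (f ?P) * real (length ?w) powr h ?P))"
      by (simp only: enc_cnf_eq)
    \<comment> \<open>The exponent can be replaced by its absolute value because a nonempty word has
      length at least 1; after that, the power is monotone in the base.\<close>
    moreover have "real (length ?w) powr h ?P \<le> real (?b ^ k) powr \<bar>h ?P\<bar>"
    proof (cases "length ?w = 0")
      case False
      then have "real (length ?w) powr h ?P \<le> real (length ?w) powr \<bar>h ?P\<bar>"
        by (intro powr_mono) (auto simp: Suc_le_eq)
      also have "\<dots> \<le> real (?b ^ k) powr \<bar>h ?P\<bar>"
        using len[OF ok] by (intro powr_mono2) (auto simp del: of_nat_power)
      finally show ?thesis .
    qed simp
    then have "real (?b ^ k) + 2 * (real (f ?P) * real (length ?w) powr h ?P) \<le> total_time f h G k n"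
      unfolding total_time_def Let_def by (intro add_left_mono mult_left_mono) auto
    moreover have "2 powr log 2 (total_time f h G k n) = total_time f h G k n"
      using total_time_ge[of f h G k n] by (intro powr_log_cancel) auto
    ultimately show ?thesis by (simp only: decides_within_mono)
  qed
  then have "\<not> ETH"
    unfolding ETH_def using N log_total_time_smallo[OF h G(2) f, of k] by blast
  then show False using assms(1) by contradiction
qed

end
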